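(* Let $\mathcal{G}$ be an ample groupoid, let $c:\mathcal{G}\to\mathbb{Z}$ be a cocycle (a continuous groupoid homomorphism), and let $M$ be a $\mathcal{G}$-module. Then there is a long exact sequence in cohomology $$0\to H^0(\mathcal{G},M)\to H^0(\mathcal{G}\times_c\mathbb{Z},\pi^*M)\xrightarrow{\ \mathrm{id}-c^{*(0)}\ }H^0(\mathcal{G}\times_c\mathbb{Z},\pi^*M)\to H^1(\mathcal{G},M)\to\cdots$$ $$\cdots\to H^n(\mathcal{G},M)\to H^n(\mathcal{G}\times_c\mathbb{Z},\pi^*M)\xrightarrow{\ \mathrm{id}-c^{*(n)}\ }H^n(\mathcal{G}\times_c\mathbb{Z},\pi^*M)\to H^{n+1}(\mathcal{G},M)\to\cdots,$$ where $\pi^*M$ is the pullback $\mathcal{G}\times_c\mathbb{Z}$-module along $\pi:\mathcal{G}\times_c\mathbb{Z}\to\mathcal{G}$, $\pi(g,k)=g$, and $c^{*(n)}$ is the map on $H^n(\mathcal{G}\times_c\mathbb{Z},\pi^*M)$ induced by the groupoid isomorphism $\hat{c}_1(g,k)=(g,k+1)$.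
   Context: All spaces and groupoids are Hausdorff (and locally compact). An ample groupoid $\mathcal{G}$ is an étale groupoid whose unit space $\mathcal{G}^{(0)}$ is totally disconnected; $r,s$ denote range and source. $\mathcal{G}^{(1)}=\mathcal{G}$ and, for $n\ge2$, $\mathcal{G}^{(n)}$ is the space of composable $n$-tuples. For a totally disconnected space $X$, $\mathbb{Z}[X]=C_c(X,\mathbb{Z})$ is the group of continuous compactly supported functions $X\to\mathbb{Z}$. $\mathbb{Z}[\mathcal{G}]$ is a ring under convolution $(f_1f_2)(g)=\sum_{s(h)=r(g)}f_1(h^{-1})f_2(hg)$. A $\mathcal{G}$-module is a left $\mathbb{Z}[\mathcal{G}]$-module $M$ with $\mathbb{Z}[\mathcal{G}]M=M$; $\mathrm{Hom}_{\mathcal{G}}$ means $\mathrm{Hom}_{\mathbb{Z}[\mathcal{G}]}$. $\chi_U$ is the indicator function of $U$. Cohomology. For $n\ge 1$, $\mathcal{G}$ acts on the left of $\mathcal{G}^{(n)}$ with anchor map $p(g_1,\dots,g_n)=r(g_1)$ by $g\cdot(g_1,\dots,g_n)=(gg_1,g_2,\dots,g_n)$, and $\mathbb{Z}[\mathcal{G}^{(n)}]$ is a $\mathcal{G}$-module via $(f\cdot m)(y)=\sum_{s(g)=p(y)}f(g^{-1})m(g\cdot y)$. For $n\ge1$, $0\le i\le n$, let $b^n_i:\mathcal{G}^{(n+1)}\to\mathcal{G}^{(n)}$ be $b^n_i(g_0,\dots,g_n)=(g_0,\dots,g_ig_{i+1},\dots,g_n)$ for $i<n$ and $b^n_n(g_0,\dots,g_n)=(g_0,\dots,g_{n-1})$.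 For a local homeomorphism $\tau:X\to Y$ put $\tau_*(f)(y)=\sum_{\tau(x)=y}f(x)$, and let $b_n=\sum_{i=0}^n(-1)^ib^n_{i*}$ for $n\ge 1$. For $n\ge0$ let $\delta_n:\mathrm{Hom}_{\mathcal{G}}(\mathbb{Z}[\mathcal{G}^{(n+1)}],M)\to\mathrm{Hom}_{\mathcal{G}}(\mathbb{Z}[\mathcal{G}^{(n+2)}],M)$, $\delta_n(\varphi)=\varphi\circ b_{n+1}$, and $\delta_{-1}=0$. Then $H^n(\mathcal{G},M)=\ker\delta_n/\mathrm{im}\,\delta_{n-1}$. Sheaves and modules. A $\mathcal{G}$-sheaf is a sheaf of abelian groups $\pi_{\mathcal{A}}:\mathcal{A}\to\mathcal{G}^{(0)}$ (étale space) with group isomorphisms $\mathcal{A}_{s(g)}\to\mathcal{A}_{r(g)}$, $a\mapsto g\cdot a$, functorial in $g$ and jointly continuous. The $\mathcal{G}$-sheaf $\mathcal{M}$ associated to a $\mathcal{G}$-module $M$ has fibers $M_x=\varinjlim_{x\in U}\chi_UM$ ($U\subseteq\mathcal{G}^{(0)}$ compact open), $[m]_x$ denoting the class of $m$, with basis of topology the sets $\{[m]_x:x\in U\}$ ($U$ compact open, $m\in\chi_UM$) and action $g\cdot[m]_{s(g)}=[\chi_Vm]_{r(g)}$ for a compact open bisection $V\ni g$. The compactly supported continuous sections $\Gamma_c(\mathcal{M})$ form a $\mathcal{G}$-module via $(f\xi)(x)=\sum_{r(g)=x}f(g)(g\cdot\xi(s(g)))$, and $M\cong\Gamma_c(\mathcal{M})$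 via $m\mapsto(x\mapsto[m]_x)$. Pullbacks. Let $\phi:\mathcal{G}_1\to\mathcal{G}_2$ be an étale homomorphism (a groupoid homomorphism that is a local homeomorphism) of ample groupoids, $\phi^{(n)}(g_1,\dots,g_n)=(\phi(g_1),\dots,\phi(g_n))$. For a $\mathcal{G}_2$-module $M\cong\Gamma_c(\mathcal{M})$, the pullback sheaf is $\phi^*\mathcal{M}=\{(x,a):x\in\mathcal{G}_1^{(0)},a\in\mathcal{M}_{\phi(x)}\}$ with $g\cdot(s(g),a)=(r(g),\phi(g)\cdot a)$, and $\phi^*M:=\Gamma_c(\phi^*\mathcal{M})$. The induced maps $\hat\phi^{(n)}:\mathrm{Hom}_{\mathcal{G}_2}(\mathbb{Z}[\mathcal{G}_2^{(n)}],M)\to\mathrm{Hom}_{\mathcal{G}_1}(\mathbb{Z}[\mathcal{G}_1^{(n)}],\phi^*M)$ are $$\hat\phi^{(n)}(h)(f)(x)=\Bigl(x,\sum_{r(g_1)=x}f(g_1,\dots,g_n)\,h(\chi_{V_{g_1,\dots,g_n}})(\phi(x))\Bigr),$$ where $V_{g_1,\dots,g_n}\subseteq\mathcal{G}_2^{(n)}$ is any compact open set containing $\phi^{(n)}(g_1,\dots,g_n)$ on which $p$ is a homeomorphism onto its image. They commute with the coboundary maps and induce $\phi^*:H^*(\mathcal{G}_2,M)\to H^*(\mathcal{G}_1,\phi^*M)$. Skew product. $\mathcal{G}\times_c\mathbb{Z}$ is the set $\mathcal{G}\times\mathbb{Z}$ with product topology, unit space $\mathcal{G}^{(0)}\times\mathbb{Z}$,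 $r(g,k)=(r(g),k)$, $s(g,k)=(s(g),k+c(g))$, $(g,k)(h,k+c(g))=(gh,k)$, and $(g,k)^{-1}=(g^{-1},k+c(g))$. The map $\pi(g,k)=g$ is a surjective étale homomorphism. Since $\pi\circ\hat c_1=\pi$, one has $\hat c_1^*\pi^*M=\pi^*M$ (canonical identification), and $c^{*(n)}:H^n(\mathcal{G}\times_c\mathbb{Z},\pi^*M)\to H^n(\mathcal{G}\times_c\mathbb{Z},\pi^*M)$ is the map $\hat c_1^*$ in degree $n$. *)

theory Defs
  imports
    "HOL-Analysis.Analysis"
    "HOL-Algebra.Module"
    "HOL-Algebra.Free_Abelian_Groups"
begin

section \<open>Ample groupoids\<close>

text \<open>
  A groupoid is given by its space of arrows, and the unit space is the set of those arrows
  that are ranges. The product \<open>gmult\<close> is only meaningful on pairs \<open>(g, h)\<close> with \<open>src g = rng h\<close>.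
\<close>

record 'g groupoid =
  arrows :: "'g topology"
  gmult :: "'g \<Rightarrow> 'g \<Rightarrow> 'g"
  ginv :: "'g \<Rightarrow> 'g"
  rng :: "'g \<Rightarrow> 'g"
  src :: "'g \<Rightarrow> 'g"

abbreviation arr :: "'g groupoid \<Rightarrow> 'g set" where
  "arr G \<equiv> topspace (arrows G)"

definition units :: "'g groupoid \<Rightarrow> 'g set" where
  "units G = rng G ` arr G"

definition unit_space :: "'g groupoid \<Rightarrow> 'g topology" where
  "unit_space G = subtopology (arrows G) (units G)"

definition local_homeo :: "'a topology \<Rightarrow> 'b topology \<Rightarrow> ('a \<Rightarrow> 'b) \<Rightarrow> bool" where
  "local_homeo X Y f \<longleftrightarrow> f \<in> topspace X \<rightarrow> topspace Y \<and>
     (\<forall>x\<in>topspace X. \<exists>U. openin X U \<and> x \<in> U \<and> openin Y (f ` U) \<and>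
        homeomorphic_map (subtopology X U) (subtopology Y (f ` U)) f)"

definition totally_disconnected :: "'a topology \<Rightarrow> bool" where
  "totally_disconnected X \<longleftrightarrow> (\<forall>S. connectedin X S \<longrightarrow> (\<exists>a. S \<subseteq> {a}))"

locale groupoid =
  fixes G :: "'g groupoid"
  assumes rng_closed: "g \<in> arr G \<Longrightarrow> rng G g \<in> arr G"
    and src_units: "g \<in> arr G \<Longrightarrow> src G g \<in> units G"
    and mult_closed: "\<lbrakk>g \<in> arr G; h \<in> arr G; src G g = rng G h\<rbrakk> \<Longrightarrow> gmult G g h \<in> arr G"
    and inv_closed: "g \<in> arr G \<Longrightarrow> ginv G g \<in> arr G"
    and rng_unit: "u \<in> units G \<Longrightarrow> rng G u = u"
    and src_unit: "u \<in> units G \<Longrightarrow> src G u = u"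
    and rng_mult: "\<lbrakk>g \<in> arr G; h \<in> arr G; src G g = rng G h\<rbrakk> \<Longrightarrow> rng G (gmult G g h) = rng G g"
    and src_mult: "\<lbrakk>g \<in> arr G; h \<in> arr G; src G g = rng G h\<rbrakk> \<Longrightarrow> src G (gmult G g h) = src G h"
    and assoc: "\<lbrakk>g \<in> arr G; h \<in> arr G; k \<in> arr G; src G g = rng G h; src G h = rng G k\<rbrakk>
      \<Longrightarrow> gmult G (gmult G g h) k = gmult G g (gmult G h k)"
    and left_unit: "g \<in> arr G \<Longrightarrow> gmult G (rng G g) g = g"
    and right_unit: "g \<in> arr G \<Longrightarrow> gmult G g (src G g) = g"
    and rng_inv: "g \<in> arr G \<Longrightarrow> rng G (ginv G g) = src G g"
    and src_inv: "g \<in> arr G \<Longrightarrow> src G (ginv G g) = rng G g"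
    and right_inv: "g \<in> arr G \<Longrightarrow> gmult G g (ginv G g) = rng G g"
    and left_inv: "g \<in> arr G \<Longrightarrow> gmult G (ginv G g) g = src G g"

locale topological_groupoid = groupoid +
  assumes continuous_mult:
    "continuous_map
       (subtopology (prod_topology (arrows G) (arrows G))
          {(g, h). g \<in> arr G \<and> h \<in> arr G \<and> src G g = rng G h})
       (arrows G) (\<lambda>(g, h). gmult G g h)"
    and continuous_inv: "continuous_map (arrows G) (arrows G) (ginv G)"

locale ample_groupoid = topological_groupoid +
  assumes hausdorff: "Hausdorff_space (arrows G)"
    and locally_compact: "locally_compact_space (arrows G)"
    and etale_rng: "local_homeo (arrows G) (unit_space G) (rng G)"
    and etale_src: "local_homeo (arrows G) (unit_space G) (src G)"
    and units_totally_disconnected: "totally_disconnected (unit_space G)"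

definition cocycle :: "'g groupoid \<Rightarrow> ('g \<Rightarrow> int) \<Rightarrow> bool" where
  "cocycle G c \<longleftrightarrow> continuous_map (arrows G) (discrete_topology UNIV) c \<and>
     (\<forall>g\<in>arr G. \<forall>h\<in>arr G. src G g = rng G h \<longrightarrow> c (gmult G g h) = c g + c h)"

definition skew_product :: "'g groupoid \<Rightarrow> ('g \<Rightarrow> int) \<Rightarrow> ('g \<times> int) groupoid" where
  "skew_product G c = \<lparr>
     arrows = prod_topology (arrows G) (discrete_topology UNIV),
     gmult = (\<lambda>(g, k) (h, l). (gmult G g h, k)),
     ginv = (\<lambda>(g, k). (ginv G g, k + c g)),
     rng = (\<lambda>(g, k). (rng G g, k)),
     src = (\<lambda>(g, k). (src G g, k + c g))\<rparr>"

definition compact_open :: "'a topology \<Rightarrow> 'a set \<Rightarrow> bool" where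
  "compact_open X U \<longleftrightarrow> compactin X U \<and> openin X U"

definition compact_open_bisection :: "'g groupoid \<Rightarrow> 'g set \<Rightarrow> bool" where
  "compact_open_bisection G V \<longleftrightarrow>
     compact_open (arrows G) V \<and> inj_on (rng G) V \<and> inj_on (src G) V"


section \<open>Modules over the convolution ring\<close>

text \<open>
  \<open>Zfun X\<close> is $C_c(X, \mathbb{Z})$: the nonvanishing set of a continuous function to a discrete
  space is clopen, hence equal to the support. Functions are normalised to vanish off \<open>X\<close>.
  All sums over fibres are the library's sums \<open>sum'\<close> and \<open>gfinprod\<close> of families with finitely
  many nontrivial terms.
\<close>

definition Zfun :: "'a topology \<Rightarrow> ('a \<Rightarrow> int) set" where
  "Zfun X = {f. continuous_map X (discrete_topology UNIV) f \<and>
     compactin X {x \<in> topspace X. f x \<noteq> 0} \<and> (\<forall>x. x \<notin> topspace X \<longrightarrow> f x = 0)}"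

definition convolution :: "'g groupoid \<Rightarrow> ('g \<Rightarrow> int) \<Rightarrow> ('g \<Rightarrow> int) \<Rightarrow> 'g \<Rightarrow> int" where
  "convolution G f1 f2 = (\<lambda>g. if g \<in> arr G
     then sum' (\<lambda>h. f1 (ginv G h) * f2 (gmult G h g)) {h \<in> arr G. src G h = rng G g} else 0)"

text \<open>
  Modules over the (in general non-unital) ring \<open>Zfun (arrows G)\<close> are represented by the
  library's module record; its fields \<open>mult\<close> and \<open>one\<close> play no role.
\<close>

definition groupoid_module :: "'g groupoid \<Rightarrow> ('g \<Rightarrow> int, 'm) module \<Rightarrow> bool" where
  "groupoid_module G M \<longleftrightarrow> abelian_group M \<and>
     (\<forall>f\<in>Zfun (arrows G). \<forall>m\<in>carrier M. f \<odot>\<^bsub>M\<^esub> m \<in> carrier M) \<and>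
     (\<forall>f\<in>Zfun (arrows G). \<forall>m\<in>carrier M. \<forall>m'\<in>carrier M.
        f \<odot>\<^bsub>M\<^esub> (m \<oplus>\<^bsub>M\<^esub> m') = f \<odot>\<^bsub>M\<^esub> m \<oplus>\<^bsub>M\<^esub> f \<odot>\<^bsub>M\<^esub> m') \<and>
     (\<forall>f1\<in>Zfun (arrows G). \<forall>f2\<in>Zfun (arrows G). \<forall>m\<in>carrier M.
        (\<lambda>g. f1 g + f2 g) \<odot>\<^bsub>M\<^esub> m = f1 \<odot>\<^bsub>M\<^esub> m \<oplus>\<^bsub>M\<^esub> f2 \<odot>\<^bsub>M\<^esub> m) \<and>
     (\<forall>f1\<in>Zfun (arrows G). \<forall>f2\<in>Zfun (arrows G). \<forall>m\<in>carrier M.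
        convolution G f1 f2 \<odot>\<^bsub>M\<^esub> m = f1 \<odot>\<^bsub>M\<^esub> (f2 \<odot>\<^bsub>M\<^esub> m)) \<and>
     generate (add_monoid M) {f \<odot>\<^bsub>M\<^esub> m | f m. f \<in> Zfun (arrows G) \<and> m \<in> carrier M} = carrier M"

definition module_hom ::
  "'g groupoid \<Rightarrow> ('g \<Rightarrow> int, 'a) module \<Rightarrow> ('g \<Rightarrow> int, 'm) module \<Rightarrow> ('a \<Rightarrow> 'm) set" where
  "module_hom G A M = {\<phi> \<in> carrier A \<rightarrow>\<^sub>E carrier M.
     (\<forall>a\<in>carrier A. \<forall>b\<in>carrier A. \<phi> (a \<oplus>\<^bsub>A\<^esub> b) = \<phi> a \<oplus>\<^bsub>M\<^esub> \<phi> b) \<and>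
     (\<forall>f\<in>Zfun (arrows G). \<forall>a\<in>carrier A. \<phi> (f \<odot>\<^bsub>A\<^esub> a) = f \<odot>\<^bsub>M\<^esub> \<phi> a)}"

definition hom_group ::
  "'g groupoid \<Rightarrow> ('g \<Rightarrow> int, 'a) module \<Rightarrow> ('g \<Rightarrow> int, 'm) module \<Rightarrow> ('a \<Rightarrow> 'm) monoid" where
  "hom_group G A M = \<lparr>
     carrier = module_hom G A M,
     mult = (\<lambda>\<phi> \<psi>. \<lambda>a\<in>carrier A. \<phi> a \<oplus>\<^bsub>M\<^esub> \<psi> a),
     one = (\<lambda>a\<in>carrier A. \<zero>\<^bsub>M\<^esub>)\<rparr>"


section \<open>Cohomology\<close>

text \<open>
  A composable \<open>n\<close>-tuple $(g_1, \dots, g_n)$ is a function on \<open>{..<n}\<close>, indexed from \<open>0\<close>.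
  Everything below is used for \<open>n \<ge> 1\<close> only; \<open>nerve G 0\<close> is a point and not the unit space.
\<close>

definition nerve :: "'g groupoid \<Rightarrow> nat \<Rightarrow> (nat \<Rightarrow> 'g) topology" where
  "nerve G n = subtopology (product_topology (\<lambda>_. arrows G) {..<n})
     {y. \<forall>i. Suc i < n \<longrightarrow> src G (y i) = rng G (y (Suc i))}"

definition anchor :: "'g groupoid \<Rightarrow> (nat \<Rightarrow> 'g) \<Rightarrow> 'g" where
  "anchor G y = rng G (y 0)"

definition translate :: "'g groupoid \<Rightarrow> 'g \<Rightarrow> (nat \<Rightarrow> 'g) \<Rightarrow> nat \<Rightarrow> 'g" where
  "translate G g y = y(0 := gmult G g (y 0))"

definition nerve_module :: "'g groupoid \<Rightarrow> nat \<Rightarrow> ('g \<Rightarrow> int, (nat \<Rightarrow> 'g) \<Rightarrow> int) module" where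
  "nerve_module G n = \<lparr>
     carrier = Zfun (nerve G n),
     monoid.mult = undefined,
     one = undefined,
     ring.zero = (\<lambda>y. 0),
     ring.add = (\<lambda>m m'. \<lambda>y. m y + m' y),
     module.smult = (\<lambda>f m. \<lambda>y. if y \<in> topspace (nerve G n)
       then sum' (\<lambda>g. f (ginv G g) * m (translate G g y)) {g \<in> arr G. src G g = anchor G y}
       else 0)\<rparr>"

text \<open>
  \<open>face G n i\<close> is $b^n_i : G^{(n+1)} \to G^{(n)}$ for \<open>0 \<le> i \<le> n\<close>; for \<open>i = n\<close> only the first
  branch of the conditional is reached, so that the last entry is dropped.
\<close>

definition face :: "'g groupoid \<Rightarrow> nat \<Rightarrow> nat \<Rightarrow> (nat \<Rightarrow> 'g) \<Rightarrow> nat \<Rightarrow> 'g" where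
  "face G n i y = (\<lambda>j\<in>{..<n}.
     if j < i then y j else if j = i then gmult G (y i) (y (Suc i)) else y (Suc j))"

definition pushforward :: "'a topology \<Rightarrow> 'b topology \<Rightarrow> ('a \<Rightarrow> 'b) \<Rightarrow> ('a \<Rightarrow> int) \<Rightarrow> 'b \<Rightarrow> int" where
  "pushforward X Y \<tau> f = (\<lambda>y. if y \<in> topspace Y then sum' f {x \<in> topspace X. \<tau> x = y} else 0)"

definition boundary :: "'g groupoid \<Rightarrow> nat \<Rightarrow> ((nat \<Rightarrow> 'g) \<Rightarrow> int) \<Rightarrow> (nat \<Rightarrow> 'g) \<Rightarrow> int" where
  "boundary G n f = (\<lambda>y. \<Sum>i\<le>n. (-1) ^ i * pushforward (nerve G (Suc n)) (nerve G n) (face G n i) f y)"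

definition cochains :: "'g groupoid \<Rightarrow> ('g \<Rightarrow> int, 'm) module \<Rightarrow> nat
    \<Rightarrow> (((nat \<Rightarrow> 'g) \<Rightarrow> int) \<Rightarrow> 'm) monoid" where
  "cochains G M n = hom_group G (nerve_module G (Suc n)) M"

definition coboundary_map :: "'g groupoid \<Rightarrow> nat
    \<Rightarrow> (((nat \<Rightarrow> 'g) \<Rightarrow> int) \<Rightarrow> 'm) \<Rightarrow> (((nat \<Rightarrow> 'g) \<Rightarrow> int) \<Rightarrow> 'm)" where
  "coboundary_map G n \<phi> =
     (\<lambda>f\<in>carrier (nerve_module G (Suc (Suc n))). \<phi> (boundary G (Suc n) f))"

definition cocycle_group :: "'g groupoid \<Rightarrow> ('g \<Rightarrow> int, 'm) module \<Rightarrow> nat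
    \<Rightarrow> (((nat \<Rightarrow> 'g) \<Rightarrow> int) \<Rightarrow> 'm) monoid" where
  "cocycle_group G M n = (cochains G M n)
     \<lparr>carrier := kernel (cochains G M n) (cochains G M (Suc n)) (coboundary_map G n)\<rparr>"

definition coboundaries :: "'g groupoid \<Rightarrow> ('g \<Rightarrow> int, 'm) module \<Rightarrow> nat
    \<Rightarrow> (((nat \<Rightarrow> 'g) \<Rightarrow> int) \<Rightarrow> 'm) set" where
  "coboundaries G M n = (case n of
     0 \<Rightarrow> {\<one>\<^bsub>cochains G M 0\<^esub>}
   | Suc k \<Rightarrow> coboundary_map G k ` carrier (cochains G M k))"

definition cohomology :: "'g groupoid \<Rightarrow> ('g \<Rightarrow> int, 'm) module \<Rightarrow> nat
    \<Rightarrow> (((nat \<Rightarrow> 'g) \<Rightarrow> int) \<Rightarrow> 'm) set monoid" where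
  "cohomology G M n = cocycle_group G M n Mod coboundaries G M n"

text \<open>
  The map $[h] \mapsto [F(h)]$ into \<open>cohomology G M n\<close> induced by a map \<open>F\<close> of cocycles. If \<open>F\<close>
  respects coboundaries, the cosets in the union all coincide.
\<close>

definition cohomology_map :: "'g groupoid \<Rightarrow> ('g \<Rightarrow> int, 'm) module \<Rightarrow> nat
    \<Rightarrow> ('h \<Rightarrow> ((nat \<Rightarrow> 'g) \<Rightarrow> int) \<Rightarrow> 'm) \<Rightarrow> 'h set \<Rightarrow> (((nat \<Rightarrow> 'g) \<Rightarrow> int) \<Rightarrow> 'm) set" where
  "cohomology_map G M n F X = (\<Union>h\<in>X. coboundaries G M n #>\<^bsub>cocycle_group G M n\<^esub> F h)"

definition change_coefficients :: "'g groupoid \<Rightarrow> nat \<Rightarrow> ('m \<Rightarrow> 'n)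
    \<Rightarrow> (((nat \<Rightarrow> 'g) \<Rightarrow> int) \<Rightarrow> 'm) \<Rightarrow> (((nat \<Rightarrow> 'g) \<Rightarrow> int) \<Rightarrow> 'n)" where
  "change_coefficients G n \<theta> \<phi> = (\<lambda>f\<in>carrier (nerve_module G (Suc n)). \<theta> (\<phi> f))"


section \<open>Sheaves and their modules of sections\<close>

text \<open>
  The data of a sheaf of abelian groups over the unit space of a groupoid, given as an etale
  space, with an action of the groupoid. Addition and action are only meaningful on elements of
  one fibre and on pairs \<open>(g, a)\<close> with \<open>a\<close> in the fibre over the source of \<open>g\<close>, respectively.
\<close>

record ('g, 'a) sheaf =
  total :: "'a topology"
  proj :: "'a \<Rightarrow> 'g"
  fibre_add :: "'a \<Rightarrow> 'a \<Rightarrow> 'a"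
  fibre_zero :: "'g \<Rightarrow> 'a"
  act :: "'g \<Rightarrow> 'a \<Rightarrow> 'a"

text \<open>
  Fibres are groups in the multiplicative notation of the group library: below, \<open>gfinprod\<close> over
  a fibre is a sum and \<open>a [^] k\<close> is the integer multiple $k a$.
\<close>

definition fibre :: "('g, 'a) sheaf \<Rightarrow> 'g \<Rightarrow> 'a monoid" where
  "fibre A x = \<lparr>carrier = {a \<in> topspace (total A). proj A a = x},
     mult = fibre_add A, one = fibre_zero A x\<rparr>"

text \<open>
  Compactly supported sections. The zero set of a section of an etale space is open, so the
  nonvanishing set is closed and equals the support.
\<close>

definition compact_sections :: "'g groupoid \<Rightarrow> ('g, 'a) sheaf \<Rightarrow> ('g \<Rightarrow> 'a) set" where
  "compact_sections G A = {\<xi> \<in> extensional (units G).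
     continuous_map (unit_space G) (total A) \<xi> \<and> (\<forall>x\<in>units G. proj A (\<xi> x) = x) \<and>
     compactin (unit_space G) {x \<in> units G. \<xi> x \<noteq> fibre_zero A x}}"

definition section_module :: "'g groupoid \<Rightarrow> ('g, 'a) sheaf \<Rightarrow> ('g \<Rightarrow> int, 'g \<Rightarrow> 'a) module" where
  "section_module G A = \<lparr>
     carrier = compact_sections G A,
     monoid.mult = undefined,
     one = undefined,
     ring.zero = (\<lambda>x\<in>units G. fibre_zero A x),
     ring.add = (\<lambda>\<xi> \<eta>. \<lambda>x\<in>units G. fibre_add A (\<xi> x) (\<eta> x)),
     module.smult = (\<lambda>f \<xi>. \<lambda>x\<in>units G.
       gfinprod (fibre A x) (\<lambda>g. act A g (\<xi> (src G g)) [^]\<^bsub>fibre A x\<^esub> f g)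
         {g \<in> arr G. rng G g = x})\<rparr>"

text \<open>
  The direct limit $M_x = \varinjlim_{x \in U} \chi_U M$ is the quotient of the set of pairs
  \<open>(U, m)\<close> with $m \in \chi_U M$ by the relation of having equal restrictions to some smaller
  neighbourhood of \<open>x\<close>. Its elements are tagged with \<open>x\<close> to make the fibres disjoint.
\<close>

definition chi_image :: "('g \<Rightarrow> int, 'm) module \<Rightarrow> 'g set \<Rightarrow> 'm set" where
  "chi_image M U = (\<lambda>m. indicator U \<odot>\<^bsub>M\<^esub> m) ` carrier M"

definition germ_pairs :: "'g groupoid \<Rightarrow> ('g \<Rightarrow> int, 'm) module \<Rightarrow> 'g \<Rightarrow> ('g set \<times> 'm) set" where
  "germ_pairs G M x = {(U, m). compact_open (unit_space G) U \<and> x \<in> U \<and> m \<in> chi_image M U}"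

definition germ_rel :: "'g groupoid \<Rightarrow> ('g \<Rightarrow> int, 'm) module \<Rightarrow> 'g
    \<Rightarrow> (('g set \<times> 'm) \<times> ('g set \<times> 'm)) set" where
  "germ_rel G M x = {((U, m), (V, m')). (U, m) \<in> germ_pairs G M x \<and> (V, m') \<in> germ_pairs G M x \<and>
     (\<exists>W. compact_open (unit_space G) W \<and> x \<in> W \<and> W \<subseteq> U \<inter> V \<and>
        indicator W \<odot>\<^bsub>M\<^esub> m = indicator W \<odot>\<^bsub>M\<^esub> m')}"

text \<open>
  $[m]_x$: the class of \<open>(U, m)\<close>, which is the same for all \<open>U\<close> with \<open>(U, m) \<in> germ_pairs G M x\<close>.
\<close>

definition germ_class :: "'g groupoid \<Rightarrow> ('g \<Rightarrow> int, 'm) module \<Rightarrow> 'g \<Rightarrow> 'm \<Rightarrow> ('g set \<times> 'm) set" where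
  "germ_class G M x m = germ_rel G M x `` {(U, m) | U. (U, m) \<in> germ_pairs G M x}"

definition germ :: "'g groupoid \<Rightarrow> ('g \<Rightarrow> int, 'm) module \<Rightarrow> 'g \<Rightarrow> 'm
    \<Rightarrow> 'g \<times> ('g set \<times> 'm) set" where
  "germ G M x m = (x, germ_class G M x m)"

text \<open>
  Addition and action on classes are defined through representatives; the classes in each
  union coincide.
\<close>

definition associated_sheaf :: "'g groupoid \<Rightarrow> ('g \<Rightarrow> int, 'm) module
    \<Rightarrow> ('g, 'g \<times> ('g set \<times> 'm) set) sheaf" where
  "associated_sheaf G M = \<lparr>
     total = topology_generated_by
       {(\<lambda>x. germ G M x m) ` U | U m. compact_open (unit_space G) U \<and> m \<in> chi_image M U},
     proj = fst,
     fibre_add = (\<lambda>(x, a) (_, b). (x,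
       \<Union>{germ_class G M x (indicator (U \<inter> V) \<odot>\<^bsub>M\<^esub> m \<oplus>\<^bsub>M\<^esub> indicator (U \<inter> V) \<odot>\<^bsub>M\<^esub> m')
          | U m V m'. (U, m) \<in> a \<and> (V, m') \<in> b})),
     fibre_zero = (\<lambda>x. germ G M x \<zero>\<^bsub>M\<^esub>),
     act = (\<lambda>g (_, a). (rng G g,
       \<Union>{germ_class G M (rng G g) (indicator V \<odot>\<^bsub>M\<^esub> m)
          | V U m. compact_open_bisection G V \<and> g \<in> V \<and> (U, m) \<in> a}))\<rparr>"

definition module_to_sections :: "'g groupoid \<Rightarrow> ('g \<Rightarrow> int, 'm) module \<Rightarrow> 'm
    \<Rightarrow> 'g \<Rightarrow> 'g \<times> ('g set \<times> 'm) set" where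
  "module_to_sections G M m = (\<lambda>x\<in>units G. germ G M x m)"


section \<open>Pullbacks\<close>

definition pullback_sheaf :: "'g groupoid \<Rightarrow> ('g \<Rightarrow> 'h) \<Rightarrow> ('h, 'a) sheaf \<Rightarrow> ('g, 'g \<times> 'a) sheaf" where
  "pullback_sheaf G1 \<phi> A = \<lparr>
     total = subtopology (prod_topology (unit_space G1) (total A)) {(x, a). proj A a = \<phi> x},
     proj = fst,
     fibre_add = (\<lambda>(x, a) (_, b). (x, fibre_add A a b)),
     fibre_zero = (\<lambda>x. (x, fibre_zero A (\<phi> x))),
     act = (\<lambda>g (_, a). (rng G1 g, act A (\<phi> g) a))\<rparr>"

definition anchor_nbhd :: "'g groupoid \<Rightarrow> nat \<Rightarrow> (nat \<Rightarrow> 'g) \<Rightarrow> (nat \<Rightarrow> 'g) set \<Rightarrow> bool" where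
  "anchor_nbhd G n y V \<longleftrightarrow> compact_open (nerve G n) V \<and> y \<in> V \<and>
     homeomorphic_map (subtopology (nerve G n) V) (subtopology (unit_space G) (anchor G ` V)) (anchor G)"

text \<open>
  The map $\hat\phi^{(n+1)}$ on \<open>n\<close>-cochains; for module homomorphisms \<open>h\<close> the value does not
  depend on the neighbourhood that is chosen.
\<close>

definition pullback_cochain :: "'g groupoid \<Rightarrow> 'h groupoid \<Rightarrow> ('g \<Rightarrow> 'h) \<Rightarrow> ('h, 'a) sheaf \<Rightarrow> nat
    \<Rightarrow> (((nat \<Rightarrow> 'h) \<Rightarrow> int) \<Rightarrow> 'h \<Rightarrow> 'a) \<Rightarrow> (((nat \<Rightarrow> 'g) \<Rightarrow> int) \<Rightarrow> 'g \<Rightarrow> 'g \<times> 'a)" where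
  "pullback_cochain G1 G2 \<phi> A n h = (\<lambda>f\<in>carrier (nerve_module G1 (Suc n)). \<lambda>x\<in>units G1. (x,
     gfinprod (fibre A (\<phi> x))
       (\<lambda>y. h (indicator (SOME V. anchor_nbhd G2 (Suc n) (\<lambda>i\<in>{..<Suc n}. \<phi> (y i)) V)) (\<phi> x)
          [^]\<^bsub>fibre A (\<phi> x)\<^esub> f y)
       {y \<in> topspace (nerve G1 (Suc n)). anchor G1 y = x}))"


section \<open>The maps of the long exact sequence\<close>

definition pi_sheaf :: "'g groupoid \<Rightarrow> ('g \<Rightarrow> int) \<Rightarrow> ('g \<Rightarrow> int, 'm) module
    \<Rightarrow> ('g \<times> int, ('g \<times> int) \<times> 'g \<times> ('g set \<times> 'm) set) sheaf" where
  "pi_sheaf G c M = pullback_sheaf (skew_product G c) fst (associated_sheaf G M)"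

definition pi_module :: "'g groupoid \<Rightarrow> ('g \<Rightarrow> int) \<Rightarrow> ('g \<Rightarrow> int, 'm) module
    \<Rightarrow> ('g \<times> int \<Rightarrow> int, 'g \<times> int \<Rightarrow> ('g \<times> int) \<times> 'g \<times> ('g set \<times> 'm) set) module" where
  "pi_module G c M = section_module (skew_product G c) (pi_sheaf G c M)"

text \<open>
  $\pi^*$ on cohomology, where \<open>M\<close> is first identified with the sections of its associated sheaf.
\<close>

definition pi_star :: "'g groupoid \<Rightarrow> ('g \<Rightarrow> int) \<Rightarrow> ('g \<Rightarrow> int, 'm) module \<Rightarrow> nat
    \<Rightarrow> (((nat \<Rightarrow> 'g) \<Rightarrow> int) \<Rightarrow> 'm) set
    \<Rightarrow> (((nat \<Rightarrow> 'g \<times> int) \<Rightarrow> int) \<Rightarrow> 'g \<times> int \<Rightarrow> ('g \<times> int) \<times> 'g \<times> ('g set \<times> 'm) set) set" where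
  "pi_star G c M n = cohomology_map (skew_product G c) (pi_module G c M) n
     (\<lambda>h. pullback_cochain (skew_product G c) G fst (associated_sheaf G M) n
        (change_coefficients G n (module_to_sections G M) h))"

definition shift :: "'g \<times> int \<Rightarrow> 'g \<times> int" where
  "shift = (\<lambda>(g, k). (g, k + 1))"

text \<open>
  The canonical identification of $\hat c_1^* \pi^* \mathcal{M}$ with $\pi^* \mathcal{M}$ on
  sections: a point of the former is \<open>(x, (shift x, a))\<close> with \<open>a\<close> a point of $\mathcal{M}$ over
  \<open>fst (shift x) = fst x\<close>, and it corresponds to \<open>(x, a)\<close>.
\<close>

definition shift_identification :: "'g groupoid \<Rightarrow> ('g \<Rightarrow> int)
    \<Rightarrow> ('g \<times> int \<Rightarrow> ('g \<times> int) \<times> ('g \<times> int) \<times> 'b) \<Rightarrow> ('g \<times> int \<Rightarrow> ('g \<times> int) \<times> 'b)" where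
  "shift_identification G c \<xi> = (\<lambda>x\<in>units (skew_product G c). (x, snd (snd (\<xi> x))))"

definition c_star :: "'g groupoid \<Rightarrow> ('g \<Rightarrow> int) \<Rightarrow> ('g \<Rightarrow> int, 'm) module \<Rightarrow> nat
    \<Rightarrow> (((nat \<Rightarrow> 'g \<times> int) \<Rightarrow> int) \<Rightarrow> 'g \<times> int \<Rightarrow> ('g \<times> int) \<times> 'g \<times> ('g set \<times> 'm) set) set
    \<Rightarrow> (((nat \<Rightarrow> 'g \<times> int) \<Rightarrow> int) \<Rightarrow> 'g \<times> int \<Rightarrow> ('g \<times> int) \<times> 'g \<times> ('g set \<times> 'm) set) set" where
  "c_star G c M n = cohomology_map (skew_product G c) (pi_module G c M) n
     (\<lambda>h. change_coefficients (skew_product G c) n (shift_identification G c)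
        (pullback_cochain (skew_product G c) (skew_product G c) shift (pi_sheaf G c M) n h))"

text \<open>The map $\mathrm{id} - c^{*(n)}$, in the multiplicative notation of \<open>cohomology\<close>.\<close>

definition id_minus_c_star :: "'g groupoid \<Rightarrow> ('g \<Rightarrow> int) \<Rightarrow> ('g \<Rightarrow> int, 'm) module \<Rightarrow> nat
    \<Rightarrow> (((nat \<Rightarrow> 'g \<times> int) \<Rightarrow> int) \<Rightarrow> 'g \<times> int \<Rightarrow> ('g \<times> int) \<times> 'g \<times> ('g set \<times> 'm) set) set
    \<Rightarrow> (((nat \<Rightarrow> 'g \<times> int) \<Rightarrow> int) \<Rightarrow> 'g \<times> int \<Rightarrow> ('g \<times> int) \<times> 'g \<times> ('g set \<times> 'm) set) set" where
  "id_minus_c_star G c M n X =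
     (let H = cohomology (skew_product G c) (pi_module G c M) n in X \<otimes>\<^bsub>H\<^esub> inv\<^bsub>H\<^esub> (c_star G c M n X))"

definition exact_at :: "('a, 'i) monoid_scheme \<Rightarrow> ('a \<Rightarrow> 'b) \<Rightarrow> ('b, 'j) monoid_scheme
    \<Rightarrow> ('b \<Rightarrow> 'c) \<Rightarrow> ('c, 'k) monoid_scheme \<Rightarrow> bool" where
  "exact_at A f B g C \<longleftrightarrow> group_hom A B f \<and> group_hom B C g \<and> f ` carrier A = kernel B C g"

end

theory Submission
  imports Defs
begin

text \<open>
  Evaluating a cochain at indicator functions of small neighbourhoods identifies the \<open>n\<close>-cochains
  with values in the sections of an equivariant sheaf with the continuous equivariant families of
  germs over the nerve. Since \<open>M\<close> is the module of sections of its associated sheaf, $\pi^*$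
  becomes the pullback of such families along the projection of nerves, so it is injective, and
  its image consists of the families that do not depend on the integer coordinate. These are
  exactly the kernel of $\mathrm{id} - c^*$. On cochains $\mathrm{id} - c^*$ is surjective: a
  preimage is a signed sum of shifts, with limits of summation read off from the integer
  coordinates and the cocycle. Hence $\pi^*$ and $\mathrm{id} - c^*$ form a short exact sequence
  of cochain complexes, whose long exact sequence is the one claimed.
\<close>

section \<open>Compactly supported functions on locally Boolean spaces\<close>

text \<open>The correspondence with germs rests on a generation fact: a compactly supported integer
  function is a finite integer combination of indicators of compact open sets that are as small as
  desired, so additive maps need only be compared on sets where the anchor is injective. On these
  the ring action is multiplication of sets, and linearity over indicators of unit sets makes every
  cochain local. Germs are used because a test function loses its compact support when pulled back
  along \<pi>, whose fibres are copies of the integers, while a family of germs can be pulled back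
  freely. The nerve of the skew product is the nerve of \<open>G\<close> times the integers: the
  level of the first arrow and the partial sums of \<open>c\<close> determine all other levels. The
  slice at level 0 is a continuous section of the projection but not an equivariant one, since
  equivariance relates the lift of a translate by \<open>g\<close> at level 0 to a lift at level
  \<open>c g\<close>; shift invariance repairs this. The convolution ring need not have a unit, so
  identifying \<open>M\<close> with sections relies on local units, obtained from the condition that
  products generate \<open>M\<close>.\<close>

lemma homeomorphic_map_restrict_open:
  assumes "continuous_map X Y f" "open_map X Y f" "openin X U" "inj_on f U"
  shows "homeomorphic_map (subtopology X U) (subtopology Y (f ` U)) f"
proof (rule bijective_open_imp_homeomorphic_map)
  have U: "U \<subseteq> topspace X" using assms(3) openin_subset by blast
  show "continuous_map (subtopology X U) (subtopology Y (f ` U)) f"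
    using assms(1) by (auto simp: continuous_map_in_subtopology continuous_map_from_subtopology)
  show "open_map (subtopology X U) (subtopology Y (f ` U)) f"
    using assms(2,3) U by (intro open_map_into_subtopology open_map_from_subtopology) auto
  show "f ` topspace (subtopology X U) = topspace (subtopology Y (f ` U))"
    using U continuous_map_image_subset_topspace[OF assms(1)] by auto
  show "inj_on f (topspace (subtopology X U))" using assms(4) by (simp add: inj_on_Int)
qed

text \<open>An open continuous map restricts to a homeomorphism from any open set on which it is
  injective onto the image. The three properties on the right can be composed and verified
  separately.\<close>

lemma local_homeo_iff:
  "local_homeo X Y f \<longleftrightarrow> continuous_map X Y f \<and> open_map X Y f \<and>
     (\<forall>x\<in>topspace X. \<exists>U. openin X U \<and> x \<in> U \<and> inj_on f U)" (is "?L \<longleftrightarrow> ?R")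
proof
  assume L: ?L
  then have Pi: "f \<in> topspace X \<rightarrow> topspace Y"
    and ex: "\<And>x. x \<in> topspace X \<Longrightarrow> \<exists>U. openin X U \<and> x \<in> U \<and> openin Y (f ` U) \<and>
        homeomorphic_map (subtopology X U) (subtopology Y (f ` U)) f"
    by (auto simp: local_homeo_def)
  have "continuous_map X Y f"
    unfolding continuous_map
  proof (intro conjI allI impI)
    show "f ` topspace X \<subseteq> topspace Y" using Pi by auto
    fix V assume V: "openin Y V"
    show "openin X {x \<in> topspace X. f x \<in> V}"
    proof (subst openin_subopen, intro ballI)
      fix x assume "x \<in> {x \<in> topspace X. f x \<in> V}"
      then have x: "x \<in> topspace X" "f x \<in> V" by auto
      from ex[OF x(1)] obtain U where U: "openin X U" "x \<in> U"
        and h: "homeomorphic_map (subtopology X U) (subtopology Y (f ` U)) f" by auto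
      have "continuous_map (subtopology X U) Y f"
        using homeomorphic_imp_continuous_map[OF h] continuous_map_into_fulltopology by blast
      from openin_continuous_map_preimage[OF this V]
      have "openin (subtopology X U) {x \<in> topspace X \<inter> U. f x \<in> V}" by simp
      then have "openin X {x \<in> topspace X \<inter> U. f x \<in> V}"
        using U(1) by (rule openin_trans_full)
      then show "\<exists>T. openin X T \<and> x \<in> T \<and> T \<subseteq> {x \<in> topspace X. f x \<in> V}"
        using x U by (intro exI[of _ "{x \<in> topspace X \<inter> U. f x \<in> V}"]) auto
    qed
  qed
  moreover have "open_map X Y f"
    unfolding open_map_def
  proof (intro allI impI)
    fix W assume W: "openin X W"
    show "openin Y (f ` W)"
    proof (subst openin_subopen, intro ballI)
      fix y assume "y \<in> f ` W"
      then obtain x where x: "x \<in> W" "y = f x" by auto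
      then have "x \<in> topspace X" using W openin_subset by blast
      from ex[OF this] obtain U where U: "openin X U" "x \<in> U" "openin Y (f ` U)"
        and h: "homeomorphic_map (subtopology X U) (subtopology Y (f ` U)) f" by auto
      have "openin (subtopology X U) (W \<inter> U)" using W U openin_subtopology_Int by blast
      then have "openin (subtopology Y (f ` U)) (f ` (W \<inter> U))"
        using homeomorphic_imp_open_map[OF h] by (simp add: open_map_def)
      then have "openin Y (f ` (W \<inter> U))" using U(3) by (rule openin_trans_full)
      then show "\<exists>T. openin Y T \<and> y \<in> T \<and> T \<subseteq> f ` W" using x U by blast
    qed
  qed
  moreover have "\<forall>x\<in>topspace X. \<exists>U. openin X U \<and> x \<in> U \<and> inj_on f U"
  proof
    fix x assume "x \<in> topspace X"
    from ex[OF this] obtain U where U: "openin X U" "x \<in> U"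
      and h: "homeomorphic_map (subtopology X U) (subtopology Y (f ` U)) f" by auto
    have "inj_on f (topspace X \<inter> U)" using homeomorphic_imp_injective_map[OF h] by simp
    moreover have "topspace X \<inter> U = U" using U openin_subset by blast
    ultimately show "\<exists>U. openin X U \<and> x \<in> U \<and> inj_on f U" using U by auto
  qed
  ultimately show ?R by blast
next
  assume R: ?R
  then have c: "continuous_map X Y f" and o: "open_map X Y f" by auto
  show ?L
    unfolding local_homeo_def
  proof (intro conjI ballI)
    show "f \<in> topspace X \<rightarrow> topspace Y" using c by (simp add: continuous_map_funspace)
    fix x assume "x \<in> topspace X"
    with R obtain U where U: "openin X U" "x \<in> U" "inj_on f U" by blast
    have "homeomorphic_map (subtopology X U) (subtopology Y (f ` U)) f"
      using U c o by (intro homeomorphic_map_restrict_open) 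
    then show "\<exists>U. openin X U \<and> x \<in> U \<and> openin Y (f ` U) \<and>
        homeomorphic_map (subtopology X U) (subtopology Y (f ` U)) f"
      using U o by (auto simp: open_map_def)
  qed
qed

lemma local_homeo_imp:
  assumes "local_homeo X Y f"
  shows "continuous_map X Y f" "open_map X Y f"
  using assms by (auto simp: local_homeo_iff)

lemma local_homeo_inj_nbhd:
  assumes "local_homeo X Y f" "x \<in> topspace X"
  obtains U where "openin X U" "x \<in> U" "inj_on f U"
  using assms by (auto simp: local_homeo_iff)

text \<open>A local section through \<open>x\<close> pulls an open set around \<open>x\<close> back
  to a neighbourhood of \<open>f x\<close>, and applying \<open>f\<close> after the section shows
  that this neighbourhood lies in the image. Openness of the projections of nerves and of sheaves is
  obtained in this way.\<close>

lemma open_map_local_sections: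
  assumes "\<And>x. x \<in> topspace X \<Longrightarrow> \<exists>N s. openin Y N \<and> f x \<in> N \<and>
     continuous_map (subtopology Y N) X s \<and> s (f x) = x \<and> (\<forall>y\<in>N. f (s y) = y)"
  shows "open_map X Y f"
  unfolding open_map_def
proof (intro allI impI)
  fix W assume W: "openin X W"
  show "openin Y (f ` W)"
  proof (subst openin_subopen, intro ballI)
    fix y assume "y \<in> f ` W"
    then obtain x where x: "x \<in> W" "y = f x" by auto
    then have "x \<in> topspace X" using W openin_subset by blast
    from assms[OF this] obtain N s where N: "openin Y N" "f x \<in> N"
       "continuous_map (subtopology Y N) X s" "s (f x) = x" "\<forall>y\<in>N. f (s y) = y" by blast
    have Ns: "N \<subseteq> topspace Y" using N(1) openin_subset by blast
    have "openin (subtopology Y N) {y \<in> topspace (subtopology Y N). s y \<in> W}"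
      using N(3) W by (rule openin_continuous_map_preimage)
    then have "openin Y {y \<in> topspace (subtopology Y N). s y \<in> W}"
      using N(1) by (rule openin_trans_full)
    moreover have "y \<in> {y \<in> topspace (subtopology Y N). s y \<in> W}" using x N Ns by auto
    moreover have "{y \<in> topspace (subtopology Y N). s y \<in> W} \<subseteq> f ` W"
    proof
      fix z assume "z \<in> {y \<in> topspace (subtopology Y N). s y \<in> W}"
      then have "z = f (s z)" "s z \<in> W" using N(5) by auto
      then show "z \<in> f ` W" by blast
    qed
    ultimately show "\<exists>T. openin Y T \<and> y \<in> T \<and> T \<subseteq> f ` W" by blast
  qed
qed

text \<open>A continuous map over \<open>Z\<close> between spaces that are both etale over
  \<open>Z\<close> is itself etale. Injectivity is inherited from \<open>q\<close>; for openness,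
  \<open>p\<close> is injective near \<open>t x\<close>, so a point there with the same image under
  \<open>p\<close> as a nearby \<open>t w\<close> must be \<open>t w\<close>. Face maps and
  equivariant maps become local homeomorphisms through their anchors.\<close>

lemma local_homeo_cancel:
  assumes t: "continuous_map X Y t" and q: "local_homeo X Z q" and p: "local_homeo Y Z p"
    and eq: "\<And>x. x \<in> topspace X \<Longrightarrow> p (t x) = q x"
  shows "local_homeo X Y t"
  unfolding local_homeo_iff
proof (intro conjI ballI)
  show "continuous_map X Y t" by fact
  have inj: "\<exists>U. openin X U \<and> x \<in> U \<and> inj_on t U" if x: "x \<in> topspace X" for x
  proof -
    obtain U where U: "openin X U" "x \<in> U" "inj_on q U" using local_homeo_inj_nbhd[OF q x] .
    have "U \<subseteq> topspace X" using U(1) openin_subset by blast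
    then have "inj_on t U" using U(3) eq unfolding inj_on_def by (metis subsetD)
    then show ?thesis using U by blast
  qed
  then show "\<exists>U. openin X U \<and> x \<in> U \<and> inj_on t U" if "x \<in> topspace X" for x using that .
  show "open_map X Y t"
    unfolding open_map_def
  proof (intro allI impI)
    fix W assume W: "openin X W"
    show "openin Y (t ` W)"
    proof (subst openin_subopen, intro ballI)
      fix y assume "y \<in> t ` W"
      then obtain x where x: "x \<in> W" "y = t x" by auto
      then have xX: "x \<in> topspace X" using W openin_subset by blast
      then have "t x \<in> topspace Y" using t by (metis continuous_map_image_subset_topspace image_subset_iff)
      then obtain P where P: "openin Y P" "t x \<in> P" "inj_on p P" using local_homeo_inj_nbhd[OF p] by blast
      define W' where "W' = W \<inter> {x \<in> topspace X. t x \<in> P}"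
      have "openin X W'" unfolding W'_def using W P t by (intro openin_Int openin_continuous_map_preimage)
      then have "openin Z (q ` W')" using local_homeo_imp(2)[OF q] by (simp add: open_map_def)
      then have "openin Y ({y \<in> topspace Y. p y \<in> q ` W'} \<inter> P)"
        using P(1) local_homeo_imp(1)[OF p] by (intro openin_Int openin_continuous_map_preimage)
      moreover have "y \<in> {y \<in> topspace Y. p y \<in> q ` W'} \<inter> P"
        using x xX P \<open>t x \<in> topspace Y\<close> eq by (auto simp: W'_def)
      moreover have "{y \<in> topspace Y. p y \<in> q ` W'} \<inter> P \<subseteq> t ` W"
      proof
        fix z assume z: "z \<in> {y \<in> topspace Y. p y \<in> q ` W'} \<inter> P"
        then obtain w where w: "w \<in> W'" "p z = q w" by auto
        then have "w \<in> topspace X" "t w \<in> P" "w \<in> W" by (auto simp: W'_def)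
        then have "p z = p (t w)" using eq w by simp
        then have "z = t w" using P(3) z \<open>t w \<in> P\<close> by (auto dest: inj_onD)
        then show "z \<in> t ` W" using \<open>w \<in> W\<close> by blast
      qed
      ultimately show "\<exists>T. openin Y T \<and> y \<in> T \<and> T \<subseteq> t ` W" by blast
    qed
  qed
qed

section \<open>Compact open sets and spaces with a basis of them\<close>

lemma compact_open_subset: "compact_open X U \<Longrightarrow> U \<subseteq> topspace X"
  by (simp add: compact_open_def openin_subset)

lemma compact_open_empty [simp]: "compact_open X {}"
  by (simp add: compact_open_def)

lemma compact_open_Un: "compact_open X U \<Longrightarrow> compact_open X V \<Longrightarrow> compact_open X (U \<union> V)"
  by (simp add: compact_open_def compactin_Un openin_Un)

lemma compact_open_closedin: "Hausdorff_space X \<Longrightarrow> compact_open X U \<Longrightarrow> closedin X U"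
  by (simp add: compact_open_def compactin_imp_closedin)

lemma compact_open_Int_clopen:
  assumes "compact_open X U" "openin X C" "closedin X C"
  shows "compact_open X (U \<inter> C)"
  using assms by (simp add: compact_open_def compact_Int_closedin openin_Int)

lemma compact_open_Int: "Hausdorff_space X \<Longrightarrow> compact_open X U \<Longrightarrow> compact_open X V \<Longrightarrow> compact_open X (U \<inter> V)"
  using compact_open_Int_clopen compact_open_closedin compact_open_def by metis

lemma compact_open_Diff:
  assumes "Hausdorff_space X" "compact_open X U" "compact_open X V"
  shows "compact_open X (U - V)"
proof -
  have "U - V = U \<inter> (topspace X - V)" using assms(2) compact_open_subset by blast
  moreover have "openin X (topspace X - V)" "closedin X (topspace X - V)"
    using assms compact_open_closedin compact_open_def by blast+
  ultimately show ?thesis using compact_open_Int_clopen assms(2) by metis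
qed

lemma compact_open_image:
  assumes "continuous_map X Y f" "open_map X Y f" "compact_open X U"
  shows "compact_open Y (f ` U)"
  using assms by (auto simp: compact_open_def open_map_def intro: image_compactin)

lemma compact_open_subtopology:
  assumes "openin X S"
  shows "compact_open (subtopology X S) U \<longleftrightarrow> compact_open X U \<and> U \<subseteq> S"
  using openin_open_subtopology[OF assms] by (auto simp: compact_open_def compactin_subtopology)

text \<open>These are the locally compact zero-dimensional Hausdorff spaces, described through a
  basis of compact open sets because that property lifts along local homeomorphisms.\<close>

definition locally_boolean :: "'a topology \<Rightarrow> bool" where
  "locally_boolean X \<longleftrightarrow> Hausdorff_space X \<and>
     (\<forall>U x. openin X U \<longrightarrow> x \<in> U \<longrightarrow> (\<exists>K. compact_open X K \<and> x \<in> K \<and> K \<subseteq> U))"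

lemma locally_boolean_Hausdorff: "locally_boolean X \<Longrightarrow> Hausdorff_space X"
  by (simp add: locally_boolean_def)

lemma locally_boolean_nbhd:
  assumes "locally_boolean X" "openin X U" "x \<in> U"
  obtains K where "compact_open X K" "x \<in> K" "K \<subseteq> U"
  using assms unfolding locally_boolean_def by meson

text \<open>In a compact Hausdorff neighbourhood the quasi-components are the connected components,
  hence points here. So \<open>x\<close> can be separated by a clopen set from the compact remainder
  \<open>K - V\<close>, and the part containing \<open>x\<close> lies in \<open>V\<close>.\<close>

lemma locally_boolean_totally_disconnected:
  assumes H: "Hausdorff_space X" and lc: "locally_compact_space X" and td: "totally_disconnected X"
  shows "locally_boolean X"
  unfolding locally_boolean_def
proof (intro conjI allI impI)
  show "Hausdorff_space X" by fact
  fix U x assume U: "openin X U" "x \<in> U"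
  have "neighbourhood_base_of (compactin X) X"
    using H lc locally_compact_space_neighbourhood_base by blast
  then obtain V K where V: "openin X V" "compactin X K" "x \<in> V" "V \<subseteq> K" "K \<subseteq> U"
    using U unfolding neighbourhood_base_of by meson
  define Y where "Y = subtopology X K"
  have KX: "K \<subseteq> topspace X" using V(2) compactin_subset_topspace by blast
  have tY: "topspace Y = K" using KX by (auto simp: Y_def)
  have cY: "compact_space Y" using V(2) by (simp add: Y_def compact_space_subtopology)
  have hY: "Hausdorff_space Y" using H by (simp add: Y_def Hausdorff_space_subtopology)
  define C where "C = quasi_component_of_set Y x"
  have xC: "x \<in> C" using V tY by (auto simp: C_def)
  have Cq: "C \<in> quasi_components_of Y" using V tY by (auto simp: C_def quasi_components_of_def)
  then have "C \<in> connected_components_of Y"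
    using quasi_eq_connected_components_of cY hY by blast
  then have "connectedin Y C" by (simp add: connectedin_connected_components_of)
  then have "connectedin X C" by (simp add: Y_def connectedin_subtopology)
  then have Cx: "C = {x}" using td xC by (auto simp: totally_disconnected_def)
  have "closedin Y (K - V)"
  proof -
    have "openin Y (V \<inter> K)" using V(1) by (simp add: Y_def openin_subtopology_Int)
    then have "closedin Y (topspace Y - (V \<inter> K))" by blast
    moreover have "topspace Y - (V \<inter> K) = K - V" using tY by auto
    ultimately show ?thesis by simp
  qed
  then have "compactin Y (K - V)" using cY closedin_compact_space by blast
  then have "separated_between Y C (K - V)"
    using Cq separated_between_quasi_component_compact Cx V(3) by (auto simp: disjnt_iff)
  then obtain W where W: "closedin Y W" "openin Y W" "x \<in> W" "K - V \<subseteq> K - W"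
    unfolding separated_between Cx tY by blast
  have WV: "W \<subseteq> V" using W(4) W(2) openin_subset[of Y W] tY by blast
  have "compactin Y W" using W(1) cY closedin_compact_space by blast
  then have "compactin X W" by (simp add: Y_def compactin_subtopology)
  \<comment> \<open>Relative openness in \<open>K\<close> becomes openness in \<open>X\<close>
    because \<open>W\<close> lies inside the open set \<open>V\<close>.\<close>
  moreover obtain T where T: "openin X T" "W = T \<inter> K" using W(2) by (auto simp: Y_def openin_subtopology)
  then have "W = T \<inter> V" using WV V(4) by blast
  then have "openin X W" using T V(1) by blast
  ultimately show "\<exists>K. compact_open X K \<and> x \<in> K \<and> K \<subseteq> U"
    using W(3) WV V by (intro exI[of _ W]) (auto simp: compact_open_def)
qed

text \<open>A compact open set inside the image of a sheet is carried back by the homeomorphism of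
  that sheet. Arrow spaces and nerves inherit their bases from the unit space in this way.\<close>

lemma locally_boolean_local_homeo:
  assumes H: "Hausdorff_space X" and f: "local_homeo X Y f" and Y: "locally_boolean Y"
  shows "locally_boolean X"
  unfolding locally_boolean_def
proof (intro conjI allI impI)
  show "Hausdorff_space X" by fact
  fix U x assume U: "openin X U" "x \<in> U"
  then have "x \<in> topspace X" using openin_subset by blast
  then obtain V where V: "openin X V" "x \<in> V" "inj_on f V" using local_homeo_inj_nbhd[OF f] by blast
  define W where "W = U \<inter> V"
  have W: "openin X W" "x \<in> W" "inj_on f W" using U V by (auto simp: W_def intro: inj_on_subset)
  note cf = local_homeo_imp[OF f]
  have "openin Y (f ` W)" using cf W by (simp add: open_map_def)
  then obtain K where K: "compact_open Y K" "f x \<in> K" "K \<subseteq> f ` W"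
    using locally_boolean_nbhd[OF Y] W(2) by blast
  have WX: "W \<subseteq> topspace X" using W(1) openin_subset by blast
  define L where "L = {x \<in> topspace X. f x \<in> K} \<inter> W"
  have "openin X L" unfolding L_def using W K cf by (auto simp: compact_open_def intro: openin_continuous_map_preimage)
  moreover have "homeomorphic_map (subtopology X W) (subtopology Y (f ` W)) f"
    using cf W by (intro homeomorphic_map_restrict_open)
  from homeomorphic_map_compactness[OF this, of L]
  have "compactin (subtopology X W) L \<longleftrightarrow> compactin (subtopology Y (f ` W)) (f ` L)"
    using WX by (auto simp: L_def)
  moreover have "f ` L = K" using K WX by (auto simp: L_def)
  ultimately have "compact_open X L" using K by (auto simp: compact_open_def compactin_subtopology)
  then show "\<exists>K. compact_open X K \<and> x \<in> K \<and> K \<subseteq> U" using W K WX by (intro exI[of _ L]) (auto simp: L_def W_def)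
qed

section \<open>Integer-valued functions of compact support\<close>

lemma continuous_map_discrete_iff:
  "continuous_map X (discrete_topology UNIV) f \<longleftrightarrow> (\<forall>n. openin X {x \<in> topspace X. f x = n})"
proof
  assume c: "continuous_map X (discrete_topology UNIV) f"
  show "\<forall>n. openin X {x \<in> topspace X. f x = n}"
    using openin_continuous_map_preimage[OF c, of "{n}" for n] by simp
next
  assume o: "\<forall>n. openin X {x \<in> topspace X. f x = n}"
  show "continuous_map X (discrete_topology UNIV) f"
    unfolding continuous_map
  proof (intro conjI allI impI)
    fix U 
    have "{x \<in> topspace X. f x \<in> U} = (\<Union>n\<in>U. {x \<in> topspace X. f x = n})" by auto
    then show "openin X {x \<in> topspace X. f x \<in> U}" using o by auto
  qed auto
qed

lemma clopen_discrete_preimage: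
  assumes c: "continuous_map X (discrete_topology UNIV) f"
  shows "openin X {x \<in> topspace X. f x \<in> S}" "closedin X {x \<in> topspace X. f x \<in> S}"
  using openin_continuous_map_preimage[OF c, of S] closedin_continuous_map_preimage[OF c, of S] by auto

lemma Zfun_outside: "f \<in> Zfun X \<Longrightarrow> x \<notin> topspace X \<Longrightarrow> f x = 0"
  by (simp add: Zfun_def)

lemma Zfun_continuous: "f \<in> Zfun X \<Longrightarrow> continuous_map X (discrete_topology UNIV) f"
  by (simp add: Zfun_def)

lemma Zfun_supp: "f \<in> Zfun X \<Longrightarrow> compact_open X {x. f x \<noteq> 0}"
proof -
  assume f: "f \<in> Zfun X"
  then have "{x. f x \<noteq> 0} = {x \<in> topspace X. f x \<noteq> 0}" by (auto simp: Zfun_def)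
  then show ?thesis using f clopen_discrete_preimage[of X f "- {0}"] by (auto simp: Zfun_def compact_open_def)
qed

lemma ZfunI:
  assumes c: "continuous_map X (discrete_topology UNIV) f" and K: "compactin X K"
    and supp: "\<And>x. f x \<noteq> 0 \<Longrightarrow> x \<in> K"
  shows "f \<in> Zfun X"
proof -
  have "closedin X {x \<in> topspace X. f x \<in> - {0}}" using clopen_discrete_preimage(2)[OF c] .
  moreover have "{x \<in> topspace X. f x \<in> - {0}} \<subseteq> K" using supp by auto
  ultimately have "compactin X {x \<in> topspace X. f x \<in> - {0}}" using closed_compactin[OF K] by blast
  then show ?thesis using c supp compactin_subset_topspace[OF K] by (auto simp: Zfun_def)
qed

text \<open>A pair of functions is continuous into a product of discrete spaces, which is discrete;
  the condition at 0 confines the support to the union of the two supports.\<close>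

lemma Zfun_combine:
  assumes "f \<in> Zfun X" "g \<in> Zfun X" "\<phi> 0 0 = (0::int)"
  shows "(\<lambda>x. \<phi> (f x) (g x)) \<in> Zfun X"
proof (rule ZfunI)
  have "continuous_map X (prod_topology (discrete_topology UNIV) (discrete_topology UNIV)) (\<lambda>x. (f x, g x))"
    using assms by (intro continuous_map_pairedI Zfun_continuous)
  then have "continuous_map X (discrete_topology (UNIV \<times> UNIV)) (\<lambda>x. (f x, g x))"
    by (simp only: prod_topology_discrete_topology)
  then have "continuous_map X (discrete_topology UNIV) (\<lambda>x. (f x, g x))" by simp
  then have "continuous_map X (discrete_topology UNIV) ((\<lambda>(a, b). \<phi> a b) \<circ> (\<lambda>x. (f x, g x)))"
    by (rule continuous_map_compose) simp
  then show "continuous_map X (discrete_topology UNIV) (\<lambda>x. \<phi> (f x) (g x))" by (simp add: o_def)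
  show "compactin X ({x. f x \<noteq> 0} \<union> {x. g x \<noteq> 0})"
    using assms Zfun_supp by (auto simp: compact_open_def intro: compactin_Un)
  show "x \<in> {x. f x \<noteq> 0} \<union> {x. g x \<noteq> 0}" if "\<phi> (f x) (g x) \<noteq> 0" for x
    using that assms(3) by auto
qed

lemma Zfun_add: "f \<in> Zfun X \<Longrightarrow> g \<in> Zfun X \<Longrightarrow> (\<lambda>x. f x + g x) \<in> Zfun X"
  by (rule Zfun_combine) auto

lemma Zfun_uminus: "f \<in> Zfun X \<Longrightarrow> (\<lambda>x. - f x) \<in> Zfun X"
  using Zfun_combine[of f X f "\<lambda>a b. - a"] by simp

lemma Zfun_zero: "(\<lambda>x. 0) \<in> Zfun X"
  by (rule ZfunI[of _ _ "{}"]) auto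

lemma Zfun_cmult: "f \<in> Zfun X \<Longrightarrow> (\<lambda>x. k * f x) \<in> Zfun X"
  using Zfun_combine[of f X f "\<lambda>a b. k * a"] by simp

lemma Zfun_sum:
  "(\<And>i. i \<in> I \<Longrightarrow> f i \<in> Zfun X) \<Longrightarrow> (\<lambda>x. \<Sum>i\<in>I. f i x) \<in> Zfun X"
  by (induction I rule: infinite_finite_induct) (auto intro: Zfun_add Zfun_zero)

lemma Zfun_indicator:
  assumes "Hausdorff_space X" "compact_open X U"
  shows "indicator U \<in> Zfun X"
proof (rule ZfunI)
  have "{x \<in> topspace X. indicator U x = n} = (if n = 1 then U else if n = 0 then topspace X - U else {})" for n :: int
    using compact_open_subset[OF assms(2)] by (auto simp: indicator_def)
  then show "continuous_map X (discrete_topology UNIV) (indicator U :: _ \<Rightarrow> int)"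
    using compact_open_closedin[OF assms] assms(2) by (auto simp: continuous_map_discrete_iff compact_open_def)
  show "compactin X U" using assms(2) by (simp add: compact_open_def)
qed (simp add: indicator_def)

lemma Zfun_restrict:
  assumes "f \<in> Zfun X" "openin X C" "closedin X C"
  shows "(\<lambda>x. if x \<in> C then f x else 0) \<in> Zfun X"
proof (rule ZfunI)
  have "{x \<in> topspace X. (if x \<in> C then f x else 0) = n} =
     (C \<inter> {x \<in> topspace X. f x \<in> {n}}) \<union> (if n = 0 then topspace X - C else {})" for n
    using openin_subset[OF assms(2)] by auto
  moreover have "openin X ((C \<inter> {x \<in> topspace X. f x \<in> {n}}) \<union> (if n = 0 then topspace X - C else {}))" for n
    using assms(2,3) clopen_discrete_preimage(1)[OF Zfun_continuous[OF assms(1)], of "{n}"]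
    by (intro openin_Un openin_Int) (auto simp: closedin_def)
  ultimately show "continuous_map X (discrete_topology UNIV) (\<lambda>x. if x \<in> C then f x else 0)"
    by (simp add: continuous_map_discrete_iff)
  show "compactin X {x. f x \<noteq> 0}" using Zfun_supp[OF assms(1)] by (simp add: compact_open_def)
qed (auto split: if_splits)

text \<open>Compactness of the support splits the function into finitely many multiples of
  indicators. The predicate \<open>Q\<close> is an arbitrary hereditary notion of smallness that
  holds locally; with injectivity of a local homeomorphism for \<open>Q\<close>, additive statements
  reduce to single sheets.\<close>

lemma Zfun_induct [consumes 2, case_names empty subset nbhd zero add uminus indicator]:
  assumes X: "locally_boolean X" and f: "f \<in> Zfun X"
    and Q0: "Q {}"
    and Qsub: "\<And>U V. Q U \<Longrightarrow> V \<subseteq> U \<Longrightarrow> Q V"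
    and Qnbhd: "\<And>x. x \<in> topspace X \<Longrightarrow> \<exists>U. openin X U \<and> x \<in> U \<and> Q U"
    and zero: "P (\<lambda>x. 0)"
    and add: "\<And>f g. f \<in> Zfun X \<Longrightarrow> g \<in> Zfun X \<Longrightarrow> P f \<Longrightarrow> P g \<Longrightarrow> P (\<lambda>x. f x + g x)"
    and minus: "\<And>f. f \<in> Zfun X \<Longrightarrow> P f \<Longrightarrow> P (\<lambda>x. - f x)"
    and ind: "\<And>U. compact_open X U \<Longrightarrow> Q U \<Longrightarrow> P (indicator U)"
  shows "P f"
proof -
  have H: "Hausdorff_space X" using X by (rule locally_boolean_Hausdorff)
  have natmult: "P (\<lambda>x. int k * indicator U x)" if "compact_open X U" "Q U" for k U
  proof (induction k)
    case (Suc k)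
    have "P (\<lambda>x. int k * indicator U x + indicator U x)"
      using Suc ind[OF that] Zfun_indicator[OF H that(1)] by (intro add Zfun_cmult)
    then show ?case by (simp add: algebra_simps)
  qed (use zero in simp)
  have mult: "P (\<lambda>x. k * indicator U x)" if "compact_open X U" "Q U" for k U
  proof (cases "k \<ge> 0")
    case True
    then show ?thesis using natmult[OF that, of "nat k"] by simp
  next
    case False
    have "P (\<lambda>x. - (int (nat (- k)) * indicator U x))"
      using natmult[OF that] Zfun_indicator[OF H that(1)] by (intro minus Zfun_cmult)
    then show ?thesis using False by simp
  qed
  have main: "finite F \<Longrightarrow> (\<forall>U\<in>F. compact_open X U \<and> Q U \<and> (\<exists>n. \<forall>x\<in>U. f x \<in> {0, n})) \<Longrightarrow>
     {x. f x \<noteq> 0} \<subseteq> \<Union>F \<Longrightarrow> f \<in> Zfun X \<Longrightarrow> P f" for F f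
  proof (induction F arbitrary: f rule: finite_induct)
    case empty
    then have "f = (\<lambda>x. 0)" by auto
    then show ?case using zero by simp
  next
    case (insert U F)
    then obtain n where U: "compact_open X U" "Q U" "\<forall>x\<in>U. f x \<in> {0, n}" by auto
    have clop: "openin X U" "closedin X U" "openin X (topspace X - U)" "closedin X (topspace X - U)"
      using U(1) compact_open_closedin[OF H] by (auto simp: compact_open_def)
    define V where "V = U \<inter> {x \<in> topspace X. f x \<in> {n}}"
    have V: "compact_open X V" "Q V"
      using U clopen_discrete_preimage[OF Zfun_continuous[OF insert.prems(3)], of "{n}"] Qsub[OF U(2), of V]
      by (auto simp: V_def intro!: compact_open_Int_clopen)
    define g where "g = (\<lambda>x. if x \<in> topspace X - U then f x else 0)"
    have g: "g \<in> Zfun X" unfolding g_def using insert.prems(3) clop(3,4) by (rule Zfun_restrict)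
    have "P g"
    proof (rule insert.IH)
      show "\<forall>U\<in>F. compact_open X U \<and> Q U \<and> (\<exists>n. \<forall>x\<in>U. g x \<in> {0, n})"
      proof
        fix U' assume "U' \<in> F"
        then obtain n where "compact_open X U'" "Q U'" "\<forall>x\<in>U'. f x \<in> {0, n}" using insert.prems(1) by blast
        then show "compact_open X U' \<and> Q U' \<and> (\<exists>n. \<forall>x\<in>U'. g x \<in> {0, n})"
          by (intro conjI exI[of _ n]) (auto simp: g_def)
      qed
      show "{x. g x \<noteq> 0} \<subseteq> \<Union>F" using insert.prems(2) by (auto simp: g_def)
    qed (rule g)
    moreover have "P (\<lambda>x. n * indicator V x)" using V by (rule mult)
    ultimately have "P (\<lambda>x. n * indicator V x + g x)"
      using g V Zfun_indicator[OF H] by (intro add Zfun_cmult) auto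
    moreover have "(\<lambda>x. n * indicator V x + g x) = f"
      using U(3) compact_open_subset[OF U(1)] Zfun_outside[OF insert.prems(3)]
      by (auto simp: fun_eq_iff g_def V_def indicator_def)
    ultimately show ?case by simp
  qed
  let ?K = "{x. f x \<noteq> 0}"
  let ?B = "{U. compact_open X U \<and> Q U \<and> (\<exists>n. \<forall>x\<in>U. f x \<in> {0, n})}"
  have K: "compactin X ?K" using Zfun_supp[OF f] by (simp add: compact_open_def)
  have cov: "?K \<subseteq> \<Union>?B"
  proof
    fix x assume "x \<in> ?K"
    then have x: "x \<in> topspace X" using Zfun_outside[OF f] by blast
    obtain U where U: "openin X U" "x \<in> U" "Q U" using Qnbhd[OF x] by blast
    have "openin X (U \<inter> {y \<in> topspace X. f y \<in> {f x}})"
      using U clopen_discrete_preimage[OF Zfun_continuous[OF f]] by blast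
    then obtain V where V: "compact_open X V" "x \<in> V" "V \<subseteq> U \<inter> {y \<in> topspace X. f y \<in> {f x}}"
      using locally_boolean_nbhd[OF X] U x by (metis (no_types, lifting) IntI insertI1 mem_Collect_eq)
    then have "V \<in> ?B" using Qsub[OF U(3)] by auto
    then show "x \<in> \<Union>?B" using V by blast
  qed
  have "\<exists>F. finite F \<and> F \<subseteq> ?B \<and> ?K \<subseteq> \<Union>F"
    by (rule compactinD[OF K]) (use cov in \<open>auto simp: compact_open_def\<close>)
  then obtain F where "finite F" "F \<subseteq> ?B" "?K \<subseteq> \<Union>F" by blast
  then show ?thesis using f by (intro main[of F]) auto
qed

text \<open>Written multiplicatively, so that maps into the fibres of a sheaf, which are groups in
  multiplicative notation, are ordinary group homomorphisms.\<close>

definition Zgroup :: "'a topology \<Rightarrow> ('a \<Rightarrow> int) monoid" where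
  "Zgroup X = \<lparr>carrier = Zfun X, mult = (\<lambda>f g x. f x + g x), one = (\<lambda>x. 0)\<rparr>"

lemma Zgroup_simps [simp]:
  "carrier (Zgroup X) = Zfun X" "f \<otimes>\<^bsub>Zgroup X\<^esub> g = (\<lambda>x. f x + g x)" "\<one>\<^bsub>Zgroup X\<^esub> = (\<lambda>x. 0)"
  by (simp_all add: Zgroup_def)

lemma comm_group_Zgroup: "comm_group (Zgroup X)"
proof (rule comm_groupI)
  fix f assume "f \<in> carrier (Zgroup X)"
  then show "\<exists>g\<in>carrier (Zgroup X). g \<otimes>\<^bsub>Zgroup X\<^esub> f = \<one>\<^bsub>Zgroup X\<^esub>"
    by (intro bexI[of _ "\<lambda>x. - f x"]) (auto intro: Zfun_uminus)
qed (auto simp: algebra_simps intro: Zfun_add Zfun_zero)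

lemma inv_Zgroup: "f \<in> Zfun X \<Longrightarrow> inv\<^bsub>Zgroup X\<^esub> f = (\<lambda>x. - f x)"
  by (rule group.inv_equality[OF comm_group.axioms(2)[OF comm_group_Zgroup]]) (auto intro: Zfun_uminus)

text \<open>The functions on which two homomorphisms agree are closed under sums and negation, and
  the indicators of small sets generate everything.\<close>

lemma Zfun_hom_eqI:
  assumes X: "locally_boolean X" and f: "f \<in> Zfun X"
    and Q0: "Q {}"
    and Qsub: "\<And>U V. Q U \<Longrightarrow> V \<subseteq> U \<Longrightarrow> Q V"
    and Qnbhd: "\<And>x. x \<in> topspace X \<Longrightarrow> \<exists>U. openin X U \<and> x \<in> U \<and> Q U"
    and K: "group K" and F1: "F1 \<in> hom (Zgroup X) K" and F2: "F2 \<in> hom (Zgroup X) K"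
    and eq: "\<And>U. compact_open X U \<Longrightarrow> Q U \<Longrightarrow> F1 (indicator U) = F2 (indicator U)"
  shows "F1 f = F2 f"
proof -
  have Z: "group (Zgroup X)" using comm_group_Zgroup comm_group.axioms(2) by blast
  interpret F1: group_hom "Zgroup X" K F1 using Z K F1 by (simp add: group_hom_def group_hom_axioms_def)
  interpret F2: group_hom "Zgroup X" K F2 using Z K F2 by (simp add: group_hom_def group_hom_axioms_def)
  show ?thesis
    using X f
  proof (induction rule: Zfun_induct[where Q = Q])
    case zero
    then show ?case using F1.hom_one F2.hom_one by simp
  next
    case (add f g)
    then show ?case using F1.hom_mult[of f g] F2.hom_mult[of f g] by simp
  next
    case (uminus f)
    then show ?case using F1.hom_inv[of f] F2.hom_inv[of f] by (simp add: inv_Zgroup)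
  qed (use Q0 Qsub Qnbhd eq in blast)+
qed

text \<open>The indicator of a set on which \<open>\<tau>\<close> is injective meets a fibre at most
  once, and finiteness survives sums. It is needed before any additivity of \<open>sum'\<close>,
  whose value on a family with infinitely many nonzero terms is the default 0.\<close>

lemma finite_fibre_support:
  assumes X: "locally_boolean X" and f: "f \<in> Zfun X" and t: "local_homeo X Y \<tau>"
  shows "finite {x. \<tau> x = y \<and> f x \<noteq> 0}"
  using X f
proof (induction rule: Zfun_induct[where Q = "inj_on \<tau>"])
  case (nbhd x)
  then show ?case using local_homeo_inj_nbhd[OF t] by metis
next
  case (add f g)
  have "{x. \<tau> x = y \<and> f x + g x \<noteq> 0} \<subseteq> {x. \<tau> x = y \<and> f x \<noteq> 0} \<union> {x. \<tau> x = y \<and> g x \<noteq> 0}" by auto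
  then show ?case using add by (meson finite_UnI finite_subset)
next
  case (indicator U)
  have "{x. \<tau> x = y \<and> indicator U x \<noteq> (0::int)} \<subseteq> {the_inv_into U \<tau> y}"
    using indicator(2) by (auto simp: indicator_def the_inv_into_f_f)
  then show ?case using finite_subset by blast
qed (auto intro: inj_on_subset)

section \<open>Pushforward along local homeomorphisms\<close>

lemma pushforward_add:
  assumes X: "locally_boolean X" and f: "f \<in> Zfun X" "g \<in> Zfun X" and t: "local_homeo X Y \<tau>"
  shows "pushforward X Y \<tau> (\<lambda>x. f x + g x) = (\<lambda>y. pushforward X Y \<tau> f y + pushforward X Y \<tau> g y)"
proof -
  have "finite {x \<in> {x \<in> topspace X. \<tau> x = y}. h x \<noteq> 0}" if "h \<in> Zfun X" for h y
    by (rule finite_subset[OF _ finite_fibre_support[OF X that t, of y]]) auto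
  then show ?thesis using f by (auto simp: pushforward_def fun_eq_iff sum.distrib')
qed

lemma pushforward_uminus: "pushforward X Y \<tau> (\<lambda>x. - f x) = (\<lambda>y. - pushforward X Y \<tau> f y)"
  by (auto simp: pushforward_def fun_eq_iff sum.G_def sum_negf)

lemma sum'_indicator_inj:
  assumes "inj_on \<tau> U"
  shows "sum' (indicator U) {x. \<tau> x = y \<and> P x} = (if \<exists>x\<in>U. \<tau> x = y \<and> P x then 1 else 0 :: int)"
proof (cases "\<exists>x\<in>U. \<tau> x = y \<and> P x")
  case True
  then obtain x where x: "x \<in> U" "\<tau> x = y" "P x" by auto
  have "sum' (indicator U) {x} = (sum' (indicator U) {x. \<tau> x = y \<and> P x} :: int)"
    by (rule sum.mono_neutral_left') (use x assms in \<open>auto simp: indicator_def inj_on_def\<close>)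
  then show ?thesis using True x by simp
next
  case False
  have "sum' (indicator U) {} = (sum' (indicator U) {x. \<tau> x = y \<and> P x} :: int)"
    by (rule sum.mono_neutral_left') (use False in \<open>auto simp: indicator_def\<close>)
  then show ?thesis using False by simp
qed

lemma pushforward_indicator:
  assumes "U \<subseteq> topspace X" "inj_on \<tau> U" "\<tau> ` U \<subseteq> topspace Y"
  shows "pushforward X Y \<tau> (indicator U) = indicator (\<tau> ` U)"
proof
  fix y
  have "{x \<in> topspace X. \<tau> x = y} = {x. \<tau> x = y \<and> x \<in> topspace X}" by auto
  then show "pushforward X Y \<tau> (indicator U) y = indicator (\<tau> ` U) y"
    using assms sum'_indicator_inj[OF assms(2), of y "\<lambda>x. x \<in> topspace X"]
    by (auto simp: pushforward_def indicator_def)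
qed

text \<open>On a sheet the pushforward of an indicator is the indicator of the image, which is
  compact open because \<open>\<tau>\<close> is continuous and open.\<close>

lemma pushforward_Zfun:
  assumes X: "locally_boolean X" and Y: "Hausdorff_space Y" and f: "f \<in> Zfun X" and t: "local_homeo X Y \<tau>"
  shows "pushforward X Y \<tau> f \<in> Zfun Y"
  using X f
proof (induction rule: Zfun_induct[where Q = "inj_on \<tau>"])
  case (nbhd x)
  then show ?case using local_homeo_inj_nbhd[OF t] by metis
next
  case zero
  have "pushforward X Y \<tau> (\<lambda>x. 0) = (\<lambda>y. 0)" by (auto simp: pushforward_def fun_eq_iff sum.G_def)
  then show ?case by (simp add: Zfun_zero)
next
  case (add f g)
  then show ?case using pushforward_add[OF X _ _ t] by (simp add: Zfun_add)
next
  case (uminus f)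
  then show ?case by (simp add: pushforward_uminus Zfun_uminus)
next
  case (indicator U)
  have "compact_open Y (\<tau> ` U)" using local_homeo_imp[OF t] indicator by (intro compact_open_image)
  then have "pushforward X Y \<tau> (indicator U) = indicator (\<tau> ` U)"
    using indicator by (intro pushforward_indicator) (auto dest: compact_open_subset)
  then show ?case using Zfun_indicator[OF Y \<open>compact_open Y (\<tau> ` U)\<close>] by simp
qed (auto intro: inj_on_subset)

section \<open>Groupoid actions\<close>

lemma sum'_single:
  assumes "\<And>x. x \<in> A \<Longrightarrow> x \<noteq> a \<Longrightarrow> f x = 0"
  shows "sum' f A = (if a \<in> A then f a else 0)"
proof (cases "a \<in> A")
  case True
  have "sum' f {a} = sum' f A" by (rule sum.mono_neutral_left') (use True assms in auto)
  then show ?thesis using True by simp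
next
  case False
  have "sum' f {} = sum' f A" by (rule sum.mono_neutral_left') (use False assms in auto)
  then show ?thesis using False by simp
qed

lemma sum'_zero: "(\<And>x. x \<in> A \<Longrightarrow> f x = 0) \<Longrightarrow> sum' f A = 0"
  using sum'_single[of A undefined f] by auto

lemma sum'_cmult: "sum' (\<lambda>x. (k::int) * f x) A = k * sum' f A"
  by (cases "k = 0") (simp_all add: sum.G_def sum_distrib_left)

text \<open>On the image of a sheet the inverse is a continuous local section. This is how an arrow
  of a bisection is selected continuously by its range, and a point of a small set by its
  anchor.\<close>

lemma continuous_map_the_inv_into:
  assumes f: "local_homeo X Y f" and U: "openin X U" "inj_on f U"
  shows "continuous_map (subtopology Y (f ` U)) X (the_inv_into U f)"
proof -
  have UX: "U \<subseteq> topspace X" using U openin_subset by blast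
  have "homeomorphic_map (subtopology X U) (subtopology Y (f ` U)) f"
    using local_homeo_imp[OF f] U by (intro homeomorphic_map_restrict_open)
  then obtain g where g: "homeomorphic_maps (subtopology X U) (subtopology Y (f ` U)) f g"
    using homeomorphic_map_maps by blast
  then have cg: "continuous_map (subtopology Y (f ` U)) X g"
    by (simp add: homeomorphic_maps_def continuous_map_in_subtopology)
  moreover have "g y = the_inv_into U f y" if "y \<in> topspace (subtopology Y (f ` U))" for y
  proof -
    from that obtain u where "u \<in> U" "y = f u" by auto
    then show ?thesis using g UX U(2) by (auto simp: homeomorphic_maps_def the_inv_into_f_f)
  qed
  ultimately show ?thesis using continuous_map_eq by blast
qed

lemma local_homeo_compose:
  assumes f: "local_homeo X Y f" and g: "local_homeo Y Z g"
  shows "local_homeo X Z (g \<circ> f)"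
  unfolding local_homeo_iff
proof (intro conjI ballI)
  note c = local_homeo_imp[OF f] local_homeo_imp[OF g]
  show "continuous_map X Z (g \<circ> f)" using c continuous_map_compose by blast
  show "open_map X Z (g \<circ> f)" using c open_map_compose by blast
  fix x assume x: "x \<in> topspace X"
  then have "f x \<in> topspace Y" using c(1) by (metis continuous_map_image_subset_topspace image_subset_iff)
  then obtain V where V: "openin Y V" "f x \<in> V" "inj_on g V" using local_homeo_inj_nbhd[OF g] by blast
  obtain U where U: "openin X U" "x \<in> U" "inj_on f U" using local_homeo_inj_nbhd[OF f x] .
  let ?W = "U \<inter> {x \<in> topspace X. f x \<in> V}"
  have "openin X ?W" using U V c by (intro openin_Int openin_continuous_map_preimage)
  moreover have "inj_on (g \<circ> f) ?W" using U(3) V(3) by (auto simp: inj_on_def)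
  ultimately show "\<exists>U. openin X U \<and> x \<in> U \<and> inj_on (g \<circ> f) U" using U V x by blast
qed

lemma pushforward_cmult: "pushforward X Y \<tau> (\<lambda>x. k * f x) = (\<lambda>y. k * pushforward X Y \<tau> f y)"
  by (auto simp: pushforward_def fun_eq_iff sum'_cmult)

lemma continuous_map_into_prod_subtopology:
  assumes "continuous_map Z X f" "continuous_map Z Y g" "\<And>z. z \<in> topspace Z \<Longrightarrow> (f z, g z) \<in> E"
  shows "continuous_map Z (subtopology (prod_topology X Y) E) (\<lambda>z. (f z, g z))"
  using assms by (intro continuous_map_into_subtopology continuous_map_pairedI) auto

context groupoid
begin

lemma units_arr: "u \<in> units G \<Longrightarrow> u \<in> arr G"
  by (auto simp: units_def rng_closed)

lemma rng_units: "g \<in> arr G \<Longrightarrow> rng G g \<in> units G"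
  by (simp add: units_def)

lemma units_iff: "u \<in> units G \<longleftrightarrow> u \<in> arr G \<and> rng G u = u"
  using units_arr rng_unit rng_units by metis

lemma inv_unique:
  assumes "g \<in> arr G" "h \<in> arr G" "src G g = rng G h" "gmult G g h = rng G g"
  shows "h = ginv G g"
proof -
  have "h = gmult G (gmult G (ginv G g) g) h" using assms left_inv left_unit by metis
  also have "\<dots> = gmult G (ginv G g) (gmult G g h)" using assms assoc inv_closed src_inv by metis
  also have "\<dots> = ginv G g" using assms right_unit inv_closed src_inv by metis
  finally show ?thesis .
qed

lemma inv_inv: "g \<in> arr G \<Longrightarrow> ginv G (ginv G g) = g"
  by (metis inv_closed inv_unique left_inv rng_inv src_inv)

lemma inv_unit: "u \<in> units G \<Longrightarrow> ginv G u = u"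
  by (metis inv_unique right_unit rng_unit src_unit units_arr)

end

context ample_groupoid
begin

lemma topspace_unit_space [simp]: "topspace (unit_space G) = units G"
  using units_arr by (auto simp: unit_space_def)

lemma continuous_rng_unit_space: "continuous_map (arrows G) (unit_space G) (rng G)"
  using etale_rng local_homeo_imp by blast

lemma continuous_src_unit_space: "continuous_map (arrows G) (unit_space G) (src G)"
  using etale_src local_homeo_imp by blast

lemma continuous_unit_space_arrows: "continuous_map Z (unit_space G) f \<Longrightarrow> continuous_map Z (arrows G) f"
  by (simp add: unit_space_def continuous_map_in_subtopology)

lemma continuous_rng: "continuous_map (arrows G) (arrows G) (rng G)"
  by (intro continuous_unit_space_arrows continuous_rng_unit_space)

lemma continuous_src: "continuous_map (arrows G) (arrows G) (src G)"
  by (intro continuous_unit_space_arrows continuous_src_unit_space)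

text \<open>Near a unit both \<open>g\<close> and \<open>rng G g\<close> lie in a set on which
  \<open>rng G\<close> is injective, and they have the same range because \<open>rng G\<close> is
  idempotent; so \<open>g\<close> is its own range.\<close>

lemma openin_units: "openin (arrows G) (units G)"
proof (subst openin_subopen, intro ballI)
  fix u assume u: "u \<in> units G"
  then have ua: "u \<in> arr G" by (rule units_arr)
  obtain U where U: "openin (arrows G) U" "u \<in> U" "inj_on (rng G) U"
    using local_homeo_inj_nbhd[OF etale_rng ua] by blast
  let ?W = "U \<inter> {g \<in> arr G. rng G g \<in> U}"
  have "openin (arrows G) ?W"
    using U continuous_rng by (intro openin_Int openin_continuous_map_preimage)
  moreover have "u \<in> ?W" using U u ua rng_unit by simp
  moreover have "?W \<subseteq> units G"
  proof
    fix g assume g: "g \<in> ?W"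
    then have "rng G (rng G g) = rng G g" using rng_unit rng_units by auto
    then have "rng G g = g" using U(3) g by (auto dest: inj_onD)
    then show "g \<in> units G" using g rng_units by force
  qed
  ultimately show "\<exists>T. openin (arrows G) T \<and> u \<in> T \<and> T \<subseteq> units G" by blast
qed

lemma closedin_units: "closedin (arrows G) (units G)"
proof -
  have "units G = {g \<in> arr G. rng G g = g}" using units_iff by blast
  then show ?thesis
    using closedin_continuous_maps_eq[OF hausdorff continuous_rng continuous_map_id] by simp
qed

lemma compact_open_unit_space: "compact_open (unit_space G) U \<longleftrightarrow> compact_open (arrows G) U \<and> U \<subseteq> units G"
  using compact_open_subtopology[OF openin_units] by (simp add: unit_space_def)

lemma Hausdorff_unit_space: "Hausdorff_space (unit_space G)"
  using hausdorff by (simp add: unit_space_def Hausdorff_space_subtopology)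

lemma locally_boolean_unit_space: "locally_boolean (unit_space G)"
proof (rule locally_boolean_totally_disconnected)
  show "locally_compact_space (unit_space G)"
    using locally_compact closedin_units by (simp add: unit_space_def locally_compact_space_closed_subset)
qed (use Hausdorff_unit_space units_totally_disconnected in auto)

lemma locally_boolean_arrows: "locally_boolean (arrows G)"
  using hausdorff etale_rng locally_boolean_unit_space by (rule locally_boolean_local_homeo)

lemma bisection_nbhd:
  assumes "openin (arrows G) U" "g \<in> U"
  obtains B where "compact_open_bisection G B" "g \<in> B" "B \<subseteq> U"
proof -
  have g: "g \<in> arr G" using assms openin_subset by blast
  obtain U1 where U1: "openin (arrows G) U1" "g \<in> U1" "inj_on (rng G) U1" using local_homeo_inj_nbhd[OF etale_rng g] .
  obtain U2 where U2: "openin (arrows G) U2" "g \<in> U2" "inj_on (src G) U2" using local_homeo_inj_nbhd[OF etale_src g] .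
  have "openin (arrows G) (U \<inter> (U1 \<inter> U2))" using assms U1 U2 by blast
  moreover have "g \<in> U \<inter> (U1 \<inter> U2)" using assms U1 U2 by blast
  ultimately obtain B where "compact_open (arrows G) B" "g \<in> B" "B \<subseteq> U \<inter> (U1 \<inter> U2)"
    using locally_boolean_nbhd[OF locally_boolean_arrows] by blast
  then show ?thesis using U1(3) U2(3)
    by (intro that[of B]) (auto simp: compact_open_bisection_def intro: inj_on_subset)
qed

lemma bisection_subset:
  "compact_open_bisection G B \<Longrightarrow> compact_open (arrows G) C \<Longrightarrow> C \<subseteq> B \<Longrightarrow> compact_open_bisection G C"
  by (auto simp: compact_open_bisection_def intro: inj_on_subset)

lemma bisection_arr: "compact_open_bisection G B \<Longrightarrow> g \<in> B \<Longrightarrow> g \<in> arr G"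
  using compact_open_subset by (auto simp: compact_open_bisection_def)

lemma units_bisection: "compact_open (unit_space G) U \<Longrightarrow> compact_open_bisection G U"
  unfolding compact_open_unit_space compact_open_bisection_def inj_on_def
  by (metis rng_unit src_unit subsetD)

lemma compact_open_rng: "compact_open (arrows G) B \<Longrightarrow> compact_open (unit_space G) (rng G ` B)"
  using local_homeo_imp[OF etale_rng] by (rule compact_open_image)

lemma compact_open_src: "compact_open (arrows G) B \<Longrightarrow> compact_open (unit_space G) (src G ` B)"
  using local_homeo_imp[OF etale_src] by (rule compact_open_image)

lemma indicator_bisection: "compact_open_bisection G B \<Longrightarrow> indicator B \<in> Zfun (arrows G)"
  by (simp add: compact_open_bisection_def Zfun_indicator hausdorff)

lemma indicator_units: "compact_open (unit_space G) U \<Longrightarrow> indicator U \<in> Zfun (arrows G)"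
  by (intro indicator_bisection units_bisection)

text \<open>Convolution and the action on functions on nerves are both instances. The space, its
  anchor and its action are arguments, so that two spaces can occur in one statement.\<close>

definition smul :: "'x topology \<Rightarrow> ('x \<Rightarrow> 'a) \<Rightarrow> ('a \<Rightarrow> 'x \<Rightarrow> 'x) \<Rightarrow> ('a \<Rightarrow> int) \<Rightarrow> ('x \<Rightarrow> int) \<Rightarrow> 'x \<Rightarrow> int" where
  "smul X p t f m = (\<lambda>y. if y \<in> topspace X
     then sum' (\<lambda>g. f (ginv G g) * m (t g y)) {g \<in> arr G. src G g = p y} else 0)"

lemma bisection_Zfun_induct [consumes 1, case_names zero add uminus indicator]:
  assumes "f \<in> Zfun (arrows G)"
    and "P (\<lambda>x. 0)"
    and "\<And>f g. f \<in> Zfun (arrows G) \<Longrightarrow> g \<in> Zfun (arrows G) \<Longrightarrow> P f \<Longrightarrow> P g \<Longrightarrow> P (\<lambda>x. f x + g x)"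
    and "\<And>f. f \<in> Zfun (arrows G) \<Longrightarrow> P f \<Longrightarrow> P (\<lambda>x. - f x)"
    and "\<And>B. compact_open_bisection G B \<Longrightarrow> P (indicator B)"
  shows "P f"
  using locally_boolean_arrows assms(1)
proof (induction rule: Zfun_induct[where Q = "\<lambda>B. inj_on (rng G) B \<and> inj_on (src G) B"])
  case (nbhd g)
  then obtain B where "compact_open_bisection G B" "g \<in> B" "B \<subseteq> arr G"
    using bisection_nbhd[of "arr G" g] by auto
  then show ?case by (auto simp: compact_open_bisection_def compact_open_def)
next
  case (indicator U)
  then show ?case using assms(5) by (simp add: compact_open_bisection_def)
qed (use assms in \<open>auto intro: inj_on_subset\<close>)

lemma bisection_hom_eqI:
  assumes "f \<in> Zfun (arrows G)" "group K" "F1 \<in> hom (Zgroup (arrows G)) K" "F2 \<in> hom (Zgroup (arrows G)) K"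
    and "\<And>B. compact_open_bisection G B \<Longrightarrow> F1 (indicator B) = F2 (indicator B)"
  shows "F1 f = F2 f"
proof (rule Zfun_hom_eqI[OF locally_boolean_arrows assms(1), where Q = "\<lambda>B. inj_on (rng G) B \<and> inj_on (src G) B"])
  fix g assume "g \<in> arr G"
  then obtain B where "compact_open_bisection G B" "g \<in> B" "B \<subseteq> arr G"
    using bisection_nbhd[of "arr G" g] by auto
  then show "\<exists>U. openin (arrows G) U \<and> g \<in> U \<and> inj_on (rng G) U \<and> inj_on (src G) U"
    by (auto simp: compact_open_bisection_def compact_open_def)
qed (use assms in \<open>auto simp: compact_open_bisection_def intro: inj_on_subset\<close>)

end

text \<open>
  Both the groupoid itself, acting by left multiplication, and its nerves are of this form.
\<close>

locale gspace = ample_groupoid G for G :: "'g groupoid" +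
  fixes X :: "'x topology" and p :: "'x \<Rightarrow> 'g" and t :: "'g \<Rightarrow> 'x \<Rightarrow> 'x"
  assumes X_Hausdorff: "Hausdorff_space X"
    and p_local_homeo: "local_homeo X (unit_space G) p"
    and t_continuous: "continuous_map (subtopology (prod_topology (arrows G) X) {(g, y). src G g = p y}) X (\<lambda>(g, y). t g y)"
    and p_t: "\<lbrakk>g \<in> arr G; y \<in> topspace X; src G g = p y\<rbrakk> \<Longrightarrow> p (t g y) = rng G g"
    and t_unit: "y \<in> topspace X \<Longrightarrow> t (p y) y = y"
    and t_mult: "\<lbrakk>g \<in> arr G; h \<in> arr G; y \<in> topspace X; src G g = rng G h; src G h = p y\<rbrakk>
      \<Longrightarrow> t (gmult G g h) y = t g (t h y)"
begin

abbreviation smulX :: "('g \<Rightarrow> int) \<Rightarrow> ('x \<Rightarrow> int) \<Rightarrow> 'x \<Rightarrow> int" where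
  "smulX \<equiv> smul X p t"

definition bis_act :: "'g set \<Rightarrow> 'x set \<Rightarrow> 'x set" where
  "bis_act B V = {t g y | g y. g \<in> B \<and> y \<in> V \<and> src G g = p y}"

lemma locally_boolean_X: "locally_boolean X"
  using X_Hausdorff p_local_homeo locally_boolean_unit_space by (rule locally_boolean_local_homeo)

lemma p_continuous: "continuous_map X (unit_space G) p" and p_open: "open_map X (unit_space G) p"
  using local_homeo_imp[OF p_local_homeo] by auto

lemma p_units: "y \<in> topspace X \<Longrightarrow> p y \<in> units G"
  using p_continuous by (metis continuous_map_image_subset_topspace image_subset_iff topspace_unit_space)

lemma t_closed: "\<lbrakk>g \<in> arr G; y \<in> topspace X; src G g = p y\<rbrakk> \<Longrightarrow> t g y \<in> topspace X"
  using continuous_map_image_subset_topspace[OF t_continuous, THEN subsetD, OF imageI, of "(g, y)"] by simp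

lemma t_inv_left: "\<lbrakk>g \<in> arr G; y \<in> topspace X; src G g = p y\<rbrakk> \<Longrightarrow> t (ginv G g) (t g y) = y"
  using t_mult[of "ginv G g" g y] t_unit left_inv inv_closed src_inv by simp

lemma t_inv_right: "\<lbrakk>g \<in> arr G; y \<in> topspace X; rng G g = p y\<rbrakk> \<Longrightarrow> t g (t (ginv G g) y) = y"
  using t_inv_left[of "ginv G g" y] inv_closed inv_inv src_inv by simp

text \<open>The anchor of \<open>z\<close> selects a unique arrow \<open>b\<close> of
  \<open>B\<close>, so membership in the product set is decided by moving \<open>z\<close> back
  along \<open>b\<close>.\<close>

lemma bis_act_mem:
  assumes "B \<subseteq> arr G" "inj_on (rng G) B" "V \<subseteq> topspace X" "b \<in> B" "z \<in> topspace X" "p z = rng G b"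
  shows "z \<in> bis_act B V \<longleftrightarrow> t (ginv G b) z \<in> V"
proof
  assume "z \<in> bis_act B V"
  then obtain g y where gy: "z = t g y" "g \<in> B" "y \<in> V" "src G g = p y" by (auto simp: bis_act_def)
  then have "p z = rng G g" using p_t assms by blast
  then have "g = b" using assms gy by (auto dest: inj_onD)
  then show "t (ginv G b) z \<in> V" using gy t_inv_left assms by (metis subsetD)
next
  assume V: "t (ginv G b) z \<in> V"
  have b: "b \<in> arr G" using assms by blast
  have "z = t b (t (ginv G b) z)" using t_inv_right[OF b] assms by simp
  moreover have "src G b = p (t (ginv G b) z)"
    using p_t[of "ginv G b" z] b assms by (simp add: inv_closed src_inv rng_inv)
  ultimately show "z \<in> bis_act B V" using V assms by (auto simp: bis_act_def)
qed

lemma bis_act_subset: "B \<subseteq> arr G \<Longrightarrow> V \<subseteq> topspace X \<Longrightarrow> bis_act B V \<subseteq> topspace X"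
  using t_closed by (auto simp: bis_act_def)

lemma bis_act_anchor: "B \<subseteq> arr G \<Longrightarrow> V \<subseteq> topspace X \<Longrightarrow> z \<in> bis_act B V \<Longrightarrow> p z \<in> rng G ` B"
  using p_t unfolding bis_act_def by blast

text \<open>Compactness: the composable pairs form a closed part of the product of \<open>B\<close>
  and \<open>V\<close>, because source and anchor agree on a closed set, and the action is
  continuous. Openness: over the ranges of \<open>B\<close>, the product set is the preimage of
  \<open>V\<close> under the continuous map that moves \<open>z\<close> back along the arrow of
  \<open>B\<close> ending at its anchor.\<close>

lemma compact_open_bis_act:
  assumes B: "compact_open (arrows G) B" "inj_on (rng G) B" and V: "compact_open X V"
  shows "compact_open X (bis_act B V)"
proof -
  have BG: "B \<subseteq> arr G" and VX: "V \<subseteq> topspace X" using B V compact_open_subset by blast+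
  let ?E = "{(g, y). src G g = p y}"
  let ?P = "prod_topology (arrows G) X"
  have "closedin ?P {z \<in> topspace ?P. (src G \<circ> fst) z = (p \<circ> snd) z}"
    by (rule closedin_continuous_maps_eq[OF hausdorff continuous_map_compose[OF continuous_map_fst continuous_src]
        continuous_map_compose[OF continuous_map_snd continuous_unit_space_arrows[OF p_continuous]]])
  then have "compactin ?P ((B \<times> V) \<inter> {z \<in> topspace ?P. (src G \<circ> fst) z = (p \<circ> snd) z})"
    using B V by (intro compact_Int_closedin) (auto simp: compactin_Times compact_open_def)
  moreover have "(B \<times> V) \<inter> {z \<in> topspace ?P. (src G \<circ> fst) z = (p \<circ> snd) z} = (B \<times> V) \<inter> ?E"
    using BG VX by auto
  ultimately have "compactin (subtopology ?P ?E) ((B \<times> V) \<inter> ?E)" by (simp add: compactin_subtopology)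
  then have "compactin X ((\<lambda>(g, y). t g y) ` ((B \<times> V) \<inter> ?E))" using t_continuous by (rule image_compactin)
  moreover have "(\<lambda>(g, y). t g y) ` ((B \<times> V) \<inter> ?E) = bis_act B V" by (auto simp: bis_act_def)
  ultimately have c: "compactin X (bis_act B V)" by simp
  let ?N = "{z \<in> topspace X. p z \<in> rng G ` B}"
  let ?s = "\<lambda>z. the_inv_into B (rng G) (p z)"
  have oB: "openin (arrows G) B" using B by (simp add: compact_open_def)
  then have "openin (unit_space G) (rng G ` B)" using local_homeo_imp[OF etale_rng] by (simp add: open_map_def)
  then have N: "openin X ?N" using p_continuous by (intro openin_continuous_map_preimage)
  have "continuous_map (subtopology X ?N) (subtopology (unit_space G) (rng G ` B)) p"
    using p_continuous by (auto simp: continuous_map_in_subtopology continuous_map_from_subtopology)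
  then have s: "continuous_map (subtopology X ?N) (arrows G) ?s"
    using continuous_map_compose[OF _ continuous_map_the_inv_into[OF etale_rng oB B(2)]] by (simp add: o_def)
  then have s': "continuous_map (subtopology X ?N) (arrows G) (\<lambda>z. ginv G (?s z))"
    using continuous_map_compose[OF _ continuous_inv] by (simp add: o_def)
  have sB: "?s z \<in> B" "rng G (?s z) = p z" if "z \<in> ?N" for z
    using that B(2) by (auto simp: the_inv_into_f_f)
  have "continuous_map (subtopology X ?N) (subtopology ?P ?E) (\<lambda>z. (ginv G (?s z), z))"
  proof (rule continuous_map_into_prod_subtopology[OF s'])
    show "continuous_map (subtopology X ?N) X (\<lambda>z. z)" by (simp add: continuous_map_from_subtopology)
    fix z assume "z \<in> topspace (subtopology X ?N)"
    then have "z \<in> ?N" by simp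
    from sB[OF this] have "src G (ginv G (?s z)) = p z" using BG src_inv by (metis subsetD)
    then show "(ginv G (?s z), z) \<in> ?E" by simp
  qed
  from continuous_map_compose[OF this t_continuous]
  have "continuous_map (subtopology X ?N) X (\<lambda>z. t (ginv G (?s z)) z)" by (simp add: o_def)
  then have "openin (subtopology X ?N) {z \<in> topspace (subtopology X ?N). t (ginv G (?s z)) z \<in> V}"
    using V by (intro openin_continuous_map_preimage) (auto simp: compact_open_def)
  then have "openin X {z \<in> topspace (subtopology X ?N). t (ginv G (?s z)) z \<in> V}"
    using N by (rule openin_trans_full)
  moreover have "{z \<in> topspace (subtopology X ?N). t (ginv G (?s z)) z \<in> V} = bis_act B V" (is "?L = _")
  proof -
    have "z \<in> ?L \<longleftrightarrow> z \<in> bis_act B V" if "z \<in> ?N" for z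
      using bis_act_mem[OF BG B(2) VX sB(1)[OF that], of z] sB(2)[OF that] that by simp
    then have "\<And>z. z \<in> ?N \<Longrightarrow> z \<in> ?L \<longleftrightarrow> z \<in> bis_act B V" .
    moreover have "bis_act B V \<subseteq> ?N" using bis_act_subset[OF BG VX] bis_act_anchor[OF BG VX] by blast
    moreover have "?L \<subseteq> ?N" by auto
    ultimately show ?thesis by blast
  qed
  ultimately show ?thesis using c by (simp add: compact_open_def)
qed

text \<open>Injectivity of the range on \<open>B\<close> leaves at most one nonzero term in the
  convolution sum, the one for the inverse of the arrow of \<open>B\<close> that ends at
  \<open>p z\<close>. On indicators the ring action thus becomes the product of sets.\<close>

lemma smul_indicator:
  assumes B: "B \<subseteq> arr G" "inj_on (rng G) B" and V: "V \<subseteq> topspace X"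
  shows "smulX (indicator B) (indicator V) = indicator (bis_act B V)"
proof
  fix z
  show "smulX (indicator B) (indicator V) z = indicator (bis_act B V) z"
  proof (cases "z \<in> topspace X \<and> p z \<in> rng G ` B")
    case False
    then have "indicator B (ginv G g) = (0::int)" if "z \<in> topspace X" "g \<in> arr G" "src G g = p z" for g
      using that rng_inv by (auto simp: indicator_def image_iff)
    then have "smulX (indicator B) (indicator V) z = 0"
      by (auto simp: smul_def intro!: sum'_zero)
    moreover have "z \<notin> bis_act B V" using False bis_act_subset[OF B(1) V] bis_act_anchor[OF B(1) V] by blast
    ultimately show ?thesis by simp
  next
    case True
    then obtain b where b: "b \<in> B" "p z = rng G b" and z: "z \<in> topspace X" by auto
    have bG: "b \<in> arr G" using b B by blast
    have "smulX (indicator B) (indicator V) z =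
      indicator B (ginv G (ginv G b)) * indicator V (t (ginv G b) z)"
      unfolding smul_def using z
    proof (subst sum'_single[where a = "ginv G b"])
      fix g assume g: "g \<in> {g \<in> arr G. src G g = p z}" "g \<noteq> ginv G b"
      have "ginv G g \<notin> B"
      proof
        assume "ginv G g \<in> B"
        then have "ginv G g = b" using inj_onD[OF B(2), of "ginv G g" b] b g rng_inv by simp
        then show False using g inv_inv by auto
      qed
      then show "indicator B (ginv G g) * indicator V (t g z) = (0::int)" by simp
    qed (use bG b inv_closed src_inv in auto)
    then show ?thesis using bis_act_mem[OF B V b(1) z b(2)] inv_inv[OF bG] b(1) by (auto simp: indicator_def)
  qed
qed

text \<open>Inversion exchanges the fibres of source and range, so the nonzero summands are
  controlled by the support of \<open>f\<close> on a fibre of the local homeomorphism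
  \<open>rng G\<close>.\<close>

lemma finite_smul_support:
  assumes "f \<in> Zfun (arrows G)"
  shows "finite {g \<in> {g \<in> arr G. src G g = p z}. f (ginv G g) * m (t g z) \<noteq> 0}"
proof (rule finite_subset)
  show "finite (ginv G ` {h. rng G h = p z \<and> f h \<noteq> 0})"
    using finite_fibre_support[OF locally_boolean_arrows assms etale_rng] by (rule finite_imageI)
  show "{g \<in> {g \<in> arr G. src G g = p z}. f (ginv G g) * m (t g z) \<noteq> 0} \<subseteq> ginv G ` {h. rng G h = p z \<and> f h \<noteq> 0}"
  proof
    fix g assume "g \<in> {g \<in> {g \<in> arr G. src G g = p z}. f (ginv G g) * m (t g z) \<noteq> 0}"
    then show "g \<in> ginv G ` {h. rng G h = p z \<and> f h \<noteq> 0}"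
      by (intro image_eqI[of _ _ "ginv G g"]) (auto simp: inv_inv rng_inv)
  qed
qed

lemma smul_add_left:
  assumes "f \<in> Zfun (arrows G)" "f' \<in> Zfun (arrows G)"
  shows "smulX (\<lambda>g. f g + f' g) m = (\<lambda>y. smulX f m y + smulX f' m y)"
  using finite_smul_support[OF assms(1)] finite_smul_support[OF assms(2)]
  by (auto simp: smul_def fun_eq_iff distrib_right sum.distrib')

lemma smul_add_right:
  assumes "f \<in> Zfun (arrows G)"
  shows "smulX f (\<lambda>y. m y + m' y) = (\<lambda>y. smulX f m y + smulX f m' y)"
  using finite_smul_support[OF assms(1)]
  by (auto simp: smul_def fun_eq_iff distrib_left sum.distrib')

lemma smul_cmult_right: "smulX f (\<lambda>y. k * m y) = (\<lambda>y. k * smulX f m y)"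
  using sum'_cmult[of k] by (auto simp: smul_def fun_eq_iff mult.left_commute[of _ k])

lemma smul_cmult_left: "smulX (\<lambda>g. k * f g) m = (\<lambda>y. k * smulX f m y)"
  using sum'_cmult[of k] by (auto simp: smul_def fun_eq_iff mult.assoc)

lemma smul_zero [simp]: "smulX f (\<lambda>y. 0) = (\<lambda>y. 0)" "smulX (\<lambda>g. 0) m = (\<lambda>y. 0)"
  using smul_cmult_right[of f 0 "\<lambda>y. 0"] smul_cmult_left[of 0 "\<lambda>y. 0" m] by simp_all

lemma smul_uminus: "smulX f (\<lambda>y. - m y) = (\<lambda>y. - smulX f m y)" "smulX (\<lambda>g. - f g) m = (\<lambda>y. - smulX f m y)"
  using smul_cmult_right[of f "-1" m] smul_cmult_left[of "-1" f m] by simp_all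

lemma small_nbhd:
  assumes "openin X U" "y \<in> U"
  obtains V where "compact_open X V" "y \<in> V" "V \<subseteq> U" "inj_on p V"
proof -
  have "y \<in> topspace X" using assms openin_subset by blast
  then obtain W where W: "openin X W" "y \<in> W" "inj_on p W" using local_homeo_inj_nbhd[OF p_local_homeo] by blast
  then obtain V where "compact_open X V" "y \<in> V" "V \<subseteq> U \<inter> W"
    using locally_boolean_nbhd[OF locally_boolean_X, of "U \<inter> W" y] assms by blast
  then show ?thesis using W by (intro that[of V]) (auto intro: inj_on_subset)
qed

lemma small_nbhd_ex: "y \<in> topspace X \<Longrightarrow> \<exists>V. openin X V \<and> y \<in> V \<and> inj_on p V"
  using local_homeo_inj_nbhd[OF p_local_homeo] by metis

lemma X_Zfun_induct [consumes 1, case_names zero add uminus indicator]: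
  assumes "m \<in> Zfun X" "P (\<lambda>x. 0)"
    and "\<And>f g. f \<in> Zfun X \<Longrightarrow> g \<in> Zfun X \<Longrightarrow> P f \<Longrightarrow> P g \<Longrightarrow> P (\<lambda>x. f x + g x)"
    and "\<And>f. f \<in> Zfun X \<Longrightarrow> P f \<Longrightarrow> P (\<lambda>x. - f x)"
    and "\<And>V. compact_open X V \<Longrightarrow> inj_on p V \<Longrightarrow> P (indicator V)"
  shows "P m"
  using locally_boolean_X assms(1)
  by (induction rule: Zfun_induct[where Q = "inj_on p"])
    (use small_nbhd_ex assms in \<open>auto intro: inj_on_subset\<close>)

lemma X_hom_eqI:
  assumes "m \<in> Zfun X" "group K" "F1 \<in> hom (Zgroup X) K" "F2 \<in> hom (Zgroup X) K"
    and "\<And>V. compact_open X V \<Longrightarrow> inj_on p V \<Longrightarrow> F1 (indicator V) = F2 (indicator V)"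
  shows "F1 m = F2 m"
  by (rule Zfun_hom_eqI[OF locally_boolean_X assms(1), where Q = "inj_on p"])
    (use small_nbhd_ex assms in \<open>auto intro: inj_on_subset\<close>)

text \<open>Biadditivity reduces the claim to a bisection and a small set, whose product set is
  again compact open.\<close>

lemma smul_Zfun:
  assumes f: "f \<in> Zfun (arrows G)" and m: "m \<in> Zfun X"
  shows "smulX f m \<in> Zfun X"
  using f
proof (induction rule: bisection_Zfun_induct)
  case (indicator B)
  then have B: "compact_open (arrows G) B" "inj_on (rng G) B" "B \<subseteq> arr G"
    by (auto simp: compact_open_bisection_def dest: compact_open_subset)
  note iB = indicator_bisection[OF indicator]
  show ?case using m
  proof (induction rule: X_Zfun_induct)
    case (indicator V)
    then show ?case using smul_indicator[OF B(3,2) compact_open_subset[OF indicator(1)]]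
        Zfun_indicator[OF X_Hausdorff compact_open_bis_act[OF B(1,2) indicator(1)]] by simp
  qed (simp_all add: Zfun_zero smul_add_right[OF iB] Zfun_add smul_uminus Zfun_uminus)
qed (simp_all add: Zfun_zero smul_add_left Zfun_add smul_uminus Zfun_uminus)

end

section \<open>Nerves and boundary maps\<close>

text \<open>The anchor of a product determines the arrow of \<open>B\<close> through its range; the
  source of that arrow then determines the point of \<open>V\<close>.\<close>

lemma (in gspace) inj_on_bis_act:
  assumes "B \<subseteq> arr G" "inj_on (rng G) B" "V \<subseteq> topspace X" "inj_on p V"
  shows "inj_on p (bis_act B V)"
proof (rule inj_onI)
  fix y z assume "y \<in> bis_act B V" "z \<in> bis_act B V" and eq: "p y = p z"
  then obtain g v h w where y: "y = t g v" "g \<in> B" "v \<in> V" "src G g = p v"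
    and z: "z = t h w" "h \<in> B" "w \<in> V" "src G h = p w" by (auto simp: bis_act_def)
  have "rng G g = rng G h" using eq y z p_t assms by (metis subsetD)
  then have "g = h" using y z assms(2) by (auto dest: inj_onD)
  then have "v = w" using y z assms(4) by (auto dest: inj_onD)
  then show "y = z" using y z \<open>g = h\<close> by simp
qed

context ample_groupoid
begin

lemma gspace_arrows: "gspace G (arrows G) (rng G) (gmult G)"
proof
  have "subtopology (prod_topology (arrows G) (arrows G)) {(g, y). src G g = rng G y} =
    subtopology (prod_topology (arrows G) (arrows G)) {(g, h). g \<in> arr G \<and> h \<in> arr G \<and> src G g = rng G h}"
    by (subst subtopology_restrict[symmetric]) (rule arg_cong[where f = "subtopology _"], auto)
  then show "continuous_map (subtopology (prod_topology (arrows G) (arrows G)) {(g, y). src G g = rng G y})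
     (arrows G) (\<lambda>(g, y). gmult G g y)"
    using continuous_mult by simp
qed (use hausdorff etale_rng rng_mult left_unit assoc in auto)

lemma convolution_smul: "convolution G f1 f2 = smul (arrows G) (rng G) (gmult G) f1 f2"
  by (simp add: convolution_def smul_def)

text \<open>By biadditivity only the indicators of a bisection \<open>B\<close> and of a small
  \<open>V\<close> matter. For these the claim is that an equivariant map carries the product of
  \<open>B\<close> and \<open>V\<close> to the product of \<open>B\<close> and the image of
  \<open>V\<close>.\<close>

lemma pushforward_smul:
  assumes X: "gspace G X p t" and Y: "gspace G Y q u"
    and c: "continuous_map X Y \<tau>" and anchor: "\<And>y. y \<in> topspace X \<Longrightarrow> q (\<tau> y) = p y"
    and equiv: "\<And>g y. g \<in> arr G \<Longrightarrow> y \<in> topspace X \<Longrightarrow> src G g = p y \<Longrightarrow> \<tau> (t g y) = u g (\<tau> y)"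
    and f: "f \<in> Zfun (arrows G)" and m: "m \<in> Zfun X"
  shows "pushforward X Y \<tau> (smul X p t f m) = smul Y q u f (pushforward X Y \<tau> m)"
proof -
  interpret X: gspace G X p t by (rule X)
  interpret Y: gspace G Y q u by (rule Y)
  have \<tau>: "local_homeo X Y \<tau>"
    using c X.p_local_homeo Y.p_local_homeo anchor by (rule local_homeo_cancel)
  note padd = pushforward_add[OF X.locally_boolean_X _ _ \<tau>]
  have cl: "\<tau> y \<in> topspace Y" if "y \<in> topspace X" for y
    using that c by (metis continuous_map_image_subset_topspace image_subset_iff)
  have pz: "pushforward X Y \<tau> (\<lambda>x. 0) = (\<lambda>y. 0)" using pushforward_cmult[of X Y \<tau> 0] by simp
  show ?thesis using f
  proof (induction rule: bisection_Zfun_induct)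
    case (indicator B)
    then have B: "inj_on (rng G) B" "B \<subseteq> arr G"
      by (auto simp: compact_open_bisection_def dest: compact_open_subset)
    note iB = indicator_bisection[OF indicator]
    show ?case using m
    proof (induction rule: X.X_Zfun_induct)
      case (indicator V)
      then have V: "V \<subseteq> topspace X" by (simp add: compact_open_subset)
      have inj: "inj_on \<tau> W" if "W \<subseteq> topspace X" "inj_on p W" for W
        using that anchor unfolding inj_on_def by (metis subsetD)
      have BV: "X.bis_act B V \<subseteq> topspace X" "inj_on p (X.bis_act B V)"
        using B V indicator X.bis_act_subset X.inj_on_bis_act by auto
      have \<tau>V: "\<tau> ` V \<subseteq> topspace Y" "\<tau> ` X.bis_act B V \<subseteq> topspace Y" using V BV cl by auto
      have "\<tau> ` X.bis_act B V = Y.bis_act B (\<tau> ` V)"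
      proof (intro equalityI subsetI)
        fix z assume "z \<in> \<tau> ` X.bis_act B V"
        then obtain g v where "z = \<tau> (t g v)" "g \<in> B" "v \<in> V" "src G g = p v" by (auto simp: X.bis_act_def)
        then have "z = u g (\<tau> v)" "src G g = q (\<tau> v)" using equiv[of g v] anchor[of v] B V by auto
        then show "z \<in> Y.bis_act B (\<tau> ` V)" using \<open>g \<in> B\<close> \<open>v \<in> V\<close> by (auto simp: Y.bis_act_def)
      next
        fix z assume "z \<in> Y.bis_act B (\<tau> ` V)"
        then obtain g v where gv: "z = u g (\<tau> v)" "g \<in> B" "v \<in> V" "src G g = q (\<tau> v)" by (auto simp: Y.bis_act_def)
        then have "src G g = p v" using anchor V by auto
        moreover from this have "z = \<tau> (t g v)" using equiv[of g v] gv(1-3) B(2) V by (simp add: subset_iff)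
        ultimately show "z \<in> \<tau> ` X.bis_act B V" using gv by (auto simp: X.bis_act_def)
      qed
      then show ?case
        using pushforward_indicator[OF V inj[OF V indicator(2)] \<tau>V(1)]
          pushforward_indicator[OF BV(1) inj[OF BV] \<tau>V(2)]
          X.smul_indicator[OF B(2,1) V] Y.smul_indicator[OF B(2,1) \<tau>V(1)] by simp
    qed (simp_all add: pz padd X.smul_add_right[OF iB] Y.smul_add_right[OF iB] X.smul_uminus Y.smul_uminus
        X.smul_Zfun[OF iB] pushforward_uminus)
  qed (simp_all add: pz padd X.smul_add_left Y.smul_add_left X.smul_uminus Y.smul_uminus X.smul_Zfun m pushforward_uminus)
qed

section \<open>Nerves as etale spaces over the units\<close>

lemma mem_nerve:
  "y \<in> topspace (nerve G n) \<longleftrightarrow> y \<in> extensional {..<n} \<and> (\<forall>i<n. y i \<in> arr G) \<and>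
     (\<forall>i. Suc i < n \<longrightarrow> src G (y i) = rng G (y (Suc i)))"
  by (auto simp: nerve_def PiE_iff)

lemma nerve_arr: "y \<in> topspace (nerve G n) \<Longrightarrow> i < n \<Longrightarrow> y i \<in> arr G"
  by (simp add: mem_nerve)

lemma nerve_eqI:
  assumes "y \<in> topspace (nerve G n)" "z \<in> topspace (nerve G n)" "\<And>i. i < n \<Longrightarrow> y i = z i"
  shows "y = z"
  using assms by (auto simp: mem_nerve intro: extensionalityI)

lemma continuous_nerve_coordinate: "i < n \<Longrightarrow> continuous_map (nerve G n) (arrows G) (\<lambda>y. y i)"
  unfolding nerve_def by (intro continuous_map_from_subtopology continuous_map_product_projection) simp

lemma continuous_into_nerve:
  assumes "\<And>i. i < n \<Longrightarrow> continuous_map Z (arrows G) (\<lambda>z. f z i)"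
    and "\<And>z. z \<in> topspace Z \<Longrightarrow> f z \<in> topspace (nerve G n)"
  shows "continuous_map Z (nerve G n) f"
  using assms by (auto simp: nerve_def continuous_map_in_subtopology continuous_map_componentwise PiE_iff)

lemma Hausdorff_nerve: "Hausdorff_space (nerve G n)"
  using hausdorff by (simp add: nerve_def Hausdorff_space_subtopology Hausdorff_space_product_topology)

lemma continuous_anchor: "continuous_map (nerve G (Suc n)) (unit_space G) (anchor G)"
  using continuous_map_compose[OF continuous_nerve_coordinate continuous_rng_unit_space, of 0 "Suc n"]
  by (simp add: o_def anchor_def[abs_def])

text \<open>Once the last arrow is confined to a bisection \<open>B\<close>, it is determined by its
  range, that is, by the source of the preceding arrow. This makes the truncation injective on an
  open set and provides continuous local sections of it.\<close>

lemma local_homeo_nerve_last: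
  "local_homeo (nerve G (Suc (Suc n))) (nerve G (Suc n)) (\<lambda>y. restrict y {..<Suc n})"
    (is "local_homeo ?X ?Y ?r")
  unfolding local_homeo_iff
proof (intro conjI ballI)
  have mem: "?r y \<in> topspace ?Y" if "y \<in> topspace ?X" for y
    using that by (auto simp: mem_nerve)
  show "continuous_map ?X ?Y ?r"
    using mem by (intro continuous_into_nerve) (auto intro: continuous_nerve_coordinate)
  show "\<exists>U. openin ?X U \<and> y \<in> U \<and> inj_on ?r U" if y: "y \<in> topspace ?X" for y
  proof -
    have "y (Suc n) \<in> arr G" using y by (simp add: nerve_arr)
    then obtain B where B: "compact_open_bisection G B" "y (Suc n) \<in> B" "B \<subseteq> arr G"
      using bisection_nbhd[of "arr G"] by blast
    let ?U = "{z \<in> topspace ?X. z (Suc n) \<in> B}"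
    have "openin ?X ?U"
      using B by (intro openin_continuous_map_preimage[OF continuous_nerve_coordinate])
        (auto simp: compact_open_bisection_def compact_open_def)
    moreover have "inj_on ?r ?U"
    proof (rule inj_onI)
      fix y z assume y: "y \<in> ?U" and z: "z \<in> ?U" and eq: "?r y = ?r z"
      have e: "y i = z i" if "i < Suc n" for i using fun_cong[OF eq, of i] that by simp
      have "rng G (y (Suc n)) = rng G (z (Suc n))" using y z e[of n] by (auto simp: mem_nerve)
      then have "y (Suc n) = z (Suc n)" using B y z by (auto simp: compact_open_bisection_def dest: inj_onD)
      then show "y = z" using y z e by (intro nerve_eqI[of y "Suc (Suc n)"]) (auto simp: less_Suc_eq)
    qed
    ultimately show ?thesis using y B by blast
  qed
  show "open_map ?X ?Y ?r"
  proof (rule open_map_local_sections)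
    fix y assume y: "y \<in> topspace ?X"
    then have "y (Suc n) \<in> arr G" by (simp add: nerve_arr)
    then obtain B where B: "compact_open_bisection G B" "y (Suc n) \<in> B" "B \<subseteq> arr G"
      using bisection_nbhd[of "arr G"] by blast
    then have B': "openin (arrows G) B" "inj_on (rng G) B"
      by (auto simp: compact_open_bisection_def compact_open_def)
    let ?N = "{w \<in> topspace ?Y. src G (w n) \<in> rng G ` B}"
    \<comment> \<open>The unique arrow of \<open>B\<close> that can be appended to
      \<open>w\<close>.\<close>
    let ?\<sigma> = "\<lambda>w. the_inv_into B (rng G) (src G (w n))"
    let ?s = "\<lambda>w. w(Suc n := ?\<sigma> w)"
    have cs: "continuous_map ?Y (unit_space G) (\<lambda>w. src G (w n))"
      using continuous_map_compose[OF continuous_nerve_coordinate continuous_src_unit_space, of n "Suc n"]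
      by (simp add: o_def)
    have "openin (unit_space G) (rng G ` B)"
      using B' local_homeo_imp[OF etale_rng] by (simp add: open_map_def)
    then have N: "openin ?Y ?N" using cs by (intro openin_continuous_map_preimage)
    have "continuous_map (subtopology ?Y ?N) (subtopology (unit_space G) (rng G ` B)) (\<lambda>w. src G (w n))"
      using cs by (auto simp: continuous_map_in_subtopology continuous_map_from_subtopology)
    then have c\<sigma>: "continuous_map (subtopology ?Y ?N) (arrows G) ?\<sigma>"
      using continuous_map_compose[OF _ continuous_map_the_inv_into[OF etale_rng B']] by (simp add: o_def)
    have \<sigma>: "?\<sigma> w \<in> B" "rng G (?\<sigma> w) = src G (w n)" if "w \<in> ?N" for w
      using that B' by (auto simp: the_inv_into_f_f)
    have sX: "?s w \<in> topspace ?X" if w: "w \<in> ?N" for w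
    proof -
      have "?\<sigma> w \<in> arr G" using \<sigma>(1)[OF w] B(3) by blast
      then show ?thesis using w \<sigma>(2)[OF w] by (auto simp: mem_nerve extensional_def less_Suc_eq)
    qed
    have "continuous_map (subtopology ?Y ?N) ?X ?s"
    proof (rule continuous_into_nerve)
      show "continuous_map (subtopology ?Y ?N) (arrows G) (\<lambda>z. ?s z i)" if "i < Suc (Suc n)" for i
        using that c\<sigma> continuous_map_from_subtopology[OF continuous_nerve_coordinate[of i "Suc n"]]
        by (cases "i = Suc n") auto
    qed (use sX in auto)
    moreover have "?r y \<in> ?N" using y B mem[OF y] by (auto simp: mem_nerve)
    moreover have "?r (?s w) = w" if "w \<in> ?N" for w
      using that by (auto simp: mem_nerve extensional_def fun_eq_iff)
    moreover have "?s (?r y) = y"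
    proof (rule nerve_eqI[OF sX[OF \<open>?r y \<in> ?N\<close>] y])
      fix i assume "i < Suc (Suc n)"
      moreover have "the_inv_into B (rng G) (rng G (y (Suc n))) = y (Suc n)" using B B' by (simp add: the_inv_into_f_f)
      ultimately show "?s (?r y) i = y i" using y by (auto simp: mem_nerve less_Suc_eq)
    qed
    ultimately show "\<exists>N s. openin ?Y N \<and> ?r y \<in> N \<and> continuous_map (subtopology ?Y N) ?X s \<and>
        s (?r y) = y \<and> (\<forall>w\<in>N. ?r (s w) = w)" using N by blast
  qed
qed

text \<open>Dropping the last entry does not affect the first arrow, so the anchor of a longer tuple
  factors through truncation. One-tuples are arrows, and their anchor is the range.\<close>

lemma local_homeo_anchor: "local_homeo (nerve G (Suc n)) (unit_space G) (anchor G)"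
proof (induction n)
  case 0
  have "local_homeo (nerve G (Suc 0)) (arrows G) (\<lambda>y. y 0)"
    unfolding local_homeo_iff
  proof (intro conjI ballI)
    show "continuous_map (nerve G (Suc 0)) (arrows G) (\<lambda>y. y 0)" by (rule continuous_nerve_coordinate) simp
    show "open_map (nerve G (Suc 0)) (arrows G) (\<lambda>y. y 0)"
    proof (rule open_map_local_sections)
      fix y assume y: "y \<in> topspace (nerve G (Suc 0))"
      let ?s = "\<lambda>g. (\<lambda>i\<in>{..<Suc 0}. g)"
      have "continuous_map (arrows G) (nerve G (Suc 0)) ?s"
        by (rule continuous_into_nerve) (auto simp: mem_nerve)
      moreover have "?s (y 0) = y" using y by (intro nerve_eqI[of _ "Suc 0"]) (auto simp: mem_nerve)
      ultimately show "\<exists>N s. openin (arrows G) N \<and> y 0 \<in> N \<and> continuous_map (subtopology (arrows G) N) (nerve G (Suc 0)) s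
          \<and> s (y 0) = y \<and> (\<forall>g\<in>N. s g 0 = g)"
        using y by (intro exI[of _ "arr G"] exI[of _ ?s]) (auto simp: mem_nerve continuous_map_from_subtopology)
    qed
    fix y assume y: "y \<in> topspace (nerve G (Suc 0))"
    have "inj_on (\<lambda>y. y 0) (topspace (nerve G (Suc 0)))"
      by (rule inj_onI, rule nerve_eqI[of _ "Suc 0"]) auto
    then show "\<exists>U. openin (nerve G (Suc 0)) U \<and> y \<in> U \<and> inj_on (\<lambda>y. y 0) U" using y by blast
  qed
  from local_homeo_compose[OF this etale_rng] show ?case by (simp add: o_def anchor_def[abs_def])
next
  case (Suc n)
  from local_homeo_compose[OF local_homeo_nerve_last Suc] 
  show ?case by (simp add: o_def anchor_def[abs_def])
qed

lemma translate_nerve: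
  assumes "g \<in> arr G" "y \<in> topspace (nerve G (Suc n))" "src G g = anchor G y"
  shows "translate G g y \<in> topspace (nerve G (Suc n))"
  using assms mult_closed src_mult[of g "y 0"]
  by (auto simp: mem_nerve translate_def anchor_def extensional_def)

lemma gspace_nerve: "gspace G (nerve G (Suc n)) (anchor G) (translate G)"
proof
  let ?E = "{(g, y). src G g = anchor G y}"
  let ?P = "prod_topology (arrows G) (nerve G (Suc n))"
  show "Hausdorff_space (nerve G (Suc n))" by (rule Hausdorff_nerve)
  show "local_homeo (nerve G (Suc n)) (unit_space G) (anchor G)" by (rule local_homeo_anchor)
  have c1: "continuous_map (subtopology ?P ?E) (arrows G) fst"
    by (intro continuous_map_from_subtopology continuous_map_fst)
  have c2: "continuous_map (subtopology ?P ?E) (arrows G) (\<lambda>z. snd z i)" if "i < Suc n" for i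
    using continuous_map_compose[OF continuous_map_snd continuous_nerve_coordinate[OF that], of "arrows G"]
    by (auto simp: o_def intro: continuous_map_from_subtopology)
  have "continuous_map (subtopology ?P ?E) (nerve G (Suc n)) (\<lambda>z. translate G (fst z) (snd z))"
  proof (rule continuous_into_nerve)
    have "continuous_map (subtopology ?P ?E) (arrows G) (\<lambda>z. gmult G (fst z) (snd z 0))"
    proof -
      interpret A: gspace G "arrows G" "rng G" "gmult G" by (rule gspace_arrows)
      have "continuous_map (subtopology ?P ?E)
        (subtopology (prod_topology (arrows G) (arrows G)) {(g, y). src G g = rng G y}) (\<lambda>z. (fst z, snd z 0))"
        using c1 c2 by (intro continuous_map_into_prod_subtopology) (auto simp: anchor_def)
      from continuous_map_compose[OF this A.t_continuous] show ?thesis by (simp add: o_def)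
    qed
    then show "continuous_map (subtopology ?P ?E) (arrows G) (\<lambda>z. translate G (fst z) (snd z) i)" if "i < Suc n" for i
      using that c2 by (cases "i = 0") (auto simp: translate_def)
  qed (auto intro: translate_nerve)
  then show "continuous_map (subtopology ?P ?E) (nerve G (Suc n)) (\<lambda>(g, y). translate G g y)"
    by (simp add: case_prod_unfold)
qed (auto simp: anchor_def translate_def rng_mult nerve_arr left_unit assoc)

lemma nerve_module_simps:
  "carrier (nerve_module G n) = Zfun (nerve G n)"
  "\<zero>\<^bsub>nerve_module G n\<^esub> = (\<lambda>y. 0)"
  "m \<oplus>\<^bsub>nerve_module G n\<^esub> m' = (\<lambda>y. m y + m' y)"
  "f \<odot>\<^bsub>nerve_module G n\<^esub> m = smul (nerve G n) (anchor G) (translate G) f m"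
  by (simp_all add: nerve_module_def smul_def)

section \<open>Face maps and the boundary operator\<close>

lemma face_0 [simp]: "j < n \<Longrightarrow> face G n i y j = (if j < i then y j else if j = i then gmult G (y i) (y (Suc i)) else y (Suc j))"
  by (simp add: face_def)

lemma face_nerve:
  assumes y: "y \<in> topspace (nerve G (Suc n))" and i: "i \<le> n"
  shows "face G n i y \<in> topspace (nerve G n)"
proof -
  have comp: "src G (y j) = rng G (y (Suc j))" if "j < n" for j using y that by (simp add: mem_nerve)
  have a: "y j \<in> arr G" if "j \<le> n" for j using y that by (simp add: nerve_arr)
  have "face G n i y j \<in> arr G" if "j < n" for j
    using that a comp mult_closed by simp
  moreover have "src G (face G n i y j) = rng G (face G n i y (Suc j))" if "Suc j < n" for j
    using that a comp src_mult rng_mult by (simp add: less_Suc_eq)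
  moreover have "face G n i y \<in> extensional {..<n}" by (simp add: face_def)
  ultimately show ?thesis by (simp add: mem_nerve)
qed

lemma anchor_face:
  assumes "y \<in> topspace (nerve G (Suc (Suc n)))" "i \<le> Suc n"
  shows "anchor G (face G (Suc n) i y) = anchor G y"
  using assms rng_mult[of "y 0" "y (Suc 0)"] by (auto simp: anchor_def mem_nerve)

lemma continuous_face:
  assumes "i \<le> n"
  shows "continuous_map (nerve G (Suc n)) (nerve G n) (face G n i)"
proof (rule continuous_into_nerve)
  fix j assume j: "j < n"
  interpret A: gspace G "arrows G" "rng G" "gmult G" by (rule gspace_arrows)
  show "continuous_map (nerve G (Suc n)) (arrows G) (\<lambda>y. face G n i y j)"
  proof (cases "j = i")
    case True
    then have "continuous_map (nerve G (Suc n))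
        (subtopology (prod_topology (arrows G) (arrows G)) {(g, y). src G g = rng G y}) (\<lambda>y. (y i, y (Suc i)))"
      using j by (intro continuous_map_into_prod_subtopology continuous_nerve_coordinate) (auto simp: mem_nerve)
    from continuous_map_compose[OF this A.t_continuous] show ?thesis using True j by (simp add: o_def)
  next
    case False
    then show ?thesis using j by (cases "j < i") (auto intro: continuous_nerve_coordinate)
  qed
qed (use assms face_nerve in auto)

text \<open>Each face keeps the range of the first arrow as long as at least one entry remains, so
  it is a continuous map over the unit space between nerves that are etale over it.\<close>

lemma local_homeo_face: "i \<le> Suc n \<Longrightarrow> local_homeo (nerve G (Suc (Suc n))) (nerve G (Suc n)) (face G (Suc n) i)"
  by (rule local_homeo_cancel[OF continuous_face local_homeo_anchor local_homeo_anchor]) (auto intro: anchor_face)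

lemma face_translate:
  assumes "g \<in> arr G" "y \<in> topspace (nerve G (Suc (Suc n)))" "src G g = anchor G y"
  shows "face G (Suc n) i (translate G g y) = translate G g (face G (Suc n) i y)"
proof
  fix j
  show "face G (Suc n) i (translate G g y) j = translate G g (face G (Suc n) i y) j"
    using assms assoc[of g "y 0" "y (Suc 0)"]
    by (cases "j < Suc n") (auto simp: translate_def anchor_def mem_nerve face_def)
qed

text \<open>Associativity can enter only for \<open>i = j + 1\<close>, where three consecutive
  arrows are multiplied in the two possible ways; all other cases are bookkeeping of
  indices.\<close>

lemma face_face:
  assumes y: "y \<in> topspace (nerve G (Suc (Suc n)))" and "j < i" "i \<le> Suc n"
  shows "face G n j (face G (Suc n) i y) = face G n (i - 1) (face G (Suc n) j y)"
proof
  fix k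
  have comp: "src G (y j) = rng G (y (Suc j))" if "j < Suc n" for j using y that by (simp add: mem_nerve)
  have a: "y j \<in> arr G" if "j \<le> Suc n" for j using y that by (simp add: nerve_arr)
  obtain i' where i: "i = Suc i'" using assms by (cases i) auto
  show "face G n j (face G (Suc n) i y) k = face G n (i - 1) (face G (Suc n) j y) k"
  proof (cases "k < n")
    case True
    then show ?thesis
      using assms i assoc[of "y j" "y (Suc j)" "y (Suc (Suc j))"] a comp
      by (cases "k = j"; cases "i' = j") (auto simp: face_def)
  qed (simp add: face_def)
qed

lemma boundary_Zfun:
  assumes "f \<in> Zfun (nerve G (Suc (Suc n)))"
  shows "boundary G (Suc n) f \<in> Zfun (nerve G (Suc n))"
proof -
  interpret N: gspace G "nerve G (Suc (Suc n))" "anchor G" "translate G" by (rule gspace_nerve)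
  show ?thesis unfolding boundary_def
    using assms by (intro Zfun_sum Zfun_cmult pushforward_Zfun N.locally_boolean_X Hausdorff_nerve local_homeo_face) auto
qed

lemma boundary_add:
  assumes "f \<in> Zfun (nerve G (Suc (Suc n)))" "f' \<in> Zfun (nerve G (Suc (Suc n)))"
  shows "boundary G (Suc n) (\<lambda>y. f y + f' y) = (\<lambda>y. boundary G (Suc n) f y + boundary G (Suc n) f' y)"
proof -
  interpret N: gspace G "nerve G (Suc (Suc n))" "anchor G" "translate G" by (rule gspace_nerve)
  show ?thesis
    using pushforward_add[OF N.locally_boolean_X assms local_homeo_face]
    by (simp add: boundary_def fun_eq_iff sum.distrib distrib_left)
qed

lemma boundary_cmult: "boundary G n (\<lambda>y. k * f y) = (\<lambda>y. k * boundary G n f y)"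
  by (simp add: boundary_def pushforward_cmult fun_eq_iff sum_distrib_left mult.left_commute)

lemma boundary_sum:
  assumes "\<And>i. i \<in> I \<Longrightarrow> f i \<in> Zfun (nerve G (Suc (Suc n)))"
  shows "boundary G (Suc n) (\<lambda>y. \<Sum>i\<in>I. f i y) = (\<lambda>y. \<Sum>i\<in>I. boundary G (Suc n) (f i) y)"
  using assms
proof (induction I rule: infinite_finite_induct)
  case (insert i I)
  then show ?case using boundary_add[of "f i" n "\<lambda>y. \<Sum>i\<in>I. f i y"] Zfun_sum[of I f] by simp
qed (use boundary_cmult[of "Suc n" 0 "\<lambda>y. 0"] in simp_all)

lemma boundary_smul:
  assumes "f \<in> Zfun (arrows G)" "m \<in> Zfun (nerve G (Suc (Suc n)))"
  shows "boundary G (Suc n) (smul (nerve G (Suc (Suc n))) (anchor G) (translate G) f m) =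
    smul (nerve G (Suc n)) (anchor G) (translate G) f (boundary G (Suc n) m)"
proof -
  interpret N: gspace G "nerve G (Suc n)" "anchor G" "translate G" by (rule gspace_nerve)
  interpret N': gspace G "nerve G (Suc (Suc n))" "anchor G" "translate G" by (rule gspace_nerve)
  have sum: "N.smulX f (\<lambda>y. \<Sum>i\<in>I. h i y) = (\<lambda>y. \<Sum>i\<in>I. N.smulX f (h i) y)" for I :: "nat set" and h
    by (induction I rule: infinite_finite_induct) (simp_all add: N.smul_add_right[OF assms(1)])
  have "pushforward (nerve G (Suc (Suc n))) (nerve G (Suc n)) (face G (Suc n) i) (N'.smulX f m) =
    N.smulX f (pushforward (nerve G (Suc (Suc n))) (nerve G (Suc n)) (face G (Suc n) i) m)" if "i \<le> Suc n" for i
    using that assms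
    by (intro pushforward_smul gspace_nerve continuous_face anchor_face face_translate) auto
  then show ?thesis by (simp add: boundary_def sum N.smul_cmult_right del: sum.atMost_Suc)
qed

text \<open>A face preserves the anchor, so it is injective wherever the anchor is, and the
  pushforward of an indicator is the indicator of the image. The images are again compact open and
  small, which allows the operator to be applied a second time.\<close>

lemma boundary_indicator:
  assumes "compact_open (nerve G (Suc (Suc n))) V" "inj_on (anchor G) V"
  shows "boundary G (Suc n) (indicator V) = (\<lambda>y. \<Sum>i\<le>Suc n. (-1) ^ i * indicator (face G (Suc n) i ` V) y)"
    and "i \<le> Suc n \<Longrightarrow> compact_open (nerve G (Suc n)) (face G (Suc n) i ` V)"
    and "i \<le> Suc n \<Longrightarrow> inj_on (anchor G) (face G (Suc n) i ` V)"
proof -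
  have V: "V \<subseteq> topspace (nerve G (Suc (Suc n)))" using assms compact_open_subset by blast
  have "inj_on (face G (Suc n) i) V" if "i \<le> Suc n" for i
    using assms(2) V that anchor_face unfolding inj_on_def by (metis subsetD)
  then have "pushforward (nerve G (Suc (Suc n))) (nerve G (Suc n)) (face G (Suc n) i) (indicator V) =
     indicator (face G (Suc n) i ` V)" if "i \<le> Suc n" for i
    using V that face_nerve by (intro pushforward_indicator) auto
  then show "boundary G (Suc n) (indicator V) = (\<lambda>y. \<Sum>i\<le>Suc n. (-1) ^ i * indicator (face G (Suc n) i ` V) y)"
    by (simp add: boundary_def)
  show "compact_open (nerve G (Suc n)) (face G (Suc n) i ` V)" if "i \<le> Suc n"
    using local_homeo_imp[OF local_homeo_face[OF that]] assms(1) by (rule compact_open_image)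
  show "inj_on (anchor G) (face G (Suc n) i ` V)" if "i \<le> Suc n"
  proof (rule inj_onI, clarify)
    fix y z assume "y \<in> V" "z \<in> V" "anchor G (face G (Suc n) i y) = anchor G (face G (Suc n) i z)"
    then have "anchor G y = anchor G z" using V that anchor_face by (metis subsetD)
    then have "y = z" using assms(2) \<open>y \<in> V\<close> \<open>z \<in> V\<close> by (auto dest: inj_onD)
    then show "face G (Suc n) i y = face G (Suc n) i z" by simp
  qed
qed

text \<open>The bijection from (i, j) to (j, i - 1) between the pairs with \<open>j < i\<close> and
  those with \<open>i \<le> j\<close> preserves the value of \<open>a\<close> and reverses the sign,
  so the two triangles cancel.\<close>

lemma alternating_double_sum:
  fixes a :: "nat \<Rightarrow> nat \<Rightarrow> int"
  assumes "\<And>i j. j < i \<Longrightarrow> i \<le> Suc n \<Longrightarrow> a i j = a j (i - 1)"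
  shows "(\<Sum>i\<le>Suc n. (-1) ^ i * (\<Sum>j\<le>n. (-1) ^ j * a i j)) = 0"
proof -
  let ?f = "\<lambda>(i, j). (-1) ^ (i + j) * a i j"
  let ?A = "{(i, j). j < i \<and> i \<le> Suc n}" and ?B = "{(i, j). i \<le> j \<and> j \<le> n}"
  have fin: "finite ?A" "finite ?B"
    by (rule finite_subset[of _ "{..Suc n} \<times> {..Suc n}"], auto)+
  have sgn: "- ((-1) ^ (i + j - Suc 0) * x) = (-1) ^ (i + j) * x"
    "- ((-1) ^ (j + i - Suc 0) * x) = (-1) ^ (i + j) * x" if "j < i" for i j and x :: int
    using that by (cases i; simp add: add.commute)+
  have "(\<Sum>i\<le>Suc n. (-1) ^ i * (\<Sum>j\<le>n. (-1) ^ j * a i j)) = sum ?f ({..Suc n} \<times> {..n})"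
    by (simp only: sum_distrib_left sum.cartesian_product power_add mult.assoc)
  also have "\<dots> = sum ?f (?A \<union> ?B)" by (rule sum.cong) auto
  also have "\<dots> = sum ?f ?A + sum ?f ?B"
    by (rule sum.union_disjoint[OF fin]) auto
  also have "sum ?f ?A = sum (\<lambda>(i, j). - ((-1) ^ (i + j) * a i j)) ?B"
    by (rule sum.reindex_bij_witness[of _ "\<lambda>(i, j). (Suc j, i)" "\<lambda>(i, j). (j, i - 1)"])
      (use assms sgn in \<open>auto\<close>)
  also have "\<dots> = - sum ?f ?B" by (simp add: sum_negf case_prod_unfold)
  finally show ?thesis by simp
qed

text \<open>On the indicator of a small set the double boundary is an alternating double sum of
  indicators of iterated faces, which cancels by the identity \<open>face_face\<close>.\<close>

lemma boundary_boundary: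
  assumes "f \<in> Zfun (nerve G (Suc (Suc (Suc n))))"
  shows "boundary G (Suc n) (boundary G (Suc (Suc n)) f) = (\<lambda>y. 0)"
proof -
  interpret N: gspace G "nerve G (Suc (Suc (Suc n)))" "anchor G" "translate G" by (rule gspace_nerve)
  show ?thesis using assms
  proof (induction rule: N.X_Zfun_induct)
    case zero
    then show ?case using boundary_cmult[of _ 0 "\<lambda>y. 0"] by simp
  next
    case (add f g)
    then show ?case by (simp add: boundary_add boundary_Zfun)
  next
    case (uminus f)
    then show ?case using boundary_cmult[of _ "-1"] by simp
  next
    case (indicator V)
    note bi = boundary_indicator[OF indicator]
    have VX: "V \<subseteq> topspace (nerve G (Suc (Suc (Suc n))))" using indicator compact_open_subset by blast
    let ?W = "\<lambda>i. face G (Suc (Suc n)) i ` V"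
    have iW: "indicator (?W i) \<in> Zfun (nerve G (Suc (Suc n)))" if "i \<le> Suc (Suc n)" for i
      using bi(2)[OF that] Hausdorff_nerve by (simp add: Zfun_indicator)
    have "boundary G (Suc n) (boundary G (Suc (Suc n)) (indicator V)) =
      (\<lambda>y. \<Sum>i\<le>Suc (Suc n). (-1) ^ i * boundary G (Suc n) (indicator (?W i)) y)"
      unfolding bi(1) using iW by (subst boundary_sum) (auto simp: boundary_cmult intro: Zfun_cmult)
    also have "\<dots> = (\<lambda>y. \<Sum>i\<le>Suc (Suc n). (-1) ^ i * (\<Sum>j\<le>Suc n. (-1) ^ j * indicator (face G (Suc n) j ` ?W i) y))"
      using boundary_indicator(1)[OF bi(2) bi(3)] by (intro ext sum.cong) auto
    also have "\<dots> = (\<lambda>y. 0)"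
    proof
      fix y
      have "face G (Suc n) j ` ?W i = face G (Suc n) (i - 1) ` ?W j" if "j < i" "i \<le> Suc (Suc n)" for i j
        using face_face[OF _ that] VX unfolding image_image by (intro image_cong) auto
      then show "(\<Sum>i\<le>Suc (Suc n). (-1) ^ i * (\<Sum>j\<le>Suc n. (-1) ^ j * indicator (face G (Suc n) j ` ?W i) y)) = (0::int)"
        by (intro alternating_double_sum) simp
    qed
    finally show ?case .
  qed
qed

end

section \<open>Equivariant sheaves and their sections\<close>

lemma (in comm_monoid) gfinprod_single:
  assumes "\<And>x. x \<in> A \<Longrightarrow> x \<noteq> a \<Longrightarrow> f x = \<one>" "a \<in> A \<Longrightarrow> f a \<in> carrier G"
  shows "gfinprod G f A = (if a \<in> A then f a else \<one>)"
proof (cases "a \<in> A \<and> f a \<noteq> \<one>")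
  case True
  then have "{x \<in> A. f x \<noteq> \<one>} = {a}" using assms by auto
  then show ?thesis using True assms(2) by (simp add: gfinprod_def)
next
  case False
  then have e: "{x \<in> A. f x \<noteq> \<one>} = {}" using assms by auto
  have "gfinprod G f A = \<one>" unfolding gfinprod_def e by simp
  then show ?thesis using False by auto
qed

lemma (in comm_monoid) gfinprod_cong_on:
  "g \<in> A \<rightarrow> carrier G \<Longrightarrow> (\<And>i. i \<in> A \<Longrightarrow> f i = g i) \<Longrightarrow> gfinprod G f A = gfinprod G g A"
  by (rule gfinprod_cong) (auto simp: simp_implies_def)

lemma (in comm_monoid) gfinprod_one: "(\<And>x. x \<in> A \<Longrightarrow> f x = \<one>) \<Longrightarrow> gfinprod G f A = \<one>"
  using gfinprod_single[of A undefined f] by auto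

lemma continuous_map_local:
  assumes "\<And>z. z \<in> topspace Z \<Longrightarrow> \<exists>N h. openin Z N \<and> z \<in> N \<and> continuous_map (subtopology Z N) Y h \<and> (\<forall>w\<in>N. f w = h w)"
  shows "continuous_map Z Y f"
proof -
  obtain N h where N: "\<And>z. z \<in> topspace Z \<Longrightarrow> openin Z (N z) \<and> z \<in> N z \<and>
     continuous_map (subtopology Z (N z)) Y (h z) \<and> (\<forall>w\<in>N z. f w = h z w)"
    using assms by metis
  show ?thesis
  proof (rule pasting_lemma[where I = "topspace Z" and T = N and f = h])
    fix i j x assume "i \<in> topspace Z" "j \<in> topspace Z" "x \<in> topspace Z \<inter> N i \<inter> N j"
    then have "f x = h i x" "f x = h j x" using N[of i] N[of j] by blast+
    then show "h i x = h j x" by simp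
  qed (use N in auto)
qed

text \<open>An etale sheaf of abelian groups with a continuous action. The total space of germs need
  not be Hausdorff: sets on which two sections coincide are open, but possibly not closed.\<close>

locale gsheaf = ample_groupoid G for G :: "'g groupoid" +
  fixes A :: "('g, 'a) sheaf"
  assumes fibre_comm_group: "x \<in> units G \<Longrightarrow> comm_group (fibre A x)"
    and proj_local_homeo: "local_homeo (total A) (unit_space G) (proj A)"
    and add_continuous: "continuous_map (subtopology (prod_topology (total A) (total A)) {(a, b). proj A a = proj A b})
      (total A) (\<lambda>(a, b). fibre_add A a b)"
    and zero_continuous: "continuous_map (unit_space G) (total A) (fibre_zero A)"
    and inv_continuous: "continuous_map (total A) (total A) (\<lambda>a. inv\<^bsub>fibre A (proj A a)\<^esub> a)"
    and act_hom: "g \<in> arr G \<Longrightarrow> act A g \<in> hom (fibre A (src G g)) (fibre A (rng G g))"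
    and act_unit: "\<lbrakk>x \<in> units G; a \<in> carrier (fibre A x)\<rbrakk> \<Longrightarrow> act A x a = a"
    and act_mult: "\<lbrakk>g \<in> arr G; h \<in> arr G; src G g = rng G h; a \<in> carrier (fibre A (src G h))\<rbrakk>
      \<Longrightarrow> act A (gmult G g h) a = act A g (act A h a)"
    and act_continuous: "continuous_map (subtopology (prod_topology (arrows G) (total A)) {(g, a). proj A a = src G g})
      (total A) (\<lambda>(g, a). act A g a)"
begin

abbreviation F where "F x \<equiv> fibre A x"

lemma fibre_simps: "carrier (F x) = {a \<in> topspace (total A). proj A a = x}" 
  "a \<otimes>\<^bsub>F x\<^esub> b = fibre_add A a b" "\<one>\<^bsub>F x\<^esub> = fibre_zero A x"
  by (simp_all add: fibre_def)

lemma fibre_group: "x \<in> units G \<Longrightarrow> group (F x)"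
  using fibre_comm_group comm_group.axioms(2) by blast

lemma fibre_comm_monoid: "x \<in> units G \<Longrightarrow> comm_monoid (F x)"
  using fibre_comm_group comm_group.axioms(1) by blast

lemma act_group_hom: "g \<in> arr G \<Longrightarrow> group_hom (F (src G g)) (F (rng G g)) (act A g)"
  using fibre_group src_units rng_units act_hom by (simp add: group_hom_def group_hom_axioms_def)

lemma act_closed: "g \<in> arr G \<Longrightarrow> a \<in> carrier (F (src G g)) \<Longrightarrow> act A g a \<in> carrier (F (rng G g))"
  using act_hom by (auto simp: hom_def)

text \<open>A section over \<open>Z\<close> of the pullback of the sheaf along \<open>q\<close>.
  Ordinary sections are the case of the identity, families over a nerve the case of the
  anchor.\<close>

definition lift :: "'z topology \<Rightarrow> ('z \<Rightarrow> 'g) \<Rightarrow> ('z \<Rightarrow> 'a) \<Rightarrow> bool" where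
  "lift Z q u \<longleftrightarrow> continuous_map Z (unit_space G) q \<and> continuous_map Z (total A) u \<and>
     (\<forall>z\<in>topspace Z. u z \<in> carrier (F (q z)))"

lemma lift_units: "lift Z q u \<Longrightarrow> z \<in> topspace Z \<Longrightarrow> q z \<in> units G"
  unfolding lift_def by (metis continuous_map_image_subset_topspace image_subset_iff topspace_unit_space)

lemma lift_carrier: "lift Z q u \<Longrightarrow> z \<in> topspace Z \<Longrightarrow> u z \<in> carrier (F (q z))"
  by (simp add: lift_def)

lemma lift_continuous: "lift Z q u \<Longrightarrow> continuous_map Z (total A) u"
  by (simp add: lift_def)

lemma lift_cong:
  assumes "lift Z q u" "\<And>z. z \<in> topspace Z \<Longrightarrow> u z = v z"
  shows "lift Z q v"
  using assms continuous_map_eq[of Z "total A" u v] by (auto simp: lift_def)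

lemma lift_add:
  assumes "lift Z q u" "lift Z q v"
  shows "lift Z q (\<lambda>z. u z \<otimes>\<^bsub>F (q z)\<^esub> v z)"
proof -
  have "continuous_map Z (subtopology (prod_topology (total A) (total A)) {(a, b). proj A a = proj A b}) (\<lambda>z. (u z, v z))"
    using assms by (intro continuous_map_into_prod_subtopology) (auto simp: lift_def fibre_simps)
  from continuous_map_compose[OF this add_continuous]
  have "continuous_map Z (total A) (\<lambda>z. u z \<otimes>\<^bsub>F (q z)\<^esub> v z)" by (simp add: o_def fibre_simps)
  moreover have "u z \<otimes>\<^bsub>F (q z)\<^esub> v z \<in> carrier (F (q z))" if "z \<in> topspace Z" for z
    by (rule monoid.m_closed[OF group.is_monoid[OF fibre_group[OF lift_units[OF assms(1) that]]]
          lift_carrier[OF assms(1) that] lift_carrier[OF assms(2) that]])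
  ultimately show ?thesis using assms(1) by (simp add: lift_def)
qed

lemma lift_inv:
  assumes "lift Z q u"
  shows "lift Z q (\<lambda>z. inv\<^bsub>F (q z)\<^esub> (u z))"
proof -
  have "continuous_map Z (total A) (\<lambda>z. inv\<^bsub>F (proj A (u z))\<^esub> (u z))"
    using continuous_map_compose[OF lift_continuous[OF assms] inv_continuous] by (simp add: o_def)
  then have "continuous_map Z (total A) (\<lambda>z. inv\<^bsub>F (q z)\<^esub> (u z))"
    by (rule continuous_map_eq) (use assms in \<open>auto simp: lift_def fibre_simps\<close>)
  moreover have "inv\<^bsub>F (q z)\<^esub> (u z) \<in> carrier (F (q z))" if "z \<in> topspace Z" for z
    by (rule group.inv_closed[OF fibre_group[OF lift_units[OF assms that]] lift_carrier[OF assms that]])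
  ultimately show ?thesis using assms(1) by (simp add: lift_def)
qed

lemma lift_one:
  assumes "continuous_map Z (unit_space G) q"
  shows "lift Z q (\<lambda>z. \<one>\<^bsub>F (q z)\<^esub>)"
proof -
  have "continuous_map Z (total A) (\<lambda>z. \<one>\<^bsub>F (q z)\<^esub>)"
    using continuous_map_compose[OF assms zero_continuous] by (simp add: o_def fibre_simps)
  moreover have "\<one>\<^bsub>F x\<^esub> \<in> carrier (F x)" if "x \<in> units G" for x
    using fibre_group[OF that] by (simp add: group.is_monoid monoid.one_closed)
  ultimately show ?thesis using assms continuous_map_image_subset_topspace[OF assms]
    by (auto simp: lift_def)
qed

lemma lift_finprod:
  assumes "continuous_map Z (unit_space G) q" "\<And>i. i \<in> I \<Longrightarrow> lift Z q (u i)" "finite I"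
  shows "lift Z q (\<lambda>z. finprod (F (q z)) (\<lambda>i. u i z) I)"
  using assms(3,2)
proof (induction I rule: finite_induct)
  case empty
  have "lift Z q (\<lambda>z. \<one>\<^bsub>F (q z)\<^esub>)" using assms(1) by (rule lift_one)
  then show ?case
  proof (rule lift_cong)
    fix z assume "z \<in> topspace Z"
    then have "q z \<in> units G"
      using assms(1) by (metis continuous_map_image_subset_topspace image_subset_iff topspace_unit_space)
    then show "\<one>\<^bsub>F (q z)\<^esub> = finprod (F (q z)) (\<lambda>i. u i z) {}"
      by (simp add: comm_monoid.finprod_empty[OF fibre_comm_monoid])
  qed
next
  case (insert i I)
  have "lift Z q (\<lambda>z. u i z \<otimes>\<^bsub>F (q z)\<^esub> finprod (F (q z)) (\<lambda>i. u i z) I)"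
    using insert by (intro lift_add) auto
  then show ?case
  proof (rule lift_cong)
    fix z assume z: "z \<in> topspace Z"
    have "lift Z q (u i)" by (rule insert.prems) simp
    then have "q z \<in> units G" using z by (rule lift_units)
    then interpret comm_monoid "F (q z)" by (rule fibre_comm_monoid)
    show "u i z \<otimes>\<^bsub>F (q z)\<^esub> finprod (F (q z)) (\<lambda>i. u i z) I = finprod (F (q z)) (\<lambda>i. u i z) (insert i I)"
    proof (rule finprod_insert[symmetric])
      show "(\<lambda>i. u i z) \<in> I \<rightarrow> carrier (F (q z))"
        using insert.prems lift_carrier[OF _ z] by blast
      show "u i z \<in> carrier (F (q z))" using \<open>lift Z q (u i)\<close> z by (rule lift_carrier)
    qed (use insert.hyps in auto)
  qed
qed

lemma lift_compose:
  assumes "lift Z q u" "continuous_map Y Z f"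
  shows "lift Y (\<lambda>y. q (f y)) (\<lambda>y. u (f y))"
  using assms continuous_map_compose[OF assms(2), of "unit_space G" q]
    continuous_map_compose[OF assms(2), of "total A" u] continuous_map_image_subset_topspace[OF assms(2)]
  by (auto simp: lift_def o_def image_subset_iff)

lemma lift_subtopology: "lift Z q u \<Longrightarrow> lift (subtopology Z N) q u"
  by (auto simp: lift_def continuous_map_from_subtopology)

lemma lift_act:
  assumes "lift Z q u" "continuous_map Z (arrows G) f" "\<And>z. z \<in> topspace Z \<Longrightarrow> src G (f z) = q z"
  shows "lift Z (\<lambda>z. rng G (f z)) (\<lambda>z. act A (f z) (u z))"
proof -
  have "continuous_map Z (subtopology (prod_topology (arrows G) (total A)) {(g, a). proj A a = src G g}) (\<lambda>z. (f z, u z))"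
    using assms by (intro continuous_map_into_prod_subtopology) (auto simp: lift_def fibre_simps)
  from continuous_map_compose[OF this act_continuous]
  have "continuous_map Z (total A) (\<lambda>z. act A (f z) (u z))" by (simp add: o_def)
  moreover have "continuous_map Z (unit_space G) (\<lambda>z. rng G (f z))"
    using continuous_map_compose[OF assms(2) continuous_rng_unit_space] by (simp add: o_def)
  moreover have "f z \<in> arr G" if "z \<in> topspace Z" for z
    using that assms(2) by (metis continuous_map_image_subset_topspace image_subset_iff)
  ultimately show ?thesis using assms act_closed by (auto simp: lift_def)
qed

lemma lift_local:
  assumes "continuous_map Z (unit_space G) q"
   "\<And>z. z \<in> topspace Z \<Longrightarrow> \<exists>N v. openin Z N \<and> z \<in> N \<and> lift (subtopology Z N) q v \<and> (\<forall>w\<in>N. u w = v w)"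
  shows "lift Z q u"
proof -
  have "continuous_map Z (total A) u"
  proof (rule continuous_map_local)
    fix z assume "z \<in> topspace Z"
    from assms(2)[OF this] show "\<exists>N h. openin Z N \<and> z \<in> N \<and> continuous_map (subtopology Z N) (total A) h \<and> (\<forall>w\<in>N. u w = h w)"
      by (auto simp: lift_def)
  qed
  moreover have "u z \<in> carrier (F (q z))" if z: "z \<in> topspace Z" for z
    using assms(2)[OF z] z by (auto simp: lift_def)
  ultimately show ?thesis using assms(1) by (simp add: lift_def)
qed

text \<open>Where both lifts stay in a neighbourhood on which \<open>proj A\<close> is injective,
  they agree, because they lie over the same point.\<close>

lemma lift_eq_open:
  assumes "lift Z q u" "lift Z q v"
  shows "openin Z {z \<in> topspace Z. u z = v z}"
proof (subst openin_subopen, intro ballI)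
  fix z assume "z \<in> {z \<in> topspace Z. u z = v z}"
  then have z: "z \<in> topspace Z" "u z = v z" by auto
  then have "u z \<in> topspace (total A)" using lift_carrier[OF assms(1) z(1)] by (simp add: fibre_simps)
  then obtain W where W: "openin (total A) W" "u z \<in> W" "inj_on (proj A) W"
    using local_homeo_inj_nbhd[OF proj_local_homeo] by blast
  let ?N = "{z \<in> topspace Z. u z \<in> W} \<inter> {z \<in> topspace Z. v z \<in> W}"
  have "openin Z ?N" using W assms lift_continuous by (intro openin_Int openin_continuous_map_preimage)
  moreover have "z \<in> ?N" using z W by auto
  moreover have "?N \<subseteq> {z \<in> topspace Z. u z = v z}"
  proof
    fix w assume w: "w \<in> ?N"
    then have "proj A (u w) = proj A (v w)"
      using lift_carrier[OF assms(1), of w] lift_carrier[OF assms(2), of w] by (auto simp: fibre_simps)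
    then show "w \<in> {z \<in> topspace Z. u z = v z}" using w W(3) by (auto dest: inj_onD)
  qed
  ultimately show "\<exists>T. openin Z T \<and> z \<in> T \<and> T \<subseteq> {z \<in> topspace Z. u z = v z}" by blast
qed

lemma section_lift: "\<xi> \<in> compact_sections G A \<Longrightarrow> lift (unit_space G) (\<lambda>x. x) \<xi>"
  using continuous_map_image_subset_topspace[of "unit_space G" "total A" \<xi>]
  by (auto simp: compact_sections_def lift_def fibre_simps)

lemma section_carrier: "\<xi> \<in> compact_sections G A \<Longrightarrow> x \<in> units G \<Longrightarrow> \<xi> x \<in> carrier (F x)"
  using section_lift lift_carrier by fastforce

lemma section_extensional: "\<xi> \<in> compact_sections G A \<Longrightarrow> \<xi> \<in> extensional (units G)"
  by (simp add: compact_sections_def)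

lemma section_support: "\<xi> \<in> compact_sections G A \<Longrightarrow> compactin (unit_space G) {x \<in> units G. \<xi> x \<noteq> \<one>\<^bsub>F x\<^esub>}"
  by (simp add: compact_sections_def fibre_simps)

lemma section_eqI:
  "\<xi> \<in> compact_sections G A \<Longrightarrow> \<eta> \<in> compact_sections G A \<Longrightarrow> (\<And>x. x \<in> units G \<Longrightarrow> \<xi> x = \<eta> x) \<Longrightarrow> \<xi> = \<eta>"
  using section_extensional extensionalityI by blast

text \<open>The zero section agrees with \<open>\<xi>\<close> on an open set, so the support is
  closed, and a closed part of the compact set \<open>K\<close> is compact.\<close>

lemma sectionI:
  assumes l: "lift (unit_space G) (\<lambda>x. x) \<xi>" and K: "compactin (unit_space G) K"
    and supp: "\<And>x. x \<in> units G \<Longrightarrow> x \<notin> K \<Longrightarrow> \<xi> x = \<one>\<^bsub>F x\<^esub>"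
  shows "restrict \<xi> (units G) \<in> compact_sections G A"
proof -
  have l': "lift (unit_space G) (\<lambda>x. x) (restrict \<xi> (units G))"
    using l by (rule lift_cong) simp
  have "openin (unit_space G) {x \<in> topspace (unit_space G). restrict \<xi> (units G) x = \<one>\<^bsub>F x\<^esub>}"
    by (rule lift_eq_open[OF l' lift_one]) simp
  then have "closedin (unit_space G) (topspace (unit_space G) - {x \<in> topspace (unit_space G). restrict \<xi> (units G) x = \<one>\<^bsub>F x\<^esub>})"
    by blast
  moreover have "topspace (unit_space G) - {x \<in> topspace (unit_space G). restrict \<xi> (units G) x = \<one>\<^bsub>F x\<^esub>}
     = {x \<in> units G. restrict \<xi> (units G) x \<noteq> \<one>\<^bsub>F x\<^esub>}" by auto
  ultimately have "compactin (unit_space G) {x \<in> units G. restrict \<xi> (units G) x \<noteq> \<one>\<^bsub>F x\<^esub>}"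
    using supp by (intro closed_compactin[OF K]) auto
  then show ?thesis using l' by (auto simp: compact_sections_def lift_def fibre_simps)
qed

section \<open>The module of compactly supported sections\<close>

lemma section_module_simps:
  "carrier (section_module G A) = compact_sections G A"
  "\<zero>\<^bsub>section_module G A\<^esub> = (\<lambda>x\<in>units G. \<one>\<^bsub>F x\<^esub>)"
  "\<xi> \<oplus>\<^bsub>section_module G A\<^esub> \<eta> = (\<lambda>x\<in>units G. \<xi> x \<otimes>\<^bsub>F x\<^esub> \<eta> x)"
  "f \<odot>\<^bsub>section_module G A\<^esub> \<xi> = (\<lambda>x\<in>units G. gfinprod (F x) (\<lambda>g. act A g (\<xi> (src G g)) [^]\<^bsub>F x\<^esub> f g) {g \<in> arr G. rng G g = x})"
  by (simp_all add: section_module_def fibre_simps)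

lemma section_add_closed:
  assumes "\<xi> \<in> compact_sections G A" "\<eta> \<in> compact_sections G A"
  shows "(\<lambda>x\<in>units G. \<xi> x \<otimes>\<^bsub>F x\<^esub> \<eta> x) \<in> compact_sections G A"
proof (rule sectionI)
  show "lift (unit_space G) (\<lambda>x. x) (\<lambda>x. \<xi> x \<otimes>\<^bsub>F x\<^esub> \<eta> x)"
    using assms[THEN section_lift] by (rule lift_add)
  show "compactin (unit_space G) ({x \<in> units G. \<xi> x \<noteq> \<one>\<^bsub>F x\<^esub>} \<union> {x \<in> units G. \<eta> x \<noteq> \<one>\<^bsub>F x\<^esub>})"
    using assms[THEN section_support] by (rule compactin_Un)
  fix x assume x: "x \<in> units G" "x \<notin> {x \<in> units G. \<xi> x \<noteq> \<one>\<^bsub>F x\<^esub>} \<union> {x \<in> units G. \<eta> x \<noteq> \<one>\<^bsub>F x\<^esub>}"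
  interpret group "F x" using x by (simp add: fibre_group)
  show "\<xi> x \<otimes>\<^bsub>F x\<^esub> \<eta> x = \<one>\<^bsub>F x\<^esub>" using x by simp
qed

lemma section_zero_closed: "(\<lambda>x\<in>units G. \<one>\<^bsub>F x\<^esub>) \<in> compact_sections G A"
  by (rule sectionI[of _ "{}"]) (auto intro: lift_one)

lemma section_inv_closed:
  assumes "\<xi> \<in> compact_sections G A"
  shows "(\<lambda>x\<in>units G. inv\<^bsub>F x\<^esub> (\<xi> x)) \<in> compact_sections G A"
proof (rule sectionI)
  show "lift (unit_space G) (\<lambda>x. x) (\<lambda>x. inv\<^bsub>F x\<^esub> (\<xi> x))"
    using section_lift[OF assms] by (rule lift_inv)
  show "compactin (unit_space G) {x \<in> units G. \<xi> x \<noteq> \<one>\<^bsub>F x\<^esub>}"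
    using assms by (rule section_support)
  fix x assume x: "x \<in> units G" "x \<notin> {x \<in> units G. \<xi> x \<noteq> \<one>\<^bsub>F x\<^esub>}"
  interpret group "F x" using x by (simp add: fibre_group)
  show "inv\<^bsub>F x\<^esub> (\<xi> x) = \<one>\<^bsub>F x\<^esub>" using x by simp
qed

lemma section_abelian_group: "abelian_group (section_module G A)"
proof (rule abelian_groupI; unfold section_module_simps)
  fix \<xi> \<eta> \<zeta> assume s: "\<xi> \<in> compact_sections G A" "\<eta> \<in> compact_sections G A"
  show "(\<lambda>x\<in>units G. \<xi> x \<otimes>\<^bsub>F x\<^esub> \<eta> x) \<in> compact_sections G A" using s by (rule section_add_closed)
  show "(\<lambda>x\<in>units G. \<xi> x \<otimes>\<^bsub>F x\<^esub> \<eta> x) = (\<lambda>x\<in>units G. \<eta> x \<otimes>\<^bsub>F x\<^esub> \<xi> x)"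
    using s section_carrier by (intro restrict_ext comm_monoid.m_comm[OF fibre_comm_monoid])
  assume s': "\<zeta> \<in> compact_sections G A"
  have "\<xi> x \<otimes>\<^bsub>F x\<^esub> \<eta> x \<otimes>\<^bsub>F x\<^esub> \<zeta> x = \<xi> x \<otimes>\<^bsub>F x\<^esub> (\<eta> x \<otimes>\<^bsub>F x\<^esub> \<zeta> x)" if "x \<in> units G" for x
    using s s' section_carrier that by (intro monoid.m_assoc[OF group.is_monoid[OF fibre_group]])
  then show "(\<lambda>x\<in>units G. (\<lambda>x\<in>units G. \<xi> x \<otimes>\<^bsub>F x\<^esub> \<eta> x) x \<otimes>\<^bsub>F x\<^esub> \<zeta> x) =
     (\<lambda>x\<in>units G. \<xi> x \<otimes>\<^bsub>F x\<^esub> (\<lambda>x\<in>units G. \<eta> x \<otimes>\<^bsub>F x\<^esub> \<zeta> x) x)"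
    by (intro restrict_ext) simp
next
  fix \<xi> assume s: "\<xi> \<in> compact_sections G A"
  have "\<one>\<^bsub>F x\<^esub> \<otimes>\<^bsub>F x\<^esub> \<xi> x = \<xi> x" if "x \<in> units G" for x
    using s section_carrier that by (intro monoid.l_one[OF group.is_monoid[OF fibre_group]])
  then show "(\<lambda>x\<in>units G. (\<lambda>x\<in>units G. \<one>\<^bsub>F x\<^esub>) x \<otimes>\<^bsub>F x\<^esub> \<xi> x) = \<xi>"
    using section_extensional[OF s] by (auto simp: fun_eq_iff extensional_def)
  have "inv\<^bsub>F x\<^esub> (\<xi> x) \<otimes>\<^bsub>F x\<^esub> \<xi> x = \<one>\<^bsub>F x\<^esub>" if "x \<in> units G" for x
    using s section_carrier that by (intro group.l_inv[OF fibre_group])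
  then have "(\<lambda>x\<in>units G. (\<lambda>x\<in>units G. inv\<^bsub>F x\<^esub> (\<xi> x)) x \<otimes>\<^bsub>F x\<^esub> \<xi> x) = (\<lambda>x\<in>units G. \<one>\<^bsub>F x\<^esub>)"
    by (intro restrict_ext) simp
  then show "\<exists>\<eta>\<in>compact_sections G A. (\<lambda>x\<in>units G. \<eta> x \<otimes>\<^bsub>F x\<^esub> \<xi> x) = (\<lambda>x\<in>units G. \<one>\<^bsub>F x\<^esub>)"
    using section_inv_closed[OF s] by blast
qed (rule section_zero_closed)

lemma act_section: "\<xi> \<in> compact_sections G A \<Longrightarrow> g \<in> arr G \<Longrightarrow> act A g (\<xi> (src G g)) \<in> carrier (F (rng G g))"
  by (intro act_closed section_carrier src_units)

text \<open>At most one arrow of \<open>B\<close> ends at a given unit, so the fibre sum has a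
  single term, with exponent 1: the indicator transports \<open>\<xi>\<close> along
  \<open>B\<close>.\<close>

lemma smult_bisection:
  assumes B: "compact_open_bisection G B" and \<xi>: "\<xi> \<in> compact_sections G A"
  shows "b \<in> B \<Longrightarrow> (indicator B \<odot>\<^bsub>section_module G A\<^esub> \<xi>) (rng G b) = act A b (\<xi> (src G b))"
    and "x \<in> units G \<Longrightarrow> x \<notin> rng G ` B \<Longrightarrow> (indicator B \<odot>\<^bsub>section_module G A\<^esub> \<xi>) x = \<one>\<^bsub>F x\<^esub>"
proof -
  have inj: "inj_on (rng G) B" using B by (simp add: compact_open_bisection_def)
  show "(indicator B \<odot>\<^bsub>section_module G A\<^esub> \<xi>) (rng G b) = act A b (\<xi> (src G b))" if b: "b \<in> B"
  proof -
    have bG: "b \<in> arr G" using B b by (rule bisection_arr)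
    interpret comm_group "F (rng G b)" using bG by (intro fibre_comm_group rng_units)
    note ab = act_section[OF \<xi> bG]
    have one: "indicator B b = (1::int)" using b by simp
    have "gfinprod (F (rng G b)) (\<lambda>g. act A g (\<xi> (src G g)) [^]\<^bsub>F (rng G b)\<^esub> (indicator B g :: int)) {g \<in> arr G. rng G g = rng G b}
      = (if b \<in> {g \<in> arr G. rng G g = rng G b} then act A b (\<xi> (src G b)) [^]\<^bsub>F (rng G b)\<^esub> (indicator B b :: int) else \<one>\<^bsub>F (rng G b)\<^esub>)"
    proof (rule gfinprod_single)
      fix g assume g: "g \<in> {g \<in> arr G. rng G g = rng G b}" "g \<noteq> b"
      then have "g \<notin> B" using inj_onD[OF inj _ _ b] by auto
      then show "act A g (\<xi> (src G g)) [^]\<^bsub>F (rng G b)\<^esub> (indicator B g :: int) = \<one>\<^bsub>F (rng G b)\<^esub>" by simp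
    qed (use ab in auto)
    then show ?thesis using bG ab one by (simp add: section_module_simps rng_units)
  qed
  show "(indicator B \<odot>\<^bsub>section_module G A\<^esub> \<xi>) x = \<one>\<^bsub>F x\<^esub>" if x: "x \<in> units G" "x \<notin> rng G ` B"
  proof -
    interpret comm_group "F x" using x by (intro fibre_comm_group)
    have "gfinprod (F x) (\<lambda>g. act A g (\<xi> (src G g)) [^]\<^bsub>F x\<^esub> (indicator B g :: int)) {g \<in> arr G. rng G g = x} = \<one>\<^bsub>F x\<^esub>"
    proof (rule gfinprod_one)
      fix g assume "g \<in> {g \<in> arr G. rng G g = x}"
      then have "g \<notin> B" using x by auto
      then show "act A g (\<xi> (src G g)) [^]\<^bsub>F x\<^esub> (indicator B g :: int) = \<one>\<^bsub>F x\<^esub>" by simp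
    qed
    then show ?thesis using x by (simp add: section_module_simps)
  qed
qed

lemma smult_extensional: "f \<odot>\<^bsub>section_module G A\<^esub> \<xi> \<in> extensional (units G)"
  by (simp add: section_module_simps)

lemma finite_smult_support:
  assumes f: "f \<in> Zfun (arrows G)" 
  shows "finite {g \<in> {g \<in> arr G. rng G g = x}. (u g [^]\<^bsub>F x\<^esub> f g) \<noteq> \<one>\<^bsub>F x\<^esub>}"
proof (rule finite_subset)
  show "finite {g. rng G g = x \<and> f g \<noteq> 0}" using finite_fibre_support[OF locally_boolean_arrows f etale_rng] .
  show "{g \<in> {g \<in> arr G. rng G g = x}. (u g [^]\<^bsub>F x\<^esub> f g) \<noteq> \<one>\<^bsub>F x\<^esub>} \<subseteq> {g. rng G g = x \<and> f g \<noteq> 0}" by auto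
qed

lemma smult_add_left:
  assumes f: "f \<in> Zfun (arrows G)" "f' \<in> Zfun (arrows G)" and \<xi>: "\<xi> \<in> compact_sections G A"
  shows "(\<lambda>g. f g + f' g) \<odot>\<^bsub>section_module G A\<^esub> \<xi> =
    f \<odot>\<^bsub>section_module G A\<^esub> \<xi> \<oplus>\<^bsub>section_module G A\<^esub> f' \<odot>\<^bsub>section_module G A\<^esub> \<xi>"
  unfolding section_module_simps
proof (intro restrict_ext)
  fix x assume x: "x \<in> units G"
  interpret comm_group "F x" using x by (rule fibre_comm_group)
  let ?S = "{g \<in> arr G. rng G g = x}"
  have c: "act A g (\<xi> (src G g)) \<in> carrier (F x)" if "g \<in> ?S" for g using act_section[OF \<xi>] that by blast
  have "gfinprod (F x) (\<lambda>g. act A g (\<xi> (src G g)) [^]\<^bsub>F x\<^esub> (f g + f' g)) ?S =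
    gfinprod (F x) (\<lambda>g. act A g (\<xi> (src G g)) [^]\<^bsub>F x\<^esub> f g \<otimes>\<^bsub>F x\<^esub> act A g (\<xi> (src G g)) [^]\<^bsub>F x\<^esub> f' g) ?S"
    using c by (intro gfinprod_cong) (auto simp: int_pow_mult)
  also have "\<dots> = gfinprod (F x) (\<lambda>g. act A g (\<xi> (src G g)) [^]\<^bsub>F x\<^esub> f g) ?S \<otimes>\<^bsub>F x\<^esub>
      gfinprod (F x) (\<lambda>g. act A g (\<xi> (src G g)) [^]\<^bsub>F x\<^esub> f' g) ?S"
    using finite_smult_support[OF f(1)] finite_smult_support[OF f(2)] c by (intro gfinprod_distrib) auto
  finally show "gfinprod (F x) (\<lambda>g. act A g (\<xi> (src G g)) [^]\<^bsub>F x\<^esub> (f g + f' g)) ?S =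
    (\<lambda>x\<in>units G. gfinprod (F x) (\<lambda>g. act A g (\<xi> (src G g)) [^]\<^bsub>F x\<^esub> f g) {g \<in> arr G. rng G g = x}) x \<otimes>\<^bsub>F x\<^esub>
      (\<lambda>x\<in>units G. gfinprod (F x) (\<lambda>g. act A g (\<xi> (src G g)) [^]\<^bsub>F x\<^esub> f' g) {g \<in> arr G. rng G g = x}) x"
    using x by simp
qed

lemma smult_add_right:
  assumes f: "f \<in> Zfun (arrows G)" and \<xi>: "\<xi> \<in> compact_sections G A" "\<eta> \<in> compact_sections G A"
  shows "f \<odot>\<^bsub>section_module G A\<^esub> (\<xi> \<oplus>\<^bsub>section_module G A\<^esub> \<eta>) =
    f \<odot>\<^bsub>section_module G A\<^esub> \<xi> \<oplus>\<^bsub>section_module G A\<^esub> f \<odot>\<^bsub>section_module G A\<^esub> \<eta>"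
  unfolding section_module_simps
proof (intro restrict_ext)
  fix x assume x: "x \<in> units G"
  interpret comm_group "F x" using x by (rule fibre_comm_group)
  let ?S = "{g \<in> arr G. rng G g = x}"
  let ?a = "\<lambda>\<xi> g. act A g (\<xi> (src G g))"
  have c: "?a \<zeta> g \<in> carrier (F x)" if "g \<in> ?S" "\<zeta> \<in> compact_sections G A" for g \<zeta>
    using act_section[OF that(2), of g] that(1) by blast
  have "gfinprod (F x) (\<lambda>g. act A g ((\<lambda>x\<in>units G. \<xi> x \<otimes>\<^bsub>F x\<^esub> \<eta> x) (src G g)) [^]\<^bsub>F x\<^esub> f g) ?S =
    gfinprod (F x) (\<lambda>g. ?a \<xi> g [^]\<^bsub>F x\<^esub> f g \<otimes>\<^bsub>F x\<^esub> ?a \<eta> g [^]\<^bsub>F x\<^esub> f g) ?S"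
  proof (rule gfinprod_cong_on)
    show "(\<lambda>g. ?a \<xi> g [^]\<^bsub>F x\<^esub> f g \<otimes>\<^bsub>F x\<^esub> ?a \<eta> g [^]\<^bsub>F x\<^esub> f g) \<in> ?S \<rightarrow> carrier (F x)" using c \<xi> by auto
    fix g assume "g \<in> ?S"
    then have g: "g \<in> arr G" "rng G g = x" by auto
    interpret h: group_hom "F (src G g)" "F (rng G g)" "act A g" using g(1) by (rule act_group_hom)
    show "act A g ((\<lambda>x\<in>units G. \<xi> x \<otimes>\<^bsub>F x\<^esub> \<eta> x) (src G g)) [^]\<^bsub>F x\<^esub> f g =
       ?a \<xi> g [^]\<^bsub>F x\<^esub> f g \<otimes>\<^bsub>F x\<^esub> ?a \<eta> g [^]\<^bsub>F x\<^esub> f g"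
      using g \<xi> c[of g] by (simp add: src_units section_carrier int_pow_distrib)
  qed
  also have "\<dots> = gfinprod (F x) (\<lambda>g. ?a \<xi> g [^]\<^bsub>F x\<^esub> f g) ?S \<otimes>\<^bsub>F x\<^esub> gfinprod (F x) (\<lambda>g. ?a \<eta> g [^]\<^bsub>F x\<^esub> f g) ?S"
    using finite_smult_support[OF f] finite_smult_support[OF f] c \<xi> by (intro gfinprod_distrib) auto
  finally show "gfinprod (F x) (\<lambda>g. act A g ((\<lambda>x\<in>units G. \<xi> x \<otimes>\<^bsub>F x\<^esub> \<eta> x) (src G g)) [^]\<^bsub>F x\<^esub> f g) ?S =
    (\<lambda>x\<in>units G. gfinprod (F x) (\<lambda>g. ?a \<xi> g [^]\<^bsub>F x\<^esub> f g) {g \<in> arr G. rng G g = x}) x \<otimes>\<^bsub>F x\<^esub>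
    (\<lambda>x\<in>units G. gfinprod (F x) (\<lambda>g. ?a \<eta> g [^]\<^bsub>F x\<^esub> f g) {g \<in> arr G. rng G g = x}) x"
    using x by simp
qed

text \<open>The ranges of \<open>B\<close> form a clopen set. Over it the section is a composite of
  continuous maps through the inverse of \<open>rng G\<close> on \<open>B\<close>; over the
  complement it is the zero section.\<close>

lemma smult_bisection_lift:
  assumes B: "compact_open_bisection G B" and \<xi>: "\<xi> \<in> compact_sections G A"
  shows "lift (unit_space G) (\<lambda>x. x) (indicator B \<odot>\<^bsub>section_module G A\<^esub> \<xi>)"
proof (rule lift_local)
  show "continuous_map (unit_space G) (unit_space G) (\<lambda>x. x)" by simp
  have B': "compact_open (arrows G) B" "openin (arrows G) B" "inj_on (rng G) B"
    using B by (auto simp: compact_open_bisection_def compact_open_def)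
  have rB: "compact_open (unit_space G) (rng G ` B)" using B'(1) by (rule compact_open_rng)
  fix x assume x: "x \<in> topspace (unit_space G)"
  show "\<exists>N v. openin (unit_space G) N \<and> x \<in> N \<and> lift (subtopology (unit_space G) N) (\<lambda>x. x) v \<and>
      (\<forall>w\<in>N. (indicator B \<odot>\<^bsub>section_module G A\<^esub> \<xi>) w = v w)"
  proof (cases "x \<in> rng G ` B")
    case True
    let ?N = "rng G ` B" and ?\<sigma> = "the_inv_into B (rng G)"
    have c: "continuous_map (subtopology (unit_space G) ?N) (arrows G) ?\<sigma>"
      using etale_rng B'(2,3) by (rule continuous_map_the_inv_into)
    have "lift (unit_space G) (\<lambda>x. x) \<xi>" using \<xi> by (rule section_lift)
    from lift_compose[OF this continuous_map_compose[OF c continuous_src_unit_space]]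
    have "lift (subtopology (unit_space G) ?N) (\<lambda>y. src G (?\<sigma> y)) (\<lambda>y. \<xi> (src G (?\<sigma> y)))" by simp
    from lift_act[OF this c]
    have l: "lift (subtopology (unit_space G) ?N) (\<lambda>y. rng G (?\<sigma> y)) (\<lambda>y. act A (?\<sigma> y) (\<xi> (src G (?\<sigma> y))))" by simp
    have r: "rng G (?\<sigma> y) = y" if "y \<in> ?N" for y using f_the_inv_into_f[OF B'(3) that] .
    have "act A (?\<sigma> y) (\<xi> (src G (?\<sigma> y))) \<in> carrier (F y)" if "y \<in> topspace (subtopology (unit_space G) ?N)" for y
      using lift_carrier[OF l that] r[of y] that by simp
    moreover have "continuous_map (subtopology (unit_space G) ?N) (unit_space G) (\<lambda>y. y)"
      by (intro continuous_map_from_subtopology) simp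
    ultimately have "lift (subtopology (unit_space G) ?N) (\<lambda>y. y) (\<lambda>y. act A (?\<sigma> y) (\<xi> (src G (?\<sigma> y))))"
      using lift_continuous[OF l] unfolding lift_def by blast
    moreover have "(indicator B \<odot>\<^bsub>section_module G A\<^esub> \<xi>) w = act A (?\<sigma> w) (\<xi> (src G (?\<sigma> w)))" if "w \<in> ?N" for w
      using that B'(3) smult_bisection(1)[OF B \<xi>] by (auto simp: the_inv_into_f_f)
    ultimately show ?thesis using True rB unfolding compact_open_def by blast
  next
    case False
    let ?N = "units G - rng G ` B"
    have "openin (unit_space G) (topspace (unit_space G) - rng G ` B)"
      using compact_open_closedin[OF Hausdorff_unit_space rB] by blast
    then have "openin (unit_space G) ?N" by simp
    moreover have "lift (subtopology (unit_space G) ?N) (\<lambda>x. x) (\<lambda>x. \<one>\<^bsub>F x\<^esub>)"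
      by (intro lift_subtopology lift_one) simp
    ultimately show ?thesis using False x smult_bisection(2)[OF B \<xi>] by (intro exI[of _ ?N] exI[of _ "\<lambda>x. \<one>\<^bsub>F x\<^esub>"]) auto
  qed
qed

lemma smult_zero_left: "(\<lambda>g. 0) \<odot>\<^bsub>section_module G A\<^esub> \<xi> = \<zero>\<^bsub>section_module G A\<^esub>"
  unfolding section_module_simps
proof (intro restrict_ext)
  fix x assume x: "x \<in> units G"
  interpret comm_group "F x" using x by (rule fibre_comm_group)
  show "gfinprod (F x) (\<lambda>g. act A g (\<xi> (src G g)) [^]\<^bsub>F x\<^esub> (0::int)) {g \<in> arr G. rng G g = x} = \<one>\<^bsub>F x\<^esub>"
    by (rule gfinprod_one) simp
qed

lemma smult_uminus_left:
  assumes f: "f \<in> Zfun (arrows G)" and \<xi>: "\<xi> \<in> compact_sections G A"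
    and c: "f \<odot>\<^bsub>section_module G A\<^esub> \<xi> \<in> compact_sections G A"
  shows "(\<lambda>g. - f g) \<odot>\<^bsub>section_module G A\<^esub> \<xi> = (\<lambda>x\<in>units G. inv\<^bsub>F x\<^esub> ((f \<odot>\<^bsub>section_module G A\<^esub> \<xi>) x))"
proof (rule extensionalityI[of _ "units G"])
  fix x assume x: "x \<in> units G"
  interpret comm_group "F x" using x by (rule fibre_comm_group)
  have "act A g (\<xi> (src G g)) [^]\<^bsub>F x\<^esub> - f g \<in> carrier (F x)" if "g \<in> {g \<in> arr G. rng G g = x}" for g
    using act_section[OF \<xi>, of g] that by simp
  then have s: "((\<lambda>g. - f g) \<odot>\<^bsub>section_module G A\<^esub> \<xi>) x \<in> carrier (F x)"
    using x unfolding section_module_simps by (simp add: gfinprod_closed Pi_def)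
  have "(\<lambda>g. - f g + f g) \<odot>\<^bsub>section_module G A\<^esub> \<xi> = \<zero>\<^bsub>section_module G A\<^esub>"
    using smult_zero_left by simp
  then have "((\<lambda>g. - f g) \<odot>\<^bsub>section_module G A\<^esub> \<xi> \<oplus>\<^bsub>section_module G A\<^esub> f \<odot>\<^bsub>section_module G A\<^esub> \<xi>) x = \<zero>\<^bsub>section_module G A\<^esub> x"
    by (simp only: smult_add_left[OF Zfun_uminus[OF f] f \<xi>])
  then have "((\<lambda>g. - f g) \<odot>\<^bsub>section_module G A\<^esub> \<xi>) x \<otimes>\<^bsub>F x\<^esub> (f \<odot>\<^bsub>section_module G A\<^esub> \<xi>) x = \<one>\<^bsub>F x\<^esub>"
    using x by (simp only: section_module_simps(2,3) restrict_apply if_True)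
  then show "((\<lambda>g. - f g) \<odot>\<^bsub>section_module G A\<^esub> \<xi>) x = (\<lambda>x\<in>units G. inv\<^bsub>F x\<^esub> ((f \<odot>\<^bsub>section_module G A\<^esub> \<xi>) x)) x"
    using s section_carrier[OF c x] x by (simp add: inv_equality)
qed (simp_all add: smult_extensional)

lemma smult_closed:
  assumes "f \<in> Zfun (arrows G)" and \<xi>: "\<xi> \<in> compact_sections G A"
  shows "f \<odot>\<^bsub>section_module G A\<^esub> \<xi> \<in> compact_sections G A"
  using assms(1)
proof (induction rule: bisection_Zfun_induct)
  case zero
  show ?case using section_zero_closed by (simp only: smult_zero_left section_module_simps)
next
  case (add f g)
  show ?case using section_add_closed[OF add(3,4)] by (simp only: smult_add_left[OF add(1,2) \<xi>] section_module_simps(3))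
next
  case (uminus f)
  show ?case using section_inv_closed[OF uminus(2)] by (simp only: smult_uminus_left[OF uminus(1) \<xi> uminus(2)])
next
  case (indicator B)
  then have "compactin (unit_space G) (rng G ` B)"
    using compact_open_rng by (auto simp: compact_open_bisection_def compact_open_def)
  then have "restrict (indicator B \<odot>\<^bsub>section_module G A\<^esub> \<xi>) (units G) \<in> compact_sections G A"
    using smult_bisection_lift[OF indicator \<xi>] smult_bisection(2)[OF indicator \<xi>] by (intro sectionI)
  then show ?case using smult_extensional extensional_restrict by metis
qed

end

section \<open>Cochain groups\<close>

text \<open>Scalars acting by endomorphisms of an abelian group: this is what makes the maps of
  \<open>module_hom\<close> an abelian group under pointwise addition, when it holds for source and
  target.\<close>

definition smodule :: "'g groupoid \<Rightarrow> ('g \<Rightarrow> int, 'm) module \<Rightarrow> bool" where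
  "smodule G M \<longleftrightarrow> abelian_group M \<and>
     (\<forall>f\<in>Zfun (arrows G). \<forall>m\<in>carrier M. f \<odot>\<^bsub>M\<^esub> m \<in> carrier M) \<and>
     (\<forall>f\<in>Zfun (arrows G). \<forall>m\<in>carrier M. \<forall>m'\<in>carrier M.
        f \<odot>\<^bsub>M\<^esub> (m \<oplus>\<^bsub>M\<^esub> m') = f \<odot>\<^bsub>M\<^esub> m \<oplus>\<^bsub>M\<^esub> f \<odot>\<^bsub>M\<^esub> m')"

lemma groupoid_module_smodule: "groupoid_module G M \<Longrightarrow> smodule G M"
  by (simp add: groupoid_module_def smodule_def)

lemma smoduleD:
  assumes "smodule G M"
  shows "abelian_group M"
    "f \<in> Zfun (arrows G) \<Longrightarrow> m \<in> carrier M \<Longrightarrow> f \<odot>\<^bsub>M\<^esub> m \<in> carrier M"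
    "f \<in> Zfun (arrows G) \<Longrightarrow> m \<in> carrier M \<Longrightarrow> m' \<in> carrier M \<Longrightarrow>
      f \<odot>\<^bsub>M\<^esub> (m \<oplus>\<^bsub>M\<^esub> m') = f \<odot>\<^bsub>M\<^esub> m \<oplus>\<^bsub>M\<^esub> f \<odot>\<^bsub>M\<^esub> m'"
  using assms by (auto simp: smodule_def)

lemma smodule_group_hom:
  assumes "smodule G M" "f \<in> Zfun (arrows G)"
  shows "group_hom (add_monoid M) (add_monoid M) (\<lambda>m. f \<odot>\<^bsub>M\<^esub> m)"
proof -
  interpret abelian_group M using assms(1) by (rule smoduleD)
  show ?thesis using assms smoduleD[OF assms(1)] a_group
    by (auto simp: group_hom_def group_hom_axioms_def hom_def)
qed

lemma smodule_zero_inv: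
  assumes "smodule G M" "f \<in> Zfun (arrows G)"
  shows "f \<odot>\<^bsub>M\<^esub> \<zero>\<^bsub>M\<^esub> = \<zero>\<^bsub>M\<^esub>" "m \<in> carrier M \<Longrightarrow> f \<odot>\<^bsub>M\<^esub> (\<ominus>\<^bsub>M\<^esub> m) = \<ominus>\<^bsub>M\<^esub> (f \<odot>\<^bsub>M\<^esub> m)"
proof -
  interpret h: group_hom "add_monoid M" "add_monoid M" "\<lambda>m. f \<odot>\<^bsub>M\<^esub> m" using assms by (rule smodule_group_hom)
  show "f \<odot>\<^bsub>M\<^esub> \<zero>\<^bsub>M\<^esub> = \<zero>\<^bsub>M\<^esub>" using h.hom_one by simp
  show "f \<odot>\<^bsub>M\<^esub> (\<ominus>\<^bsub>M\<^esub> m) = \<ominus>\<^bsub>M\<^esub> (f \<odot>\<^bsub>M\<^esub> m)" if "m \<in> carrier M" using h.hom_inv[of m] that by (simp add: a_inv_def)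
qed

lemma hom_group_simps:
  "carrier (hom_group G A M) = module_hom G A M"
  "\<phi> \<otimes>\<^bsub>hom_group G A M\<^esub> \<psi> = (\<lambda>a\<in>carrier A. \<phi> a \<oplus>\<^bsub>M\<^esub> \<psi> a)"
  "\<one>\<^bsub>hom_group G A M\<^esub> = (\<lambda>a\<in>carrier A. \<zero>\<^bsub>M\<^esub>)"
  by (simp_all add: hom_group_def)

lemma module_homD:
  assumes "\<phi> \<in> module_hom G A M"
  shows "a \<in> carrier A \<Longrightarrow> \<phi> a \<in> carrier M"
    "\<phi> \<in> extensional (carrier A)"
    "a \<in> carrier A \<Longrightarrow> b \<in> carrier A \<Longrightarrow> \<phi> (a \<oplus>\<^bsub>A\<^esub> b) = \<phi> a \<oplus>\<^bsub>M\<^esub> \<phi> b"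
    "f \<in> Zfun (arrows G) \<Longrightarrow> a \<in> carrier A \<Longrightarrow> \<phi> (f \<odot>\<^bsub>A\<^esub> a) = f \<odot>\<^bsub>M\<^esub> \<phi> a"
  using assms by (auto simp: module_hom_def PiE_iff)

lemma module_homI:
  assumes "\<phi> \<in> extensional (carrier A)" "\<And>a. a \<in> carrier A \<Longrightarrow> \<phi> a \<in> carrier M"
    "\<And>a b. a \<in> carrier A \<Longrightarrow> b \<in> carrier A \<Longrightarrow> \<phi> (a \<oplus>\<^bsub>A\<^esub> b) = \<phi> a \<oplus>\<^bsub>M\<^esub> \<phi> b"
    "\<And>f a. f \<in> Zfun (arrows G) \<Longrightarrow> a \<in> carrier A \<Longrightarrow> \<phi> (f \<odot>\<^bsub>A\<^esub> a) = f \<odot>\<^bsub>M\<^esub> \<phi> a"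
  shows "\<phi> \<in> module_hom G A M"
  using assms by (auto simp: module_hom_def PiE_iff)

lemma module_hom_eqI:
  "\<phi> \<in> module_hom G A M \<Longrightarrow> \<psi> \<in> module_hom G A M \<Longrightarrow> (\<And>a. a \<in> carrier A \<Longrightarrow> \<phi> a = \<psi> a) \<Longrightarrow> \<phi> = \<psi>"
  using module_homD(2) extensionalityI by metis

lemma module_hom_group_hom:
  assumes "smodule G A" "smodule G M" "\<phi> \<in> module_hom G A M"
  shows "group_hom (add_monoid A) (add_monoid M) \<phi>"
proof -
  interpret A: abelian_group A using assms(1) by (rule smoduleD)
  interpret M: abelian_group M using assms(2) by (rule smoduleD)
  show ?thesis using module_homD[OF assms(3)] A.a_group M.a_group
    by (auto simp: group_hom_def group_hom_axioms_def hom_def)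
qed

lemma comm_group_hom_group:
  assumes A: "smodule G A" and M: "smodule G M"
  shows "comm_group (hom_group G A M)"
proof -
  interpret A: abelian_group A using A by (rule smoduleD)
  interpret M: abelian_group M using M by (rule smoduleD)
  note [simp] = smoduleD(2,3)[OF A] smoduleD(2,3)[OF M]
  show ?thesis
  proof (rule comm_groupI; unfold hom_group_simps)
    show "(\<lambda>a\<in>carrier A. \<zero>\<^bsub>M\<^esub>) \<in> module_hom G A M"
      by (rule module_homI) (simp_all add: smodule_zero_inv[OF M])
    fix \<phi> assume \<phi>: "\<phi> \<in> module_hom G A M"
    note p = module_homD[OF \<phi>]
    show "(\<lambda>a\<in>carrier A. (\<lambda>a\<in>carrier A. \<zero>\<^bsub>M\<^esub>) a \<oplus>\<^bsub>M\<^esub> \<phi> a) = \<phi>"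
      using p by (intro extensionalityI[of _ "carrier A"]) simp_all
    have "(\<lambda>a\<in>carrier A. \<ominus>\<^bsub>M\<^esub> (\<phi> a)) \<in> module_hom G A M"
      using p by (intro module_homI) (simp_all add: smodule_zero_inv[OF M] M.minus_add M.a_comm)
    moreover have "(\<lambda>a\<in>carrier A. (\<lambda>a\<in>carrier A. \<ominus>\<^bsub>M\<^esub> (\<phi> a)) a \<oplus>\<^bsub>M\<^esub> \<phi> a) = (\<lambda>a\<in>carrier A. \<zero>\<^bsub>M\<^esub>)"
      using p by (intro restrict_ext) (simp add: M.l_neg)
    ultimately show "\<exists>\<psi>\<in>module_hom G A M. (\<lambda>a\<in>carrier A. \<psi> a \<oplus>\<^bsub>M\<^esub> \<phi> a) = (\<lambda>a\<in>carrier A. \<zero>\<^bsub>M\<^esub>)" by blast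
    fix \<psi> assume \<psi>: "\<psi> \<in> module_hom G A M"
    note q = module_homD[OF \<psi>]
    show "(\<lambda>a\<in>carrier A. \<phi> a \<oplus>\<^bsub>M\<^esub> \<psi> a) \<in> module_hom G A M"
      using p q by (intro module_homI) (simp_all add: M.a_ac)
    show "(\<lambda>a\<in>carrier A. \<phi> a \<oplus>\<^bsub>M\<^esub> \<psi> a) = (\<lambda>a\<in>carrier A. \<psi> a \<oplus>\<^bsub>M\<^esub> \<phi> a)"
      using p q by (intro restrict_ext) (simp add: M.a_comm)
    fix \<omega> assume "\<omega> \<in> module_hom G A M"
    note r = module_homD[OF this]
    show "(\<lambda>a\<in>carrier A. (\<lambda>a\<in>carrier A. \<phi> a \<oplus>\<^bsub>M\<^esub> \<psi> a) a \<oplus>\<^bsub>M\<^esub> \<omega> a) =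
      (\<lambda>a\<in>carrier A. \<phi> a \<oplus>\<^bsub>M\<^esub> (\<lambda>a\<in>carrier A. \<psi> a \<oplus>\<^bsub>M\<^esub> \<omega> a) a)"
      using p q r by (intro restrict_ext) (simp add: M.a_assoc)
  qed
qed

context ample_groupoid
begin

lemma smodule_nerve: "smodule G (nerve_module G (Suc n))"
proof -
  interpret N: gspace G "nerve G (Suc n)" "anchor G" "translate G" by (rule gspace_nerve)
  have "abelian_group (nerve_module G (Suc n))"
  proof (rule abelian_groupI; unfold nerve_module_simps)
    fix f assume "f \<in> Zfun (nerve G (Suc n))"
    then show "\<exists>g\<in>Zfun (nerve G (Suc n)). (\<lambda>y. g y + f y) = (\<lambda>y. 0)"
      by (intro bexI[of _ "\<lambda>y. - f y"]) (auto intro: Zfun_uminus)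
  qed (auto intro: Zfun_add Zfun_zero)
  then show ?thesis by (simp add: smodule_def nerve_module_simps N.smul_Zfun N.smul_add_right)
qed

lemma comm_group_cochains: "smodule G M \<Longrightarrow> comm_group (cochains G M n)"
  unfolding cochains_def by (intro comm_group_hom_group smodule_nerve)

lemma cochains_simps:
  "carrier (cochains G M n) = module_hom G (nerve_module G (Suc n)) M"
  "\<phi> \<otimes>\<^bsub>cochains G M n\<^esub> \<psi> = (\<lambda>f\<in>Zfun (nerve G (Suc n)). \<phi> f \<oplus>\<^bsub>M\<^esub> \<psi> f)"
  "\<one>\<^bsub>cochains G M n\<^esub> = (\<lambda>f\<in>Zfun (nerve G (Suc n)). \<zero>\<^bsub>M\<^esub>)"
  by (simp_all add: cochains_def hom_group_simps nerve_module_simps)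

lemma coboundary_map_apply:
  "coboundary_map G n \<phi> = (\<lambda>f\<in>Zfun (nerve G (Suc (Suc n))). \<phi> (boundary G (Suc n) f))"
  by (simp add: coboundary_map_def nerve_module_simps)

lemma coboundary_map_closed:
  assumes "\<phi> \<in> module_hom G (nerve_module G (Suc n)) M"
  shows "coboundary_map G n \<phi> \<in> module_hom G (nerve_module G (Suc (Suc n))) M"
proof -
  interpret N: gspace G "nerve G (Suc (Suc n))" "anchor G" "translate G" by (rule gspace_nerve)
  note p = module_homD[OF assms, unfolded nerve_module_simps]
  show ?thesis unfolding coboundary_map_apply
    by (rule module_homI; unfold nerve_module_simps)
      (simp_all add: p boundary_Zfun boundary_add Zfun_add N.smul_Zfun boundary_smul)
qed

lemma coboundary_map_hom: "coboundary_map G n \<in> hom (cochains G M n) (cochains G M (Suc n))"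
proof -
  have "coboundary_map G n (\<lambda>f\<in>Zfun (nerve G (Suc n)). \<phi> f \<oplus>\<^bsub>M\<^esub> \<psi> f) =
     (\<lambda>f\<in>Zfun (nerve G (Suc (Suc n))). coboundary_map G n \<phi> f \<oplus>\<^bsub>M\<^esub> coboundary_map G n \<psi> f)" for \<phi> \<psi>
    unfolding coboundary_map_apply by (intro restrict_ext) (simp add: boundary_Zfun)
  then show ?thesis by (auto simp: hom_def cochains_simps coboundary_map_closed)
qed

lemma coboundary_coboundary:
  assumes M: "smodule G M" and \<phi>: "\<phi> \<in> carrier (cochains G M n)"
  shows "coboundary_map G (Suc n) (coboundary_map G n \<phi>) = \<one>\<^bsub>cochains G M (Suc (Suc n))\<^esub>"
proof -
  interpret h: group_hom "add_monoid (nerve_module G (Suc n))" "add_monoid M" \<phi>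
    using smodule_nerve M \<phi> by (intro module_hom_group_hom) (simp_all add: cochains_simps)
  have z: "\<phi> (\<lambda>y. 0) = \<zero>\<^bsub>M\<^esub>" using h.hom_one by (simp add: nerve_module_simps)
  show ?thesis unfolding coboundary_map_apply cochains_simps
    by (intro restrict_ext) (simp add: boundary_Zfun boundary_boundary z)
qed

end

lemma (in gsheaf) smodule_section: "smodule G (section_module G A)"
  unfolding smodule_def
proof (intro conjI ballI)
  fix f \<xi> \<eta> assume f: "f \<in> Zfun (arrows G)" and \<xi>: "\<xi> \<in> carrier (section_module G A)"
  then show "f \<odot>\<^bsub>section_module G A\<^esub> \<xi> \<in> carrier (section_module G A)"
    using smult_closed by (simp only: section_module_simps(1))
  assume "\<eta> \<in> carrier (section_module G A)"
  then show "f \<odot>\<^bsub>section_module G A\<^esub> (\<xi> \<oplus>\<^bsub>section_module G A\<^esub> \<eta>) =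
    f \<odot>\<^bsub>section_module G A\<^esub> \<xi> \<oplus>\<^bsub>section_module G A\<^esub> f \<odot>\<^bsub>section_module G A\<^esub> \<eta>"
    using f \<xi> smult_add_right by (simp only: section_module_simps(1))
qed (rule section_abelian_group)

text \<open>The nerve modules are the instances for nerves. In the general form the correspondence
  between homomorphisms and equivariant families is established at once for all etale spaces with an
  action.\<close>

definition space_module :: "'g groupoid \<Rightarrow> 'x topology \<Rightarrow> ('x \<Rightarrow> 'g) \<Rightarrow> ('g \<Rightarrow> 'x \<Rightarrow> 'x) \<Rightarrow> ('g \<Rightarrow> int, 'x \<Rightarrow> int) module" where
  "space_module G X p t = \<lparr>
     carrier = Zfun X, monoid.mult = undefined, one = undefined,
     ring.zero = (\<lambda>y. 0), ring.add = (\<lambda>m m'. \<lambda>y. m y + m' y),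
     module.smult = (\<lambda>f m. \<lambda>y. if y \<in> topspace X
       then sum' (\<lambda>g. f (ginv G g) * m (t g y)) {g \<in> arr G. src G g = p y} else 0)\<rparr>"

lemma nerve_module_space: "nerve_module G n = space_module G (nerve G n) (anchor G) (translate G)"
  by (simp add: nerve_module_def space_module_def)

lemma (in ample_groupoid) space_module_simps:
  "carrier (space_module G X p t) = Zfun X"
  "m \<oplus>\<^bsub>space_module G X p t\<^esub> m' = (\<lambda>y. m y + m' y)"
  "f \<odot>\<^bsub>space_module G X p t\<^esub> m = smul X p t f m"
  by (simp_all add: space_module_def smul_def)

locale gspace_sheaf = gspace G X p t + gsheaf G A
  for G :: "'g groupoid" and X :: "'x topology" and p t and A :: "('g, 'a) sheaf"
begin

definition eqsec :: "('x \<Rightarrow> 'a) \<Rightarrow> bool" where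
  "eqsec \<phi> \<longleftrightarrow> lift X p \<phi> \<and>
     (\<forall>g\<in>arr G. \<forall>y\<in>topspace X. src G g = p y \<longrightarrow> \<phi> (t g y) = act A g (\<phi> y))"

text \<open>Integration of \<open>\<phi>\<close> against \<open>f\<close> along the fibres of the
  anchor. On equivariant families it is inverse to \<open>germ_at\<close>.\<close>

definition ev :: "('x \<Rightarrow> 'a) \<Rightarrow> ('x \<Rightarrow> int) \<Rightarrow> 'g \<Rightarrow> 'a" where
  "ev \<phi> = (\<lambda>f\<in>Zfun X. \<lambda>x\<in>units G. gfinprod (F x) (\<lambda>y. \<phi> y [^]\<^bsub>F x\<^esub> f y) {y \<in> topspace X. p y = x})"

abbreviation HomX where "HomX \<equiv> module_hom G (space_module G X p t) (section_module G A)"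

lemma eqsec_lift: "eqsec \<phi> \<Longrightarrow> lift X p \<phi>"
  by (simp add: eqsec_def)

lemma eqsec_carrier: "eqsec \<phi> \<Longrightarrow> y \<in> topspace X \<Longrightarrow> \<phi> y \<in> carrier (F (p y))"
  by (rule lift_carrier[OF eqsec_lift])

lemma fibrewise_carrier: "lift X p \<phi> \<Longrightarrow> y \<in> {y \<in> topspace X. p y = x} \<Longrightarrow> \<phi> y \<in> carrier (F x)"
  using lift_carrier[of X p \<phi> y] by simp

lemma eqsec_act: "eqsec \<phi> \<Longrightarrow> g \<in> arr G \<Longrightarrow> y \<in> topspace X \<Longrightarrow> src G g = p y \<Longrightarrow> \<phi> (t g y) = act A g (\<phi> y)"
  by (simp add: eqsec_def)

lemma ev_apply: "f \<in> Zfun X \<Longrightarrow> x \<in> units G \<Longrightarrow>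
  ev \<phi> f x = gfinprod (F x) (\<lambda>y. \<phi> y [^]\<^bsub>F x\<^esub> f y) {y \<in> topspace X. p y = x}"
  by (simp add: ev_def)

lemma ev_extensional: "f \<in> Zfun X \<Longrightarrow> ev \<phi> f \<in> extensional (units G)"
  by (simp add: ev_def)

lemma ev_cong:
  assumes "lift X p \<psi>" "\<And>y. y \<in> topspace X \<Longrightarrow> \<phi> y = \<psi> y"
  shows "ev \<phi> = ev \<psi>"
  unfolding ev_def
proof (intro restrict_ext)
  fix f :: "'x \<Rightarrow> int" and x assume x: "x \<in> units G"
  interpret comm_group "F x" using x by (rule fibre_comm_group)
  show "gfinprod (F x) (\<lambda>y. \<phi> y [^]\<^bsub>F x\<^esub> f y) {y \<in> topspace X. p y = x} =
    gfinprod (F x) (\<lambda>y. \<psi> y [^]\<^bsub>F x\<^esub> f y) {y \<in> topspace X. p y = x}"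
  proof (rule gfinprod_cong_on)
    show "(\<lambda>y. \<psi> y [^]\<^bsub>F x\<^esub> f y) \<in> {y \<in> topspace X. p y = x} \<rightarrow> carrier (F x)"
      by (intro Pi_I int_pow_closed fibrewise_carrier[OF assms(1)])
  qed (use assms(2) in auto)
qed

lemma finite_ev_support:
  assumes f: "f \<in> Zfun X" 
  shows "finite {y \<in> {y \<in> topspace X. p y = x}. (u y [^]\<^bsub>F x\<^esub> f y) \<noteq> \<one>\<^bsub>F x\<^esub>}"
proof (rule finite_subset)
  show "finite {y. p y = x \<and> f y \<noteq> 0}" using finite_fibre_support[OF locally_boolean_X f p_local_homeo] .
  show "{y \<in> {y \<in> topspace X. p y = x}. (u y [^]\<^bsub>F x\<^esub> f y) \<noteq> \<one>\<^bsub>F x\<^esub>} \<subseteq> {y. p y = x \<and> f y \<noteq> 0}" by auto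
qed

lemma ev_carrier:
  assumes "lift X p \<phi>" "f \<in> Zfun X" "x \<in> units G"
  shows "ev \<phi> f x \<in> carrier (F x)"
proof -
  interpret comm_group "F x" using assms(3) by (rule fibre_comm_group)
  show ?thesis unfolding ev_apply[OF assms(2,3)]
    by (intro gfinprod_closed Pi_I int_pow_closed fibrewise_carrier[OF assms(1)])
qed

lemma ev_add:
  assumes \<phi>: "lift X p \<phi>" and f: "f \<in> Zfun X" "f' \<in> Zfun X" and x: "x \<in> units G"
  shows "ev \<phi> (\<lambda>y. f y + f' y) x = ev \<phi> f x \<otimes>\<^bsub>F x\<^esub> ev \<phi> f' x"
proof -
  interpret comm_group "F x" using x by (rule fibre_comm_group)
  let ?S = "{y \<in> topspace X. p y = x}"
  have c: "\<phi> y \<in> carrier (F x)" if "y \<in> ?S" for y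
    using that by (rule fibrewise_carrier[OF \<phi>])
  have "gfinprod (F x) (\<lambda>y. \<phi> y [^]\<^bsub>F x\<^esub> (f y + f' y)) ?S =
    gfinprod (F x) (\<lambda>y. \<phi> y [^]\<^bsub>F x\<^esub> f y \<otimes>\<^bsub>F x\<^esub> \<phi> y [^]\<^bsub>F x\<^esub> f' y) ?S"
    using c by (intro gfinprod_cong_on) (auto simp: int_pow_mult)
  also have "\<dots> = gfinprod (F x) (\<lambda>y. \<phi> y [^]\<^bsub>F x\<^esub> f y) ?S \<otimes>\<^bsub>F x\<^esub> gfinprod (F x) (\<lambda>y. \<phi> y [^]\<^bsub>F x\<^esub> f' y) ?S"
    using finite_ev_support[OF f(1)] finite_ev_support[OF f(2)] c by (intro gfinprod_distrib) auto
  finally show ?thesis using f x Zfun_add[OF f] by (simp add: ev_apply)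
qed

lemma ev_hom:
  assumes "lift X p \<phi>" "x \<in> units G"
  shows "(\<lambda>f. ev \<phi> f x) \<in> hom (Zgroup X) (F x)"
  using assms ev_add ev_carrier by (auto simp: hom_def)

lemma ev_uminus:
  assumes "lift X p \<phi>" "f \<in> Zfun X" "x \<in> units G"
  shows "ev \<phi> (\<lambda>y. - f y) x = inv\<^bsub>F x\<^esub> (ev \<phi> f x)"
proof -
  interpret h: group_hom "Zgroup X" "F x" "\<lambda>f. ev \<phi> f x"
    using ev_hom[OF assms(1,3)] fibre_group[OF assms(3)] comm_group.axioms(2)[OF comm_group_Zgroup]
    by (simp add: group_hom_def group_hom_axioms_def)
  show ?thesis using h.hom_inv[of f] assms(2) by (simp add: inv_Zgroup)
qed

lemma ev_zero:
  assumes "lift X p \<phi>" "x \<in> units G"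
  shows "ev \<phi> (\<lambda>y. 0) x = \<one>\<^bsub>F x\<^esub>"
proof -
  interpret h: group_hom "Zgroup X" "F x" "\<lambda>f. ev \<phi> f x"
    using ev_hom[OF assms] fibre_group[OF assms(2)] comm_group.axioms(2)[OF comm_group_Zgroup]
    by (simp add: group_hom_def group_hom_axioms_def)
  show ?thesis using h.hom_one by simp
qed

lemma ev_indicator:
  assumes \<phi>: "lift X p \<phi>" and V: "compact_open X V" "inj_on p V"
  shows "y \<in> V \<Longrightarrow> ev \<phi> (indicator V) (p y) = \<phi> y"
    and "x \<in> units G \<Longrightarrow> x \<notin> p ` V \<Longrightarrow> ev \<phi> (indicator V) x = \<one>\<^bsub>F x\<^esub>"
proof -
  have iV: "indicator V \<in> Zfun X" using V(1) by (rule Zfun_indicator[OF X_Hausdorff])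
  show "ev \<phi> (indicator V) (p y) = \<phi> y" if y: "y \<in> V"
  proof -
    have yX: "y \<in> topspace X" using y V compact_open_subset by blast
    interpret comm_group "F (p y)" using p_units[OF yX] by (rule fibre_comm_group)
    have c: "\<phi> y \<in> carrier (F (p y))" using \<phi> yX by (rule lift_carrier)
    have one: "indicator V y = (1::int)" using y by simp
    have "gfinprod (F (p y)) (\<lambda>z. \<phi> z [^]\<^bsub>F (p y)\<^esub> (indicator V z :: int)) {z \<in> topspace X. p z = p y}
      = (if y \<in> {z \<in> topspace X. p z = p y} then \<phi> y [^]\<^bsub>F (p y)\<^esub> (indicator V y :: int) else \<one>\<^bsub>F (p y)\<^esub>)"
    proof (rule gfinprod_single)
      fix z assume z: "z \<in> {z \<in> topspace X. p z = p y}" "z \<noteq> y"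
      then have "z \<notin> V" using inj_onD[OF V(2) _ _ y] by auto
      then show "\<phi> z [^]\<^bsub>F (p y)\<^esub> (indicator V z :: int) = \<one>\<^bsub>F (p y)\<^esub>" by simp
    qed (use c in auto)
    then show ?thesis using yX c one by (simp add: ev_apply[OF iV] p_units)
  qed
  show "ev \<phi> (indicator V) x = \<one>\<^bsub>F x\<^esub>" if x: "x \<in> units G" "x \<notin> p ` V"
  proof -
    interpret comm_group "F x" using x by (intro fibre_comm_group)
    show ?thesis unfolding ev_apply[OF iV x(1)]
    proof (rule gfinprod_one)
      fix y assume "y \<in> {y \<in> topspace X. p y = x}"
      then have "y \<notin> V" using x by auto
      then show "\<phi> y [^]\<^bsub>F x\<^esub> (indicator V y :: int) = \<one>\<^bsub>F x\<^esub>" by simp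
    qed
  qed
qed

lemma p_image_compact_open: "compact_open X V \<Longrightarrow> compact_open (unit_space G) (p ` V)"
  using p_continuous p_open by (rule compact_open_image)

text \<open>For a small \<open>V\<close> the section is \<open>\<phi>\<close> transported to the
  image of \<open>V\<close> by the inverse of the anchor and extended by zero. The complement of the
  image is open because the image is compact in a Hausdorff space.\<close>

lemma ev_section:
  assumes \<phi>: "lift X p \<phi>" and f: "f \<in> Zfun X"
  shows "ev \<phi> f \<in> compact_sections G A"
  using f
proof (induction rule: X_Zfun_induct)
  case zero
  have "ev \<phi> (\<lambda>y. 0) = (\<lambda>x\<in>units G. \<one>\<^bsub>F x\<^esub>)"
    by (rule extensionalityI[of _ "units G"]) (simp_all add: ev_zero[OF \<phi>] Zfun_zero ev_extensional)
  then show ?case using section_zero_closed by (simp only:)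
next
  case (add f g)
  have "ev \<phi> (\<lambda>y. f y + g y) = (\<lambda>x\<in>units G. ev \<phi> f x \<otimes>\<^bsub>F x\<^esub> ev \<phi> g x)"
    by (rule extensionalityI[of _ "units G"])
      (simp_all add: ev_add[OF \<phi> add(1,2)] Zfun_add[OF add(1,2)] ev_extensional)
  then show ?case using section_add_closed[OF add(3,4)] by (simp only:)
next
  case (uminus f)
  have "ev \<phi> (\<lambda>y. - f y) = (\<lambda>x\<in>units G. inv\<^bsub>F x\<^esub> (ev \<phi> f x))"
    by (rule extensionalityI[of _ "units G"])
      (simp_all add: ev_uminus[OF \<phi> uminus(1)] Zfun_uminus[OF uminus(1)] ev_extensional)
  then show ?case using section_inv_closed[OF uminus(2)] by (simp only:)
next
  case (indicator V)
  have iV: "indicator V \<in> Zfun X" using indicator(1) by (rule Zfun_indicator[OF X_Hausdorff])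
  have pV: "compact_open (unit_space G) (p ` V)" using indicator(1) by (rule p_image_compact_open)
  have oV: "openin X V" using indicator by (simp add: compact_open_def)
  have "lift (unit_space G) (\<lambda>x. x) (ev \<phi> (indicator V))"
  proof (rule lift_local)
    fix x assume x: "x \<in> topspace (unit_space G)"
    show "\<exists>N v. openin (unit_space G) N \<and> x \<in> N \<and> lift (subtopology (unit_space G) N) (\<lambda>x. x) v \<and>
      (\<forall>w\<in>N. ev \<phi> (indicator V) w = v w)"
    proof (cases "x \<in> p ` V")
      case True
      let ?\<sigma> = "the_inv_into V p"
      have c: "continuous_map (subtopology (unit_space G) (p ` V)) X ?\<sigma>"
        using p_local_homeo oV indicator(2) by (rule continuous_map_the_inv_into)
      have l: "lift (subtopology (unit_space G) (p ` V)) (\<lambda>x. p (?\<sigma> x)) (\<lambda>x. \<phi> (?\<sigma> x))"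
        using \<phi> c by (rule lift_compose)
      have r: "p (?\<sigma> y) = y" "?\<sigma> y \<in> V" if "y \<in> p ` V" for y
        using f_the_inv_into_f[OF indicator(2) that] the_inv_into_into[OF indicator(2) that] by auto
      have "\<phi> (?\<sigma> y) \<in> carrier (F y)" if "y \<in> topspace (subtopology (unit_space G) (p ` V))" for y
        using lift_carrier[OF l that] r[of y] that by simp
      moreover have "continuous_map (subtopology (unit_space G) (p ` V)) (unit_space G) (\<lambda>y. y)"
        by (intro continuous_map_from_subtopology) simp
      ultimately have "lift (subtopology (unit_space G) (p ` V)) (\<lambda>x. x) (\<lambda>x. \<phi> (?\<sigma> x))"
        using lift_continuous[OF l] unfolding lift_def by blast
      moreover have "ev \<phi> (indicator V) w = \<phi> (?\<sigma> w)" if "w \<in> p ` V" for w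
        using ev_indicator(1)[OF \<phi> indicator r(2)[OF that]] r(1)[OF that] by simp
      ultimately show ?thesis using True pV unfolding compact_open_def by blast
    next
      case False
      let ?N = "units G - p ` V"
      have "openin (unit_space G) (topspace (unit_space G) - p ` V)"
        using compact_open_closedin[OF Hausdorff_unit_space pV] by blast
      then have "openin (unit_space G) ?N" by simp
      moreover have "lift (subtopology (unit_space G) ?N) (\<lambda>x. x) (\<lambda>x. \<one>\<^bsub>F x\<^esub>)"
        by (intro lift_subtopology lift_one) simp
      ultimately show ?thesis using False x ev_indicator(2)[OF \<phi> indicator]
        by (intro exI[of _ ?N] exI[of _ "\<lambda>x. \<one>\<^bsub>F x\<^esub>"]) auto
    qed
  qed simp
  then have "restrict (ev \<phi> (indicator V)) (units G) \<in> compact_sections G A"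
    using pV ev_indicator(2)[OF \<phi> indicator] by (intro sectionI[of _ "p ` V"]) (auto simp: compact_open_def)
  moreover have "ev \<phi> (indicator V) \<in> extensional (units G)" using iV by (simp add: ev_def)
  ultimately show ?case by (simp only: extensional_restrict)
qed

text \<open>Both sides are biadditive, so the ring element may be a bisection \<open>B\<close> and
  the function a small set \<open>V\<close>. Over the range of \<open>b\<close> in \<open>B\<close>
  both sides are, by equivariance, the image under \<open>b\<close> of the value of
  \<open>\<phi>\<close> at the point of \<open>V\<close> over the source of \<open>b\<close>, and
  neutral if there is no such point.\<close>

lemma ev_smul:
  assumes \<phi>: "eqsec \<phi>" and f: "f \<in> Zfun (arrows G)" and m: "m \<in> Zfun X"
  shows "ev \<phi> (smulX f m) = f \<odot>\<^bsub>section_module G A\<^esub> ev \<phi> m"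
proof (rule extensionalityI[of _ "units G"])
  note l = eqsec_lift[OF \<phi>]
  show "ev \<phi> (smulX f m) \<in> extensional (units G)" using smul_Zfun[OF f m] by (simp add: ev_def)
  show "f \<odot>\<^bsub>section_module G A\<^esub> ev \<phi> m \<in> extensional (units G)" by (rule smult_extensional)
  fix x assume x: "x \<in> units G"
  have g: "group (F x)" using x by (rule fibre_group)
  have sc: "(h \<odot>\<^bsub>section_module G A\<^esub> \<xi>) x \<in> carrier (F x)" if "h \<in> Zfun (arrows G)" "\<xi> \<in> compact_sections G A" for h \<xi>
    using section_carrier[OF smult_closed[OF that] x] .
  have add_apply: "(\<xi> \<oplus>\<^bsub>section_module G A\<^esub> \<eta>) x = \<xi> x \<otimes>\<^bsub>F x\<^esub> \<eta> x" for \<xi> \<eta>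
    using x by (simp add: section_module_simps(3))
  show "ev \<phi> (smulX f m) x = (f \<odot>\<^bsub>section_module G A\<^esub> ev \<phi> m) x"
  proof (rule bisection_hom_eqI[OF f g, where ?F1.0 = "\<lambda>f. ev \<phi> (smulX f m) x" and ?F2.0 = "\<lambda>f. (f \<odot>\<^bsub>section_module G A\<^esub> ev \<phi> m) x"])
    show "(\<lambda>f. ev \<phi> (smulX f m) x) \<in> hom (Zgroup (arrows G)) (F x)"
      using ev_carrier[OF l _ x] ev_add[OF l _ _ x] smul_Zfun m by (auto simp: hom_def smul_add_left)
    show "(\<lambda>f. (f \<odot>\<^bsub>section_module G A\<^esub> ev \<phi> m) x) \<in> hom (Zgroup (arrows G)) (F x)"
      using ev_section[OF l m] sc smult_add_left by (auto simp: hom_def add_apply)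
  next
    fix B assume B: "compact_open_bisection G B"
    then have B': "compact_open (arrows G) B" "inj_on (rng G) B" "inj_on (src G) B" "B \<subseteq> arr G"
      by (auto simp: compact_open_bisection_def dest: compact_open_subset)
    note iB = indicator_bisection[OF B]
    show "ev \<phi> (smulX (indicator B) m) x = (indicator B \<odot>\<^bsub>section_module G A\<^esub> ev \<phi> m) x"
    proof (rule X_hom_eqI[OF m g, where ?F1.0 = "\<lambda>m. ev \<phi> (smulX (indicator B) m) x" and ?F2.0 = "\<lambda>m. (indicator B \<odot>\<^bsub>section_module G A\<^esub> ev \<phi> m) x"])
      show "(\<lambda>m. ev \<phi> (smulX (indicator B) m) x) \<in> hom (Zgroup X) (F x)"
        using ev_carrier[OF l _ x] ev_add[OF l _ _ x] smul_Zfun[OF iB] by (auto simp: hom_def smul_add_right[OF iB])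
      have eva: "ev \<phi> (\<lambda>y. a y + b y) = ev \<phi> a \<oplus>\<^bsub>section_module G A\<^esub> ev \<phi> b" if "a \<in> Zfun X" "b \<in> Zfun X" for a b
        unfolding section_module_simps(3) using ev_add[OF l that] Zfun_add[OF that]
        by (intro extensionalityI[of _ "units G"]) (simp_all add: ev_extensional)
      show "(\<lambda>m. (indicator B \<odot>\<^bsub>section_module G A\<^esub> ev \<phi> m) x) \<in> hom (Zgroup X) (F x)"
        using ev_section[OF l] sc[OF iB] smult_add_right[OF iB] by (auto simp: hom_def add_apply eva)
      fix V assume V: "compact_open X V" "inj_on p V"
      have VX: "V \<subseteq> topspace X" using V compact_open_subset by blast
      have BV: "compact_open X (bis_act B V)" "inj_on p (bis_act B V)"
        using compact_open_bis_act[OF B'(1,2) V(1)] inj_on_bis_act[OF B'(4,2) VX V(2)] by auto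
      have iV: "indicator V \<in> Zfun X" using V(1) by (rule Zfun_indicator[OF X_Hausdorff])
      note es = ev_section[OF l iV]
      have "ev \<phi> (indicator (bis_act B V)) x = (indicator B \<odot>\<^bsub>section_module G A\<^esub> ev \<phi> (indicator V)) x"
      proof (cases "x \<in> rng G ` B")
        case True
        then obtain b where b: "b \<in> B" "x = rng G b" by auto
        have bG: "b \<in> arr G" using b B' by blast
        have R: "(indicator B \<odot>\<^bsub>section_module G A\<^esub> ev \<phi> (indicator V)) x = act A b (ev \<phi> (indicator V) (src G b))"
          using smult_bisection(1)[OF B es b(1)] b by simp
        show ?thesis
        proof (cases "src G b \<in> p ` V")
          case True
          then obtain v where v: "v \<in> V" "src G b = p v" by auto
          then have tb: "t b v \<in> bis_act B V" using b by (auto simp: bis_act_def)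
          have pt: "p (t b v) = x" using p_t[OF bG] v VX b by auto
          have "ev \<phi> (indicator (bis_act B V)) x = \<phi> (t b v)"
            using ev_indicator(1)[OF l BV tb] pt by simp
          also have "\<dots> = act A b (\<phi> v)" using eqsec_act[OF \<phi> bG] v VX by auto
          also have "\<phi> v = ev \<phi> (indicator V) (src G b)" using ev_indicator(1)[OF l V v(1)] v by simp
          finally show ?thesis using R by simp
        next
          case False
          interpret h: group_hom "F (src G b)" "F (rng G b)" "act A b" using bG by (rule act_group_hom)
          have "x \<notin> p ` bis_act B V"
          proof
            assume "x \<in> p ` bis_act B V"
            then obtain g v where gv: "g \<in> B" "v \<in> V" "src G g = p v" "x = p (t g v)" by (auto simp: bis_act_def)
            have "g \<in> arr G" "v \<in> topspace X" using gv B' VX by auto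
            then have "rng G g = rng G b" using p_t[of g v] gv b by simp
            then have "g = b" using inj_onD[OF B'(2) _ gv(1) b(1)] by simp
            then show False using False gv by auto
          qed
          then show ?thesis using R ev_indicator(2)[OF l BV x] ev_indicator(2)[OF l V _ False] src_units[OF bG] b
            by simp
        qed
      next
        case False
        then have "x \<notin> p ` bis_act B V" using bis_act_anchor[OF B'(4) VX] by blast
        then show ?thesis using False ev_indicator(2)[OF l BV x] smult_bisection(2)[OF B es x] by simp
      qed
      then show "ev \<phi> (smulX (indicator B) (indicator V)) x = (indicator B \<odot>\<^bsub>section_module G A\<^esub> ev \<phi> (indicator V)) x"
        by (simp add: smul_indicator[OF B'(4,2) VX])
    qed
  qed
qed

lemma ev_HomX:
  assumes "eqsec \<phi>"
  shows "ev \<phi> \<in> HomX"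
proof (rule module_homI; unfold space_module_simps section_module_simps(1))
  note l = eqsec_lift[OF assms]
  show "ev \<phi> \<in> extensional (Zfun X)" by (simp add: ev_def)
  show "ev \<phi> a \<in> compact_sections G A" if "a \<in> Zfun X" for a using l that by (rule ev_section)
  show "ev \<phi> (smulX f a) = f \<odot>\<^bsub>section_module G A\<^esub> ev \<phi> a" if "f \<in> Zfun (arrows G)" "a \<in> Zfun X" for f a
    using assms that by (rule ev_smul)
  show "ev \<phi> (\<lambda>y. a y + b y) = ev \<phi> a \<oplus>\<^bsub>section_module G A\<^esub> ev \<phi> b" if "a \<in> Zfun X" "b \<in> Zfun X" for a b
    unfolding section_module_simps(3) using ev_add[OF l that] Zfun_add[OF that]
    by (intro extensionalityI[of _ "units G"]) (simp_all add: ev_extensional)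
qed

text \<open>For a module homomorphism the choice of the small neighbourhood is immaterial, by
  \<open>germ_at_eq\<close>.\<close>

definition germ_at :: "(('x \<Rightarrow> int) \<Rightarrow> 'g \<Rightarrow> 'a) \<Rightarrow> 'x \<Rightarrow> 'a" where
  "germ_at h y = h (indicator (SOME V. compact_open X V \<and> y \<in> V \<and> inj_on p V)) (p y)"

lemma HomX_section: "h \<in> HomX \<Longrightarrow> f \<in> Zfun X \<Longrightarrow> h f \<in> compact_sections G A"
  using module_homD(1)[of h G "space_module G X p t" "section_module G A" f]
  by (simp add: space_module_simps section_module_simps(1))

lemma HomX_smul: "h \<in> HomX \<Longrightarrow> f \<in> Zfun (arrows G) \<Longrightarrow> m \<in> Zfun X \<Longrightarrow> h (smulX f m) = f \<odot>\<^bsub>section_module G A\<^esub> h m"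
  using module_homD(4)[of h G "space_module G X p t" "section_module G A" f m] by (simp add: space_module_simps)

lemma HomX_hom: "h \<in> HomX \<Longrightarrow> x \<in> units G \<Longrightarrow> (\<lambda>f. h f x) \<in> hom (Zgroup X) (F x)"
  using module_homD(3)[of h G "space_module G X p t" "section_module G A"] HomX_section[THEN section_carrier]
  by (auto simp: hom_def space_module_simps section_module_simps(3))

text \<open>Units act trivially, so multiplying by the units below \<open>W\<close> cuts
  \<open>V\<close> down to the part lying over them, which is \<open>W\<close> by injectivity of the
  anchor.\<close>

lemma bis_act_units:
  assumes V: "V \<subseteq> topspace X" "inj_on p V" and W: "W \<subseteq> V"
  shows "bis_act (p ` W) V = W"
proof (intro equalityI subsetI)
  fix z assume "z \<in> bis_act (p ` W) V"
  then obtain w v where z: "z = t (p w) v" "w \<in> W" "v \<in> V" "src G (p w) = p v" by (auto simp: bis_act_def)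
  have "p w \<in> units G" using z V W p_units by blast
  then have "p w = p v" using z src_unit by simp
  then have "w = v" using inj_onD[OF V(2)] z W by blast
  then show "z \<in> W" using z t_unit V by auto
next
  fix w assume w: "w \<in> W"
  then have "w = t (p w) w" "src G (p w) = p w" using t_unit V W src_unit p_units by (auto simp: subset_iff)
  then show "w \<in> bis_act (p ` W) V" using w W unfolding bis_act_def by blast
qed

text \<open>Restricting a test function amounts to multiplying it by the indicator of a set of
  units, hence commutes with \<open>h\<close>. This is the locality of module homomorphisms.\<close>

lemma HomX_indicator_restrict:
  assumes h: "h \<in> HomX" and V: "compact_open X V" "inj_on p V" and W: "compact_open X W" "W \<subseteq> V"
  shows "h (indicator W) = indicator (p ` W) \<odot>\<^bsub>section_module G A\<^esub> h (indicator V)"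
proof -
  have VX: "V \<subseteq> topspace X" using V compact_open_subset by blast
  have pW: "compact_open_bisection G (p ` W)" using W(1) by (intro units_bisection p_image_compact_open)
  have "smulX (indicator (p ` W)) (indicator V) = indicator W"
    using smul_indicator[of "p ` W" V] pW VX bis_act_units[OF VX V(2) W(2)]
    by (simp add: compact_open_bisection_def compact_open_subset)
  then show ?thesis
    using HomX_smul[OF h indicator_bisection[OF pW] Zfun_indicator[OF X_Hausdorff V(1)]] by simp
qed

lemma smult_units:
  assumes U: "compact_open (unit_space G) U" and \<xi>: "\<xi> \<in> compact_sections G A" and x: "x \<in> units G"
  shows "(indicator U \<odot>\<^bsub>section_module G A\<^esub> \<xi>) x = (if x \<in> U then \<xi> x else \<one>\<^bsub>F x\<^esub>)"
proof -
  have B: "compact_open_bisection G U" using U by (rule units_bisection)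
  have U': "U \<subseteq> units G" using U compact_open_unit_space by blast
  show ?thesis
  proof (cases "x \<in> U")
    case True
    then show ?thesis using smult_bisection(1)[OF B \<xi> True] x
      by (simp add: rng_unit src_unit act_unit section_carrier[OF \<xi>])
  next
    case False
    then have "x \<notin> rng G ` U" using U' rng_unit by (auto simp: subset_iff)
    then show ?thesis using smult_bisection(2)[OF B \<xi> x] False by simp
  qed
qed

text \<open>Two small neighbourhoods are compared with their intersection: passing to it multiplies
  the section by an indicator that is 1 at \<open>p y\<close>.\<close>

lemma germ_at_eq:
  assumes h: "h \<in> HomX" and V: "compact_open X V" "inj_on p V" "y \<in> V"
  shows "germ_at h y = h (indicator V) (p y)"
proof -
  let ?V' = "SOME V. compact_open X V \<and> y \<in> V \<and> inj_on p V"
  have V': "compact_open X ?V' \<and> y \<in> ?V' \<and> inj_on p ?V'" by (rule someI[of _ V]) (use V in auto)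
  have yX: "y \<in> topspace X" using V compact_open_subset by blast
  have W: "compact_open X (V \<inter> ?V')" using V V' X_Hausdorff by (intro compact_open_Int) auto
  have *: "h (indicator (V \<inter> ?V')) (p y) = h (indicator U) (p y)"
    if U: "compact_open X U" "inj_on p U" "y \<in> U" "V \<inter> ?V' \<subseteq> U" for U
    using HomX_indicator_restrict[OF h U(1,2) W U(4)]
      smult_units[OF p_image_compact_open[OF W] HomX_section[OF h Zfun_indicator[OF X_Hausdorff U(1)]] p_units[OF yX]] V V'
    by auto
  show ?thesis unfolding germ_at_def using *[of V] *[of ?V'] V V' by auto
qed

text \<open>Near \<open>y\<close> one neighbourhood \<open>V\<close> serves all points, so the germs
  are a single section composed with the anchor. Equivariance is linearity of \<open>h\<close> for a
  bisection through \<open>g\<close>, whose product with \<open>V\<close> is a small neighbourhood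
  of the translate.\<close>

lemma germ_at_eqsec:
  assumes h: "h \<in> HomX"
  shows "eqsec (germ_at h)"
  unfolding eqsec_def
proof (intro conjI ballI impI)
  show "lift X p (germ_at h)"
  proof (rule lift_local[OF p_continuous])
    fix y assume "y \<in> topspace X"
    then obtain V where V: "compact_open X V" "y \<in> V" "inj_on p V" using small_nbhd[of "topspace X" y] by auto
    have "lift X (\<lambda>y. p y) (\<lambda>y. h (indicator V) (p y))"
      by (rule lift_compose[OF section_lift[OF HomX_section[OF h Zfun_indicator[OF X_Hausdorff V(1)]]] p_continuous])
    then show "\<exists>N v. openin X N \<and> y \<in> N \<and> lift (subtopology X N) p v \<and> (\<forall>w\<in>N. germ_at h w = v w)"
      using germ_at_eq[OF h V(1,3)] V lift_subtopology unfolding compact_open_def by blast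
  qed
next
  fix g y assume g: "g \<in> arr G" and y: "y \<in> topspace X" and gy: "src G g = p y"
  obtain V where V: "compact_open X V" "y \<in> V" "inj_on p V" using small_nbhd[of "topspace X" y] y by auto
  obtain B where B: "compact_open_bisection G B" "g \<in> B" using bisection_nbhd[of "arr G" g] g by auto
  then have B': "compact_open (arrows G) B" "inj_on (rng G) B" "B \<subseteq> arr G"
    by (auto simp: compact_open_bisection_def dest: compact_open_subset)
  have VX: "V \<subseteq> topspace X" using V compact_open_subset by blast
  have BV: "compact_open X (bis_act B V)" "inj_on p (bis_act B V)" "t g y \<in> bis_act B V"
    using compact_open_bis_act[OF B'(1,2) V(1)] inj_on_bis_act[OF B'(3,2) VX V(3)] B V gy by (auto simp: bis_act_def)
  have iV: "indicator V \<in> Zfun X" using V(1) by (rule Zfun_indicator[OF X_Hausdorff])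
  have "germ_at h (t g y) = h (indicator (bis_act B V)) (rng G g)"
    using germ_at_eq[OF h BV] p_t[OF g y gy] by simp
  also have "indicator (bis_act B V) = smulX (indicator B) (indicator V)"
    using smul_indicator[OF B'(3,2) VX] by simp
  also have "h \<dots> = indicator B \<odot>\<^bsub>section_module G A\<^esub> h (indicator V)"
    using HomX_smul[OF h indicator_bisection[OF B(1)] iV] .
  also have "\<dots> (rng G g) = act A g (h (indicator V) (src G g))"
    using smult_bisection(1)[OF B(1) HomX_section[OF h iV] B(2)] .
  also have "\<dots> = act A g (germ_at h y)" using germ_at_eq[OF h V(1,3,2)] gy by simp
  finally show "germ_at h (t g y) = act A g (germ_at h y)" .
qed

text \<open>It suffices to test indicators of small sets \<open>V\<close>. Off the image of
  \<open>V\<close> the section \<open>h (indicator V)\<close> vanishes by locality, and below a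
  point of \<open>V\<close> its value is the germ there.\<close>

lemma ev_germ_at:
  assumes h: "h \<in> HomX"
  shows "ev (germ_at h) = h"
proof (rule module_hom_eqI[OF ev_HomX[OF germ_at_eqsec[OF h]] h], unfold space_module_simps)
  note l = eqsec_lift[OF germ_at_eqsec[OF h]]
  fix f assume f: "f \<in> Zfun X"
  show "ev (germ_at h) f = h f"
  proof (rule section_eqI[OF ev_section[OF l f] HomX_section[OF h f]])
    fix x assume x: "x \<in> units G"
    show "ev (germ_at h) f x = h f x"
    proof (rule X_hom_eqI[OF f fibre_group[OF x] ev_hom[OF l x] HomX_hom[OF h x]])
      fix V assume V: "compact_open X V" "inj_on p V"
      show "ev (germ_at h) (indicator V) x = h (indicator V) x"
      proof (cases "x \<in> p ` V")
        case True
        then obtain y where "y \<in> V" "x = p y" by auto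
        then show ?thesis using ev_indicator(1)[OF l V] germ_at_eq[OF h V] by simp
      next
        case False
        have "h (indicator V) = indicator (p ` V) \<odot>\<^bsub>section_module G A\<^esub> h (indicator V)"
          using HomX_indicator_restrict[OF h V V(1)] by simp
        then have "h (indicator V) x = \<one>\<^bsub>F x\<^esub>"
          using smult_units[OF p_image_compact_open[OF V(1)] HomX_section[OF h Zfun_indicator[OF X_Hausdorff V(1)]] x] False
          by simp
        then show ?thesis using ev_indicator(2)[OF l V x False] by simp
      qed
    qed
  qed
qed

lemma germ_at_ev:
  assumes "eqsec \<phi>" "y \<in> topspace X"
  shows "germ_at (ev \<phi>) y = \<phi> y"
proof -
  obtain V where V: "compact_open X V" "y \<in> V" "inj_on p V" using small_nbhd[of "topspace X" y] assms by auto
  then show ?thesis using germ_at_eq[OF ev_HomX[OF assms(1)] V(1,3,2)] ev_indicator(1)[OF eqsec_lift[OF assms(1)] V(1,3,2)] by simp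
qed

lemma HomX_eqI:
  assumes "h \<in> HomX" "h' \<in> HomX" "\<And>y. y \<in> topspace X \<Longrightarrow> germ_at h y = germ_at h' y"
  shows "h = h'"
proof -
  have "h = ev (germ_at h)" using ev_germ_at[OF assms(1)] by (rule sym)
  also have "\<dots> = ev (germ_at h')" by (rule ev_cong[OF eqsec_lift[OF germ_at_eqsec[OF assms(2)]] assms(3)])
  also have "\<dots> = h'" using assms(2) by (rule ev_germ_at)
  finally show ?thesis .
qed

end

section \<open>Cochains as equivariant sections over nerves\<close>

lemma hom_finprod:
  assumes G: "comm_group G" and H: "comm_group H" and h: "h \<in> hom G H" and f: "f \<in> I \<rightarrow> carrier G"
  shows "h (finprod G f I) = finprod H (\<lambda>i. h (f i)) I"
proof -
  interpret G: comm_group G by (rule G)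
  interpret H: comm_group H by (rule H)
  interpret h: group_hom G H h using h by (simp add: group_hom_def group_hom_axioms_def G.is_group H.is_group)
  show ?thesis using f
  proof (induction I rule: infinite_finite_induct)
    case (insert i I)
    then have "(\<lambda>i. h (f i)) \<in> I \<rightarrow> carrier H" using h.hom_closed by blast
    then show ?case using insert by simp
  qed simp_all
qed

text \<open>Injectivity makes both families nontrivial at the same indices. Otherwise a family with
  infinitely many nontrivial terms, whose product is 1 by default, could be mapped to one of finite
  support with a different product.\<close>

lemma inj_hom_gfinprod:
  assumes G: "comm_group G" and H: "comm_group H" and h: "h \<in> hom G H" "inj_on h (carrier G)"
    and f: "f \<in> I \<rightarrow> carrier G"
  shows "h (gfinprod G f I) = gfinprod H (\<lambda>i. h (f i)) I"
proof -
  interpret G: comm_group G by (rule G)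
  interpret H: comm_group H by (rule H)
  interpret h: group_hom G H h using h by (simp add: group_hom_def group_hom_axioms_def G.is_group H.is_group)
  have "f i \<noteq> \<one>\<^bsub>G\<^esub> \<longleftrightarrow> h (f i) \<noteq> \<one>\<^bsub>H\<^esub>" if "i \<in> I" for i
    using inj_onD[OF h(2), of "f i" "\<one>\<^bsub>G\<^esub>"] f that h.hom_one by auto
  then have "{i \<in> I. f i \<noteq> \<one>\<^bsub>G\<^esub>} = {i \<in> I. h (f i) \<noteq> \<one>\<^bsub>H\<^esub>}" by auto
  moreover have "h (finprod G f J) = finprod H (\<lambda>i. h (f i)) J" if "J \<subseteq> I" for J
    using f that by (intro hom_finprod[OF G H h(1)]) auto
  ultimately show ?thesis by (simp add: gfinprod_def h.hom_one)
qed

lemma Zgroup_int_pow: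
  assumes "f \<in> Zfun X"
  shows "f [^]\<^bsub>Zgroup X\<^esub> (k::int) = (\<lambda>x. k * f x)"
proof -
  have nat: "f [^]\<^bsub>Zgroup X\<^esub> (n::nat) = (\<lambda>x. int n * f x)" for n
    by (induction n) (simp_all add: algebra_simps)
  show ?thesis
  proof (cases "k < 0")
    case True
    then have "f [^]\<^bsub>Zgroup X\<^esub> k = inv\<^bsub>Zgroup X\<^esub> (\<lambda>x. int (nat (- k)) * f x)"
      by (simp only: int_pow_def2 nat if_True)
    also have "\<dots> = (\<lambda>x. - (int (nat (- k)) * f x))" by (rule inv_Zgroup[OF Zfun_cmult[OF assms]])
    finally show ?thesis using True by simp
  next
    case False
    then have "f [^]\<^bsub>Zgroup X\<^esub> k = (\<lambda>x. int (nat k) * f x)" by (simp only: int_pow_def2 nat if_False)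
    then show ?thesis using False by simp
  qed
qed

lemma Zgroup_hom_lincomb:
  assumes K: "comm_group K" and F: "F \<in> hom (Zgroup X) K" and f: "\<And>i. i \<in> I \<Longrightarrow> f i \<in> Zfun X" and I: "finite I"
  shows "F (\<lambda>x. \<Sum>i\<in>I. k i * f i x) = finprod K (\<lambda>i. F (f i) [^]\<^bsub>K\<^esub> (k i :: int)) I"
proof -
  interpret K: comm_group K by (rule K)
  interpret F: group_hom "Zgroup X" K F
    using F comm_group.axioms(2)[OF comm_group_Zgroup] by (simp add: group_hom_def group_hom_axioms_def K.is_group)
  have pow: "F (\<lambda>x. k i * f i x) = F (f i) [^]\<^bsub>K\<^esub> k i" if "i \<in> I" for i
    using F.hom_int_pow[of "f i" "k i"] Zgroup_int_pow[OF f[OF that]] f[OF that] by simp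
  show ?thesis using I f pow
  proof (induction I rule: finite_induct)
    case empty
    then show ?case using F.hom_one by simp
  next
    case (insert i I)
    have c: "F (f j) \<in> carrier K" if "j \<in> insert i I" for j using insert.prems(1)[OF that] F.hom_closed by simp
    have z: "(\<lambda>x. k j * f j x) \<in> Zfun X" if "j \<in> insert i I" for j using insert.prems(1)[OF that] by (rule Zfun_cmult)
    have "(\<lambda>x. \<Sum>i\<in>I. k i * f i x) \<in> Zfun X" using z by (intro Zfun_sum) auto
    then have "F (\<lambda>x. \<Sum>i\<in>insert i I. k i * f i x) = F (\<lambda>x. k i * f i x) \<otimes>\<^bsub>K\<^esub> F (\<lambda>x. \<Sum>i\<in>I. k i * f i x)"
      using F.hom_mult[of "\<lambda>x. k i * f i x" "\<lambda>x. \<Sum>i\<in>I. k i * f i x"] z insert.hyps by simp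
    also have "\<dots> = F (f i) [^]\<^bsub>K\<^esub> k i \<otimes>\<^bsub>K\<^esub> finprod K (\<lambda>i. F (f i) [^]\<^bsub>K\<^esub> k i) I"
      using insert.IH insert.prems by simp
    also have "\<dots> = finprod K (\<lambda>i. F (f i) [^]\<^bsub>K\<^esub> k i) (insert i I)"
      using insert.hyps c by (intro K.finprod_insert[symmetric] Pi_I K.int_pow_closed) auto
    finally show ?case .
  qed
qed

context gsheaf
begin

section \<open>Germs of cochains\<close>

lemma gspace_sheaf_nerve: "gspace_sheaf G (nerve G (Suc n)) (anchor G) (translate G) A"
  by (intro gspace_sheaf.intro gspace_nerve gsheaf_axioms)

text \<open>Degree \<open>n\<close> refers to tuples of length \<open>n + 1\<close>. The degree is
  an argument and the sheaf comes from the locale, so that cochains of two groupoids can be compared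
  in all degrees at once.\<close>

definition ngerm :: "nat \<Rightarrow> (((nat \<Rightarrow> 'g) \<Rightarrow> int) \<Rightarrow> 'g \<Rightarrow> 'a) \<Rightarrow> (nat \<Rightarrow> 'g) \<Rightarrow> 'a" where
  "ngerm n = gspace_sheaf.germ_at (nerve G (Suc n)) (anchor G)"

definition nev :: "nat \<Rightarrow> ((nat \<Rightarrow> 'g) \<Rightarrow> 'a) \<Rightarrow> ((nat \<Rightarrow> 'g) \<Rightarrow> int) \<Rightarrow> 'g \<Rightarrow> 'a" where
  "nev n = gspace_sheaf.ev G (nerve G (Suc n)) (anchor G) A"

definition neqsec :: "nat \<Rightarrow> ((nat \<Rightarrow> 'g) \<Rightarrow> 'a) \<Rightarrow> bool" where
  "neqsec n \<phi> \<longleftrightarrow> lift (nerve G (Suc n)) (anchor G) \<phi> \<and>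
     (\<forall>g\<in>arr G. \<forall>y\<in>topspace (nerve G (Suc n)). src G g = anchor G y \<longrightarrow> \<phi> (translate G g y) = act A g (\<phi> y))"

abbreviation NHom where "NHom n \<equiv> carrier (cochains G (section_module G A) n)"

lemma NHom_HomX: "NHom n = module_hom G (space_module G (nerve G (Suc n)) (anchor G) (translate G)) (section_module G A)"
  by (simp add: cochains_simps nerve_module_space)

lemma neqsec_eqsec: "neqsec n = gspace_sheaf.eqsec G (nerve G (Suc n)) (anchor G) (translate G) A"
  by (rule ext) (simp add: neqsec_def gspace_sheaf.eqsec_def[OF gspace_sheaf_nerve])

lemma neqsec_carrier: "neqsec n \<phi> \<Longrightarrow> y \<in> topspace (nerve G (Suc n)) \<Longrightarrow> \<phi> y \<in> carrier (F (anchor G y))"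
  unfolding neqsec_eqsec by (rule gspace_sheaf.eqsec_carrier[OF gspace_sheaf_nerve])

lemma ngerm_neqsec: "h \<in> NHom n \<Longrightarrow> neqsec n (ngerm n h)"
  unfolding neqsec_eqsec ngerm_def NHom_HomX by (rule gspace_sheaf.germ_at_eqsec[OF gspace_sheaf_nerve])

lemma ngerm_carrier: "h \<in> NHom n \<Longrightarrow> y \<in> topspace (nerve G (Suc n)) \<Longrightarrow> ngerm n h y \<in> carrier (F (anchor G y))"
  by (rule neqsec_carrier[OF ngerm_neqsec])

lemma nev_NHom: "neqsec n \<phi> \<Longrightarrow> nev n \<phi> \<in> NHom n"
  unfolding neqsec_eqsec nev_def NHom_HomX by (rule gspace_sheaf.ev_HomX[OF gspace_sheaf_nerve])

lemma ngerm_nev: "neqsec n \<phi> \<Longrightarrow> y \<in> topspace (nerve G (Suc n)) \<Longrightarrow> ngerm n (nev n \<phi>) y = \<phi> y"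
  unfolding ngerm_def nev_def neqsec_eqsec by (rule gspace_sheaf.germ_at_ev[OF gspace_sheaf_nerve])

lemma NHom_eqI:
  "h \<in> NHom n \<Longrightarrow> h' \<in> NHom n \<Longrightarrow> (\<And>y. y \<in> topspace (nerve G (Suc n)) \<Longrightarrow> ngerm n h y = ngerm n h' y) \<Longrightarrow> h = h'"
  unfolding ngerm_def NHom_HomX by (rule gspace_sheaf.HomX_eqI[OF gspace_sheaf_nerve])

lemma ngerm_eq:
  "h \<in> NHom n \<Longrightarrow> compact_open (nerve G (Suc n)) V \<Longrightarrow> inj_on (anchor G) V \<Longrightarrow> y \<in> V \<Longrightarrow>
    ngerm n h y = h (indicator V) (anchor G y)"
  unfolding ngerm_def NHom_HomX by (rule gspace_sheaf.germ_at_eq[OF gspace_sheaf_nerve])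

lemma NHom_hom: "h \<in> NHom n \<Longrightarrow> x \<in> units G \<Longrightarrow> (\<lambda>f. h f x) \<in> hom (Zgroup (nerve G (Suc n))) (F x)"
  unfolding NHom_HomX by (rule gspace_sheaf.HomX_hom[OF gspace_sheaf_nerve])

lemma nev_eq:
  "nev n \<phi> = (\<lambda>f\<in>Zfun (nerve G (Suc n)). \<lambda>x\<in>units G.
    gfinprod (F x) (\<lambda>y. \<phi> y [^]\<^bsub>F x\<^esub> f y) {y \<in> topspace (nerve G (Suc n)). anchor G y = x})"
  unfolding nev_def by (rule gspace_sheaf.ev_def[OF gspace_sheaf_nerve])

lemma nerve_small_nbhd:
  assumes "y \<in> topspace (nerve G (Suc n))"
  obtains V where "compact_open (nerve G (Suc n)) V" "y \<in> V" "inj_on (anchor G) V"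
proof -
  interpret gspace_sheaf G "nerve G (Suc n)" "anchor G" "translate G" A by (rule gspace_sheaf_nerve)
  show ?thesis using small_nbhd[of "topspace (nerve G (Suc n))" y] assms that by auto
qed

lemma anchor_units: "y \<in> topspace (nerve G (Suc n)) \<Longrightarrow> anchor G y \<in> units G"
  by (simp add: anchor_def rng_units nerve_arr)

lemma comm_group_NHom: "comm_group (cochains G (section_module G A) n)"
  using smodule_section by (rule comm_group_cochains)

lemma ngerm_mult:
  assumes h: "h \<in> NHom n" "h' \<in> NHom n" and y: "y \<in> topspace (nerve G (Suc n))"
  shows "ngerm n (h \<otimes>\<^bsub>cochains G (section_module G A) n\<^esub> h') y = ngerm n h y \<otimes>\<^bsub>F (anchor G y)\<^esub> ngerm n h' y"
proof -
  interpret C: comm_group "cochains G (section_module G A) n" by (rule comm_group_NHom)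
  obtain V where V: "compact_open (nerve G (Suc n)) V" "y \<in> V" "inj_on (anchor G) V" using nerve_small_nbhd[OF y] .
  note [simp] = ngerm_eq[OF _ V(1,3,2)]
  show ?thesis using h y anchor_units[OF y] Zfun_indicator[OF Hausdorff_nerve V(1)]
    by (simp add: C.m_closed) (simp add: cochains_simps section_module_simps(3))
qed

lemma ngerm_inv:
  assumes h: "h \<in> NHom n" and y: "y \<in> topspace (nerve G (Suc n))"
  shows "ngerm n (inv\<^bsub>cochains G (section_module G A) n\<^esub> h) y = inv\<^bsub>F (anchor G y)\<^esub> (ngerm n h y)"
proof -
  interpret C: comm_group "cochains G (section_module G A) n" by (rule comm_group_NHom)
  interpret group "F (anchor G y)" using anchor_units[OF y] by (rule fibre_group)
  have "(\<lambda>h. ngerm n h y) \<in> hom (cochains G (section_module G A) n) (F (anchor G y))"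
    using ngerm_mult[OF _ _ y] ngerm_carrier[OF _ y] by (auto simp: hom_def)
  then interpret group_hom "cochains G (section_module G A) n" "F (anchor G y)" "\<lambda>h. ngerm n h y"
    by (simp add: group_hom_def group_hom_axioms_def C.is_group is_group)
  show ?thesis using hom_inv[OF h] .
qed

text \<open>Evaluation on a small \<open>V\<close> turns the pushforwards into indicators of the
  faces of \<open>V\<close>, which are small neighbourhoods of the faces of \<open>y\<close>. All
  faces share the anchor of \<open>y\<close>, so the alternating sum takes place in a single
  fibre.\<close>

lemma ngerm_coboundary:
  assumes h: "h \<in> NHom n" and y: "y \<in> topspace (nerve G (Suc (Suc n)))"
  shows "ngerm (Suc n) (coboundary_map G n h) y =
    finprod (F (anchor G y)) (\<lambda>i. ngerm n h (face G (Suc n) i y) [^]\<^bsub>F (anchor G y)\<^esub> ((-1) ^ i :: int)) {..Suc n}"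
proof -
  obtain V where V: "compact_open (nerve G (Suc (Suc n))) V" "y \<in> V" "inj_on (anchor G) V" using nerve_small_nbhd[OF y] .
  have dh: "coboundary_map G n h \<in> NHom (Suc n)" using h coboundary_map_closed by (simp add: cochains_simps)
  let ?x = "anchor G y"
  have x: "?x \<in> units G" using y by (rule anchor_units)
  interpret comm_group "F ?x" using x by (rule fibre_comm_group)
  note bi = boundary_indicator[OF V(1,3)]
  have "ngerm (Suc n) (coboundary_map G n h) y = coboundary_map G n h (indicator V) ?x"
    using dh V(1,3,2) by (rule ngerm_eq)
  also have "\<dots> = h (\<lambda>z. \<Sum>i\<in>{..Suc n}. (-1) ^ i * indicator (face G (Suc n) i ` V) z) ?x"
    using Zfun_indicator[OF Hausdorff_nerve V(1)] by (simp only: coboundary_map_apply restrict_apply if_True bi(1))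
  also have "\<dots> = finprod (F ?x) (\<lambda>i. h (indicator (face G (Suc n) i ` V)) ?x [^]\<^bsub>F ?x\<^esub> ((-1) ^ i :: int)) {..Suc n}"
    using bi(2) Zfun_indicator[OF Hausdorff_nerve]
    by (intro Zgroup_hom_lincomb[OF fibre_comm_group[OF x] NHom_hom[OF h x]]) auto
  also have "\<dots> = finprod (F ?x) (\<lambda>i. ngerm n h (face G (Suc n) i y) [^]\<^bsub>F ?x\<^esub> ((-1) ^ i :: int)) {..Suc n}"
  proof (rule finprod_cong')
    show "(\<lambda>i. ngerm n h (face G (Suc n) i y) [^]\<^bsub>F ?x\<^esub> ((-1) ^ i :: int)) \<in> {..Suc n} \<rightarrow> carrier (F ?x)"
    proof (intro Pi_I int_pow_closed)
      fix i assume "i \<in> {..Suc n}"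
      then show "ngerm n h (face G (Suc n) i y) \<in> carrier (F ?x)"
        using ngerm_carrier[OF h face_nerve[OF y]] anchor_face[OF y] by simp
    qed
    fix i assume "i \<in> {..Suc n}"
    then have i: "i \<le> Suc n" by simp
    have "ngerm n h (face G (Suc n) i y) = h (indicator (face G (Suc n) i ` V)) (anchor G (face G (Suc n) i y))"
      using V(2) by (intro ngerm_eq[OF h bi(2)[OF i] bi(3)[OF i]]) simp
    then show "h (indicator (face G (Suc n) i ` V)) ?x [^]\<^bsub>F ?x\<^esub> ((-1) ^ i :: int) =
        ngerm n h (face G (Suc n) i y) [^]\<^bsub>F ?x\<^esub> ((-1) ^ i :: int)"
      using anchor_face[OF y i] by simp
  qed simp
  finally show ?thesis .
qed

end

text \<open>
  A continuous functor \<open>\<rho>\<close> together with compatible isomorphisms \<open>\<kappa> x\<close> from the fibres of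
  the pullback of the second sheaf to those of the first. This covers both \<open>\<pi>\<close> and the shift,
  the latter with the identification of the pulled back sheaf.
\<close>

locale sheaf_pullback = S1: gsheaf G1 A1 + S2: gsheaf G2 A2
  for G1 :: "'g groupoid" and A1 :: "('g, 'a) sheaf" and G2 :: "'h groupoid" and A2 :: "('h, 'b) sheaf" +
  fixes \<rho> :: "'g \<Rightarrow> 'h" and \<kappa> :: "'g \<Rightarrow> 'b \<Rightarrow> 'a"
  assumes \<rho>_continuous: "continuous_map (arrows G1) (arrows G2) \<rho>"
    and \<rho>_rng: "g \<in> arr G1 \<Longrightarrow> \<rho> (rng G1 g) = rng G2 (\<rho> g)"
    and \<rho>_src: "g \<in> arr G1 \<Longrightarrow> \<rho> (src G1 g) = src G2 (\<rho> g)"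
    and \<rho>_mult: "\<lbrakk>g \<in> arr G1; h \<in> arr G1; src G1 g = rng G1 h\<rbrakk> \<Longrightarrow> \<rho> (gmult G1 g h) = gmult G2 (\<rho> g) (\<rho> h)"
    and \<kappa>_hom: "x \<in> units G1 \<Longrightarrow> \<kappa> x \<in> hom (fibre A2 (\<rho> x)) (fibre A1 x)"
    and \<kappa>_inj: "x \<in> units G1 \<Longrightarrow> inj_on (\<kappa> x) (carrier (fibre A2 (\<rho> x)))"
    and \<kappa>_act: "g \<in> arr G1 \<Longrightarrow> a \<in> carrier (fibre A2 (\<rho> (src G1 g))) \<Longrightarrow>
      \<kappa> (rng G1 g) (act A2 (\<rho> g) a) = act A1 g (\<kappa> (src G1 g) a)"
    and \<kappa>_continuous: "continuous_map (subtopology (prod_topology (unit_space G1) (total A2)) {(x, a). proj A2 a = \<rho> x})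
      (total A1) (\<lambda>(x, a). \<kappa> x a)"
begin

definition nmap :: "nat \<Rightarrow> (nat \<Rightarrow> 'g) \<Rightarrow> nat \<Rightarrow> 'h" where
  "nmap n y = (\<lambda>i\<in>{..<Suc n}. \<rho> (y i))"

definition pull :: "nat \<Rightarrow> ((nat \<Rightarrow> 'h) \<Rightarrow> 'b) \<Rightarrow> (nat \<Rightarrow> 'g) \<Rightarrow> 'a" where
  "pull n \<phi> y = \<kappa> (anchor G1 y) (\<phi> (nmap n y))"

text \<open>Defined through germs, where compatibility with sums and faces is checked point by
  point; \<open>Phi_apply\<close> identifies it with the explicit formula for induced maps on
  cochains.\<close>

definition Phi :: "nat \<Rightarrow> (((nat \<Rightarrow> 'h) \<Rightarrow> int) \<Rightarrow> 'h \<Rightarrow> 'b) \<Rightarrow> ((nat \<Rightarrow> 'g) \<Rightarrow> int) \<Rightarrow> 'g \<Rightarrow> 'a" where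
  "Phi n h = S1.nev n (pull n (S2.ngerm n h))"

lemma \<rho>_arr: "g \<in> arr G1 \<Longrightarrow> \<rho> g \<in> arr G2"
  using \<rho>_continuous by (metis continuous_map_image_subset_topspace image_subset_iff)

lemma \<rho>_units: "x \<in> units G1 \<Longrightarrow> \<rho> x \<in> units G2"
  using S1.units_arr S1.rng_unit \<rho>_rng \<rho>_arr S2.rng_units by metis

lemma nmap_nerve: "y \<in> topspace (nerve G1 (Suc n)) \<Longrightarrow> nmap n y \<in> topspace (nerve G2 (Suc n))"
  by (auto simp: S1.mem_nerve S2.mem_nerve nmap_def \<rho>_arr simp flip: \<rho>_rng \<rho>_src)

lemma anchor_nmap: "y \<in> topspace (nerve G1 (Suc n)) \<Longrightarrow> anchor G2 (nmap n y) = \<rho> (anchor G1 y)"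
  by (simp add: anchor_def nmap_def \<rho>_rng S1.nerve_arr)

lemma continuous_nmap: "continuous_map (nerve G1 (Suc n)) (nerve G2 (Suc n)) (nmap n)"
proof (rule S2.continuous_into_nerve)
  show "continuous_map (nerve G1 (Suc n)) (arrows G2) (\<lambda>y. nmap n y i)" if "i < Suc n" for i
    using continuous_map_compose[OF S1.continuous_nerve_coordinate[OF that] \<rho>_continuous] that
    by (simp add: nmap_def o_def)
qed (rule nmap_nerve)

lemma nmap_face:
  assumes "y \<in> topspace (nerve G1 (Suc (Suc n)))" "i \<le> Suc n"
  shows "nmap n (face G1 (Suc n) i y) = face G2 (Suc n) i (nmap (Suc n) y)"
  using assms \<rho>_mult[of "y i" "y (Suc i)"]
  by (auto simp: fun_eq_iff nmap_def face_def S1.mem_nerve)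

lemma nmap_translate:
  assumes "g \<in> arr G1" "y \<in> topspace (nerve G1 (Suc n))" "src G1 g = anchor G1 y"
  shows "nmap n (translate G1 g y) = translate G2 (\<rho> g) (nmap n y)"
  using assms \<rho>_mult[of g "y 0"] by (auto simp: fun_eq_iff nmap_def translate_def anchor_def S1.mem_nerve)

lemma \<kappa>_closed: "x \<in> units G1 \<Longrightarrow> a \<in> carrier (fibre A2 (\<rho> x)) \<Longrightarrow> \<kappa> x a \<in> carrier (fibre A1 x)"
  using \<kappa>_hom by (auto simp: hom_def)

text \<open>Continuity comes from that of the induced map of nerves and of \<open>\<kappa>\<close>
  on the fibre product; equivariance comes from functoriality and the compatibility of
  \<open>\<kappa>\<close> with the actions.\<close>

lemma pull_neqsec:
  assumes \<phi>: "S2.neqsec n \<phi>"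
  shows "S1.neqsec n (pull n \<phi>)"
  unfolding S1.neqsec_def
proof (intro conjI ballI impI)
  let ?N = "nerve G1 (Suc n)"
  have l: "S2.lift ?N (\<lambda>y. anchor G2 (nmap n y)) (\<lambda>y. \<phi> (nmap n y))"
    using S2.lift_compose[OF _ continuous_nmap] \<phi> unfolding S2.neqsec_def by blast
  have ca: "continuous_map ?N (unit_space G1) (anchor G1)" by (rule S1.continuous_anchor)
  have "continuous_map ?N (subtopology (prod_topology (unit_space G1) (total A2)) {(x, a). proj A2 a = \<rho> x})
     (\<lambda>y. (anchor G1 y, \<phi> (nmap n y)))"
    using ca S2.lift_continuous[OF l] S2.lift_carrier[OF l] anchor_nmap
    by (intro continuous_map_into_prod_subtopology) (auto simp: S2.fibre_simps)
  from continuous_map_compose[OF this \<kappa>_continuous]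
  have "continuous_map ?N (total A1) (pull n \<phi>)" by (simp add: o_def pull_def[abs_def])
  moreover have "pull n \<phi> y \<in> carrier (fibre A1 (anchor G1 y))" if "y \<in> topspace ?N" for y
    using S2.neqsec_carrier[OF \<phi> nmap_nerve[OF that]] anchor_nmap[OF that] S1.anchor_units[OF that]
    by (simp add: pull_def \<kappa>_closed)
  ultimately show "S1.lift ?N (anchor G1) (pull n \<phi>)" using ca by (simp add: S1.lift_def)
next
  fix g y assume g: "g \<in> arr G1" and y: "y \<in> topspace (nerve G1 (Suc n))" and gy: "src G1 g = anchor G1 y"
  have a: "anchor G1 (translate G1 g y) = rng G1 g"
    using S1.rng_mult[OF g] y gy by (simp add: anchor_def translate_def S1.nerve_arr)
  have "\<phi> (translate G2 (\<rho> g) (nmap n y)) = act A2 (\<rho> g) (\<phi> (nmap n y))"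
    using \<phi> \<rho>_arr[OF g] nmap_nerve[OF y] \<rho>_src[OF g] gy anchor_nmap[OF y] by (simp add: S2.neqsec_def)
  moreover have "\<phi> (nmap n y) \<in> carrier (fibre A2 (\<rho> (src G1 g)))"
    using S2.neqsec_carrier[OF \<phi> nmap_nerve[OF y]] anchor_nmap[OF y] gy by simp
  ultimately show "pull n \<phi> (translate G1 g y) = act A1 g (pull n \<phi> y)"
    using \<kappa>_act[OF g] nmap_translate[OF g y gy] a gy by (simp add: pull_def)
qed

lemma Phi_NHom: "h \<in> S2.NHom n \<Longrightarrow> Phi n h \<in> S1.NHom n"
  unfolding Phi_def by (intro S1.nev_NHom pull_neqsec S2.ngerm_neqsec)

lemma ngerm_Phi:
  "h \<in> S2.NHom n \<Longrightarrow> y \<in> topspace (nerve G1 (Suc n)) \<Longrightarrow> S1.ngerm n (Phi n h) y = \<kappa> (anchor G1 y) (S2.ngerm n h (nmap n y))"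
  unfolding Phi_def by (simp add: S1.ngerm_nev pull_neqsec S2.ngerm_neqsec pull_def)

lemma Phi_hom: "Phi n \<in> hom (cochains G2 (section_module G2 A2) n) (cochains G1 (section_module G1 A1) n)"
  unfolding hom_def
proof (intro CollectI conjI Pi_I ballI)
  interpret C1: comm_group "cochains G1 (section_module G1 A1) n" by (rule S1.comm_group_NHom)
  interpret C2: comm_group "cochains G2 (section_module G2 A2) n" by (rule S2.comm_group_NHom)
  show "Phi n h \<in> S1.NHom n" if "h \<in> S2.NHom n" for h using that by (rule Phi_NHom)
  fix h h' assume h: "h \<in> S2.NHom n" "h' \<in> S2.NHom n"
  show "Phi n (h \<otimes>\<^bsub>cochains G2 (section_module G2 A2) n\<^esub> h') = Phi n h \<otimes>\<^bsub>cochains G1 (section_module G1 A1) n\<^esub> Phi n h'"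
  proof (rule S1.NHom_eqI)
    fix y assume y: "y \<in> topspace (nerve G1 (Suc n))"
    have x: "anchor G1 y \<in> units G1" using y by (rule S1.anchor_units)
    have c: "S2.ngerm n u (nmap n y) \<in> carrier (fibre A2 (\<rho> (anchor G1 y)))" if "u \<in> S2.NHom n" for u
      using S2.ngerm_carrier[OF that nmap_nerve[OF y]] anchor_nmap[OF y] by simp
    show "S1.ngerm n (Phi n (h \<otimes>\<^bsub>cochains G2 (section_module G2 A2) n\<^esub> h')) y =
      S1.ngerm n (Phi n h \<otimes>\<^bsub>cochains G1 (section_module G1 A1) n\<^esub> Phi n h') y"
      using h y \<kappa>_hom[OF x] c
      by (simp add: ngerm_Phi C2.m_closed S1.ngerm_mult Phi_NHom S2.ngerm_mult nmap_nerve anchor_nmap hom_mult)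
  qed (use h Phi_NHom in auto)
qed

text \<open>The functor commutes with faces, and every face has the anchor of the tuple, so the one
  homomorphism \<open>\<kappa>\<close> at that anchor passes through the alternating sum.\<close>

lemma Phi_coboundary:
  assumes h: "h \<in> S2.NHom n"
  shows "Phi (Suc n) (coboundary_map G2 n h) = coboundary_map G1 n (Phi n h)"
proof (rule S1.NHom_eqI)
  have dh: "coboundary_map G2 n h \<in> S2.NHom (Suc n)"
    using h S2.coboundary_map_closed by (simp add: S2.cochains_simps)
  show "Phi (Suc n) (coboundary_map G2 n h) \<in> S1.NHom (Suc n)" using dh by (rule Phi_NHom)
  show "coboundary_map G1 n (Phi n h) \<in> S1.NHom (Suc n)"
    using Phi_NHom[OF h] S1.coboundary_map_closed by (simp add: S1.cochains_simps)
  fix y assume y: "y \<in> topspace (nerve G1 (Suc (Suc n)))"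
  let ?x = "anchor G1 y"
  have x: "?x \<in> units G1" using y by (rule S1.anchor_units)
  interpret F1: comm_group "fibre A1 ?x" using x by (rule S1.fibre_comm_group)
  interpret F2: comm_group "fibre A2 (\<rho> ?x)" using \<rho>_units[OF x] by (rule S2.fibre_comm_group)
  interpret k: group_hom "fibre A2 (\<rho> ?x)" "fibre A1 ?x" "\<kappa> ?x"
    using \<kappa>_hom[OF x] by (simp add: group_hom_def group_hom_axioms_def F1.is_group F2.is_group)
  let ?a = "\<lambda>i. S2.ngerm n h (face G2 (Suc n) i (nmap (Suc n) y))"
  have a: "?a i \<in> carrier (fibre A2 (\<rho> ?x))" if "i \<le> Suc n" for i
    using S2.ngerm_carrier[OF h S2.face_nerve[OF nmap_nerve[OF y] that]] S2.anchor_face[OF nmap_nerve[OF y] that]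
      anchor_nmap[OF y] by simp
  have b: "S1.ngerm n (Phi n h) (face G1 (Suc n) i y) = \<kappa> ?x (?a i)" if "i \<le> Suc n" for i
    using ngerm_Phi[OF h S1.face_nerve[OF y that]] S1.anchor_face[OF y that] nmap_face[OF y that] by simp
  have "S1.ngerm (Suc n) (Phi (Suc n) (coboundary_map G2 n h)) y =
     \<kappa> ?x (finprod (fibre A2 (\<rho> ?x)) (\<lambda>i. ?a i [^]\<^bsub>fibre A2 (\<rho> ?x)\<^esub> ((-1) ^ i :: int)) {..Suc n})"
    using ngerm_Phi[OF dh y] S2.ngerm_coboundary[OF h nmap_nerve[OF y]] anchor_nmap[OF y] by simp
  also have "\<dots> = finprod (fibre A1 ?x) (\<lambda>i. \<kappa> ?x (?a i [^]\<^bsub>fibre A2 (\<rho> ?x)\<^esub> ((-1) ^ i :: int))) {..Suc n}"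
    using a by (intro hom_finprod[OF F2.comm_group_axioms F1.comm_group_axioms \<kappa>_hom[OF x]] Pi_I F2.int_pow_closed) auto
  also have "\<dots> = finprod (fibre A1 ?x) (\<lambda>i. S1.ngerm n (Phi n h) (face G1 (Suc n) i y) [^]\<^bsub>fibre A1 ?x\<^esub> ((-1) ^ i :: int)) {..Suc n}"
  proof (rule F1.finprod_cong')
    have "S1.ngerm n (Phi n h) (face G1 (Suc n) i y) \<in> carrier (fibre A1 ?x)" if "i \<le> Suc n" for i
      using b[OF that] k.hom_closed[OF a[OF that]] by simp
    then show "(\<lambda>i. S1.ngerm n (Phi n h) (face G1 (Suc n) i y) [^]\<^bsub>fibre A1 ?x\<^esub> ((-1) ^ i :: int)) \<in> {..Suc n} \<rightarrow> carrier (fibre A1 ?x)"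
      by (intro Pi_I F1.int_pow_closed) simp
    fix i assume "i \<in> {..Suc n}"
    then show "\<kappa> ?x (?a i [^]\<^bsub>fibre A2 (\<rho> ?x)\<^esub> ((-1) ^ i :: int)) =
       S1.ngerm n (Phi n h) (face G1 (Suc n) i y) [^]\<^bsub>fibre A1 ?x\<^esub> ((-1) ^ i :: int)"
      using b[of i] k.hom_int_pow[OF a[of i]] by simp
  qed simp
  also have "\<dots> = S1.ngerm (Suc n) (coboundary_map G1 n (Phi n h)) y"
    using S1.ngerm_coboundary[OF Phi_NHom[OF h] y] by simp
  finally show "S1.ngerm (Suc n) (Phi (Suc n) (coboundary_map G2 n h)) y = S1.ngerm (Suc n) (coboundary_map G1 n (Phi n h)) y" .
qed

text \<open>Here the neighbourhood is chosen by \<open>anchor_nbhd\<close>, not by smallness as in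
  \<open>germ_at\<close>. A small set qualifies because the anchor is continuous and open, so the
  choice succeeds; the chosen set is small because a homeomorphism is injective.\<close>

lemma anchor_nbhd_germ:
  assumes h: "h \<in> S2.NHom n" and y: "y \<in> topspace (nerve G1 (Suc n))"
  shows "h (indicator (SOME V. anchor_nbhd G2 (Suc n) (\<lambda>i\<in>{..<Suc n}. \<rho> (y i)) V)) (\<rho> (anchor G1 y)) = S2.ngerm n h (nmap n y)"
proof -
  let ?z = "nmap n y"
  let ?V = "SOME V. anchor_nbhd G2 (Suc n) ?z V"
  obtain W where W: "compact_open (nerve G2 (Suc n)) W" "?z \<in> W" "inj_on (anchor G2) W"
    using S2.nerve_small_nbhd[OF nmap_nerve[OF y]] .
  then have "anchor_nbhd G2 (Suc n) ?z W"
    using local_homeo_imp[OF S2.local_homeo_anchor]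
    by (auto simp: anchor_nbhd_def compact_open_def intro!: homeomorphic_map_restrict_open)
  then have V: "anchor_nbhd G2 (Suc n) ?z ?V" by (rule someI)
  then have cV: "compact_open (nerve G2 (Suc n)) ?V" "?z \<in> ?V" by (auto simp: anchor_nbhd_def)
  have "inj_on (anchor G2) (topspace (nerve G2 (Suc n)) \<inter> ?V)"
    using V homeomorphic_imp_injective_map unfolding anchor_nbhd_def by fastforce
  then have "inj_on (anchor G2) ?V" using compact_open_subset[OF cV(1)] by (simp add: Int_absorb1)
  from S2.ngerm_eq[OF h cV(1) this cV(2)] show ?thesis using anchor_nmap[OF y] by (simp add: nmap_def)
qed

text \<open>The isomorphism of fibres is moved from the germs to the outside of the fibre sum, by
  \<open>inj_hom_gfinprod\<close>.\<close>

lemma Phi_apply: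
  assumes h: "h \<in> S2.NHom n" 
  shows "Phi n h = (\<lambda>f\<in>Zfun (nerve G1 (Suc n)). \<lambda>x\<in>units G1. \<kappa> x
     (gfinprod (fibre A2 (\<rho> x))
       (\<lambda>y. h (indicator (SOME V. anchor_nbhd G2 (Suc n) (\<lambda>i\<in>{..<Suc n}. \<rho> (y i)) V)) (\<rho> x) [^]\<^bsub>fibre A2 (\<rho> x)\<^esub> f y)
       {y \<in> topspace (nerve G1 (Suc n)). anchor G1 y = x}))"
  unfolding Phi_def S1.nev_eq
proof (intro restrict_ext)
  fix f :: "(nat \<Rightarrow> 'g) \<Rightarrow> int" and x assume x: "x \<in> units G1"
  let ?S = "{y \<in> topspace (nerve G1 (Suc n)). anchor G1 y = x}"
  interpret F1: comm_group "fibre A1 x" using x by (rule S1.fibre_comm_group)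
  interpret F2: comm_group "fibre A2 (\<rho> x)" using \<rho>_units[OF x] by (rule S2.fibre_comm_group)
  interpret k: group_hom "fibre A2 (\<rho> x)" "fibre A1 x" "\<kappa> x"
    using \<kappa>_hom[OF x] by (simp add: group_hom_def group_hom_axioms_def F1.is_group F2.is_group)
  have a: "S2.ngerm n h (nmap n y) \<in> carrier (fibre A2 (\<rho> x))" if "y \<in> ?S" for y
    using that S2.ngerm_carrier[OF h nmap_nerve[of y n]] anchor_nmap[of y n] by simp
  have "gfinprod (fibre A2 (\<rho> x))
       (\<lambda>y. h (indicator (SOME V. anchor_nbhd G2 (Suc n) (\<lambda>i\<in>{..<Suc n}. \<rho> (y i)) V)) (\<rho> x) [^]\<^bsub>fibre A2 (\<rho> x)\<^esub> f y) ?S =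
     gfinprod (fibre A2 (\<rho> x)) (\<lambda>y. S2.ngerm n h (nmap n y) [^]\<^bsub>fibre A2 (\<rho> x)\<^esub> f y) ?S"
  proof (rule F2.gfinprod_cong_on)
    show "(\<lambda>y. S2.ngerm n h (nmap n y) [^]\<^bsub>fibre A2 (\<rho> x)\<^esub> f y) \<in> ?S \<rightarrow> carrier (fibre A2 (\<rho> x))"
      by (intro Pi_I F2.int_pow_closed a)
  qed (use anchor_nbhd_germ[OF h] in auto)
  then have "\<kappa> x (gfinprod (fibre A2 (\<rho> x))
       (\<lambda>y. h (indicator (SOME V. anchor_nbhd G2 (Suc n) (\<lambda>i\<in>{..<Suc n}. \<rho> (y i)) V)) (\<rho> x) [^]\<^bsub>fibre A2 (\<rho> x)\<^esub> f y) ?S)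
    = \<kappa> x (gfinprod (fibre A2 (\<rho> x)) (\<lambda>y. S2.ngerm n h (nmap n y) [^]\<^bsub>fibre A2 (\<rho> x)\<^esub> f y) ?S)" by simp
  also have "\<dots> = gfinprod (fibre A1 x) (\<lambda>y. \<kappa> x (S2.ngerm n h (nmap n y) [^]\<^bsub>fibre A2 (\<rho> x)\<^esub> f y)) ?S"
    by (intro inj_hom_gfinprod[OF F2.comm_group_axioms F1.comm_group_axioms \<kappa>_hom[OF x] \<kappa>_inj[OF x]] Pi_I F2.int_pow_closed a)
  also have "\<dots> = gfinprod (fibre A1 x) (\<lambda>y. pull n (S2.ngerm n h) y [^]\<^bsub>fibre A1 x\<^esub> f y) ?S"
  proof (rule F1.gfinprod_cong_on)
    have "pull n (S2.ngerm n h) y \<in> carrier (fibre A1 x)" if "y \<in> ?S" for y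
      using k.hom_closed[OF a[OF that]] that by (simp add: pull_def)
    then show "(\<lambda>y. pull n (S2.ngerm n h) y [^]\<^bsub>fibre A1 x\<^esub> f y) \<in> ?S \<rightarrow> carrier (fibre A1 x)"
      by (intro Pi_I F1.int_pow_closed)
    fix y assume y: "y \<in> ?S"
    then show "\<kappa> x (S2.ngerm n h (nmap n y) [^]\<^bsub>fibre A2 (\<rho> x)\<^esub> f y) = pull n (S2.ngerm n h) y [^]\<^bsub>fibre A1 x\<^esub> f y"
      using k.hom_int_pow[OF a[OF y]] by (simp add: pull_def)
  qed
  finally show "gfinprod (fibre A1 x) (\<lambda>y. pull n (S2.ngerm n h) y [^]\<^bsub>fibre A1 x\<^esub> f y) ?S =
    \<kappa> x (gfinprod (fibre A2 (\<rho> x))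
       (\<lambda>y. h (indicator (SOME V. anchor_nbhd G2 (Suc n) (\<lambda>i\<in>{..<Suc n}. \<rho> (y i)) V)) (\<rho> x) [^]\<^bsub>fibre A2 (\<rho> x)\<^esub> f y) ?S)"
    by simp
qed

end

section \<open>The skew product\<close>

lemma continuous_map_discrete_add:
  assumes "continuous_map Z (discrete_topology UNIV) f" "continuous_map Z (discrete_topology UNIV) (g :: _ \<Rightarrow> int)"
  shows "continuous_map Z (discrete_topology UNIV) (\<lambda>z. f z + g z)"
  unfolding continuous_map_discrete_iff
proof
  fix n
  have "{z \<in> topspace Z. f z + g z = n} = (\<Union>k. {z \<in> topspace Z. f z = k} \<inter> {z \<in> topspace Z. g z = n - k})"
    by auto
  moreover have "openin Z \<dots>"
    using assms by (intro openin_Union) (auto simp: continuous_map_discrete_iff)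
  ultimately show "openin Z {z \<in> topspace Z. f z + g z = n}" by simp
qed

lemma local_homeo_cong:
  assumes "local_homeo X Y f" "\<And>x. x \<in> topspace X \<Longrightarrow> f x = g x"
  shows "local_homeo X Y g"
  unfolding local_homeo_iff
proof (intro conjI ballI)
  show "continuous_map X Y g" using local_homeo_imp(1)[OF assms(1)] assms(2) by (rule continuous_map_eq)
  have "f ` U = g ` U" if "openin X U" for U using openin_subset[OF that] assms(2) by (intro image_cong) auto
  then show "open_map X Y g" using local_homeo_imp(2)[OF assms(1)] by (auto simp: open_map_def)
  fix x assume "x \<in> topspace X"
  then obtain U where U: "openin X U" "x \<in> U" "inj_on f U" using local_homeo_inj_nbhd[OF assms(1)] by blast
  then have "inj_on g U" using openin_subset[OF U(1)] assms(2) inj_on_cong[of U f g] by blast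
  then show "\<exists>U. openin X U \<and> x \<in> U \<and> inj_on g U" using U by blast
qed

lemma local_homeo_involution:
  assumes c: "continuous_map X X i" and inv: "\<And>x. x \<in> topspace X \<Longrightarrow> i (i x) = x"
  shows "local_homeo X X i"
  unfolding local_homeo_iff
proof (intro conjI ballI)
  have cl: "i x \<in> topspace X" if "x \<in> topspace X" for x
    using that c by (metis continuous_map_image_subset_topspace image_subset_iff)
  show "open_map X X i"
    unfolding open_map_def
  proof (intro allI impI)
    fix U assume U: "openin X U"
    have "i ` U = {x \<in> topspace X. i x \<in> U}"
      using openin_subset[OF U] inv cl by (auto simp: subset_iff image_iff) (metis inv)
    then show "openin X (i ` U)" using openin_continuous_map_preimage[OF c U] by simp
  qed
  show "\<exists>U. openin X U \<and> x \<in> U \<and> inj_on i U" if "x \<in> topspace X" for x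
    using that inv by (intro exI[of _ "topspace X"]) (auto intro: inj_on_inverseI)
qed (rule c)

locale cocycle_groupoid = ample_groupoid G for G :: "'g groupoid" +
  fixes c :: "'g \<Rightarrow> int"
  assumes cocycle: "cocycle G c"
begin

abbreviation S where "S \<equiv> skew_product G c"

lemma c_continuous: "continuous_map (arrows G) (discrete_topology UNIV) c"
  using cocycle by (simp add: cocycle_def)

lemma c_mult: "\<lbrakk>g \<in> arr G; h \<in> arr G; src G g = rng G h\<rbrakk> \<Longrightarrow> c (gmult G g h) = c g + c h"
  using cocycle by (simp add: cocycle_def)

lemma c_unit: "u \<in> units G \<Longrightarrow> c u = 0"
  using c_mult[of u u] right_unit[of u] units_arr[of u] rng_unit[of u] src_unit[of u] by simp

lemma c_inv: "g \<in> arr G \<Longrightarrow> c (ginv G g) = - c g"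
  using c_mult[of g "ginv G g"] inv_closed rng_inv right_inv c_unit[of "rng G g"] rng_units by simp

lemma skew_simps [simp]:
  "arrows S = prod_topology (arrows G) (discrete_topology UNIV)"
  "gmult S a b = (gmult G (fst a) (fst b), snd a)"
  "ginv S a = (ginv G (fst a), snd a + c (fst a))"
  "rng S a = (rng G (fst a), snd a)"
  "src S a = (src G (fst a), snd a + c (fst a))"
  by (simp_all add: skew_product_def case_prod_unfold)

lemma units_skew [simp]: "units S = units G \<times> UNIV"
  by (auto simp: units_def image_iff) 

lemma unit_space_skew: "unit_space S = prod_topology (unit_space G) (discrete_topology UNIV)"
  by (simp add: unit_space_def subtopology_Times)

lemma groupoid_skew: "groupoid S"
  by unfold_locales
    (auto simp: rng_closed src_units mult_closed inv_closed rng_unit src_unit rng_mult src_mult assoc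
      left_unit right_unit rng_inv src_inv right_inv left_inv c_mult c_inv c_unit)

lemma continuous_skew_fst: "continuous_map Z (arrows S) f \<Longrightarrow> continuous_map Z (arrows G) (\<lambda>z. fst (f z))"
  and continuous_skew_snd: "continuous_map Z (arrows S) f \<Longrightarrow> continuous_map Z (discrete_topology UNIV) (\<lambda>z. snd (f z))"
  by (auto simp: continuous_map_pairwise o_def)

lemma topological_groupoid_skew: "topological_groupoid S"
proof (intro topological_groupoid.intro groupoid_skew topological_groupoid_axioms.intro)
  let ?E = "{(g, h). g \<in> arr S \<and> h \<in> arr S \<and> src S g = rng S h}"
  let ?Z = "subtopology (prod_topology (arrows S) (arrows S)) ?E"
  have c1: "continuous_map ?Z (arrows S) fst" and c2: "continuous_map ?Z (arrows S) snd"
    by (intro continuous_map_from_subtopology continuous_map_fst continuous_map_snd)+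
  have "continuous_map ?Z (subtopology (prod_topology (arrows G) (arrows G)) {(g, h). g \<in> arr G \<and> h \<in> arr G \<and> src G g = rng G h})
     (\<lambda>z. (fst (fst z), fst (snd z)))"
    using continuous_skew_fst[OF c1] continuous_skew_fst[OF c2]
    by (intro continuous_map_into_prod_subtopology) auto
  from continuous_map_compose[OF this continuous_mult]
  have "continuous_map ?Z (arrows G) (\<lambda>z. gmult G (fst (fst z)) (fst (snd z)))" by (simp add: o_def)
  then have "continuous_map ?Z (arrows S) (\<lambda>z. (gmult G (fst (fst z)) (fst (snd z)), snd (fst z)))"
    using continuous_skew_snd[OF c1] by (simp add: continuous_map_pairedI)
  then show "continuous_map ?Z (arrows S) (\<lambda>(g, h). gmult S g h)" by (simp add: case_prod_unfold)
  have c: "continuous_map (arrows S) (arrows S) (\<lambda>z. z)" by simp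
  have "continuous_map (arrows S) (discrete_topology UNIV) (\<lambda>a. snd a + c (fst a))"
    using continuous_map_compose[OF continuous_skew_fst[OF c] c_continuous]
    by (intro continuous_map_discrete_add continuous_skew_snd[OF c]) (simp add: o_def)
  moreover have "continuous_map (arrows S) (arrows G) (\<lambda>a. ginv G (fst a))"
    using continuous_map_compose[OF continuous_skew_fst[OF c] continuous_inv] by (simp add: o_def)
  ultimately have "continuous_map (arrows S) (arrows S) (\<lambda>a. (ginv G (fst a), snd a + c (fst a)))"
    by (simp add: continuous_map_pairedI)
  then show "continuous_map (arrows S) (arrows S) (ginv S)"
    by (rule continuous_map_eq) simp
qed

text \<open>The range map is that of \<open>G\<close> times the identity of the integers, so sheets
  and local sections are obtained from those of \<open>G\<close> by carrying the level
  along.\<close>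

lemma local_homeo_skew_rng: "local_homeo (arrows S) (unit_space S) (rng S)"
  unfolding local_homeo_iff
proof (intro conjI ballI)
  have id: "continuous_map (arrows S) (arrows S) (\<lambda>z. z)" by simp
  have "continuous_map (arrows S) (unit_space S) (\<lambda>a. (rng G (fst a), snd a))"
    unfolding unit_space_skew
    using continuous_map_compose[OF continuous_skew_fst[OF id] continuous_rng_unit_space] continuous_skew_snd[OF id]
    by (intro continuous_map_pairedI) (simp_all add: o_def)
  then show "continuous_map (arrows S) (unit_space S) (rng S)" by (rule continuous_map_eq) simp
  show "\<exists>U. openin (arrows S) U \<and> a \<in> U \<and> inj_on (rng S) U" if a: "a \<in> arr S" for a
  proof -
    have "fst a \<in> arr G" using a by auto
    then obtain U where U: "openin (arrows G) U" "fst a \<in> U" "inj_on (rng G) U"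
      using local_homeo_inj_nbhd[OF etale_rng] by blast
    have "openin (arrows S) (U \<times> UNIV)" using U(1) by (simp add: openin_prod_Times_iff)
    moreover have "inj_on (rng S) (U \<times> UNIV)" using U(3) by (auto simp: inj_on_def)
    ultimately show ?thesis using U(2) by (intro exI[of _ "U \<times> UNIV"]) (auto simp: mem_Times_iff)
  qed
  show "open_map (arrows S) (unit_space S) (rng S)"
  proof (rule open_map_local_sections)
    fix a assume a: "a \<in> arr S"
    then have aG: "fst a \<in> arr G" by auto
    then obtain B where B: "compact_open_bisection G B" "fst a \<in> B" "B \<subseteq> arr G"
      using bisection_nbhd[of "arr G"] by blast
    then have B': "openin (arrows G) B" "inj_on (rng G) B"
      by (auto simp: compact_open_bisection_def compact_open_def)
    let ?\<sigma> = "the_inv_into B (rng G)"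
    let ?N = "(rng G ` B) \<times> (UNIV :: int set)"
    let ?s = "\<lambda>x. (?\<sigma> (fst x), snd x)"
    have "openin (unit_space G) (rng G ` B)"
      using B' local_homeo_imp[OF etale_rng] by (simp add: open_map_def)
    then have N: "openin (unit_space S) ?N" by (simp add: unit_space_skew openin_prod_Times_iff)
    have sub: "subtopology (unit_space S) ?N = prod_topology (subtopology (unit_space G) (rng G ` B)) (discrete_topology UNIV)"
      by (simp add: unit_space_skew subtopology_Times)
    have "continuous_map (subtopology (unit_space S) ?N) (arrows S) ?s"
      unfolding sub skew_simps
      using continuous_map_compose[OF continuous_map_fst continuous_map_the_inv_into[OF etale_rng B']]
      by (intro continuous_map_pairedI) (simp_all add: o_def continuous_map_snd)
    moreover have "rng S a \<in> ?N" using B by auto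
    moreover have "?s (rng S a) = a" using the_inv_into_f_f[OF B'(2) B(2)] by simp
    moreover have "rng S (?s x) = x" if "x \<in> ?N" for x
      using f_the_inv_into_f[OF B'(2), of "fst x"] that by (auto simp: prod_eq_iff)
    ultimately show "\<exists>N s. openin (unit_space S) N \<and> rng S a \<in> N \<and>
        continuous_map (subtopology (unit_space S) N) (arrows S) s \<and> s (rng S a) = a \<and> (\<forall>y\<in>N. rng S (s y) = y)"
      using N by (intro exI[of _ ?N] exI[of _ ?s]) blast
  qed
qed

lemma ample_groupoid_skew: "ample_groupoid S"
proof (intro ample_groupoid.intro topological_groupoid_skew ample_groupoid_axioms.intro)
  interpret T: topological_groupoid S by (rule topological_groupoid_skew)
  show "Hausdorff_space (arrows S)" using hausdorff by (simp add: Hausdorff_space_prod_topology)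
  show "locally_compact_space (arrows S)"
    using locally_compact by (simp add: locally_compact_space_prod_topology locally_compact_space_discrete_topology)
  show "local_homeo (arrows S) (unit_space S) (rng S)" by (rule local_homeo_skew_rng)
  \<comment> \<open>The source twists the level by \<open>c\<close>; as the range after inversion,
    an involution, it needs no separate treatment of the twist.\<close>
  have "local_homeo (arrows S) (unit_space S) (rng S \<circ> ginv S)"
    using local_homeo_involution[OF T.continuous_inv T.inv_inv] local_homeo_skew_rng by (rule local_homeo_compose)
  then show "local_homeo (arrows S) (unit_space S) (src S)"
    by (rule local_homeo_cong) (simp add: T.rng_inv del: skew_simps)
  show "totally_disconnected (unit_space S)"
    unfolding totally_disconnected_def
  proof (intro allI impI)
    fix C assume C: "connectedin (unit_space S) C"
    have "connectedin (unit_space G) (fst ` C)"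
      using C unfolding unit_space_skew by (rule connectedin_continuous_map_image[OF continuous_map_fst])
    then obtain a where a: "fst ` C \<subseteq> {a}" using units_totally_disconnected by (auto simp: totally_disconnected_def)
    have "connectedin (discrete_topology (UNIV :: int set)) (snd ` C)"
      using C unfolding unit_space_skew by (rule connectedin_continuous_map_image[OF continuous_map_snd])
    then obtain b where b: "snd ` C \<subseteq> {b}" by (auto simp: connectedin_discrete_topology)
    show "\<exists>a. C \<subseteq> {a}"
      using a b by (intro exI[of _ "(a, b)"]) (auto simp: image_subset_iff prod_eq_iff)
  qed
qed

end

locale skew_sheaf = gsheaf G A + cocycle_groupoid G c
  for G :: "'g groupoid" and A :: "('g, 'a) sheaf" and c :: "'g \<Rightarrow> int"
begin

section \<open>The pullback of a sheaf along the projection\<close>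

abbreviation P where "P \<equiv> pullback_sheaf S fst A"

lemma pullback_simps:
  "total P = subtopology (prod_topology (unit_space S) (total A)) {(x, a). proj A a = fst x}"
  "proj P = fst" "fibre_add P u v = (fst u, fibre_add A (snd u) (snd v))"
  "fibre_zero P x = (x, fibre_zero A (fst x))"
  "act P g u = (rng S g, act A (fst g) (snd u))"
  by (simp_all add: pullback_sheaf_def case_prod_unfold)

lemma fibre_pullback_simps:
  "u \<otimes>\<^bsub>fibre P x\<^esub> v = (fst u, snd u \<otimes>\<^bsub>F (fst x)\<^esub> snd v)"
  "\<one>\<^bsub>fibre P x\<^esub> = (x, \<one>\<^bsub>F (fst x)\<^esub>)"
  by (simp_all add: fibre_def pullback_simps)

lemma carrier_fibre_pullback: "x \<in> units S \<Longrightarrow> carrier (fibre P x) = {x} \<times> carrier (F (fst x))"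
  using units_arr by (auto simp: fibre_def pullback_simps unit_space_skew simp del: skew_simps)

lemma comm_group_fibre_pullback:
  assumes x: "x \<in> units S"
  shows "comm_group (fibre P x)"
proof -
  have xG: "fst x \<in> units G" using x by auto
  interpret comm_group "F (fst x)" using xG by (rule fibre_comm_group)
  show ?thesis
  proof (rule comm_groupI; unfold carrier_fibre_pullback[OF x] fibre_pullback_simps)
    fix u assume "u \<in> {x} \<times> carrier (F (fst x))"
    then have "snd u \<in> carrier (F (fst x))" by auto
    then show "\<exists>v\<in>{x} \<times> carrier (F (fst x)). (fst v, snd v \<otimes>\<^bsub>F (fst x)\<^esub> snd u) = (x, \<one>\<^bsub>F (fst x)\<^esub>)"
      by (intro bexI[of _ "(x, inv\<^bsub>F (fst x)\<^esub> (snd u))"]) simp_all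
  qed (use m_assoc m_comm m_closed l_one in \<open>simp_all add: mem_Times_iff prod_eq_iff\<close>)
qed

lemma inv_fibre_pullback:
  assumes x: "x \<in> units S" and u: "u \<in> carrier (fibre P x)"
  shows "inv\<^bsub>fibre P x\<^esub> u = (x, inv\<^bsub>F (fst x)\<^esub> (snd u))"
proof -
  have xG: "fst x \<in> units G" using x by auto
  interpret A: comm_group "F (fst x)" using xG by (rule fibre_comm_group)
  interpret comm_group "fibre P x" using x by (rule comm_group_fibre_pullback)
  have u': "fst u = x" "snd u \<in> carrier (F (fst x))" using u by (simp_all add: carrier_fibre_pullback[OF x] mem_Times_iff del: units_skew)
  show ?thesis
    by (intro inv_equality) (simp_all add: carrier_fibre_pullback[OF x] fibre_pullback_simps u' mem_Times_iff del: units_skew)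
qed

lemma continuous_pullback_fst: "continuous_map Z (total P) f \<Longrightarrow> continuous_map Z (unit_space S) (\<lambda>z. fst (f z))"
  and continuous_pullback_snd: "continuous_map Z (total P) f \<Longrightarrow> continuous_map Z (total A) (\<lambda>z. snd (f z))"
  by (auto simp: pullback_simps continuous_map_in_subtopology continuous_map_pairwise o_def)

lemma continuous_into_pullback:
  assumes "continuous_map Z (unit_space S) f" "continuous_map Z (total A) u" "\<And>z. z \<in> topspace Z \<Longrightarrow> proj A (u z) = fst (f z)"
  shows "continuous_map Z (total P) (\<lambda>z. (f z, u z))"
  unfolding pullback_simps using assms by (intro continuous_map_into_prod_subtopology) auto

lemma continuous_unit_space_skew_fst: "continuous_map (unit_space S) (unit_space G) fst"
  by (simp add: unit_space_skew continuous_map_fst)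

lemma mem_total_pullback: "u \<in> topspace (total P) \<longleftrightarrow> fst u \<in> units S \<and> snd u \<in> carrier (F (fst (fst u)))"
  by (auto simp: pullback_simps fibre_simps unit_space_skew mem_Times_iff simp del: skew_simps)

text \<open>Each condition comes from the corresponding one on \<open>A\<close> for the second
  component, with the base point recorded alongside, and continuity into the fibre product is
  checked componentwise. Sheets of \<open>A\<close> give sheets of the pullback, because a point is
  determined by its base point and its second component.\<close>

lemma gsheaf_pullback: "gsheaf S P"
proof (intro gsheaf.intro ample_groupoid_skew gsheaf_axioms.intro)
  interpret S: ample_groupoid S by (rule ample_groupoid_skew)
  show "comm_group (fibre P x)" if "x \<in> units S" for x using that by (rule comm_group_fibre_pullback)
  have idP: "continuous_map (total P) (total P) (\<lambda>z. z)" by simp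
  show "local_homeo (total P) (unit_space S) (proj P)"
    unfolding local_homeo_iff
  proof (intro conjI ballI)
    show "continuous_map (total P) (unit_space S) (proj P)"
      unfolding pullback_simps(2) using continuous_pullback_fst[OF idP] .
    show "\<exists>U. openin (total P) U \<and> u \<in> U \<and> inj_on (proj P) U" if u: "u \<in> topspace (total P)" for u
    proof -
      have "snd u \<in> topspace (total A)" using u by (simp add: mem_total_pullback fibre_simps)
      then obtain W where W: "openin (total A) W" "snd u \<in> W" "inj_on (proj A) W"
        using local_homeo_inj_nbhd[OF proj_local_homeo] by blast
      let ?U = "{u \<in> topspace (total P). snd u \<in> W}"
      have "openin (total P) ?U" using continuous_pullback_snd[OF idP] W(1) by (rule openin_continuous_map_preimage)
      moreover have "inj_on (proj P) ?U"
      proof (rule inj_onI)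
        fix v w assume v: "v \<in> ?U" and w: "w \<in> ?U" and eq: "proj P v = proj P w"
        then have "proj A (snd v) = proj A (snd w)" by (auto simp: mem_total_pullback fibre_simps pullback_simps(2))
        then have "snd v = snd w" using inj_onD[OF W(3)] v w by auto
        then show "v = w" using eq by (simp add: pullback_simps(2) prod_eq_iff)
      qed
      ultimately show ?thesis using u W by blast
    qed
    show "open_map (total P) (unit_space S) (proj P)"
    proof (rule open_map_local_sections)
      fix u assume u: "u \<in> topspace (total P)"
      then have "snd u \<in> topspace (total A)" by (simp add: mem_total_pullback fibre_simps)
      then obtain W where W: "openin (total A) W" "snd u \<in> W" "inj_on (proj A) W"
        using local_homeo_inj_nbhd[OF proj_local_homeo] by blast
      \<comment> \<open>A local section of \<open>A\<close>, precomposed with the projection of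
        units, yields a local section of the pullback.\<close>
      let ?\<sigma> = "the_inv_into W (proj A)"
      let ?N = "{x \<in> topspace (unit_space S). fst x \<in> proj A ` W}"
      have "openin (unit_space G) (proj A ` W)"
        using W local_homeo_imp[OF proj_local_homeo] by (simp add: open_map_def)
      then have N: "openin (unit_space S) ?N"
        using continuous_unit_space_skew_fst by (intro openin_continuous_map_preimage)
      have "continuous_map (subtopology (unit_space S) ?N) (subtopology (unit_space G) (proj A ` W)) fst"
        using continuous_unit_space_skew_fst
        by (auto simp: continuous_map_in_subtopology continuous_map_from_subtopology)
      then have c\<sigma>: "continuous_map (subtopology (unit_space S) ?N) (total A) (\<lambda>x. ?\<sigma> (fst x))"
        using continuous_map_compose[OF _ continuous_map_the_inv_into[OF proj_local_homeo W(1,3)]] by (simp add: o_def)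
      have "continuous_map (subtopology (unit_space S) ?N) (total P) (\<lambda>x. (x, ?\<sigma> (fst x)))"
        using c\<sigma> f_the_inv_into_f[OF W(3)]
        by (intro continuous_into_pullback) (auto intro: continuous_map_from_subtopology)
      moreover have uN: "proj P u \<in> ?N" using u W S.topspace_unit_space
        by (auto simp: mem_total_pullback fibre_simps pullback_simps(2))
      moreover have "(proj P u, ?\<sigma> (fst (proj P u))) = u"
      proof -
        have "proj A (snd u) = fst (fst u)" using u by (simp add: mem_total_pullback fibre_simps)
        then show ?thesis using the_inv_into_f_f[OF W(3,2)] by (simp add: pullback_simps(2) prod_eq_iff)
      qed
      ultimately show "\<exists>N s. openin (unit_space S) N \<and> proj P u \<in> N \<and>
        continuous_map (subtopology (unit_space S) N) (total P) s \<and> s (proj P u) = u \<and> (\<forall>y\<in>N. proj P (s y) = y)"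
        using N by (intro exI[of _ ?N] exI[of _ "\<lambda>x. (x, ?\<sigma> (fst x))"]) (simp add: pullback_simps(2))
    qed
  qed
  show "continuous_map (subtopology (prod_topology (total P) (total P)) {(a, b). proj P a = proj P b}) (total P)
     (\<lambda>(a, b). fibre_add P a b)" (is "continuous_map ?Z _ _")
  proof -
    have c1: "continuous_map ?Z (total P) fst" and c2: "continuous_map ?Z (total P) snd"
      by (intro continuous_map_from_subtopology continuous_map_fst continuous_map_snd)+
    have mem: "fst z \<in> topspace (total P)" "snd z \<in> topspace (total P)" "fst (fst z) = fst (snd z)" if "z \<in> topspace ?Z" for z
      using that by (auto simp: pullback_simps(2))
    have pr: "proj A (snd (fst z)) = fst (fst (fst z))" "proj A (snd (snd z)) = fst (fst (fst z))"
      "snd (fst z) \<in> topspace (total A)" "snd (snd z) \<in> topspace (total A)" if "z \<in> topspace ?Z" for z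
      using mem[OF that] by (simp_all add: mem_total_pullback fibre_simps)
    have "continuous_map ?Z (subtopology (prod_topology (total A) (total A)) {(a, b). proj A a = proj A b})
       (\<lambda>z. (snd (fst z), snd (snd z)))"
      using continuous_pullback_snd[OF c1] continuous_pullback_snd[OF c2] pr
      by (intro continuous_map_into_prod_subtopology) auto
    from continuous_map_compose[OF this add_continuous]
    have "continuous_map ?Z (total A) (\<lambda>z. fibre_add A (snd (fst z)) (snd (snd z)))" by (simp add: o_def)
    moreover have "proj A (fibre_add A (snd (fst z)) (snd (snd z))) = fst (fst (fst z))" if "z \<in> topspace ?Z" for z
    proof -
      have "fst (fst (fst z)) \<in> units G" using mem[OF that] by (auto simp: mem_total_pullback)
      from monoid.m_closed[OF group.is_monoid[OF fibre_group[OF this]], of "snd (fst z)" "snd (snd z)"]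
      show ?thesis using pr[OF that] by (simp add: fibre_simps)
    qed
    ultimately have "continuous_map ?Z (total P) (\<lambda>z. (fst (fst z), fibre_add A (snd (fst z)) (snd (snd z))))"
      using continuous_pullback_fst[OF c1] by (intro continuous_into_pullback)
    then show ?thesis by (simp add: case_prod_unfold pullback_simps(3))
  qed
  show "continuous_map (unit_space S) (total P) (fibre_zero P)"
  proof -
    have "continuous_map (unit_space S) (total A) (\<lambda>x. fibre_zero A (fst x))"
      using continuous_map_compose[OF continuous_unit_space_skew_fst zero_continuous] by (simp add: o_def)
    moreover have "proj A (fibre_zero A (fst x)) = fst x" if "x \<in> topspace (unit_space S)" for x
    proof -
      have "fst x \<in> units G" using that by (auto simp: unit_space_skew)
      from monoid.one_closed[OF group.is_monoid[OF fibre_group[OF this]]] show ?thesis by (simp add: fibre_simps)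
    qed
    ultimately have "continuous_map (unit_space S) (total P) (\<lambda>x. (x, fibre_zero A (fst x)))"
      by (intro continuous_into_pullback) auto
    then show ?thesis by (rule continuous_map_eq) (simp add: pullback_simps(4))
  qed
  show "continuous_map (total P) (total P) (\<lambda>a. inv\<^bsub>fibre P (proj P a)\<^esub> a)"
  proof -
    have mem: "proj A (snd u) = fst (fst u)" "fst u \<in> units S" "snd u \<in> carrier (F (fst (fst u)))" if "u \<in> topspace (total P)" for u
      using that by (auto simp: mem_total_pullback fibre_simps)
    have "continuous_map (total P) (total A) (\<lambda>u. inv\<^bsub>F (proj A (snd u))\<^esub> (snd u))"
      using continuous_map_compose[OF continuous_pullback_snd[OF idP] inv_continuous] by (simp add: o_def)
    moreover have "proj A (inv\<^bsub>F (proj A (snd u))\<^esub> (snd u)) = fst (fst u)" if "u \<in> topspace (total P)" for u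
    proof -
      have "fst (fst u) \<in> units G" using mem(2)[OF that] by auto
      from group.inv_closed[OF fibre_group[OF this] mem(3)[OF that]] show ?thesis
        using mem(1)[OF that] by (simp add: fibre_simps)
    qed
    ultimately have "continuous_map (total P) (total P) (\<lambda>u. (fst u, inv\<^bsub>F (proj A (snd u))\<^esub> (snd u)))"
      using continuous_pullback_fst[OF idP] by (intro continuous_into_pullback)
    then show ?thesis
    proof (rule continuous_map_eq)
      fix u assume u: "u \<in> topspace (total P)"
      then have "u \<in> carrier (fibre P (fst u))" by (simp add: fibre_def pullback_simps(2))
      then show "(fst u, inv\<^bsub>F (proj A (snd u))\<^esub> (snd u)) = inv\<^bsub>fibre P (proj P u)\<^esub> u"
        using inv_fibre_pullback[OF mem(2)[OF u]] mem(1)[OF u] by (simp add: pullback_simps(2))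
    qed
  qed
next
  fix g assume g: "g \<in> arr S"
  then have gG: "fst g \<in> arr G" by auto
  have "src S g \<in> units S" "rng S g \<in> units S" using gG by (auto simp: src_units rng_units)
  from carrier_fibre_pullback[OF this(1)] carrier_fibre_pullback[OF this(2)]
  have [simp]: "carrier (fibre P (src G (fst g), snd g + c (fst g))) = {(src G (fst g), snd g + c (fst g))} \<times> carrier (F (src G (fst g)))"
    "carrier (fibre P (rng G (fst g), snd g)) = {(rng G (fst g), snd g)} \<times> carrier (F (rng G (fst g)))" by simp_all
  show "act P g \<in> hom (fibre P (src S g)) (fibre P (rng S g))"
    using act_hom[OF gG] by (auto simp: hom_def pullback_simps fibre_pullback_simps simp del: units_skew)
next
  fix x a assume x: "x \<in> units S" and a: "a \<in> carrier (fibre P x)"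
  then show "act P x a = a"
    unfolding carrier_fibre_pullback[OF x] by (auto simp: pullback_simps act_unit rng_unit)
next
  fix g h a assume "g \<in> arr S" "h \<in> arr S" "src S g = rng S h" and a: "a \<in> carrier (fibre P (src S h))"
  moreover from this have "src S h \<in> units S" by (auto simp: src_units)
  ultimately show "act P (gmult S g h) a = act P g (act P h a)"
    using carrier_fibre_pullback[OF \<open>src S h \<in> units S\<close>]
    by (auto simp: pullback_simps rng_mult act_mult)
next
  interpret S: ample_groupoid S by (rule ample_groupoid_skew)
  let ?Z = "subtopology (prod_topology (arrows S) (total P)) {(g, a). proj P a = src S g}"
  have c1: "continuous_map ?Z (arrows S) fst" and c2: "continuous_map ?Z (total P) snd"
    by (intro continuous_map_from_subtopology continuous_map_fst continuous_map_snd)+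
  have mem: "fst (fst z) \<in> arr G" "snd (snd z) \<in> carrier (F (src G (fst (fst z))))" if "z \<in> topspace ?Z" for z
    using that by (auto simp: mem_total_pullback pullback_simps(2))
  have "continuous_map ?Z (subtopology (prod_topology (arrows G) (total A)) {(g, a). proj A a = src G g})
      (\<lambda>z. (fst (fst z), snd (snd z)))"
    using continuous_skew_fst[OF c1] continuous_pullback_snd[OF c2] mem
    by (intro continuous_map_into_prod_subtopology) (auto simp: fibre_simps)
  from continuous_map_compose[OF this act_continuous]
  have "continuous_map ?Z (total A) (\<lambda>z. act A (fst (fst z)) (snd (snd z)))" by (simp add: o_def)
  moreover have "proj A (act A (fst (fst z)) (snd (snd z))) = fst (rng S (fst z))" if "z \<in> topspace ?Z" for z
    using act_closed[OF mem[OF that]] by (simp add: fibre_simps)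
  moreover have "continuous_map ?Z (unit_space S) (\<lambda>z. rng S (fst z))"
    using continuous_map_compose[OF c1 S.continuous_rng_unit_space] by (simp add: o_def)
  ultimately have "continuous_map ?Z (total P) (\<lambda>z. (rng S (fst z), act A (fst (fst z)) (snd (snd z))))"
    by (intro continuous_into_pullback)
  then show "continuous_map ?Z (total P) (\<lambda>(g, a). act P g a)"
    by (simp add: case_prod_unfold pullback_simps(5))
qed

end

section \<open>Pullback and shift of cochains\<close>

text \<open>With \<open>m\<close> of either sign, the first factor is the signed sum from 0 to
  \<open>m\<close>, and moving the lower limit from 0 to 1 removes exactly the term at 0. For
  \<open>m \<ge> 1\<close> the intervals of the inverted products are empty, otherwise the other two
  are.\<close>

lemma (in comm_group) signed_finprod_step:
  assumes u: "\<And>j. u (j::int) \<in> carrier G"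
  shows "(finprod G u {0..<m} \<otimes> inv finprod G u {m..<0}) \<otimes> inv (finprod G u {1..<m} \<otimes> inv finprod G u {m..<1}) = u 0"
proof (cases "m \<ge> 1")
  case True
  then have "{0..<m} = insert 0 {1..<m}" "{m..<0} = {}" "{m..<1} = {}" by auto
  then show ?thesis using u by (simp add: Pi_def m_assoc)
next
  case False
  then have "{m..<1} = insert 0 {m..<0}" "{0..<m} = {}" "{1..<m} = {}" by auto
  then show ?thesis using u by (simp add: Pi_def inv_mult_group m_ac)
qed

context skew_sheaf
begin

text \<open>Shifts by all integers, negative ones included, occur in the signed sum that solves the
  equation for the identity minus the shift.\<close>

definition shiftby :: "int \<Rightarrow> 'g \<times> int \<Rightarrow> 'g \<times> int" where
  "shiftby j a = (fst a, snd a + j)"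

lemma shift_shiftby: "shift = shiftby 1"
  by (auto simp: shift_def shiftby_def)

lemma fibre_pullback_cases:
  assumes "x \<in> units S" "u \<in> carrier (fibre P x)"
  shows "u = (x, snd u)" "snd u \<in> carrier (F (fst x))"
  using assms(2) by (auto simp: carrier_fibre_pullback[OF assms(1)] simp del: units_skew)

lemma sheaf_pullback_pi: "sheaf_pullback S P G A fst Pair"
proof (intro sheaf_pullback.intro gsheaf_pullback gsheaf_axioms sheaf_pullback_axioms.intro)
  show "continuous_map (arrows S) (arrows G) fst" by (simp add: continuous_map_fst)
  show "Pair x \<in> hom (F (fst x)) (fibre P x)" if x: "x \<in> units S" for x
    unfolding hom_def carrier_fibre_pullback[OF x] by (simp add: fibre_pullback_simps)
  show "inj_on (Pair x) (carrier (F (fst x)))" for x by (auto simp: inj_on_def)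
  have "total P = subtopology (prod_topology (unit_space S) (total A)) {(x, a). proj A a = fst x}"
    by (rule pullback_simps)
  then have "continuous_map (subtopology (prod_topology (unit_space S) (total A)) {(x, a). proj A a = fst x}) (total P) (\<lambda>z. z)"
    by simp
  then show "continuous_map (subtopology (prod_topology (unit_space S) (total A)) {(x, a). proj A a = fst x}) (total P) (\<lambda>(x, a). (x, a))"
    by (simp only: case_prod_unfold prod.collapse)
qed (auto simp: pullback_simps)

text \<open>A shift leaves the underlying arrow of \<open>G\<close>, hence the fibre of
  \<open>A\<close>, unchanged, so the comparison of fibres only replaces the recorded base point.
  For \<open>j = 1\<close> this incorporates the canonical identification of the pulled back sheaf
  with the original one.\<close>

lemma sheaf_pullback_shift: "sheaf_pullback S P S P (shiftby j) (\<lambda>x a. (x, snd a))"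
proof (intro sheaf_pullback.intro gsheaf_pullback sheaf_pullback_axioms.intro)
  have id: "continuous_map (arrows S) (arrows S) (\<lambda>z. z)" by simp
  have "continuous_map (arrows S) (arrows S) (\<lambda>a. (fst a, snd a + j))"
    unfolding skew_simps using continuous_skew_fst[OF id] continuous_skew_snd[OF id]
    by (intro continuous_map_pairedI continuous_map_discrete_add) simp_all
  then show "continuous_map (arrows S) (arrows S) (shiftby j)" by (simp add: shiftby_def[abs_def])
  have u: "shiftby j x \<in> units S" if "x \<in> units S" for x using that by (auto simp: shiftby_def)
  show "(\<lambda>a. (x, snd a)) \<in> hom (fibre P (shiftby j x)) (fibre P x)" if x: "x \<in> units S" for x
    unfolding hom_def carrier_fibre_pullback[OF x] carrier_fibre_pullback[OF u[OF x]]
    by (auto simp: fibre_pullback_simps shiftby_def)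
  show "inj_on (\<lambda>a. (x, snd a)) (carrier (fibre P (shiftby j x)))" if x: "x \<in> units S" for x
    unfolding carrier_fibre_pullback[OF u[OF x]] by (auto simp: inj_on_def)
  let ?Z = "subtopology (prod_topology (unit_space S) (total P)) {(x, a). proj P a = shiftby j x}"
  have c1: "continuous_map ?Z (unit_space S) fst" and c2: "continuous_map ?Z (total P) snd"
    by (intro continuous_map_from_subtopology continuous_map_fst continuous_map_snd)+
  have "continuous_map ?Z (total P) (\<lambda>z. (fst z, snd (snd z)))"
    using c1 continuous_pullback_snd[OF c2]
    by (intro continuous_into_pullback) (auto simp: mem_total_pullback fibre_simps pullback_simps(2) shiftby_def)
  then show "continuous_map ?Z (total P) (\<lambda>(x, a). (x, snd a))" by (simp add: case_prod_unfold)
qed (auto simp: pullback_simps shiftby_def)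

interpretation SP: gsheaf S P
  by (rule gsheaf_pullback)

interpretation pi: sheaf_pullback S P G A fst Pair
  by (rule sheaf_pullback_pi)

interpretation sh: sheaf_pullback S P S P "shiftby j" "\<lambda>x a. (x, snd a)" for j
  by (rule sheaf_pullback_shift)

definition Pi_map where "Pi_map = pi.Phi"

definition Sh_map where "Sh_map = sh.Phi 1"

text \<open>The tuple over \<open>z\<close> that starts at level \<open>k\<close>: composability
  forces the later levels to be \<open>k\<close> plus partial sums of the cocycle. Every tuple of
  the skew product arises in this way from its projection and its first level.\<close>

definition nlift :: "nat \<Rightarrow> int \<Rightarrow> (nat \<Rightarrow> 'g) \<Rightarrow> nat \<Rightarrow> 'g \<times> int" where
  "nlift n k z = (\<lambda>i\<in>{..<Suc n}. (z i, k + (\<Sum>j<i. c (z j))))"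

lemma nlift_nerve: "z \<in> topspace (nerve G (Suc n)) \<Longrightarrow> nlift n k z \<in> topspace (nerve S (Suc n))"
  by (auto simp: SP.mem_nerve mem_nerve nlift_def)

lemma nmap_nlift: "z \<in> topspace (nerve G (Suc n)) \<Longrightarrow> pi.nmap n (nlift n k z) = z"
  by (auto simp: mem_nerve nlift_def pi.nmap_def extensional_def)

lemma anchor_nlift: "anchor S (nlift n k z) = (anchor G z, k)"
  by (simp add: anchor_def nlift_def)

lemma snd_nerve_skew:
  assumes y: "y \<in> topspace (nerve S (Suc n))"
  shows "i < Suc n \<Longrightarrow> snd (y i) = snd (y 0) + (\<Sum>j<i. c (fst (y j)))"
proof (induction i)
  case (Suc i)
  then have "src S (y i) = rng S (y (Suc i))" using y by (simp add: SP.mem_nerve del: skew_simps)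
  then show ?case using Suc by simp
qed simp

text \<open>A tuple is the lift of its own projection at its own first level, so lifting the
  projection to level \<open>k\<close> amounts to a shift by the difference of levels.\<close>

lemma nlift_nmap:
  assumes y: "y \<in> topspace (nerve S (Suc n))"
  shows "nlift n k (pi.nmap n y) = sh.nmap (k - snd (y 0)) n y"
proof (rule SP.nerve_eqI[OF nlift_nerve[OF pi.nmap_nerve[OF y]] sh.nmap_nerve[OF y]])
  fix i assume i: "i < Suc n"
  then have "(\<Sum>j<i. c (pi.nmap n y j)) = (\<Sum>j<i. c (fst (y j)))" by (intro sum.cong) (auto simp: pi.nmap_def)
  then show "nlift n k (pi.nmap n y) i = sh.nmap (k - snd (y 0)) n y i"
    using snd_nerve_skew[OF y i] i by (simp add: nlift_def pi.nmap_def sh.nmap_def shiftby_def)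
qed

lemma nmap_shift_shift: "sh.nmap j n (sh.nmap k n y) = sh.nmap (j + k) n y"
  by (auto simp: sh.nmap_def shiftby_def)

lemma nmap_shift_nlift: "sh.nmap j n (nlift n k z) = nlift n (k + j) z"
  by (auto simp: sh.nmap_def shiftby_def nlift_def)

lemma continuous_nlift: "continuous_map (nerve G (Suc n)) (nerve S (Suc n)) (nlift n k)"
proof (rule SP.continuous_into_nerve)
  fix i assume i: "i < Suc n"
  have cc: "continuous_map (nerve G (Suc n)) (discrete_topology UNIV) (\<lambda>z. c (z j))" if "j < Suc n" for j
    using continuous_map_compose[OF continuous_nerve_coordinate[OF that] c_continuous] by (simp add: o_def)
  have "m \<le> Suc n \<Longrightarrow> continuous_map (nerve G (Suc n)) (discrete_topology UNIV) (\<lambda>z. k + (\<Sum>j<m. c (z j)))" for m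
  proof (induction m)
    case (Suc m)
    then have "continuous_map (nerve G (Suc n)) (discrete_topology UNIV) (\<lambda>z. (k + (\<Sum>j<m. c (z j))) + c (z m))"
      by (intro continuous_map_discrete_add[where f = "\<lambda>z. k + (\<Sum>j<m. c (z j))"] cc) auto
    then show ?case by (simp add: add.assoc)
  qed simp
  then have "continuous_map (nerve G (Suc n)) (arrows S) (\<lambda>z. (z i, k + (\<Sum>j<i. c (z j))))"
    unfolding skew_simps using i by (intro continuous_map_pairedI continuous_nerve_coordinate) auto
  then show "continuous_map (nerve G (Suc n)) (arrows S) (\<lambda>z. nlift n k z i)" using i by (simp add: nlift_def)
qed (rule nlift_nerve)

text \<open>Translation adds \<open>c g\<close> to the nonempty partial sums, so a lift of the
  translate at level \<open>k\<close> comes from a lift of \<open>z\<close> at level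
  \<open>k + c g\<close>. Lifting to a fixed level is therefore not equivariant in general.\<close>

lemma nlift_translate:
  assumes g: "g \<in> arr G" and z: "z \<in> topspace (nerve G (Suc n))" and gz: "src G g = anchor G z"
  shows "nlift n k (translate G g z) = translate S (g, k) (nlift n (k + c g) z)"
proof -
  have z0: "c (gmult G g (z 0)) = c g + c (z 0)"
    using c_mult[OF g nerve_arr[OF z]] gz by (simp add: anchor_def)
  \<comment> \<open>Only for positive \<open>i\<close> does the sum contain the altered entry 0. At
    \<open>i = 0\<close> both tuples have level \<open>k\<close>, because a product in the skew
    product keeps the level of its left factor.\<close>
  have "(\<Sum>j<i. c (translate G g z j)) = c g + (\<Sum>j<i. c (z j))" if "0 < i" for i
  proof -
    have "(\<Sum>j<i. c (translate G g z j)) = c (translate G g z 0) + (\<Sum>j\<in>{..<i} - {0}. c (translate G g z j))"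
      using that by (intro sum.remove) auto
    also have "(\<Sum>j\<in>{..<i} - {0}. c (translate G g z j)) = (\<Sum>j\<in>{..<i} - {0}. c (z j))"
      by (intro sum.cong) (auto simp: translate_def)
    also have "c (translate G g z 0) + \<dots> = c g + (c (z 0) + (\<Sum>j\<in>{..<i} - {0}. c (z j)))"
      by (simp add: translate_def z0)
    also have "c (z 0) + (\<Sum>j\<in>{..<i} - {0}. c (z j)) = (\<Sum>j<i. c (z j))"
      using that by (intro sum.remove[symmetric]) auto
    finally show ?thesis .
  qed
  then show ?thesis
    by (auto simp: fun_eq_iff nlift_def translate_def)
qed

lemma ngerm_Pi:
  "h \<in> NHom n \<Longrightarrow> y \<in> topspace (nerve S (Suc n)) \<Longrightarrow> SP.ngerm n (Pi_map n h) y = (anchor S y, ngerm n h (pi.nmap n y))"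
  unfolding Pi_map_def by (rule pi.ngerm_Phi)

lemma ngerm_Sh:
  "h \<in> SP.NHom n \<Longrightarrow> y \<in> topspace (nerve S (Suc n)) \<Longrightarrow> SP.ngerm n (Sh_map n h) y = (anchor S y, snd (SP.ngerm n h (sh.nmap 1 n y)))"
  unfolding Sh_map_def by (rule sh.ngerm_Phi)

lemma Pi_closed: "h \<in> NHom n \<Longrightarrow> Pi_map n h \<in> SP.NHom n"
  unfolding Pi_map_def by (rule pi.Phi_NHom)

lemma Sh_closed: "h \<in> SP.NHom n \<Longrightarrow> Sh_map n h \<in> SP.NHom n"
  unfolding Sh_map_def by (rule sh.Phi_NHom)

text \<open>Every tuple of \<open>G\<close> is the projection of its lift at level 0, so no germ is
  lost under pullback.\<close>

lemma Pi_inj: "inj_on (Pi_map n) (NHom n)"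
proof (rule inj_onI)
  fix h h' assume h: "h \<in> NHom n" "h' \<in> NHom n" and eq: "Pi_map n h = Pi_map n h'"
  show "h = h'"
  proof (rule NHom_eqI[OF h])
    fix z assume z: "z \<in> topspace (nerve G (Suc n))"
    have "SP.ngerm n (Pi_map n h) (nlift n 0 z) = SP.ngerm n (Pi_map n h') (nlift n 0 z)" using eq by simp
    then show "ngerm n h z = ngerm n h' z"
      using ngerm_Pi[OF h(1) nlift_nerve[OF z]] ngerm_Pi[OF h(2) nlift_nerve[OF z]] nmap_nlift[OF z] by simp
  qed
qed

lemma ngerm_fst: "h \<in> SP.NHom n \<Longrightarrow> y \<in> topspace (nerve S (Suc n)) \<Longrightarrow> SP.ngerm n h y = (anchor S y, snd (SP.ngerm n h y))"
  by (rule fibre_pullback_cases(1)[OF SP.anchor_units SP.ngerm_carrier])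

text \<open>The fixed point equation relates the germ at a tuple to the germ at its shift by 1;
  applied at shifted tuples, induction in both directions reaches every integer.\<close>

lemma Sh_invariant:
  assumes h: "h \<in> SP.NHom n" "Sh_map n h = h" and y: "y \<in> topspace (nerve S (Suc n))"
  shows "snd (SP.ngerm n h (sh.nmap j n y)) = snd (SP.ngerm n h y)"
proof (induction j rule: int_induct[of _ 0])
  case base
  have "sh.nmap 0 n y = y"
    by (rule SP.nerve_eqI[OF sh.nmap_nerve[OF y] y]) (simp add: sh.nmap_def shiftby_def)
  then show ?case by simp
next
  case (step1 j)
  have "snd (SP.ngerm n h (sh.nmap j n y)) = snd (SP.ngerm n h (sh.nmap 1 n (sh.nmap j n y)))"
    using ngerm_Sh[OF h(1) sh.nmap_nerve[OF y], of j] h(2) by simp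
  then show ?case using step1 by (simp add: nmap_shift_shift add.commute)
next
  case (step2 j)
  have "snd (SP.ngerm n h (sh.nmap (j - 1) n y)) = snd (SP.ngerm n h (sh.nmap 1 n (sh.nmap (j - 1) n y)))"
    using ngerm_Sh[OF h(1) sh.nmap_nerve[OF y], of "j - 1"] h(2) by simp
  then show ?case using step2 by (simp add: nmap_shift_shift)
qed

lemma Sh_Pi:
  assumes h: "h \<in> NHom n"
  shows "Sh_map n (Pi_map n h) = Pi_map n h"
proof (rule SP.NHom_eqI[OF Sh_closed[OF Pi_closed[OF h]] Pi_closed[OF h]])
  fix y assume y: "y \<in> topspace (nerve S (Suc n))"
  have "pi.nmap n (sh.nmap 1 n y) = pi.nmap n y" by (auto simp: pi.nmap_def sh.nmap_def shiftby_def)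
  then show "SP.ngerm n (Sh_map n (Pi_map n h)) y = SP.ngerm n (Pi_map n h) y"
    using ngerm_Sh[OF Pi_closed[OF h] y] ngerm_Pi[OF h sh.nmap_nerve[OF y, of 1]] ngerm_Pi[OF h y] by simp
qed

text \<open>The preimage is the family of germs along the lifts at level 0. Shift invariance is used
  twice: for equivariance, since translation by \<open>g\<close> involves the lift at level
  \<open>c g\<close>, and to recover the germs on all levels from those at level 0.\<close>

lemma Pi_image:
  assumes h: "h \<in> SP.NHom n" "Sh_map n h = h"
  shows "h \<in> Pi_map n ` NHom n"
proof -
  define \<phi> where "\<phi> z = snd (SP.ngerm n h (nlift n 0 z))" for z
  note nc = SP.ngerm_carrier[OF h(1)]
  have \<phi>: "neqsec n \<phi>"
    unfolding neqsec_def
  proof (intro conjI ballI impI)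
    have "SP.lift (nerve S (Suc n)) (anchor S) (SP.ngerm n h)"
      using SP.ngerm_neqsec[OF h(1)] by (simp add: SP.neqsec_def)
    from SP.lift_continuous[OF this] have c: "continuous_map (nerve S (Suc n)) (total P) (SP.ngerm n h)" .
    have "continuous_map (nerve G (Suc n)) (total A) \<phi>"
      using continuous_pullback_snd[OF continuous_map_compose[OF continuous_nlift c]] by (simp add: \<phi>_def[abs_def] o_def)
    moreover have "\<phi> z \<in> carrier (F (anchor G z))" if z: "z \<in> topspace (nerve G (Suc n))" for z
      using fibre_pullback_cases(2)[OF SP.anchor_units nc, OF nlift_nerve[OF z] nlift_nerve[OF z], of 0]
      by (simp add: \<phi>_def anchor_nlift)
    ultimately show "lift (nerve G (Suc n)) (anchor G) \<phi>"
      using continuous_anchor by (simp add: lift_def)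
    fix g z assume g: "g \<in> arr G" and z: "z \<in> topspace (nerve G (Suc n))" and gz: "src G g = anchor G z"
    have "SP.ngerm n h (translate S (g, 0) (nlift n (c g) z)) = act P (g, 0) (SP.ngerm n h (nlift n (c g) z))"
      using SP.ngerm_neqsec[OF h(1)] nlift_nerve[OF z] g gz by (simp add: SP.neqsec_def anchor_nlift)
    then have "\<phi> (translate G g z) = act A g (snd (SP.ngerm n h (nlift n (c g) z)))"
      using nlift_translate[OF g z gz, of 0] by (simp add: \<phi>_def pullback_simps)
    also have "snd (SP.ngerm n h (nlift n (c g) z)) = \<phi> z"
      using Sh_invariant[OF h nlift_nerve[OF z], of "c g" 0] by (simp add: \<phi>_def nmap_shift_nlift)
    finally show "\<phi> (translate G g z) = act A g (\<phi> z)" .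
  qed
  have "h = Pi_map n (nev n \<phi>)"
  proof (rule SP.NHom_eqI[OF h(1) Pi_closed[OF nev_NHom[OF \<phi>]]])
    fix y assume y: "y \<in> topspace (nerve S (Suc n))"
    have "SP.ngerm n (Pi_map n (nev n \<phi>)) y = (anchor S y, \<phi> (pi.nmap n y))"
      using ngerm_Pi[OF nev_NHom[OF \<phi>] y] ngerm_nev[OF \<phi> pi.nmap_nerve[OF y]] by simp
    also have "\<phi> (pi.nmap n y) = snd (SP.ngerm n h y)"
      using Sh_invariant[OF h y] by (simp add: \<phi>_def nlift_nmap[OF y])
    finally show "SP.ngerm n h y = SP.ngerm n (Pi_map n (nev n \<phi>)) y" using ngerm_fst[OF h(1) y] by simp
  qed
  then show ?thesis using nev_NHom[OF \<phi>] by blast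
qed

text \<open>
  The equation \<open>k - c\<^sup>* k = h\<close> is solved by a signed sum of the shifts of \<open>h\<close>. Summing from
  the level of the range up to the level at which the source of the first arrow sits at \<open>0\<close>
  makes the sum equivariant, since that level is not changed by left translation.
\<close>

lemma id_minus_Sh_surj:
  assumes h: "h \<in> SP.NHom n"
  shows "\<exists>k\<in>SP.NHom n. k \<otimes>\<^bsub>cochains S (section_module S P) n\<^esub> inv\<^bsub>cochains S (section_module S P) n\<^esub> (Sh_map n k) = h"
proof -
  interpret C: comm_group "cochains S (section_module S P) n" by (rule SP.comm_group_NHom)
  let ?N = "nerve S (Suc n)"
  let ?F = "\<lambda>y. fibre P (anchor S y)"
  \<comment> \<open>The germs of the shift of \<open>h\<close> by \<open>j\<close>, moved into the
    fibre over \<open>y\<close> so that they can be added.\<close>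
  define u where "u j = sh.pull j n (SP.ngerm n h)" for j
  have u: "SP.neqsec n (u j)" for j unfolding u_def by (rule sh.pull_neqsec[OF SP.ngerm_neqsec[OF h]])
  have u_eq: "u j y = (anchor S y, snd (SP.ngerm n h (sh.nmap j n y)))" for j y by (simp add: u_def sh.pull_def)
  have uc: "u j y \<in> carrier (?F y)" if "y \<in> topspace ?N" for j y using u that by (rule SP.neqsec_carrier)
  define e where "e y = snd (src S (y 0))" for y :: "nat \<Rightarrow> 'g \<times> int"
  define D0 where "D0 m y = finprod (?F y) (\<lambda>j. u j y) {0..<m} \<otimes>\<^bsub>?F y\<^esub> inv\<^bsub>?F y\<^esub> finprod (?F y) (\<lambda>j. u j y) {m..<0}"
    for m and y :: "nat \<Rightarrow> 'g \<times> int"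
  \<comment> \<open>Shifting by \<open>- e y\<close> brings the source of the first arrow to level
    0. Replacing \<open>y\<close> by its shift by 1 lowers this upper limit by 1 and raises the
    indices of the terms by 1, so that in total only the lower limit changes, from 0 to 1.\<close>
  define D where "D y = D0 (- e y) y" for y
  have lu: "SP.lift ?N (anchor S) (u j)" for j using u by (simp add: SP.neqsec_def)
  have lD0: "SP.lift ?N (anchor S) (D0 m)" for m
    unfolding D0_def by (intro SP.lift_add SP.lift_inv SP.lift_finprod SP.continuous_anchor lu) auto
  have D: "SP.neqsec n D"
    unfolding SP.neqsec_def
  proof (intro conjI ballI impI)
    show "SP.lift ?N (anchor S) D"
    proof (rule SP.lift_local[OF SP.continuous_anchor])
      fix y assume y: "y \<in> topspace ?N"
      have "continuous_map ?N (arrows S) (\<lambda>y. src S (y 0))"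
        using continuous_map_compose[OF SP.continuous_nerve_coordinate SP.continuous_src, of 0 "Suc n"] by (simp add: o_def del: skew_simps)
      \<comment> \<open>Being continuous and integer-valued, \<open>e\<close> is locally constant,
        so near \<open>y\<close> the limits of summation are fixed and \<open>D\<close> is a finite
        combination of lifts.\<close>
      then have "continuous_map ?N (discrete_topology UNIV) e"
        unfolding e_def[abs_def] by (rule continuous_skew_snd)
      then have "openin ?N {z \<in> topspace ?N. e z = e y}" by (simp add: continuous_map_discrete_iff)
      moreover have "D w = D0 (- e y) w" if "e w = e y" for w using that by (simp add: D_def)
      ultimately show "\<exists>N v. openin ?N N \<and> y \<in> N \<and> SP.lift (subtopology ?N N) (anchor S) v \<and> (\<forall>w\<in>N. D w = v w)"
        using y SP.lift_subtopology[OF lD0] by (intro exI[of _ "{z \<in> topspace ?N. e z = e y}"] exI[of _ "D0 (- e y)"]) auto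
    qed
    fix g y assume g: "g \<in> arr S" and y: "y \<in> topspace ?N" and gy: "src S g = anchor S y"
    have y0: "y 0 \<in> arr S" using y by (simp add: SP.nerve_arr del: skew_simps)
    have "src S g = rng S (y 0)" using gy by (simp add: anchor_def)
    from SP.src_mult[OF g y0 this] have eg: "e (translate S g y) = e y"
      by (simp add: e_def translate_def)
    from SP.rng_mult[OF g y0 \<open>src S g = rng S (y 0)\<close>] have ag: "anchor S (translate S g y) = rng S g"
      by (simp add: anchor_def translate_def)
    interpret h: group_hom "fibre P (src S g)" "fibre P (rng S g)" "act P g" using g by (rule SP.act_group_hom)
    have fp: "finprod (fibre P (rng S g)) (\<lambda>j. u j (translate S g y)) I = act P g (finprod (?F y) (\<lambda>j. u j y) I)" for I
    proof -
      have "u j (translate S g y) = act P g (u j y)" for j using u g y gy by (simp add: SP.neqsec_def del: skew_simps)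
      moreover have "act P g (finprod (fibre P (src S g)) (\<lambda>j. u j y) I) = finprod (fibre P (rng S g)) (\<lambda>j. act P g (u j y)) I"
        using uc[OF y] gy SP.src_units[OF g] SP.rng_units[OF g]
        by (intro hom_finprod SP.fibre_comm_group SP.act_hom[OF g] Pi_I) (simp_all del: skew_simps)
      ultimately show ?thesis using gy by (simp del: skew_simps)
    qed
    have Fy: "?F y = fibre P (src S g)" using gy by simp
    have fc: "finprod (?F y) (\<lambda>j. u j y) I \<in> carrier (?F y)" for I
      using uc[OF y] by (intro comm_monoid.finprod_closed[OF SP.fibre_comm_monoid[OF SP.anchor_units[OF y]]] Pi_I)
    show "D (translate S g y) = act P g (D y)"
      unfolding D_def D0_def eg ag fp
      using h.hom_mult h.hom_inv fc unfolding Fy by (simp del: skew_simps)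
  qed
  have "nev_D": "SP.nev n D \<in> SP.NHom n" using D by (rule SP.nev_NHom)
  have "SP.nev n D \<otimes>\<^bsub>cochains S (section_module S P) n\<^esub> inv\<^bsub>cochains S (section_module S P) n\<^esub> (Sh_map n (SP.nev n D)) = h"
  proof (rule SP.NHom_eqI[OF _ h])
    show "SP.nev n D \<otimes>\<^bsub>cochains S (section_module S P) n\<^esub> inv\<^bsub>cochains S (section_module S P) n\<^esub> (Sh_map n (SP.nev n D)) \<in> SP.NHom n"
      using nev_D Sh_closed[OF nev_D] by simp
    fix y assume y: "y \<in> topspace ?N"
    let ?x = "anchor S y"
    have x: "?x \<in> units S" using y by (rule SP.anchor_units)
    interpret Fx: comm_group "?F y" using x by (rule SP.fibre_comm_group)
    let ?y' = "sh.nmap 1 n y"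
    have y': "?y' \<in> topspace ?N" using y by (rule sh.nmap_nerve)
    have ay': "anchor S ?y' = shiftby 1 ?x" using y by (rule sh.anchor_nmap)
    have x': "anchor S ?y' \<in> units S" using y' by (rule SP.anchor_units)
    interpret Fx': comm_group "?F ?y'" using x' by (rule SP.fibre_comm_group)
    have "(\<lambda>a. (?x, snd a)) \<in> hom (?F ?y') (?F y)" using sh.\<kappa>_hom[OF x] unfolding ay' .
    then interpret k: group_hom "?F ?y'" "?F y" "\<lambda>a. (?x, snd a)"
      by (simp add: group_hom_def group_hom_axioms_def Fx.is_group Fx'.is_group)
    \<comment> \<open>Transport into the fibre over \<open>y\<close> turns the term of index
      \<open>j\<close> at the shifted tuple into the term of index \<open>j + 1\<close> at
      \<open>y\<close>.\<close>
    have ku: "(?x, snd (u j ?y')) = u (j + 1) y" for j by (simp add: u_eq nmap_shift_shift)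
    have fp: "(?x, snd (finprod (?F ?y') (\<lambda>j. u j ?y') {a..<b})) = finprod (?F y) (\<lambda>j. u j y) {a + 1..<b + 1}" for a b
    proof -
      have "(?x, snd (finprod (?F ?y') (\<lambda>j. u j ?y') {a..<b})) = finprod (?F y) (\<lambda>j. (?x, snd (u j ?y'))) {a..<b}"
        using uc[OF y'] by (intro hom_finprod[OF Fx'.comm_group_axioms Fx.comm_group_axioms k.homh] Pi_I)
      also have "\<dots> = finprod (?F y) (\<lambda>j. u (j + 1) y) {a..<b}" by (simp only: ku)
      also have "\<dots> = finprod (?F y) (\<lambda>j. u j y) ((\<lambda>j. j + 1) ` {a..<b})"
        using uc[OF y] by (intro Fx.finprod_reindex[symmetric]) auto
      also have "(\<lambda>j. j + 1) ` {a..<b} = {a + 1..<b + 1}" by (rule image_add_atLeastLessThan')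
      finally show ?thesis .
    qed
    have fc: "finprod (?F ?y') (\<lambda>j. u j ?y') I \<in> carrier (?F ?y')" for I
      using uc[OF y'] by (intro Fx'.finprod_closed Pi_I)
    have e': "e ?y' = e y + 1" by (simp add: e_def sh.nmap_def shiftby_def)
    have "SP.ngerm n (Sh_map n (SP.nev n D)) y = (?x, snd (D ?y'))"
      using ngerm_Sh[OF nev_D y] SP.ngerm_nev[OF D y'] by simp
    also have "\<dots> = finprod (?F y) (\<lambda>j. u j y) {1..<- e y} \<otimes>\<^bsub>?F y\<^esub> inv\<^bsub>?F y\<^esub> finprod (?F y) (\<lambda>j. u j y) {- e y..<1}"
      unfolding D_def D0_def e'
      using k.hom_mult[OF fc Fx'.inv_closed[OF fc]] k.hom_inv[OF fc] fp[of 0 "- (e y + 1)"] fp[of "- (e y + 1)" 0] by simp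
    finally have S: "SP.ngerm n (Sh_map n (SP.nev n D)) y =
      finprod (?F y) (\<lambda>j. u j y) {1..<- e y} \<otimes>\<^bsub>?F y\<^esub> inv\<^bsub>?F y\<^esub> finprod (?F y) (\<lambda>j. u j y) {- e y..<1}" .
    have "SP.ngerm n (SP.nev n D \<otimes>\<^bsub>cochains S (section_module S P) n\<^esub> inv\<^bsub>cochains S (section_module S P) n\<^esub> (Sh_map n (SP.nev n D))) y
      = D y \<otimes>\<^bsub>?F y\<^esub> inv\<^bsub>?F y\<^esub> (SP.ngerm n (Sh_map n (SP.nev n D)) y)"
      using SP.ngerm_mult[OF nev_D C.inv_closed[OF Sh_closed[OF nev_D]] y] SP.ngerm_inv[OF Sh_closed[OF nev_D] y]
        SP.ngerm_nev[OF D y] by simp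
    also have "\<dots> = u 0 y"
      unfolding S D_def D0_def using uc[OF y] by (rule Fx.signed_finprod_step)
    also have "\<dots> = SP.ngerm n h y"
    proof -
      have "sh.nmap 0 n y = y"
        by (rule SP.nerve_eqI[OF sh.nmap_nerve[OF y] y]) (simp add: sh.nmap_def shiftby_def)
      then show ?thesis using ngerm_fst[OF h y] by (simp add: u_eq)
    qed
    finally show "SP.ngerm n (SP.nev n D \<otimes>\<^bsub>cochains S (section_module S P) n\<^esub> inv\<^bsub>cochains S (section_module S P) n\<^esub> (Sh_map n (SP.nev n D))) y = SP.ngerm n h y" .
  qed
  then show ?thesis using nev_D by blast
qed

lemma Pi_hom: "Pi_map n \<in> hom (cochains G (section_module G A) n) (cochains S (section_module S P) n)"
  unfolding Pi_map_def by (rule pi.Phi_hom)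

lemma Sh_hom: "Sh_map n \<in> hom (cochains S (section_module S P) n) (cochains S (section_module S P) n)"
  unfolding Sh_map_def by (rule sh.Phi_hom)

lemma Pi_coboundary: "h \<in> NHom n \<Longrightarrow> Pi_map (Suc n) (coboundary_map G n h) = coboundary_map S n (Pi_map n h)"
  unfolding Pi_map_def by (rule pi.Phi_coboundary)

lemma Sh_coboundary: "h \<in> SP.NHom n \<Longrightarrow> Sh_map (Suc n) (coboundary_map S n h) = coboundary_map S n (Sh_map n h)"
  unfolding Sh_map_def by (rule sh.Phi_coboundary)

lemma Pi_pullback_cochain: "h \<in> NHom n \<Longrightarrow> pullback_cochain S G fst A n h = Pi_map n h"
  unfolding Pi_map_def by (simp only: pi.Phi_apply pullback_cochain_def SP.nerve_module_simps)

text \<open>Pulling back along \<open>shift\<close> yields points with two nested base points. The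
  identification discards the inner one, and this is the comparison of fibres built into
  \<open>Sh_map\<close>.\<close>

lemma Sh_pullback_cochain:
  assumes "h \<in> SP.NHom n"
  shows "change_coefficients S n (shift_identification G c) (pullback_cochain S S shift P n h) = Sh_map n h"
  unfolding Sh_map_def sh.Phi_apply[OF assms] change_coefficients_def pullback_cochain_def shift_identification_def
    SP.nerve_module_simps shift_shiftby
  by (intro restrict_ext) simp

end

section \<open>The associated sheaf\<close>

locale module_groupoid = ample_groupoid G for G :: "'g groupoid" +
  fixes M :: "('g \<Rightarrow> int, 'm) module"
  assumes module: "groupoid_module G M"
begin

sublocale M: abelian_group M
  using module by (simp add: groupoid_module_def)

interpretation AG: gspace G "arrows G" "rng G" "gmult G"
  by (rule gspace_arrows)

section \<open>Indicators acting on the module and local units\<close>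

abbreviation E :: "'g set \<Rightarrow> 'm \<Rightarrow> 'm" where "E U m \<equiv> indicator U \<odot>\<^bsub>M\<^esub> m"

abbreviation unit_co :: "'g set \<Rightarrow> bool" where "unit_co U \<equiv> compact_open (unit_space G) U"

lemma smult_closed [simp]: "f \<in> Zfun (arrows G) \<Longrightarrow> m \<in> carrier M \<Longrightarrow> f \<odot>\<^bsub>M\<^esub> m \<in> carrier M"
  using module by (simp add: groupoid_module_def)

lemma smult_add: "f \<in> Zfun (arrows G) \<Longrightarrow> m \<in> carrier M \<Longrightarrow> m' \<in> carrier M \<Longrightarrow> f \<odot>\<^bsub>M\<^esub> (m \<oplus>\<^bsub>M\<^esub> m') = f \<odot>\<^bsub>M\<^esub> m \<oplus>\<^bsub>M\<^esub> f \<odot>\<^bsub>M\<^esub> m'"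
  using module by (simp add: groupoid_module_def)

lemma add_smult: "f \<in> Zfun (arrows G) \<Longrightarrow> f' \<in> Zfun (arrows G) \<Longrightarrow> m \<in> carrier M \<Longrightarrow>
    (\<lambda>g. f g + f' g) \<odot>\<^bsub>M\<^esub> m = f \<odot>\<^bsub>M\<^esub> m \<oplus>\<^bsub>M\<^esub> f' \<odot>\<^bsub>M\<^esub> m"
  using module by (simp add: groupoid_module_def)

lemma smult_convolution: "f \<in> Zfun (arrows G) \<Longrightarrow> f' \<in> Zfun (arrows G) \<Longrightarrow> m \<in> carrier M \<Longrightarrow>
    f \<odot>\<^bsub>M\<^esub> (f' \<odot>\<^bsub>M\<^esub> m) = AG.smulX f f' \<odot>\<^bsub>M\<^esub> m"
  using module by (simp add: groupoid_module_def convolution_smul)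

lemma smodule_M: "smodule G M"
  using module by (rule groupoid_module_smodule)

lemmas smult_zero_uminus = smodule_zero_inv[OF smodule_M]

lemma E_closed: "unit_co U \<Longrightarrow> m \<in> carrier M \<Longrightarrow> E U m \<in> carrier M"
  by (simp add: indicator_units)

lemma E_bisection_closed: "compact_open_bisection G B \<Longrightarrow> m \<in> carrier M \<Longrightarrow> E B m \<in> carrier M"
  by (simp add: indicator_bisection)

text \<open>Compatibility of the action with convolution is combined with the rule that the product
  of two indicators is the indicator of the product set.\<close>

lemma E_E:
  assumes B: "compact_open_bisection G B" and V: "compact_open (arrows G) V" and m: "m \<in> carrier M"
  shows "E B (E V m) = E (AG.bis_act B V) m"
  using smult_convolution[OF indicator_bisection[OF B] Zfun_indicator[OF hausdorff V] m]
    AG.smul_indicator[of B V] B compact_open_subset[OF V]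
  by (simp add: compact_open_bisection_def compact_open_subset)

lemma E_units_left:
  assumes U: "unit_co U" and V: "compact_open (arrows G) V" and m: "m \<in> carrier M"
  shows "E U (E V m) = E {h \<in> V. rng G h \<in> U} m"
proof -
  have Vs: "V \<subseteq> arr G" using V by (rule compact_open_subset)
  have Us: "U \<subseteq> units G" using U compact_open_unit_space by blast
  have "AG.bis_act U V = {h \<in> V. rng G h \<in> U}"
  proof (intro equalityI subsetI)
    fix z assume "z \<in> AG.bis_act U V"
    then obtain u h where "z = gmult G u h" "u \<in> U" "h \<in> V" "src G u = rng G h" by (auto simp: AG.bis_act_def)
    moreover from this have "u = rng G h" using src_unit Us by auto
    ultimately show "z \<in> {h \<in> V. rng G h \<in> U}" using left_unit Vs by auto
  next
    fix h assume "h \<in> {h \<in> V. rng G h \<in> U}"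
    then have "h = gmult G (rng G h) h" "src G (rng G h) = rng G h" "rng G h \<in> U" "h \<in> V"
      using left_unit src_unit Vs Us by auto
    then show "h \<in> AG.bis_act U V" unfolding AG.bis_act_def by blast
  qed
  then show ?thesis using E_E[OF units_bisection[OF U] V m] by simp
qed

lemma E_units_right:
  assumes B: "compact_open_bisection G B" and U: "unit_co U" and m: "m \<in> carrier M"
  shows "E B (E U m) = E {h \<in> B. src G h \<in> U} m"
proof -
  have Us: "U \<subseteq> units G" and U': "compact_open (arrows G) U" using U compact_open_unit_space by blast+
  have "AG.bis_act B U = {h \<in> B. src G h \<in> U}"
  proof (intro equalityI subsetI)
    fix z assume "z \<in> AG.bis_act B U"
    then obtain h u where z: "z = gmult G h u" "u \<in> U" "h \<in> B" "src G h = rng G u" by (auto simp: AG.bis_act_def)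
    have "rng G u = u" using rng_unit Us z(2) by blast
    then have s: "src G h = u" using z(4) by simp
    have "z = h" using right_unit[OF bisection_arr[OF B z(3)]] unfolding s z(1) .
    then show "z \<in> {h \<in> B. src G h \<in> U}" using s z(2,3) by simp
  next
    fix h assume "h \<in> {h \<in> B. src G h \<in> U}"
    then have h: "src G h \<in> U" "h \<in> B" by auto
    have "h = gmult G h (src G h)" using right_unit[OF bisection_arr[OF B h(2)]] by simp
    moreover have "src G h = rng G (src G h)" using rng_unit Us h(1) by auto
    ultimately show "h \<in> AG.bis_act B U" unfolding AG.bis_act_def using h by blast
  qed
  then show ?thesis using E_E[OF B U' m] by simp
qed

lemma E_Int:
  assumes "unit_co U" "unit_co W" "m \<in> carrier M"
  shows "E U (E W m) = E (U \<inter> W) m"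
proof -
  have "W \<subseteq> units G" and W: "compact_open (arrows G) W" using assms(2) compact_open_unit_space by blast+
  then have "{h \<in> W. rng G h \<in> U} = U \<inter> W" using rng_unit by auto
  then show ?thesis using E_units_left[OF assms(1) W assms(3)] by simp
qed

lemma unit_co_Int: "unit_co U \<Longrightarrow> unit_co W \<Longrightarrow> unit_co (U \<inter> W)"
  by (rule compact_open_Int[OF Hausdorff_unit_space])

lemma E_subset:
  assumes "unit_co U" "unit_co W" "W \<subseteq> U" "m \<in> carrier M"
  shows "E W (E U m) = E W m"
  using E_Int[OF assms(2,1,4)] assms(3) by (simp add: Int_absorb2)

lemma E_add: "unit_co U \<Longrightarrow> m \<in> carrier M \<Longrightarrow> m' \<in> carrier M \<Longrightarrow> E U (m \<oplus>\<^bsub>M\<^esub> m') = E U m \<oplus>\<^bsub>M\<^esub> E U m'"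
  by (simp add: smult_add indicator_units)

lemma E_disjoint_Un:
  assumes "unit_co U" "unit_co W" "U \<inter> W = {}" "m \<in> carrier M"
  shows "E (U \<union> W) m = E U m \<oplus>\<^bsub>M\<^esub> E W m"
proof -
  have "indicator (U \<union> W) = (\<lambda>g. indicator U g + indicator W g :: int)"
    using assms(3) by (auto simp: indicator_def fun_eq_iff)
  then show ?thesis using add_smult[OF indicator_units[OF assms(1)] indicator_units[OF assms(2)] assms(4)] by simp
qed

text \<open>The zero function is its own sum with itself, so its action on \<open>m\<close> is
  idempotent for addition and cancels.\<close>

lemma smult_zero_left_M: "m \<in> carrier M \<Longrightarrow> (\<lambda>g. 0) \<odot>\<^bsub>M\<^esub> m = \<zero>\<^bsub>M\<^esub>"
  using add_smult[OF Zfun_zero Zfun_zero, of m] smult_closed[OF Zfun_zero, of m]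
  by (metis M.add.r_cancel_one' add_0)

text \<open>The ranges of the support of \<open>f\<close> form a compact open set of units. In the
  convolution of its indicator with \<open>f\<close> only the term with a unit on the left survives,
  so the indicator is a left local unit for \<open>f\<close>.\<close>

lemma smul_units_support:
  assumes f: "f \<in> Zfun (arrows G)"
  shows "unit_co (rng G ` {g. f g \<noteq> 0})" "AG.smulX (indicator (rng G ` {g. f g \<noteq> 0})) f = f"
proof -
  let ?U = "rng G ` {g. f g \<noteq> 0}"
    have U: "unit_co ?U" using Zfun_supp[OF f] by (rule compact_open_rng)
    have Us: "?U \<subseteq> units G" using U[THEN compact_open_unit_space[THEN iffD1]] by (rule conjunct2)
    show "unit_co ?U" by (rule U)
    show "AG.smulX (indicator ?U) f = f"
    proof
      fix g
      show "AG.smulX (indicator ?U) f g = f g"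
      proof (cases "g \<in> arr G")
        case True
        have "AG.smulX (indicator ?U) f g = indicator ?U (ginv G (rng G g)) * f (gmult G (rng G g) g)"
          unfolding smul_def using True
        proof (subst sum'_single[where a = "rng G g"])
          fix h assume h: "h \<in> {h \<in> arr G. src G h = rng G g}" "h \<noteq> rng G g"
          have "ginv G h \<notin> ?U"
          proof
            assume "ginv G h \<in> ?U"
            then have "ginv G h \<in> units G" using Us by blast
            then have "h \<in> units G" using inv_unit inv_inv h by (metis (no_types, lifting) mem_Collect_eq)
            then show False using h src_unit by auto
          qed
          then show "indicator ?U (ginv G h) * f (gmult G h g) = 0" by simp
        qed (use True rng_units src_unit units_arr in auto)
        then show ?thesis using True by (auto simp: left_unit inv_unit rng_units indicator_def)
      qed (use Zfun_outside[OF f] in \<open>simp add: smul_def\<close>)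
    qed
qed

text \<open>This is where the condition that products generate \<open>M\<close> enters: each product
  has a local unit, negation keeps it, and for a sum the union of the two unit sets serves both
  terms.\<close>

lemma E_unit_exists:
  assumes "m \<in> carrier M"
  shows "\<exists>U. unit_co U \<and> E U m = m"
proof -
  have "m \<in> generate (add_monoid M) {f \<odot>\<^bsub>M\<^esub> m | f m. f \<in> Zfun (arrows G) \<and> m \<in> carrier M}"
    using module assms by (simp add: groupoid_module_def)
  then have "m \<in> carrier M \<and> (\<exists>U. unit_co U \<and> E U m = m)"
  proof (induction rule: generate.induct)
    case one
    have "unit_co {}" by simp
    then have "E {} \<zero>\<^bsub>M\<^esub> = \<zero>\<^bsub>M\<^esub>" by (intro smult_zero_uminus indicator_units)
    then show ?case by (intro conjI exI[of _ "{}"]) (simp_all add: smult_zero_left_M)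
  next
    case (incl m)
    then obtain f m0 where m: "m = f \<odot>\<^bsub>M\<^esub> m0" "f \<in> Zfun (arrows G)" "m0 \<in> carrier M" by auto
    let ?U = "rng G ` {g. f g \<noteq> 0}"
    note U = smul_units_support(1)[OF m(2)]
    have "E ?U m = m" using smult_convolution[OF indicator_units[OF U] m(2,3)] smul_units_support(2)[OF m(2)] m by simp
    then show ?case using U m by auto
  next
    case (inv m)
    then obtain f m0 where m: "m = f \<odot>\<^bsub>M\<^esub> m0" "f \<in> Zfun (arrows G)" "m0 \<in> carrier M" by auto
    then have mc: "m \<in> carrier M" by simp
    let ?U = "rng G ` {g. f g \<noteq> 0}"
    note U = smul_units_support(1)[OF m(2)]
    have "E ?U m = m" using smult_convolution[OF indicator_units[OF U] m(2,3)] smul_units_support(2)[OF m(2)] m by simp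
    then have "E ?U (\<ominus>\<^bsub>M\<^esub> m) = \<ominus>\<^bsub>M\<^esub> m" using smult_zero_uminus(2)[OF indicator_units[OF U] mc] by simp
    then show ?case using U mc by (auto simp: a_inv_def[symmetric])
  next
    case (eng m m')
    then obtain U U' where U: "unit_co U" "E U m = m" and U': "unit_co U'" "E U' m' = m'" 
      and mc: "m \<in> carrier M" "m' \<in> carrier M" by auto
    have UU: "unit_co (U \<union> U')" using U U' by (intro compact_open_Un)
    have "E (U \<union> U') m = m" using E_Int[OF UU U(1) mc(1)] U(2) by (simp add: Int_absorb1)
    moreover have "E (U \<union> U') m' = m'" using E_Int[OF UU U'(1) mc(2)] U'(2) by (simp add: Int_absorb1)
    ultimately have "E (U \<union> U') (m \<oplus>\<^bsub>M\<^esub> m') = m \<oplus>\<^bsub>M\<^esub> m'" using E_add[OF UU mc] by simp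
    then show ?case using UU mc by auto
  qed
  then show ?thesis by blast
qed

text \<open>Equality in the direct limit at \<open>x\<close>, phrased for arbitrary elements of
  \<open>M\<close> rather than for representatives tied to a neighbourhood.\<close>

definition loc_eq :: "'g \<Rightarrow> 'm \<Rightarrow> 'm \<Rightarrow> bool" where
  "loc_eq x m m' \<longleftrightarrow> (\<exists>W. unit_co W \<and> x \<in> W \<and> E W m = E W m')"

lemma unit_nbhd:
  assumes "openin (unit_space G) U" "x \<in> U"
  obtains W where "unit_co W" "x \<in> W" "W \<subseteq> U"
  using locally_boolean_nbhd[OF locally_boolean_unit_space assms] by blast

lemma unit_nbhd_ex: "x \<in> units G \<Longrightarrow> \<exists>W. unit_co W \<and> x \<in> W"
  using unit_nbhd[of "units G" x] by (metis openin_topspace topspace_unit_space)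

lemma unit_co_units: "unit_co U \<Longrightarrow> x \<in> U \<Longrightarrow> x \<in> units G"
  using compact_open_unit_space by blast

lemma loc_eq_refl: "x \<in> units G \<Longrightarrow> loc_eq x m m"
  using unit_nbhd_ex by (auto simp: loc_eq_def)

lemma loc_eq_sym: "loc_eq x m m' \<Longrightarrow> loc_eq x m' m"
  by (auto simp: loc_eq_def)

lemma E_eq_subset:
  assumes "unit_co W" "unit_co W'" "W' \<subseteq> W" "E W m = E W m'" "m \<in> carrier M" "m' \<in> carrier M"
  shows "E W' m = E W' m'"
  using E_subset[OF assms(1-3,5)] E_subset[OF assms(1-3,6)] assms(4) by simp

lemma loc_eq_common:
  assumes "loc_eq x m1 m1'" "loc_eq x m2 m2'" "m1 \<in> carrier M" "m1' \<in> carrier M" "m2 \<in> carrier M" "m2' \<in> carrier M"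
  obtains W where "unit_co W" "x \<in> W" "E W m1 = E W m1'" "E W m2 = E W m2'"
proof -
  obtain W1 W2 where W: "unit_co W1" "x \<in> W1" "E W1 m1 = E W1 m1'" "unit_co W2" "x \<in> W2" "E W2 m2 = E W2 m2'"
    using assms(1,2) by (auto simp: loc_eq_def)
  have "unit_co (W1 \<inter> W2)" using W by (intro unit_co_Int)
  then show ?thesis using that[of "W1 \<inter> W2"] W assms E_eq_subset[of W1 "W1 \<inter> W2"] E_eq_subset[of W2 "W1 \<inter> W2"] by blast
qed

lemma loc_eq_trans:
  assumes "loc_eq x m m'" "loc_eq x m' m''" "m \<in> carrier M" "m' \<in> carrier M" "m'' \<in> carrier M"
  shows "loc_eq x m m''"
  by (rule loc_eq_common[OF assms(1,2,3,4,4,5)]) (auto simp: loc_eq_def)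

lemma loc_eq_add:
  assumes "loc_eq x m1 m1'" "loc_eq x m2 m2'" "m1 \<in> carrier M" "m1' \<in> carrier M" "m2 \<in> carrier M" "m2' \<in> carrier M"
  shows "loc_eq x (m1 \<oplus>\<^bsub>M\<^esub> m2) (m1' \<oplus>\<^bsub>M\<^esub> m2')"
proof -
  obtain W where W: "unit_co W" "x \<in> W" "E W m1 = E W m1'" "E W m2 = E W m2'" using loc_eq_common[OF assms] .
  then have "E W (m1 \<oplus>\<^bsub>M\<^esub> m2) = E W (m1' \<oplus>\<^bsub>M\<^esub> m2')" using assms by (simp add: E_add)
  then show ?thesis using W by (auto simp: loc_eq_def)
qed

lemma loc_eq_E: "unit_co U \<Longrightarrow> x \<in> U \<Longrightarrow> m \<in> carrier M \<Longrightarrow> loc_eq x (E U m) m"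
  using E_subset[of U U m] by (auto simp: loc_eq_def)

section \<open>Germ classes and their representatives\<close>

lemma chi_image_iff:
  assumes "unit_co U"
  shows "m \<in> chi_image M U \<longleftrightarrow> m \<in> carrier M \<and> E U m = m"
proof
  assume "m \<in> chi_image M U"
  then obtain m0 where "m0 \<in> carrier M" "m = E U m0" by (auto simp: chi_image_def)
  then show "m \<in> carrier M \<and> E U m = m" using E_closed[OF assms] E_subset[OF assms assms subset_refl] by simp
next
  assume m: "m \<in> carrier M \<and> E U m = m"
  then have "m = E U m" by simp
  then show "m \<in> chi_image M U" unfolding chi_image_def using m by blast
qed

text \<open>The class is formed from sets \<open>U\<close> around \<open>x\<close> on which
  \<open>m\<close> is supported, and such a set has to be found: a local unit of \<open>m\<close>
  need not contain \<open>x\<close>, but its union with a neighbourhood of \<open>x\<close> does and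
  still fixes \<open>m\<close>.\<close>

lemma mem_germ_class:
  assumes x: "x \<in> units G" and m: "m \<in> carrier M"
  shows "(V, m') \<in> germ_class G M x m \<longleftrightarrow> unit_co V \<and> x \<in> V \<and> m' \<in> carrier M \<and> E V m' = m' \<and> loc_eq x m m'"
proof
  assume "(V, m') \<in> germ_class G M x m"
  then obtain U W where "(V, m') \<in> germ_pairs G M x" "unit_co W" "x \<in> W" "E W m = E W m'"
    by (auto simp: germ_class_def germ_rel_def)
  then show "unit_co V \<and> x \<in> V \<and> m' \<in> carrier M \<and> E V m' = m' \<and> loc_eq x m m'"
    by (auto simp: germ_pairs_def chi_image_iff loc_eq_def)
next
  assume r: "unit_co V \<and> x \<in> V \<and> m' \<in> carrier M \<and> E V m' = m' \<and> loc_eq x m m'"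
  then obtain W where W: "unit_co W" "x \<in> W" "E W m = E W m'" by (auto simp: loc_eq_def)
  obtain U0 where U0: "unit_co U0" "E U0 m = m" using E_unit_exists[OF m] by blast
  obtain W0 where W0: "unit_co W0" "x \<in> W0" using unit_nbhd_ex[OF x] by blast
  have U: "unit_co (U0 \<union> W0)" using U0 W0 by (intro compact_open_Un)
  have "E (U0 \<union> W0) m = m" using E_Int[OF U U0(1) m] U0(2) by (simp add: Int_absorb1)
  then have 1: "(U0 \<union> W0, m) \<in> germ_pairs G M x" using U W0 m by (simp add: germ_pairs_def chi_image_iff)
  have 2: "(V, m') \<in> germ_pairs G M x" using r by (simp add: germ_pairs_def chi_image_iff)
  have W': "unit_co (W \<inter> ((U0 \<union> W0) \<inter> V))" using W U r by (intro unit_co_Int) auto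
  have "E (W \<inter> ((U0 \<union> W0) \<inter> V)) m = E (W \<inter> ((U0 \<union> W0) \<inter> V)) m'"
    using E_eq_subset[OF W(1) W' _ W(3) m] r by blast
  then have "((U0 \<union> W0, m), (V, m')) \<in> germ_rel G M x"
    using 1 2 W' W W0 r by (auto simp: germ_rel_def intro!: exI[of _ "W \<inter> ((U0 \<union> W0) \<inter> V)"])
  then show "(V, m') \<in> germ_class G M x m" using 1 by (auto simp: germ_class_def)
qed

lemma germ_class_nonempty:
  assumes x: "x \<in> units G" and m: "m \<in> carrier M"
  shows "\<exists>U. (U, m) \<in> germ_class G M x m"
proof -
  obtain U0 where U0: "unit_co U0" "E U0 m = m" using E_unit_exists[OF m] by blast
  obtain W0 where W0: "unit_co W0" "x \<in> W0" using unit_nbhd_ex[OF x] by blast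
  have U: "unit_co (U0 \<union> W0)" using U0 W0 by (intro compact_open_Un)
  have "E (U0 \<union> W0) m = m" using E_Int[OF U U0(1) m] U0(2) by (simp add: Int_absorb1)
  then have "(U0 \<union> W0, m) \<in> germ_class G M x m" using mem_germ_class[OF x m] U W0 m loc_eq_refl[OF x] by simp
  then show ?thesis by blast
qed

lemma germ_class_eq_iff:
  assumes x: "x \<in> units G" and m: "m \<in> carrier M" "m' \<in> carrier M"
  shows "germ_class G M x m = germ_class G M x m' \<longleftrightarrow> loc_eq x m m'"
proof
  assume eq: "germ_class G M x m = germ_class G M x m'"
  obtain U where "(U, m) \<in> germ_class G M x m" using germ_class_nonempty[OF x m(1)] by blast
  then have "loc_eq x m' m" using eq mem_germ_class[OF x m(2)] by simp
  then show "loc_eq x m m'" by (rule loc_eq_sym)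
next
  assume l: "loc_eq x m m'"
  show "germ_class G M x m = germ_class G M x m'"
  proof (rule Set.set_eqI)
    fix p :: "'g set \<times> 'm"
    obtain V n where p: "p = (V, n)" by fastforce
    have "loc_eq x m n \<longleftrightarrow> loc_eq x m' n" if "n \<in> carrier M"
      using loc_eq_trans[OF l _ m that] loc_eq_trans[OF loc_eq_sym[OF l] _ m(2,1) that] by blast
    then show "p \<in> germ_class G M x m \<longleftrightarrow> p \<in> germ_class G M x m'"
      using p mem_germ_class[OF x m(1)] mem_germ_class[OF x m(2)] by auto
  qed
qed

lemma germ_eq_iff:
  assumes "x \<in> units G" "m \<in> carrier M" "m' \<in> carrier M"
  shows "germ G M x m = germ G M y m' \<longleftrightarrow> x = y \<and> loc_eq x m m'"
  using germ_class_eq_iff[OF assms] by (auto simp: germ_def)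

lemma germ_eqI: "x \<in> units G \<Longrightarrow> m \<in> carrier M \<Longrightarrow> m' \<in> carrier M \<Longrightarrow> loc_eq x m m' \<Longrightarrow> germ G M x m = germ G M x m'"
  by (simp add: germ_eq_iff)

lemma germ_E: "unit_co U \<Longrightarrow> x \<in> U \<Longrightarrow> m \<in> carrier M \<Longrightarrow> germ G M x (E U m) = germ G M x m"
  using unit_co_units by (intro germ_eqI loc_eq_E) (auto intro: E_closed)

section \<open>The sheaf of germs and its operations\<close>

abbreviation Sh where "Sh \<equiv> associated_sheaf G M"

lemma proj_Sh: "proj Sh = fst"
  by (simp add: associated_sheaf_def)

lemma zero_Sh: "fibre_zero Sh x = germ G M x \<zero>\<^bsub>M\<^esub>"
  by (simp add: associated_sheaf_def)

lemma fst_germ [simp]: "fst (germ G M x m) = x"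
  by (simp add: germ_def)

lemma Union_constant: "c \<in> S \<Longrightarrow> \<forall>b\<in>S. b = a \<Longrightarrow> \<Union>S = a"
  by blast

text \<open>All representatives lead to the same class, so the union in the definition of the sheaf
  is that class; it is taken over a nonempty family because \<open>m\<close> and \<open>m'\<close>
  represent their own germs.\<close>

lemma add_Sh:
  assumes x: "x \<in> units G" and m: "m \<in> carrier M" "m' \<in> carrier M"
  shows "fibre_add Sh (germ G M x m) (germ G M x m') = germ G M x (m \<oplus>\<^bsub>M\<^esub> m')"
proof -
  have mm: "m \<oplus>\<^bsub>M\<^esub> m' \<in> carrier M" using m by simp
  have eq: "germ_class G M x (E (U \<inter> V) n \<oplus>\<^bsub>M\<^esub> E (U \<inter> V) n') = germ_class G M x (m \<oplus>\<^bsub>M\<^esub> m')"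
    if "(U, n) \<in> germ_class G M x m" "(V, n') \<in> germ_class G M x m'" for U n V n'
  proof -
    have n: "unit_co U" "x \<in> U" "n \<in> carrier M" "loc_eq x m n" using that(1) mem_germ_class[OF x m(1)] by auto
    have n': "unit_co V" "x \<in> V" "n' \<in> carrier M" "loc_eq x m' n'" using that(2) mem_germ_class[OF x m(2)] by auto
    have UV: "unit_co (U \<inter> V)" using n n' by (intro unit_co_Int)
    have l: "loc_eq x (E (U \<inter> V) n) m" "loc_eq x (E (U \<inter> V) n') m'"
      using loc_eq_trans[OF loc_eq_E[OF UV _ n(3)] loc_eq_sym[OF n(4)] E_closed[OF UV n(3)] n(3) m(1)]
        loc_eq_trans[OF loc_eq_E[OF UV _ n'(3)] loc_eq_sym[OF n'(4)] E_closed[OF UV n'(3)] n'(3) m(2)] n n' by auto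
    have c: "E (U \<inter> V) n \<in> carrier M" "E (U \<inter> V) n' \<in> carrier M" using E_closed[OF UV] n n' by auto
    show ?thesis using germ_class_eq_iff[OF x M.a_closed[OF c] mm] loc_eq_add[OF l c(1) m(1) c(2) m(2)] by simp
  qed
  have "\<Union>{germ_class G M x (E (U \<inter> V) n \<oplus>\<^bsub>M\<^esub> E (U \<inter> V) n') | U n V n'.
      (U, n) \<in> germ_class G M x m \<and> (V, n') \<in> germ_class G M x m'} = germ_class G M x (m \<oplus>\<^bsub>M\<^esub> m')"
    (is "\<Union>?S = _")
  proof -
    obtain U V where "(U, m) \<in> germ_class G M x m" "(V, m') \<in> germ_class G M x m'"
      using germ_class_nonempty[OF x m(1)] germ_class_nonempty[OF x m(2)] by blast
    then have "germ_class G M x (E (U \<inter> V) m \<oplus>\<^bsub>M\<^esub> E (U \<inter> V) m') \<in> ?S" by blast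
    moreover have "\<forall>a\<in>?S. a = germ_class G M x (m \<oplus>\<^bsub>M\<^esub> m')"
    proof
      fix a assume "a \<in> ?S"
      then obtain U n V n' where "a = germ_class G M x (E (U \<inter> V) n \<oplus>\<^bsub>M\<^esub> E (U \<inter> V) n')"
        "(U, n) \<in> germ_class G M x m" "(V, n') \<in> germ_class G M x m'" by blast
      then show "a = germ_class G M x (m \<oplus>\<^bsub>M\<^esub> m')" using eq by simp
    qed
    ultimately show ?thesis by (rule Union_constant)
  qed
  then show ?thesis by (simp add: associated_sheaf_def germ_def)
qed

text \<open>The action on germs depends neither on the bisection nor on the representative: over the
  ranges of \<open>V2\<close>, the part common to the two bisections with sources in
  \<open>W\<close>, both sides become the indicator of \<open>V2\<close> applied to the same
  element.\<close>

lemma act_loc_eq: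
  assumes V: "compact_open_bisection G V" "g \<in> V" and V': "compact_open_bisection G V'" "g \<in> V'"
    and l: "loc_eq (src G g) m m'" and m: "m \<in> carrier M" "m' \<in> carrier M"
  shows "loc_eq (rng G g) (E V m) (E V' m')"
proof -
  obtain W where W: "unit_co W" "src G g \<in> W" "E W m = E W m'" using l by (auto simp: loc_eq_def)
  define V2 where "V2 = (V \<inter> V') \<inter> {h \<in> arr G. src G h \<in> W}"
  have cV: "compact_open (arrows G) V" "compact_open (arrows G) V'" using V V' by (auto simp: compact_open_bisection_def)
  have oW: "openin (unit_space G) W" "closedin (unit_space G) W"
    using W(1) compact_open_closedin[OF Hausdorff_unit_space] by (auto simp: compact_open_def)
  have clop: "openin (arrows G) {h \<in> arr G. src G h \<in> W}" "closedin (arrows G) {h \<in> arr G. src G h \<in> W}"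
    using openin_continuous_map_preimage[OF continuous_src_unit_space oW(1)]
      closedin_continuous_map_preimage[OF continuous_src_unit_space oW(2)] by simp_all
  have cVV: "compact_open (arrows G) (V \<inter> V')" by (rule compact_open_Int[OF hausdorff cV])
  have "compact_open (arrows G) V2"
    unfolding V2_def using cVV clop by (rule compact_open_Int_clopen)
  moreover have "V2 \<subseteq> V" by (auto simp: V2_def)
  ultimately have V2: "compact_open_bisection G V2" by (rule bisection_subset[OF V(1)])
  have g: "g \<in> V2" using V V' W bisection_arr by (auto simp: V2_def)
  \<comment> \<open>Cutting with the ranges of \<open>V2\<close> reduces either bisection to
    \<open>V2\<close>, because the range is injective on it.\<close>
  let ?U = "rng G ` V2"
  have U: "unit_co ?U" using V2 by (intro compact_open_rng) (simp add: compact_open_bisection_def)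
  have e: "{h \<in> X. rng G h \<in> ?U} = V2" if "compact_open_bisection G X" "V2 \<subseteq> X" for X
    using that inj_onD[of "rng G" X] by (auto simp: compact_open_bisection_def)
  have s: "{h \<in> V2. src G h \<in> W} = V2" by (auto simp: V2_def)
  have sub: "V2 \<subseteq> V" "V2 \<subseteq> V'" by (auto simp: V2_def)
  have "E ?U (E V m) = E V2 m" using E_units_left[OF U cV(1) m(1)] e[OF V(1) sub(1)] by simp
  also have "\<dots> = E V2 (E W m)" using E_units_right[OF V2 W(1) m(1)] s by simp
  also have "\<dots> = E V2 (E W m')" using W by simp
  also have "\<dots> = E V2 m'" using E_units_right[OF V2 W(1) m(2)] s by simp
  also have "\<dots> = E ?U (E V' m')" using E_units_left[OF U cV(2) m(2)] e[OF V'(1) sub(2)] by simp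
  finally show ?thesis using U g by (auto simp: loc_eq_def)
qed

lemma act_Sh:
  assumes V: "compact_open_bisection G V" "g \<in> V" and m: "m \<in> carrier M"
  shows "act Sh g (germ G M (src G g) m) = germ G M (rng G g) (E V m)"
proof -
  have g: "g \<in> arr G" using V by (rule bisection_arr)
  have x: "src G g \<in> units G" "rng G g \<in> units G" using g src_units rng_units by auto
  have "\<Union>{germ_class G M (rng G g) (E V n) | V U n. compact_open_bisection G V \<and> g \<in> V \<and> (U, n) \<in> germ_class G M (src G g) m}
     = germ_class G M (rng G g) (E V m)" (is "\<Union>?S = _")
  proof -
    obtain U where "(U, m) \<in> germ_class G M (src G g) m" using germ_class_nonempty[OF x(1) m] by blast
    then have "germ_class G M (rng G g) (E V m) \<in> ?S" using V by blast
    moreover have "germ_class G M (rng G g) (E V' n) = germ_class G M (rng G g) (E V m)"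
      if "compact_open_bisection G V'" "g \<in> V'" "(U, n) \<in> germ_class G M (src G g) m" for V' U n
    proof -
      have n: "n \<in> carrier M" "loc_eq (src G g) m n" using that(3) mem_germ_class[OF x(1) m] by auto
      show ?thesis
        using germ_class_eq_iff[OF x(2) E_bisection_closed[OF that(1) n(1)] E_bisection_closed[OF V(1) m]]
          act_loc_eq[OF that(1,2) V loc_eq_sym[OF n(2)] n(1) m] by simp
    qed
    then have "\<forall>a\<in>?S. a = germ_class G M (rng G g) (E V m)" by auto
    ultimately show ?thesis by (rule Union_constant)
  qed
  then show ?thesis by (simp add: associated_sheaf_def germ_def)
qed

text \<open>The generators of the topology ask for elements supported on \<open>U\<close>; cutting
  \<open>m\<close> down to \<open>U\<close> does not alter its germs there.\<close>

lemma germ_set_generator: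
  assumes "unit_co U" "m \<in> carrier M"
  shows "(\<lambda>x. germ G M x m) ` U \<in> {(\<lambda>x. germ G M x m) ` U | U m. compact_open (unit_space G) U \<and> m \<in> chi_image M U}"
proof -
  have "(\<lambda>x. germ G M x m) ` U = (\<lambda>x. germ G M x (E U m)) ` U" using germ_E[OF assms(1) _ assms(2)] by auto
  moreover have "E U m \<in> chi_image M U" using assms(2) by (simp add: chi_image_def)
  ultimately show ?thesis using assms(1) by blast
qed

lemma openin_germ_set: "unit_co U \<Longrightarrow> m \<in> carrier M \<Longrightarrow> openin (total Sh) ((\<lambda>x. germ G M x m) ` U)"
  using germ_set_generator by (auto simp: associated_sheaf_def intro!: topology_generated_by_Basis)

lemma topspace_Sh: "topspace (total Sh) = {germ G M x m | x m. x \<in> units G \<and> m \<in> carrier M}"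
proof -
  have "topspace (total Sh) = \<Union>{(\<lambda>x. germ G M x m) ` U | U m. compact_open (unit_space G) U \<and> m \<in> chi_image M U}"
    by (simp add: associated_sheaf_def)
  also have "\<dots> = {germ G M x m | x m. x \<in> units G \<and> m \<in> carrier M}"
  proof (intro equalityI subsetI)
    fix a assume "a \<in> \<Union>{(\<lambda>x. germ G M x m) ` U | U m. compact_open (unit_space G) U \<and> m \<in> chi_image M U}"
    then show "a \<in> {germ G M x m | x m. x \<in> units G \<and> m \<in> carrier M}"
      using unit_co_units chi_image_iff by blast
  next
    fix a assume "a \<in> {germ G M x m | x m. x \<in> units G \<and> m \<in> carrier M}"
    then obtain x m where a: "a = germ G M x m" "x \<in> units G" "m \<in> carrier M" by auto
    obtain U where "unit_co U" "x \<in> U" using unit_nbhd_ex[OF a(2)] by blast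
    then show "a \<in> \<Union>{(\<lambda>x. germ G M x m) ` U | U m. compact_open (unit_space G) U \<and> m \<in> chi_image M U}"
      using germ_set_generator[of U m] a by blast
  qed
  finally show ?thesis .
qed

text \<open>Continuity is tested on the generating sets, each consisting of the germs of one
  element. So it is enough that whenever the value at \<open>z\<close> is a germ of
  \<open>m\<close>, nearby values are germs of \<open>m\<close> too.\<close>

lemma continuous_into_Sh:
  assumes f: "\<And>z. z \<in> topspace Z \<Longrightarrow> f z \<in> topspace (total Sh)"
    and nb: "\<And>z x m U. z \<in> topspace Z \<Longrightarrow> unit_co U \<Longrightarrow> x \<in> U \<Longrightarrow> m \<in> carrier M \<Longrightarrow> f z = germ G M x m \<Longrightarrow>
      \<exists>N. openin Z N \<and> z \<in> N \<and> (\<forall>w\<in>N. f w \<in> (\<lambda>x. germ G M x m) ` U)"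
  shows "continuous_map Z (total Sh) f"
proof -
  let ?S = "{(\<lambda>x. germ G M x m) ` U | U m. compact_open (unit_space G) U \<and> m \<in> chi_image M U}"
  have T: "total Sh = topology_generated_by ?S" by (simp add: associated_sheaf_def)
  show ?thesis unfolding T
  proof (rule continuous_on_generated_topo)
    fix B assume "B \<in> ?S"
    then obtain U m where B: "B = (\<lambda>x. germ G M x m) ` U" "unit_co U" "m \<in> chi_image M U" by blast
    then have m: "m \<in> carrier M" using chi_image_iff by blast
    show "openin Z (f -` B \<inter> topspace Z)"
    proof (subst openin_subopen, intro ballI)
      fix z assume z: "z \<in> f -` B \<inter> topspace Z"
      then obtain x where "x \<in> U" "f z = germ G M x m" using B by auto
      then obtain N where "openin Z N" "z \<in> N" "\<forall>w\<in>N. f w \<in> B" using nb[of z U x m] z B m by blast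
      then show "\<exists>T. openin Z T \<and> z \<in> T \<and> T \<subseteq> f -` B \<inter> topspace Z" using openin_subset[of Z N] by blast
    qed
  next
    show "f ` topspace Z \<subseteq> \<Union>?S" using f unfolding T topology_generated_by_topspace by blast
  qed
qed

lemma germ_eq_on:
  assumes "unit_co W" "E W m = E W m'" "w \<in> W" "m \<in> carrier M" "m' \<in> carrier M"
  shows "germ G M w m = germ G M w m'"
  using assms unit_co_units by (intro germ_eqI) (auto simp: loc_eq_def)

lemma continuous_germ: 
  assumes m: "m \<in> carrier M"
  shows "continuous_map (unit_space G) (total Sh) (\<lambda>x. germ G M x m)"
proof (rule continuous_into_Sh)
  fix z x m' U assume z: "z \<in> topspace (unit_space G)" and U: "unit_co U" "x \<in> U" and m': "m' \<in> carrier M"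
    and eq: "germ G M z m = germ G M x m'"
  then have "z = x" "loc_eq z m m'" using germ_eq_iff[of z m m' x] m by auto
  then obtain W where W: "unit_co W" "z \<in> W" "E W m = E W m'" by (auto simp: loc_eq_def)
  have "openin (unit_space G) (W \<inter> U)" using W U by (auto simp: compact_open_def)
  moreover have "germ G M w m \<in> (\<lambda>x. germ G M x m') ` U" if "w \<in> W \<inter> U" for w
    using germ_eq_on[OF W(1,3) _ m m'] that by blast
  ultimately show "\<exists>N. openin (unit_space G) N \<and> z \<in> N \<and> (\<forall>w\<in>N. germ G M w m \<in> (\<lambda>x. germ G M x m') ` U)"
    using W U \<open>z = x\<close> by blast
qed (use m topspace_Sh in auto)

lemma fibre_Sh_carrier: "x \<in> units G \<Longrightarrow> carrier (fibre Sh x) = {germ G M x m | m. m \<in> carrier M}"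
  by (auto simp: fibre_def topspace_Sh proj_Sh)

lemma fibre_Sh_simps:
  "x \<in> units G \<Longrightarrow> m \<in> carrier M \<Longrightarrow> m' \<in> carrier M \<Longrightarrow> germ G M x m \<otimes>\<^bsub>fibre Sh x\<^esub> germ G M x m' = germ G M x (m \<oplus>\<^bsub>M\<^esub> m')"
  "\<one>\<^bsub>fibre Sh x\<^esub> = germ G M x \<zero>\<^bsub>M\<^esub>"
  by (simp_all add: fibre_def add_Sh zero_Sh)

lemma comm_group_fibre_Sh:
  assumes x: "x \<in> units G"
  shows "comm_group (fibre Sh x)"
proof (rule comm_groupI)
  fix a assume "a \<in> carrier (fibre Sh x)"
  then obtain m where "a = germ G M x m" "m \<in> carrier M" by (auto simp: fibre_Sh_carrier[OF x])
  then show "\<exists>b\<in>carrier (fibre Sh x). b \<otimes>\<^bsub>fibre Sh x\<^esub> a = \<one>\<^bsub>fibre Sh x\<^esub>"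
    using x by (intro bexI[of _ "germ G M x (\<ominus>\<^bsub>M\<^esub> m)"]) (auto simp: fibre_Sh_carrier fibre_Sh_simps M.l_neg)
qed (use x in \<open>auto simp: fibre_Sh_carrier fibre_Sh_simps M.a_ac\<close>)

lemma inv_fibre_Sh:
  assumes x: "x \<in> units G" and m: "m \<in> carrier M"
  shows "inv\<^bsub>fibre Sh x\<^esub> (germ G M x m) = germ G M x (\<ominus>\<^bsub>M\<^esub> m)"
proof -
  interpret comm_group "fibre Sh x" using x by (rule comm_group_fibre_Sh)
  show ?thesis using x m by (intro inv_equality) (auto simp: fibre_Sh_carrier fibre_Sh_simps M.l_neg)
qed

lemma bisection_product:
  assumes V: "compact_open_bisection G V" and W: "compact_open_bisection G W"
  shows "compact_open_bisection G (AG.bis_act V W)"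
proof -
  note V' = V[unfolded compact_open_bisection_def] and W' = W[unfolded compact_open_bisection_def]
  have sub: "V \<subseteq> arr G" "W \<subseteq> arr G" using V' W' compact_open_subset by blast+
  have "inj_on (src G) (AG.bis_act V W)"
  proof (rule inj_onI)
    fix a b assume "a \<in> AG.bis_act V W" "b \<in> AG.bis_act V W" and eq: "src G a = src G b"
    then obtain g h g' h' where a: "a = gmult G g h" "g \<in> V" "h \<in> W" "src G g = rng G h"
      and b: "b = gmult G g' h'" "g' \<in> V" "h' \<in> W" "src G g' = rng G h'" by (auto simp: AG.bis_act_def)
    have "src G h = src G h'" using eq a b src_mult sub by (metis subsetD)
    then have "h = h'" using a b W' by (auto dest: inj_onD)
    then have "g = g'" using inj_onD[of "src G" V g g'] a b V' by simp
    then show "a = b" using a b \<open>h = h'\<close> by simp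
  qed
  then show ?thesis
    using AG.compact_open_bis_act[of V W] AG.inj_on_bis_act[of V W] V' W' sub by (simp add: compact_open_bisection_def)
qed

text \<open>Continuity of each operation follows one pattern: equality of two germs spreads to a
  compact open set \<open>W\<close>, over which the operation, computed with fixed elements of
  \<open>M\<close>, agrees with the prescribed element.\<close>

lemma gsheaf_Sh: "gsheaf G Sh"
proof (intro gsheaf.intro ample_groupoid_axioms gsheaf_axioms.intro)
  show "comm_group (fibre Sh x)" if "x \<in> units G" for x using that by (rule comm_group_fibre_Sh)
  show "local_homeo (total Sh) (unit_space G) (proj Sh)"
    unfolding local_homeo_iff proj_Sh
  proof (intro conjI ballI)
    show "continuous_map (total Sh) (unit_space G) fst"
      unfolding continuous_map
    proof (intro conjI allI impI)
      show "fst ` topspace (total Sh) \<subseteq> topspace (unit_space G)" by (auto simp: topspace_Sh)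
      fix O' assume O: "openin (unit_space G) O'"
      show "openin (total Sh) {a \<in> topspace (total Sh). fst a \<in> O'}"
      proof (subst openin_subopen, intro ballI)
        fix a assume "a \<in> {a \<in> topspace (total Sh). fst a \<in> O'}"
        then obtain x m where a: "a = germ G M x m" "m \<in> carrier M" "x \<in> O'" by (auto simp: topspace_Sh)
        obtain U where U: "unit_co U" "x \<in> U" "U \<subseteq> O'" using unit_nbhd[OF O a(3)] .
        have "openin (total Sh) ((\<lambda>x. germ G M x m) ` U)" using U(1) a(2) by (rule openin_germ_set)
        moreover have "(\<lambda>x. germ G M x m) ` U \<subseteq> {a \<in> topspace (total Sh). fst a \<in> O'}"
        proof
          fix b assume "b \<in> (\<lambda>x. germ G M x m) ` U"
          then obtain w where w: "b = germ G M w m" "w \<in> U" by auto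
          then have "b \<in> topspace (total Sh)" using unit_co_units[OF U(1)] a(2) unfolding topspace_Sh by blast
          then show "b \<in> {a \<in> topspace (total Sh). fst a \<in> O'}" using w U(3) by auto
        qed
        ultimately show "\<exists>T. openin (total Sh) T \<and> a \<in> T \<and> T \<subseteq> {a \<in> topspace (total Sh). fst a \<in> O'}" using a U by blast
      qed
    qed
    show "open_map (total Sh) (unit_space G) fst"
    proof (rule open_map_local_sections)
      fix a assume "a \<in> topspace (total Sh)"
      then obtain x m where a: "a = germ G M x m" "m \<in> carrier M" "x \<in> units G" by (auto simp: topspace_Sh)
      then show "\<exists>N s. openin (unit_space G) N \<and> fst a \<in> N \<and> continuous_map (subtopology (unit_space G) N) (total Sh) s \<and>
          s (fst a) = a \<and> (\<forall>y\<in>N. fst (s y) = y)"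
        using continuous_map_from_subtopology[OF continuous_germ[OF a(2)]] openin_topspace[of "unit_space G"]
        by (intro exI[of _ "units G"] exI[of _ "\<lambda>x. germ G M x m"]) simp
    qed
    fix a assume "a \<in> topspace (total Sh)"
    then obtain x m where a: "a = germ G M x m" "m \<in> carrier M" "x \<in> units G" by (auto simp: topspace_Sh)
    obtain U where U: "unit_co U" "x \<in> U" using unit_nbhd_ex[OF a(3)] by blast
    have "inj_on fst ((\<lambda>x. germ G M x m) ` U)" by (auto simp: inj_on_def)
    then show "\<exists>U. openin (total Sh) U \<and> a \<in> U \<and> inj_on fst U" using openin_germ_set[OF U(1) a(2)] U a by blast
  qed
  let ?ZA = "subtopology (prod_topology (total Sh) (total Sh)) {(a, b). proj Sh a = proj Sh b}"
  have memA: "\<exists>x m1 m2. z = (germ G M x m1, germ G M x m2) \<and> x \<in> units G \<and> m1 \<in> carrier M \<and> m2 \<in> carrier M"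
    if "z \<in> topspace ?ZA" for z
  proof -
    have z: "fst z \<in> topspace (total Sh)" "snd z \<in> topspace (total Sh)" "fst (fst z) = fst (snd z)"
      using that by (auto simp: proj_Sh)
    obtain x m1 where 1: "fst z = germ G M x m1" "x \<in> units G" "m1 \<in> carrier M" using z(1) unfolding topspace_Sh by blast
    obtain y m2 where 2: "snd z = germ G M y m2" "y \<in> units G" "m2 \<in> carrier M" using z(2) unfolding topspace_Sh by blast
    have "z = (germ G M x m1, germ G M x m2)" using 1 2 z(3) by (simp add: prod_eq_iff)
    then show ?thesis using 1 2 by blast
  qed
  show "continuous_map ?ZA (total Sh) (\<lambda>(a, b). fibre_add Sh a b)"
  proof (rule continuous_into_Sh)
    show "(\<lambda>(a, b). fibre_add Sh a b) z \<in> topspace (total Sh)" if z: "z \<in> topspace ?ZA" for z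
      using memA[OF z] by (auto simp: add_Sh topspace_Sh) (metis M.a_closed)
    fix z x m U assume z: "z \<in> topspace ?ZA" and U: "unit_co U" "x \<in> U" and m: "m \<in> carrier M"
      and eq: "(\<lambda>(a, b). fibre_add Sh a b) z = germ G M x m"
    obtain y m1 m2 where zz: "z = (germ G M y m1, germ G M y m2)" "y \<in> units G" "m1 \<in> carrier M" "m2 \<in> carrier M"
      using memA[OF z] by blast
    then have "germ G M y (m1 \<oplus>\<^bsub>M\<^esub> m2) = germ G M x m" using eq by (simp add: add_Sh)
    then have yx: "y = x" "loc_eq y (m1 \<oplus>\<^bsub>M\<^esub> m2) m" using germ_eq_iff[of y "m1 \<oplus>\<^bsub>M\<^esub> m2" m x] zz m by auto
    then obtain W where W: "unit_co W" "x \<in> W" "E W (m1 \<oplus>\<^bsub>M\<^esub> m2) = E W m" by (auto simp: loc_eq_def)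
    have WU: "unit_co (W \<inter> U)" using W U by (intro unit_co_Int)
    let ?N = "(((\<lambda>x. germ G M x m1) ` (W \<inter> U)) \<times> ((\<lambda>x. germ G M x m2) ` (W \<inter> U))) \<inter> {(a, b). proj Sh a = proj Sh b}"
    have "openin ?ZA ?N"
      using openin_germ_set[OF WU zz(3)] openin_germ_set[OF WU zz(4)]
      by (intro openin_subtopology_Int) (simp add: openin_prod_Times_iff)
    moreover have "z \<in> ?N" using zz yx W U by (auto simp: proj_Sh)
    moreover have "(\<lambda>(a, b). fibre_add Sh a b) w \<in> (\<lambda>x. germ G M x m) ` U" if "w \<in> ?N" for w
    proof -
      obtain v where v: "w = (germ G M v m1, germ G M v m2)" "v \<in> W \<inter> U" using \<open>w \<in> ?N\<close> by (auto simp: proj_Sh)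
      then have "(\<lambda>(a, b). fibre_add Sh a b) w = germ G M v (m1 \<oplus>\<^bsub>M\<^esub> m2)"
        using unit_co_units[OF WU] zz by (simp add: add_Sh)
      also have "\<dots> = germ G M v m" using v zz m by (intro germ_eq_on[OF W(1,3)]) auto
      finally show ?thesis using v by auto
    qed
    ultimately show "\<exists>N. openin ?ZA N \<and> z \<in> N \<and> (\<forall>w\<in>N. (\<lambda>(a, b). fibre_add Sh a b) w \<in> (\<lambda>x. germ G M x m) ` U)" by blast
  qed
  have "fibre_zero Sh = (\<lambda>x. germ G M x \<zero>\<^bsub>M\<^esub>)" by (rule ext) (rule zero_Sh)
  then show "continuous_map (unit_space G) (total Sh) (fibre_zero Sh)" using continuous_germ[OF M.zero_closed] by simp
  have inv: "inv\<^bsub>fibre Sh (proj Sh (germ G M x m))\<^esub> (germ G M x m) = germ G M x (\<ominus>\<^bsub>M\<^esub> m)" if "x \<in> units G" "m \<in> carrier M" for x m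
    using inv_fibre_Sh[OF that] by (simp add: proj_Sh)
  show "continuous_map (total Sh) (total Sh) (\<lambda>a. inv\<^bsub>fibre Sh (proj Sh a)\<^esub> a)"
  proof (rule continuous_into_Sh)
    show "inv\<^bsub>fibre Sh (proj Sh a)\<^esub> a \<in> topspace (total Sh)" if "a \<in> topspace (total Sh)" for a
      using that inv by (auto simp: topspace_Sh)
    fix a x m U assume a: "a \<in> topspace (total Sh)" and U: "unit_co U" "x \<in> U" and m: "m \<in> carrier M"
      and eq: "inv\<^bsub>fibre Sh (proj Sh a)\<^esub> a = germ G M x m"
    obtain y m1 where aa: "a = germ G M y m1" "y \<in> units G" "m1 \<in> carrier M" using a by (auto simp: topspace_Sh)
    then have "germ G M y (\<ominus>\<^bsub>M\<^esub> m1) = germ G M x m" using eq inv by simp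
    then have yx: "y = x" "loc_eq y (\<ominus>\<^bsub>M\<^esub> m1) m" using germ_eq_iff[of y "\<ominus>\<^bsub>M\<^esub> m1" m x] aa m by auto
    then obtain W where W: "unit_co W" "x \<in> W" "E W (\<ominus>\<^bsub>M\<^esub> m1) = E W m" by (auto simp: loc_eq_def)
    have WU: "unit_co (W \<inter> U)" using W U by (intro unit_co_Int)
    have "openin (total Sh) ((\<lambda>x. germ G M x m1) ` (W \<inter> U))" using WU aa by (intro openin_germ_set)
    moreover have "inv\<^bsub>fibre Sh (proj Sh w)\<^esub> w \<in> (\<lambda>x. germ G M x m) ` U" if "w \<in> (\<lambda>x. germ G M x m1) ` (W \<inter> U)" for w
    proof -
      obtain v where v: "w = germ G M v m1" "v \<in> W \<inter> U" using \<open>w \<in> (\<lambda>x. germ G M x m1) ` (W \<inter> U)\<close> by auto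
      then have "inv\<^bsub>fibre Sh (proj Sh w)\<^esub> w = germ G M v (\<ominus>\<^bsub>M\<^esub> m1)" using inv unit_co_units[OF WU] aa by simp
      also have "\<dots> = germ G M v m" using v aa m by (intro germ_eq_on[OF W(1,3)]) auto
      finally show ?thesis using v by auto
    qed
    ultimately show "\<exists>N. openin (total Sh) N \<and> a \<in> N \<and> (\<forall>w\<in>N. inv\<^bsub>fibre Sh (proj Sh w)\<^esub> w \<in> (\<lambda>x. germ G M x m) ` U)"
      using aa yx W U by blast
  qed
next
  fix g assume g: "g \<in> arr G"
  obtain V where V: "compact_open_bisection G V" "g \<in> V" using bisection_nbhd[of "arr G" g] g by auto
  have x: "src G g \<in> units G" "rng G g \<in> units G" using g src_units rng_units by auto
  show "act Sh g \<in> hom (fibre Sh (src G g)) (fibre Sh (rng G g))"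
    unfolding hom_def fibre_Sh_carrier[OF x(1)] fibre_Sh_carrier[OF x(2)]
  proof (rule CollectI, intro conjI Pi_I ballI)
    fix a assume "a \<in> {germ G M (src G g) m |m. m \<in> carrier M}"
    then obtain m where m: "a = germ G M (src G g) m" "m \<in> carrier M" by auto
    then show "act Sh g a \<in> {germ G M (rng G g) m |m. m \<in> carrier M}"
      using act_Sh[OF V] E_bisection_closed[OF V(1)] by auto
    fix b assume "b \<in> {germ G M (src G g) m |m. m \<in> carrier M}"
    then obtain n where n: "b = germ G M (src G g) n" "n \<in> carrier M" by auto
    show "act Sh g (a \<otimes>\<^bsub>fibre Sh (src G g)\<^esub> b) = act Sh g a \<otimes>\<^bsub>fibre Sh (rng G g)\<^esub> act Sh g b"
      using m n x E_bisection_closed[OF V(1)]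
      by (simp add: fibre_Sh_simps act_Sh[OF V] smult_add[OF indicator_bisection[OF V(1)]])
  qed
next
  fix x a assume x: "x \<in> units G" and a: "a \<in> carrier (fibre Sh x)"
  obtain m where m: "a = germ G M x m" "m \<in> carrier M" using a by (auto simp: fibre_Sh_carrier[OF x])
  obtain U where U: "unit_co U" "x \<in> U" using unit_nbhd_ex[OF x] by blast
  show "act Sh x a = a" using act_Sh[OF units_bisection[OF U(1)] U(2) m(2)] m germ_E[OF U m(2)] src_unit[OF x] rng_unit[OF x] by simp
next
  fix g h a assume g: "g \<in> arr G" and h: "h \<in> arr G" and gh: "src G g = rng G h" and a: "a \<in> carrier (fibre Sh (src G h))"
  obtain m where m: "a = germ G M (src G h) m" "m \<in> carrier M" using a h by (auto simp: fibre_Sh_carrier src_units)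
  obtain V where V: "compact_open_bisection G V" "g \<in> V" using bisection_nbhd[of "arr G" g] g by auto
  obtain W where W: "compact_open_bisection G W" "h \<in> W" using bisection_nbhd[of "arr G" h] h by auto
  have VW: "gmult G g h \<in> AG.bis_act V W" using V W gh by (auto simp: AG.bis_act_def)
  have "E V (E W m) = E (AG.bis_act V W) m" using W m by (intro E_E[OF V(1)]) (simp_all add: compact_open_bisection_def)
  then show "act Sh (gmult G g h) a = act Sh g (act Sh h a)"
    using act_Sh[OF bisection_product[OF V(1) W(1)] VW m(2)] act_Sh[OF W m(2)] act_Sh[OF V E_bisection_closed[OF W(1) m(2)]]
      m gh g h by (simp add: src_mult rng_mult)
next
  let ?Z = "subtopology (prod_topology (arrows G) (total Sh)) {(g, a). proj Sh a = src G g}"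
  have mem: "\<exists>g m. z = (g, germ G M (src G g) m) \<and> g \<in> arr G \<and> m \<in> carrier M" if "z \<in> topspace ?Z" for z
  proof -
    have z: "fst z \<in> arr G" "snd z \<in> topspace (total Sh)" "fst (snd z) = src G (fst z)"
      using that by (auto simp: proj_Sh)
    obtain y m where "snd z = germ G M y m" "m \<in> carrier M" using z(2) unfolding topspace_Sh by blast
    then have "z = (fst z, germ G M (src G (fst z)) m)" using z(3) by (simp add: prod_eq_iff)
    then show ?thesis using z(1) \<open>m \<in> carrier M\<close> by blast
  qed
  show "continuous_map ?Z (total Sh) (\<lambda>(g, a). act Sh g a)"
  proof (rule continuous_into_Sh)
    show "(\<lambda>(g, a). act Sh g a) z \<in> topspace (total Sh)" if z: "z \<in> topspace ?Z" for z
    proof -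
      obtain g m where zz: "z = (g, germ G M (src G g) m)" "g \<in> arr G" "m \<in> carrier M" using mem[OF z] by blast
      obtain V where V: "compact_open_bisection G V" "g \<in> V" using bisection_nbhd[of "arr G" g] zz by auto
      then show ?thesis using zz act_Sh[OF V zz(3)] E_bisection_closed[OF V(1) zz(3)] rng_units by (auto simp: topspace_Sh)
    qed
    fix z x m U assume z: "z \<in> topspace ?Z" and U: "unit_co U" "x \<in> U" and m: "m \<in> carrier M"
      and eq: "(\<lambda>(g, a). act Sh g a) z = germ G M x m"
    obtain g m1 where zz: "z = (g, germ G M (src G g) m1)" "g \<in> arr G" "m1 \<in> carrier M" using mem[OF z] by blast
    obtain V where V: "compact_open_bisection G V" "g \<in> V" using bisection_nbhd[of "arr G" g] zz by auto
    have Em: "E V m1 \<in> carrier M" using E_bisection_closed[OF V(1) zz(3)] .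
    have "germ G M (rng G g) (E V m1) = germ G M x m" using eq zz act_Sh[OF V zz(3)] by simp
    then have yx: "rng G g = x" "loc_eq x (E V m1) m" using germ_eq_iff[OF rng_units[OF zz(2)] Em m] by auto
    then obtain W where W: "unit_co W" "x \<in> W" "E W (E V m1) = E W m" by (auto simp: loc_eq_def)
    obtain U' where U': "unit_co U'" "src G g \<in> U'" using unit_nbhd_ex[OF src_units[OF zz(2)]] by blast
    let ?NV = "V \<inter> {h \<in> arr G. rng G h \<in> W \<inter> U}"
    have "openin (arrows G) {h \<in> arr G. rng G h \<in> W \<inter> U}"
      using W U continuous_rng_unit_space by (intro openin_continuous_map_preimage) (auto simp: compact_open_def)
    then have N0: "openin (arrows G) ?NV" using V by (auto simp: compact_open_bisection_def compact_open_def)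
    \<comment> \<open>Every arrow of \<open>V\<close> in the neighbourhood is paired with the germ
      of the same element \<open>m1\<close> at its source, so the one bisection \<open>V\<close>
      computes the action on all of these pairs.\<close>
    let ?SV = "(\<lambda>x. germ G M x m1) ` (src G ` V)"
    have sV: "unit_co (src G ` V)" using V by (intro compact_open_src) (simp add: compact_open_bisection_def)
    let ?N = "(?NV \<times> ?SV) \<inter> {(g, a). proj Sh a = src G g}"
    have "openin ?Z ?N"
      using N0 openin_germ_set[OF sV zz(3)] by (intro openin_subtopology_Int) (simp add: openin_prod_Times_iff)
    moreover have "z \<in> ?N" using zz V yx W U by (auto simp: proj_Sh)
    moreover have "(\<lambda>(g, a). act Sh g a) w \<in> (\<lambda>x. germ G M x m) ` U" if "w \<in> ?N" for w
    proof -
      obtain h where h: "w = (h, germ G M (src G h) m1)" "h \<in> ?NV" using \<open>w \<in> ?N\<close> by (auto simp: proj_Sh)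
      then have "(\<lambda>(g, a). act Sh g a) w = germ G M (rng G h) (E V m1)" using act_Sh[OF V(1) _ zz(3)] by simp
      also have "\<dots> = germ G M (rng G h) m" using h m Em by (intro germ_eq_on[OF W(1,3)]) auto
      finally show ?thesis using h by auto
    qed
    ultimately show "\<exists>N. openin ?Z N \<and> z \<in> N \<and> (\<forall>w\<in>N. (\<lambda>(g, a). act Sh g a) w \<in> (\<lambda>x. germ G M x m) ` U)"
      by (intro exI[of _ ?N] conjI ballI)
  qed
qed

end

section \<open>Modules as modules of sections\<close>

context module_groupoid
begin

interpretation SS: gsheaf G Sh
  by (rule gsheaf_Sh)

abbreviation \<theta> where "\<theta> \<equiv> module_to_sections G M"

lemma theta_apply: "x \<in> units G \<Longrightarrow> \<theta> m x = germ G M x m"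
  by (simp add: module_to_sections_def)

text \<open>A compact set in the Hausdorff unit space is closed, so \<open>x\<close> has a compact
  open neighbourhood disjoint from \<open>U\<close>, whose indicator kills the element.\<close>

lemma germ_E_outside:
  assumes U: "unit_co U" and x: "x \<in> units G" "x \<notin> U" and m: "m \<in> carrier M"
  shows "germ G M x (E U m) = germ G M x \<zero>\<^bsub>M\<^esub>"
proof -
  have "openin (unit_space G) (topspace (unit_space G) - U)"
    using compact_open_closedin[OF Hausdorff_unit_space U] by blast
  then have "openin (unit_space G) (units G - U)" by simp
  then obtain W where W: "unit_co W" "x \<in> W" "W \<subseteq> units G - U" using unit_nbhd[of "units G - U" x] x by blast
  have "W \<inter> U = {}" using W by blast
  then have "E W (E U m) = E {} m" using E_Int[OF W(1) U m] by simp
  also have "(indicator {} :: 'g \<Rightarrow> int) = (\<lambda>g. 0)" by (rule ext) simp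
  also have "(\<lambda>g. 0) \<odot>\<^bsub>M\<^esub> m = \<zero>\<^bsub>M\<^esub>" using m by (rule smult_zero_left_M)
  also have "\<dots> = E W \<zero>\<^bsub>M\<^esub>" using smult_zero_uminus(1)[OF indicator_units[OF W(1)]] by simp
  finally show ?thesis using W x E_closed[OF U m] by (intro germ_eqI) (auto simp: loc_eq_def)
qed

lemma theta_section:
  assumes m: "m \<in> carrier M"
  shows "\<theta> m \<in> compact_sections G Sh"
proof -
  obtain U where U: "unit_co U" "E U m = m" using E_unit_exists[OF m] by blast
  have "(\<lambda>x\<in>units G. germ G M x m) \<in> compact_sections G Sh"
  proof (rule SS.sectionI)
    show "SS.lift (unit_space G) (\<lambda>x. x) (\<lambda>x. germ G M x m)"
      using continuous_germ[OF m] m by (auto simp: SS.lift_def fibre_Sh_carrier)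
    show "compactin (unit_space G) U" using U by (simp add: compact_open_def)
    show "germ G M x m = \<one>\<^bsub>fibre Sh x\<^esub>" if "x \<in> units G" "x \<notin> U" for x
      using germ_E_outside[OF U(1) that m] U by (simp add: fibre_Sh_simps)
  qed
  then show ?thesis by (simp add: module_to_sections_def)
qed

lemma theta_add: "m \<in> carrier M \<Longrightarrow> m' \<in> carrier M \<Longrightarrow> \<theta> (m \<oplus>\<^bsub>M\<^esub> m') = \<theta> m \<oplus>\<^bsub>section_module G Sh\<^esub> \<theta> m'"
  unfolding SS.section_module_simps module_to_sections_def by (intro restrict_ext) (simp add: fibre_Sh_simps)

text \<open>Both sides are additive in \<open>f\<close>. For a bisection, the value at the range of
  \<open>b\<close> is the action of \<open>b\<close> by \<open>act_Sh\<close>, and outside the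
  ranges both sides vanish.\<close>

lemma theta_smult:
  assumes f: "f \<in> Zfun (arrows G)" and m: "m \<in> carrier M"
  shows "\<theta> (f \<odot>\<^bsub>M\<^esub> m) = f \<odot>\<^bsub>section_module G Sh\<^esub> \<theta> m"
proof (rule SS.section_eqI)
  note tm = theta_section[OF m]
  show "\<theta> (f \<odot>\<^bsub>M\<^esub> m) \<in> compact_sections G Sh" using f m by (intro theta_section smult_closed)
  show "f \<odot>\<^bsub>section_module G Sh\<^esub> \<theta> m \<in> compact_sections G Sh" using f tm by (rule SS.smult_closed)
  fix x assume x: "x \<in> units G"
  show "\<theta> (f \<odot>\<^bsub>M\<^esub> m) x = (f \<odot>\<^bsub>section_module G Sh\<^esub> \<theta> m) x"
  proof (rule bisection_hom_eqI[OF f, where K = "fibre Sh x" and ?F1.0 = "\<lambda>f. \<theta> (f \<odot>\<^bsub>M\<^esub> m) x"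
        and ?F2.0 = "\<lambda>f. (f \<odot>\<^bsub>section_module G Sh\<^esub> \<theta> m) x"])
    show "group (fibre Sh x)" using x by (rule SS.fibre_group)
    show "(\<lambda>f. \<theta> (f \<odot>\<^bsub>M\<^esub> m) x) \<in> hom (Zgroup (arrows G)) (fibre Sh x)"
      using x m add_smult by (auto simp: hom_def theta_apply fibre_Sh_carrier fibre_Sh_simps)
    have "(f \<odot>\<^bsub>section_module G Sh\<^esub> \<theta> m) x \<in> carrier (fibre Sh x)" if "f \<in> Zfun (arrows G)" for f
      using SS.section_carrier[OF SS.smult_closed[OF that tm] x] .
    moreover have "((\<lambda>g. f g + f' g) \<odot>\<^bsub>section_module G Sh\<^esub> \<theta> m) x =
        (f \<odot>\<^bsub>section_module G Sh\<^esub> \<theta> m) x \<otimes>\<^bsub>fibre Sh x\<^esub> (f' \<odot>\<^bsub>section_module G Sh\<^esub> \<theta> m) x"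
      if "f \<in> Zfun (arrows G)" "f' \<in> Zfun (arrows G)" for f f'
      using SS.smult_add_left[OF that tm] x by (simp only: SS.section_module_simps(3) restrict_apply if_True)
    ultimately show "(\<lambda>f. (f \<odot>\<^bsub>section_module G Sh\<^esub> \<theta> m) x) \<in> hom (Zgroup (arrows G)) (fibre Sh x)"
      by (simp add: hom_def)
    fix B assume B: "compact_open_bisection G B"
    show "\<theta> (E B m) x = (indicator B \<odot>\<^bsub>section_module G Sh\<^esub> \<theta> m) x"
    proof (cases "x \<in> rng G ` B")
      case True
      then obtain b where b: "b \<in> B" "x = rng G b" by auto
      then have "b \<in> arr G" using bisection_arr[OF B] by blast
      then show ?thesis
        using SS.smult_bisection(1)[OF B tm b(1)] act_Sh[OF B b(1) m] b x by (simp add: theta_apply src_units)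
    next
      case False
      have cB: "compact_open (arrows G) B" using B by (simp add: compact_open_bisection_def)
      have rB: "unit_co (rng G ` B)" using cB by (rule compact_open_rng)
      have "{h \<in> B. rng G h \<in> rng G ` B} = B" by auto
      then have "E (rng G ` B) (E B m) = E B m" using E_units_left[OF rB cB m] by simp
      then show ?thesis
        using germ_E_outside[OF rB x False E_bisection_closed[OF B m]] SS.smult_bisection(2)[OF B tm x False] x
        by (simp add: theta_apply fibre_Sh_simps)
    qed
  qed
qed

text \<open>A new set is added through its part disjoint from the earlier ones, where indicators are
  additive; that part is again compact open.\<close>

lemma E_eq_Union:
  assumes m: "m \<in> carrier M" "m' \<in> carrier M"
  shows "finite F \<Longrightarrow> (\<forall>W\<in>F. unit_co W \<and> E W m = E W m') \<Longrightarrow> unit_co (\<Union>F) \<and> E (\<Union>F) m = E (\<Union>F) m'"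
proof (induction F rule: finite_induct)
  case empty
  then show ?case using m by (simp add: smult_zero_left_M)
next
  case (insert W F)
  then have IH: "unit_co (\<Union>F)" "E (\<Union>F) m = E (\<Union>F) m'" and W: "unit_co W" "E W m = E W m'" by auto
  have D: "unit_co (W - \<Union>F)" using W(1) IH(1) by (rule compact_open_Diff[OF Hausdorff_unit_space])
  have "E (W - \<Union>F) m = E (W - \<Union>F) m'" by (rule E_eq_subset[OF W(1) D Diff_subset W(2) m])
  then have "E (\<Union>F \<union> (W - \<Union>F)) m = E (\<Union>F \<union> (W - \<Union>F)) m'"
    using E_disjoint_Un[OF IH(1) D Diff_disjoint m(1)] E_disjoint_Un[OF IH(1) D Diff_disjoint m(2)] IH(2) by simp
  moreover have "\<Union>F \<union> (W - \<Union>F) = \<Union>(insert W F)" by auto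
  moreover have "unit_co (\<Union>F \<union> (W - \<Union>F))" using IH(1) D by (rule compact_open_Un)
  ultimately show ?case by simp
qed

text \<open>Equal germs mean equality over small sets. Finitely many of these cover a common local
  unit of both elements, and patching over their union gives equality of the elements
  themselves.\<close>

lemma theta_inj:
  assumes m: "m \<in> carrier M" "m' \<in> carrier M" and eq: "\<theta> m = \<theta> m'"
  shows "m = m'"
proof -
  obtain U1 U2 where U1: "unit_co U1" "E U1 m = m" and U2: "unit_co U2" "E U2 m' = m'"
    using E_unit_exists[OF m(1)] E_unit_exists[OF m(2)] by blast
  define U where "U = U1 \<union> U2"
  have U: "unit_co U" unfolding U_def using U1 U2 by (intro compact_open_Un)
  have Um: "E U m = m" using E_Int[OF U U1(1) m(1)] U1(2) by (simp add: U_def Int_absorb1)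
  have Um': "E U m' = m'" using E_Int[OF U U2(1) m(2)] U2(2) by (simp add: U_def Int_absorb1)
  let ?B = "{W. unit_co W \<and> E W m = E W m'}"
  have "U \<subseteq> \<Union>?B"
  proof
    fix x assume "x \<in> U"
    then have x: "x \<in> units G" using unit_co_units[OF U] by blast
    then have "germ G M x m = germ G M x m'" using eq theta_apply by metis
    then have "loc_eq x m m'" using germ_eq_iff[OF x m] by simp
    then show "x \<in> \<Union>?B" by (auto simp: loc_eq_def)
  qed
  moreover have "compactin (unit_space G) U" using U by (simp add: compact_open_def)
  ultimately have "\<exists>F. finite F \<and> F \<subseteq> ?B \<and> U \<subseteq> \<Union>F"
    by (intro compactinD) (auto simp: compact_open_def)
  then obtain F where F: "finite F" "F \<subseteq> ?B" "U \<subseteq> \<Union>F" by blast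
  then have "unit_co (\<Union>F)" "E (\<Union>F) m = E (\<Union>F) m'" using E_eq_Union[OF m F(1)] by blast+
  then have "E U m = E U m'" using E_eq_subset[OF _ U F(3) _ m] by blast
  then show ?thesis using Um Um' by simp
qed

text \<open>The induction adds to \<open>m\<close> an element cut down to
  \<open>W - \<Union>F\<close>, whose germs over the earlier union vanish. The clause on vanishing
  germs outside the union is carried along so that \<open>m\<close> in turn contributes nothing over
  the new part.\<close>

lemma glue_germs:
  assumes "finite F" "\<forall>W\<in>F. unit_co W \<and> (\<exists>m\<in>carrier M. \<forall>w\<in>W. \<xi> w = germ G M w m)"
  shows "unit_co (\<Union>F) \<and> (\<exists>m\<in>carrier M. (\<forall>x\<in>\<Union>F. \<xi> x = germ G M x m) \<and>
     (\<forall>x\<in>units G - \<Union>F. germ G M x m = germ G M x \<zero>\<^bsub>M\<^esub>))"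
  using assms
proof (induction F rule: finite_induct)
  case empty
  then show ?case by auto
next
  case (insert W F)
  from insert obtain m where F: "unit_co (\<Union>F)" and m: "m \<in> carrier M" "\<forall>x\<in>\<Union>F. \<xi> x = germ G M x m"
     "\<forall>x\<in>units G - \<Union>F. germ G M x m = germ G M x \<zero>\<^bsub>M\<^esub>" by auto
  obtain n where W: "unit_co W" and n: "n \<in> carrier M" "\<forall>w\<in>W. \<xi> w = germ G M w n" using insert.prems by auto
  have D: "unit_co (W - \<Union>F)" using W F by (rule compact_open_Diff[OF Hausdorff_unit_space])
  let ?n = "E (W - \<Union>F) n"
  have nc: "?n \<in> carrier M" using D n(1) by (rule E_closed)
  have sum: "germ G M x (m \<oplus>\<^bsub>M\<^esub> ?n) = germ G M x m \<otimes>\<^bsub>fibre Sh x\<^esub> germ G M x ?n" if "x \<in> units G" for x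
    using that m nc by (simp add: fibre_Sh_simps)
  have c: "germ G M x k \<in> carrier (fibre Sh x)" if "x \<in> units G" "k \<in> carrier M" for x k
    using that by (auto simp: fibre_Sh_carrier)
  have z: "germ G M x \<zero>\<^bsub>M\<^esub> = \<one>\<^bsub>fibre Sh x\<^esub>" for x by (simp add: fibre_Sh_simps)
  have r: "germ G M x m \<otimes>\<^bsub>fibre Sh x\<^esub> \<one>\<^bsub>fibre Sh x\<^esub> = germ G M x m" if "x \<in> units G" for x
    using monoid.r_one[OF group.is_monoid[OF SS.fibre_group[OF that]] c[OF that m(1)]] .
  have l: "\<one>\<^bsub>fibre Sh x\<^esub> \<otimes>\<^bsub>fibre Sh x\<^esub> germ G M x k = germ G M x k" if "x \<in> units G" "k \<in> carrier M" for x k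
    using monoid.l_one[OF group.is_monoid[OF SS.fibre_group[OF that(1)]] c[OF that]] .
  have "\<xi> x = germ G M x (m \<oplus>\<^bsub>M\<^esub> ?n)" if "x \<in> \<Union>(insert W F)" for x
  proof (cases "x \<in> \<Union>F")
    case True
    then have x: "x \<in> units G" using unit_co_units[OF F] by blast
    have "germ G M x ?n = germ G M x \<zero>\<^bsub>M\<^esub>" using True by (intro germ_E_outside[OF D x _ n(1)]) auto
    moreover have "\<xi> x = germ G M x m" using m(2) True by blast
    ultimately show ?thesis using sum[OF x] r[OF x] z by simp
  next
    case False
    then have xW: "x \<in> W" "x \<in> W - \<Union>F" using that by auto
    then have x: "x \<in> units G" using unit_co_units[OF W] by blast
    have "germ G M x m = germ G M x \<zero>\<^bsub>M\<^esub>" using m(3) x False by simp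
    moreover have "germ G M x ?n = germ G M x n" using D xW(2) n(1) by (rule germ_E)
    ultimately show ?thesis using sum[OF x] n xW(1) l[OF x n(1)] z by simp
  qed
  moreover have "germ G M x (m \<oplus>\<^bsub>M\<^esub> ?n) = germ G M x \<zero>\<^bsub>M\<^esub>" if x: "x \<in> units G - \<Union>(insert W F)" for x
  proof -
    have "germ G M x ?n = germ G M x \<zero>\<^bsub>M\<^esub>" using x by (intro germ_E_outside[OF D _ _ n(1)]) auto
    moreover have "germ G M x m = germ G M x \<zero>\<^bsub>M\<^esub>" using m(3) x by simp
    ultimately show ?thesis using sum[of x] l[of x "\<zero>\<^bsub>M\<^esub>"] x z by simp
  qed
  moreover have "m \<oplus>\<^bsub>M\<^esub> ?n \<in> carrier M" using m nc by simp
  moreover have "unit_co (\<Union>(insert W F))" using compact_open_Un[OF W F] by simp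
  ultimately show ?case by blast
qed

text \<open>The support is compact and covered by sets over which \<open>\<xi>\<close> coincides
  with the germs of one element, because coincidence sets are open. Gluing finitely many of them
  gives an element whose germs vanish outside, as \<open>\<xi>\<close> does.\<close>

lemma theta_surj:
  assumes \<xi>: "\<xi> \<in> compact_sections G Sh"
  shows "\<exists>m\<in>carrier M. \<theta> m = \<xi>"
proof -
  let ?K = "{x \<in> units G. \<xi> x \<noteq> \<one>\<^bsub>fibre Sh x\<^esub>}"
  let ?B = "{W. unit_co W \<and> (\<exists>m\<in>carrier M. \<forall>w\<in>W. \<xi> w = germ G M w m)}"
  have K: "compactin (unit_space G) ?K" using \<xi> by (rule SS.section_support)
  have "?K \<subseteq> \<Union>?B"
  proof
    fix x assume "x \<in> ?K"
    then have x: "x \<in> units G" by simp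
    obtain m where m: "m \<in> carrier M" "\<xi> x = germ G M x m"
      using SS.section_carrier[OF \<xi> x] by (auto simp: fibre_Sh_carrier[OF x])
    have "openin (unit_space G) {w \<in> topspace (unit_space G). \<xi> w = \<theta> m w}"
      using SS.section_lift[OF \<xi>] SS.section_lift[OF theta_section[OF m(1)]] by (rule SS.lift_eq_open)
    moreover have "x \<in> {w \<in> topspace (unit_space G). \<xi> w = \<theta> m w}" using x m by (simp add: theta_apply)
    ultimately obtain W where W: "unit_co W" "x \<in> W" "W \<subseteq> {w \<in> topspace (unit_space G). \<xi> w = \<theta> m w}" using unit_nbhd by blast
    have "\<forall>w\<in>W. \<xi> w = germ G M w m" using W(3) theta_apply by auto
    then show "x \<in> \<Union>?B" using W m by blast
  qed
  then have "\<exists>F. finite F \<and> F \<subseteq> ?B \<and> ?K \<subseteq> \<Union>F"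
    by (intro compactinD[OF K]) (auto simp: compact_open_def)
  then obtain F where F: "finite F" "F \<subseteq> ?B" "?K \<subseteq> \<Union>F" by blast
  obtain m where m: "m \<in> carrier M" "\<forall>x\<in>\<Union>F. \<xi> x = germ G M x m"
     "\<forall>x\<in>units G - \<Union>F. germ G M x m = germ G M x \<zero>\<^bsub>M\<^esub>"
    using glue_germs[OF F(1), of \<xi>] F(2) by blast
  have "\<theta> m = \<xi>"
  proof (rule SS.section_eqI[OF theta_section[OF m(1)] \<xi>])
    fix x assume x: "x \<in> units G"
    show "\<theta> m x = \<xi> x"
    proof (cases "x \<in> \<Union>F")
      case True
      then have "\<xi> x = germ G M x m" using m(2) by blast
      then show ?thesis using x by (simp add: theta_apply)
    next
      case False
      then have "\<xi> x = \<one>\<^bsub>fibre Sh x\<^esub>" using F(3) x by blast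
      then show ?thesis using m(3) x False by (simp add: theta_apply fibre_Sh_simps)
    qed
  qed
  then show ?thesis using m(1) by blast
qed

section \<open>From cochains of the module to cochains of its sections\<close>

abbreviation Th where "Th n \<equiv> change_coefficients G n \<theta>"

lemma Th_apply: "Th n \<phi> = (\<lambda>f\<in>Zfun (nerve G (Suc n)). \<theta> (\<phi> f))"
  by (simp add: change_coefficients_def nerve_module_simps)

lemma Th_closed:
  assumes \<phi>: "\<phi> \<in> carrier (cochains G M n)"
  shows "Th n \<phi> \<in> SS.NHom n"
proof -
  interpret N: gspace G "nerve G (Suc n)" "anchor G" "translate G" by (rule gspace_nerve)
  note p = module_homD[OF \<phi>[unfolded cochains_simps(1)], unfolded nerve_module_simps]
  show ?thesis unfolding cochains_simps(1) Th_apply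
  proof (rule module_homI; unfold nerve_module_simps SS.section_module_simps(1))
    fix a b assume a: "a \<in> Zfun (nerve G (Suc n))" and b: "b \<in> Zfun (nerve G (Suc n))"
    show "(\<lambda>f\<in>Zfun (nerve G (Suc n)). \<theta> (\<phi> f)) (\<lambda>y. a y + b y) =
      (\<lambda>f\<in>Zfun (nerve G (Suc n)). \<theta> (\<phi> f)) a \<oplus>\<^bsub>section_module G Sh\<^esub> (\<lambda>f\<in>Zfun (nerve G (Suc n)). \<theta> (\<phi> f)) b"
      using a b p theta_add[OF p(1)[OF a] p(1)[OF b]] by (simp add: Zfun_add)
  next
    fix f a assume f: "f \<in> Zfun (arrows G)" and a: "a \<in> Zfun (nerve G (Suc n))"
    show "(\<lambda>f\<in>Zfun (nerve G (Suc n)). \<theta> (\<phi> f)) (N.smulX f a) =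
      f \<odot>\<^bsub>section_module G Sh\<^esub> (\<lambda>f\<in>Zfun (nerve G (Suc n)). \<theta> (\<phi> f)) a"
      using a f p theta_smult[OF f p(1)[OF a]] by (simp add: N.smul_Zfun)
  qed (use p theta_section in auto)
qed

lemma Th_hom: "Th n \<in> hom (cochains G M n) (cochains G (section_module G Sh) n)"
  unfolding hom_def
proof (rule CollectI, intro conjI Pi_I ballI)
  show "Th n \<phi> \<in> SS.NHom n" if "\<phi> \<in> carrier (cochains G M n)" for \<phi> using that by (rule Th_closed)
  fix \<phi> \<psi> assume \<phi>: "\<phi> \<in> carrier (cochains G M n)" and \<psi>: "\<psi> \<in> carrier (cochains G M n)"
  note p = module_homD(1)[OF \<phi>[unfolded cochains_simps(1)], unfolded nerve_module_simps]
    module_homD(1)[OF \<psi>[unfolded cochains_simps(1)], unfolded nerve_module_simps]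
  show "Th n (\<phi> \<otimes>\<^bsub>cochains G M n\<^esub> \<psi>) = Th n \<phi> \<otimes>\<^bsub>cochains G (section_module G Sh) n\<^esub> Th n \<psi>"
    unfolding Th_apply cochains_simps by (intro restrict_ext) (simp add: theta_add p)
qed

lemma Th_inj: "inj_on (Th n) (carrier (cochains G M n))"
proof (rule inj_onI)
  fix \<phi> \<psi> assume \<phi>: "\<phi> \<in> carrier (cochains G M n)" and \<psi>: "\<psi> \<in> carrier (cochains G M n)" and eq: "Th n \<phi> = Th n \<psi>"
  note p = module_homD(1)[OF \<phi>[unfolded cochains_simps(1)], unfolded nerve_module_simps]
    module_homD(1)[OF \<psi>[unfolded cochains_simps(1)], unfolded nerve_module_simps]
  show "\<phi> = \<psi>"
  proof (rule module_hom_eqI[OF \<phi>[unfolded cochains_simps(1)] \<psi>[unfolded cochains_simps(1)]], unfold nerve_module_simps)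
    fix a assume a: "a \<in> Zfun (nerve G (Suc n))"
    then have "\<theta> (\<phi> a) = \<theta> (\<psi> a)" using fun_cong[OF eq, of a] by (simp add: Th_apply)
    then show "\<phi> a = \<psi> a" using theta_inj[OF p(1)[OF a] p(2)[OF a]] by simp
  qed
qed

text \<open>Preimages are chosen value by value; injectivity of \<open>\<theta>\<close> forces the
  resulting function to be a module homomorphism.\<close>

lemma Th_surj:
  assumes h: "h \<in> SS.NHom n"
  shows "\<exists>\<phi>\<in>carrier (cochains G M n). Th n \<phi> = h"
proof -
  interpret N: gspace G "nerve G (Suc n)" "anchor G" "translate G" by (rule gspace_nerve)
  note p = module_homD[OF h[unfolded cochains_simps(1)], unfolded nerve_module_simps SS.section_module_simps(1)]
  have "\<forall>f\<in>Zfun (nerve G (Suc n)). \<exists>m\<in>carrier M. \<theta> m = h f" using p(1) theta_surj by blast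
  then obtain \<mu> where \<mu>: "\<And>f. f \<in> Zfun (nerve G (Suc n)) \<Longrightarrow> \<mu> f \<in> carrier M \<and> \<theta> (\<mu> f) = h f" by metis
  let ?\<phi> = "restrict \<mu> (Zfun (nerve G (Suc n)))"
  have "?\<phi> \<in> module_hom G (nerve_module G (Suc n)) M"
  proof (rule module_homI; unfold nerve_module_simps)
    fix a b assume a: "a \<in> Zfun (nerve G (Suc n))" and b: "b \<in> Zfun (nerve G (Suc n))"
    have "\<mu> (\<lambda>y. a y + b y) = \<mu> a \<oplus>\<^bsub>M\<^esub> \<mu> b"
      using \<mu>[OF a] \<mu>[OF b] \<mu>[OF Zfun_add[OF a b]] p(3)[OF a b] theta_add[of "\<mu> a" "\<mu> b"] by (intro theta_inj) auto
    then show "?\<phi> (\<lambda>y. a y + b y) = ?\<phi> a \<oplus>\<^bsub>M\<^esub> ?\<phi> b" using a b Zfun_add[OF a b] by simp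
  next
    fix f a assume f: "f \<in> Zfun (arrows G)" and a: "a \<in> Zfun (nerve G (Suc n))"
    have "\<mu> (N.smulX f a) = f \<odot>\<^bsub>M\<^esub> \<mu> a"
      using \<mu>[OF a] \<mu>[OF N.smul_Zfun[OF f a]] p(4)[OF f a] theta_smult[OF f, of "\<mu> a"] smult_closed[OF f, of "\<mu> a"]
      by (intro theta_inj) auto
    then show "?\<phi> (N.smulX f a) = f \<odot>\<^bsub>M\<^esub> ?\<phi> a" using a N.smul_Zfun[OF f a] by simp
  qed (use \<mu> in auto)
  then have \<phi>: "?\<phi> \<in> carrier (cochains G M n)" by (simp add: cochains_simps)
  moreover have "Th n ?\<phi> = h"
    using p(2) \<mu> by (intro extensionalityI[of _ "Zfun (nerve G (Suc n))"]) (simp_all add: Th_apply)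
  ultimately show ?thesis by blast
qed

lemma Th_coboundary: "Th (Suc n) (coboundary_map G n \<phi>) = coboundary_map G n (Th n \<phi>)"
  unfolding Th_apply coboundary_map_apply by (intro restrict_ext) (simp add: boundary_Zfun)

end

section \<open>Long exact cohomology sequences\<close>

locale cochain_complex =
  fixes C :: "nat \<Rightarrow> 'a monoid" and d :: "nat \<Rightarrow> 'a \<Rightarrow> 'a"
  assumes comm: "comm_group (C n)"
    and d_hom: "d n \<in> hom (C n) (C (Suc n))"
    and d_d: "x \<in> carrier (C n) \<Longrightarrow> d (Suc n) (d n x) = \<one>\<^bsub>C (Suc (Suc n))\<^esub>"
begin

sublocale Cg: comm_group "C n" for n
  by (rule comm)

lemma d_group_hom: "group_hom (C n) (C (Suc n)) (d n)"
  using d_hom by (simp add: group_hom_def group_hom_axioms_def Cg.is_group)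

sublocale dh: group_hom "C n" "C (Suc n)" "d n" for n
  by (rule d_group_hom)

definition Z where "Z n = kernel (C n) (C (Suc n)) (d n)"

definition B where "B n = (case n of 0 \<Rightarrow> {\<one>\<^bsub>C 0\<^esub>} | Suc k \<Rightarrow> d k ` carrier (C k))"

definition ZG where "ZG n = (C n)\<lparr>carrier := Z n\<rparr>"

definition H where "H n = ZG n Mod B n"

definition cls where "cls n z = B n #>\<^bsub>ZG n\<^esub> z"

lemma Z_iff: "z \<in> Z n \<longleftrightarrow> z \<in> carrier (C n) \<and> d n z = \<one>\<^bsub>C (Suc n)\<^esub>"
  by (simp add: Z_def kernel_def)

lemma Z_subgroup: "subgroup (Z n) (C n)"
  unfolding Z_def by (rule dh.subgroup_kernel)

lemma Z_mult: "z \<in> Z n \<Longrightarrow> z' \<in> Z n \<Longrightarrow> z \<otimes>\<^bsub>C n\<^esub> z' \<in> Z n"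
  using Z_subgroup by (rule subgroup.m_closed)

lemma Z_inv: "z \<in> Z n \<Longrightarrow> inv\<^bsub>C n\<^esub> z \<in> Z n"
  using Z_subgroup by (rule subgroup.m_inv_closed)

lemma Z_one: "\<one>\<^bsub>C n\<^esub> \<in> Z n"
  using Z_subgroup by (rule subgroup.one_closed)

lemma ZG_simps [simp]: "carrier (ZG n) = Z n" "x \<otimes>\<^bsub>ZG n\<^esub> y = x \<otimes>\<^bsub>C n\<^esub> y" "\<one>\<^bsub>ZG n\<^esub> = \<one>\<^bsub>C n\<^esub>"
  by (simp_all add: ZG_def)

lemma comm_group_ZG: "comm_group (ZG n)"
proof (rule comm_groupI)
  fix x assume "x \<in> carrier (ZG n)"
  then show "\<exists>y\<in>carrier (ZG n). y \<otimes>\<^bsub>ZG n\<^esub> x = \<one>\<^bsub>ZG n\<^esub>"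
    using Z_inv by (intro bexI[of _ "inv\<^bsub>C n\<^esub> x"]) (auto simp: Z_iff)
qed (auto simp: Z_mult Z_one Z_iff Cg.m_ac)

lemma inv_ZG: "z \<in> Z n \<Longrightarrow> inv\<^bsub>ZG n\<^esub> z = inv\<^bsub>C n\<^esub> z"
  using Z_inv by (intro group.inv_equality[OF comm_group.axioms(2)[OF comm_group_ZG]]) (auto simp: Z_iff)

lemma B_subgroup: "subgroup (B n) (C n)"
proof (cases n)
  case 0
  then show ?thesis by (simp add: B_def Cg.triv_subgroup)
next
  case (Suc k)
  then show ?thesis using dh.img_is_subgroup[of k] by (simp add: B_def)
qed

lemma B_Z: "b \<in> B n \<Longrightarrow> b \<in> Z n"
  by (cases n) (auto simp: B_def Z_iff d_d)

lemma B_subgroup_ZG: "subgroup (B n) (ZG n)"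
  using B_Z subgroup.m_closed[OF B_subgroup[of n]] subgroup.one_closed[OF B_subgroup[of n]]
    subgroup.m_inv_closed[OF B_subgroup[of n]]
  by (intro subgroup.intro) (auto simp: inv_ZG)

sublocale BZ: normal "B n" "ZG n" for n
  using comm_group.normal_iff_subgroup[OF comm_group_ZG] B_subgroup_ZG by blast

lemma H_group: "group (H n)"
  unfolding H_def by (rule BZ.factorgroup_is_group)

lemma carrier_H: "carrier (H n) = cls n ` Z n"
  by (simp add: H_def carrier_FactGroup cls_def)

lemma cls_H: "z \<in> Z n \<Longrightarrow> cls n z \<in> carrier (H n)"
  by (simp add: carrier_H)

lemma cls_mult: "z \<in> Z n \<Longrightarrow> z' \<in> Z n \<Longrightarrow> cls n z \<otimes>\<^bsub>H n\<^esub> cls n z' = cls n (z \<otimes>\<^bsub>C n\<^esub> z')"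
  using BZ.rcos_sum[of z n z'] by (simp add: H_def cls_def)

lemma cls_self: "z \<in> Z n \<Longrightarrow> z \<in> cls n z"
  unfolding cls_def by (rule group.rcos_self[OF comm_group.axioms(2)[OF comm_group_ZG] _ B_subgroup_ZG]) simp

lemma mem_cls: "z \<in> Z n \<Longrightarrow> w \<in> cls n z \<longleftrightarrow> w \<in> Z n \<and> w \<otimes>\<^bsub>C n\<^esub> inv\<^bsub>C n\<^esub> z \<in> B n"
proof -
  assume z: "z \<in> Z n"
  have g: "group (ZG n)" using comm_group_ZG by (rule comm_group.axioms(2))
  have "cls n z \<subseteq> Z n" using monoid.r_coset_subset_G[OF group.is_monoid[OF g] BZ.subset, of z] z by (simp add: cls_def)
  then show ?thesis
    using subgroup.rcos_module[OF B_subgroup_ZG g, of z w] z unfolding cls_def by (auto simp: inv_ZG)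
qed

lemma cls_eq_iff: "z \<in> Z n \<Longrightarrow> z' \<in> Z n \<Longrightarrow> cls n z = cls n z' \<longleftrightarrow> z \<otimes>\<^bsub>C n\<^esub> inv\<^bsub>C n\<^esub> z' \<in> B n"
proof
  assume z: "z \<in> Z n" "z' \<in> Z n"
  show "z \<otimes>\<^bsub>C n\<^esub> inv\<^bsub>C n\<^esub> z' \<in> B n" if "cls n z = cls n z'"
    using cls_self[OF z(1)] that mem_cls[OF z(2)] by simp
  assume "z \<otimes>\<^bsub>C n\<^esub> inv\<^bsub>C n\<^esub> z' \<in> B n"
  then have "z \<in> B n #>\<^bsub>ZG n\<^esub> z'" using mem_cls[OF z(2)] z by (simp add: cls_def)
  from group.repr_independence[OF comm_group.axioms(2)[OF comm_group_ZG] this _ B_subgroup_ZG]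
  show "cls n z = cls n z'" using z by (simp add: cls_def)
qed

lemma one_H: "\<one>\<^bsub>H n\<^esub> = cls n \<one>\<^bsub>C n\<^esub>"
  using BZ.coset_join2[OF _ B_subgroup_ZG, of "\<one>\<^bsub>C n\<^esub>"] Z_one subgroup.one_closed[OF B_subgroup]
  by (simp add: H_def cls_def)

lemma cls_eq_one_iff: "z \<in> Z n \<Longrightarrow> cls n z = \<one>\<^bsub>H n\<^esub> \<longleftrightarrow> z \<in> B n"
  using cls_eq_iff[OF _ Z_one, of z n] by (simp add: one_H Z_iff)

lemma cls_inv: "z \<in> Z n \<Longrightarrow> inv\<^bsub>H n\<^esub> (cls n z) = cls n (inv\<^bsub>C n\<^esub> z)"
  using cls_mult[of "inv\<^bsub>C n\<^esub> z" n z] Z_inv[of z n]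
  by (intro group.inv_equality[OF H_group]) (auto simp: one_H cls_H Z_iff)

lemma d_B: "x \<in> carrier (C n) \<Longrightarrow> d n x \<in> B (Suc n)"
  by (simp add: B_def)

end

section \<open>Cochain maps and the maps they induce on classes\<close>

locale cochain_map = C: cochain_complex C dC + D: cochain_complex D dD
  for C :: "nat \<Rightarrow> 'a monoid" and dC and D :: "nat \<Rightarrow> 'b monoid" and dD +
  fixes f :: "nat \<Rightarrow> 'a \<Rightarrow> 'b"
  assumes f_hom: "f n \<in> hom (C n) (D n)"
    and f_d: "x \<in> carrier (C n) \<Longrightarrow> f (Suc n) (dC n x) = dD n (f n x)"
begin

lemma f_group_hom: "group_hom (C n) (D n) (f n)"
  using f_hom by (simp add: group_hom_def group_hom_axioms_def C.Cg.is_group D.Cg.is_group)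

sublocale fh: group_hom "C n" "D n" "f n" for n
  by (rule f_group_hom)

lemma f_Z: "z \<in> C.Z n \<Longrightarrow> f n z \<in> D.Z n"
  using f_d[of z n] fh.hom_one[of "Suc n"] by (auto simp: C.Z_iff D.Z_iff)

lemma f_B: "b \<in> C.B n \<Longrightarrow> f n b \<in> D.B n"
proof (cases n)
  case 0
  then show "b \<in> C.B n \<Longrightarrow> f n b \<in> D.B n" using fh.hom_one[of 0] by (simp add: C.B_def D.B_def)
next
  case (Suc k)
  then show "b \<in> C.B n \<Longrightarrow> f n b \<in> D.B n" using f_d[of _ k] by (auto simp: C.B_def D.B_def)
qed

lemma f_cls: "z \<in> C.Z n \<Longrightarrow> z' \<in> C.Z n \<Longrightarrow> C.cls n z = C.cls n z' \<Longrightarrow> D.cls n (f n z) = D.cls n (f n z')"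
  using f_B[of "z \<otimes>\<^bsub>C n\<^esub> inv\<^bsub>C n\<^esub> z'" n] by (simp add: C.cls_eq_iff D.cls_eq_iff f_Z C.Z_iff[of _ n])

text \<open>A cochain map sends all members of a class into one class, so the union over
  representatives, by which induced maps are defined, collapses to a single coset.\<close>

lemma Union_coset: "z \<in> C.Z n \<Longrightarrow> (\<Union>h\<in>C.cls n z. D.B n #>\<^bsub>D.ZG n\<^esub> f n h) = D.cls n (f n z)"
proof -
  assume z: "z \<in> C.Z n"
  have "D.B n #>\<^bsub>D.ZG n\<^esub> f n h = D.cls n (f n z)" if "h \<in> C.cls n z" for h
  proof -
    have h: "h \<in> C.Z n" "h \<otimes>\<^bsub>C n\<^esub> inv\<^bsub>C n\<^esub> z \<in> C.B n" using that C.mem_cls[OF z] by auto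
    then show ?thesis using f_cls[OF h(1) z] C.cls_eq_iff[OF h(1) z] by (simp add: D.cls_def)
  qed
  then show ?thesis using C.cls_self[OF z] by blast
qed

lemma induced_group_hom:
  assumes "\<And>z. z \<in> C.Z n \<Longrightarrow> fH (C.cls n z) = D.cls n (f n z)"
  shows "group_hom (C.H n) (D.H n) fH"
proof -
  have "fH \<in> hom (C.H n) (D.H n)"
    unfolding hom_def
  proof (rule CollectI, intro conjI Pi_I ballI)
    fix X assume "X \<in> carrier (C.H n)"
    then obtain z where z: "X = C.cls n z" "z \<in> C.Z n" by (auto simp: C.carrier_H)
    then show "fH X \<in> carrier (D.H n)" using assms f_Z D.cls_H by simp
    fix Y assume "Y \<in> carrier (C.H n)"
    then obtain w where w: "Y = C.cls n w" "w \<in> C.Z n" by (auto simp: C.carrier_H)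
    have "fH (X \<otimes>\<^bsub>C.H n\<^esub> Y) = D.cls n (f n (z \<otimes>\<^bsub>C n\<^esub> w))"
      using z w assms[OF C.Z_mult[OF z(2) w(2)]] by (simp add: C.cls_mult)
    also have "f n (z \<otimes>\<^bsub>C n\<^esub> w) = f n z \<otimes>\<^bsub>D n\<^esub> f n w" using z w by (simp add: C.Z_iff)
    also have "D.cls n \<dots> = fH X \<otimes>\<^bsub>D.H n\<^esub> fH Y" using z w assms by (simp add: D.cls_mult f_Z)
    finally show "fH (X \<otimes>\<^bsub>C.H n\<^esub> Y) = fH X \<otimes>\<^bsub>D.H n\<^esub> fH Y" .
  qed
  then show ?thesis using C.H_group D.H_group by (simp add: group_hom_def group_hom_axioms_def)
qed

end

section \<open>The connecting homomorphism and exactness\<close>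

locale short_exact_complexes = i: cochain_map C dC D dD i + q: cochain_map D dD E dE q
  for C :: "nat \<Rightarrow> 'a monoid" and dC and D :: "nat \<Rightarrow> 'b monoid" and dD and E :: "nat \<Rightarrow> 'c monoid" and dE and i q +
  assumes i_inj: "inj_on (i n) (carrier (C n))"
    and exact: "i n ` carrier (C n) = kernel (D n) (E n) (q n)"
    and q_surj: "q n ` carrier (D n) = carrier (E n)"
begin

lemma i_q: "x \<in> carrier (C n) \<Longrightarrow> q n (i n x) = \<one>\<^bsub>E n\<^esub>"
  using exact[of n] by (auto simp: kernel_def)

lemma q_one_obtain:
  assumes "y \<in> carrier (D n)" "q n y = \<one>\<^bsub>E n\<^esub>"
  obtains x where "x \<in> carrier (C n)" "i n x = y"
proof -
  have "y \<in> i n ` carrier (C n)" using assms unfolding exact by (simp add: kernel_def)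
  then show ?thesis using that by auto
qed

lemma q_obtain:
  assumes "w \<in> carrier (E n)"
  obtains y where "y \<in> carrier (D n)" "q n y = w"
proof -
  have "w \<in> q n ` carrier (D n)" using assms unfolding q_surj .
  then show ?thesis using that by auto
qed

lemma i_injD: "i n x = i n y \<Longrightarrow> x \<in> carrier (C n) \<Longrightarrow> y \<in> carrier (C n) \<Longrightarrow> x = y"
  using i_inj by (auto dest: inj_onD)

lemma i_one_D: "i n x = \<one>\<^bsub>D n\<^esub> \<Longrightarrow> x \<in> carrier (C n) \<Longrightarrow> x = \<one>\<^bsub>C n\<^esub>"
  using i_injD[of n x "\<one>\<^bsub>C n\<^esub>"] i.fh.hom_one by simp

text \<open>The zigzag of the snake lemma: lift \<open>w\<close> to \<open>v\<close>, apply the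
  differential, and pull back along \<open>i\<close>. It is a relation because the lift is not
  unique.\<close>

definition connects :: "nat \<Rightarrow> 'c \<Rightarrow> 'a \<Rightarrow> bool" where
  "connects n w u \<longleftrightarrow> u \<in> carrier (C (Suc n)) \<and> (\<exists>v\<in>carrier (D n). q n v = w \<and> dD n v = i (Suc n) u)"

text \<open>The differential of \<open>u\<close> vanishes because the injective \<open>i\<close>
  maps it to a double differential; \<open>w\<close> is a cocycle because \<open>q\<close> kills the
  image of \<open>i\<close>.\<close>

lemma connects_Z:
  assumes "connects n w u"
  shows "u \<in> i.C.Z (Suc n)" "w \<in> q.D.Z n"
proof -
  obtain v where v: "v \<in> carrier (D n)" "q n v = w" "dD n v = i (Suc n) u" and u: "u \<in> carrier (C (Suc n))"
    using assms by (auto simp: connects_def)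
  have "i (Suc (Suc n)) (dC (Suc n) u) = \<one>\<^bsub>D (Suc (Suc n))\<^esub>"
    using i.f_d[OF u] v i.D.d_d[OF v(1)] by simp
  then have "dC (Suc n) u = \<one>\<^bsub>C (Suc (Suc n))\<^esub>" using u by (simp add: i_one_D)
  then show "u \<in> i.C.Z (Suc n)" using u by (simp add: i.C.Z_iff)
  have "dE n w = \<one>\<^bsub>E (Suc n)\<^esub>" using q.f_d[OF v(1)] v i_q[OF u] by simp
  then show "w \<in> q.D.Z n" using v q.fh.hom_closed by (auto simp: q.D.Z_iff)
qed

lemma connects_exists:
  assumes "w \<in> q.D.Z n"
  shows "\<exists>u. connects n w u"
proof -
  have w: "w \<in> carrier (E n)" "dE n w = \<one>\<^bsub>E (Suc n)\<^esub>" using assms by (auto simp: q.D.Z_iff)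
  obtain v where v: "v \<in> carrier (D n)" "q n v = w" using q_obtain[OF w(1)] .
  have "q (Suc n) (dD n v) = \<one>\<^bsub>E (Suc n)\<^esub>" using q.f_d[OF v(1)] v w by simp
  then obtain u where u: "u \<in> carrier (C (Suc n))" "i (Suc n) u = dD n v"
    using q_one_obtain[of "dD n v" "Suc n"] i.D.dh.hom_closed[OF v(1)] by blast
  have "connects n w u" unfolding connects_def using u v by (intro conjI bexI[of _ v]) auto
  then show ?thesis by blast
qed

lemma connects_mult:
  assumes "connects n w u" "connects n w' u'"
  shows "connects n (w \<otimes>\<^bsub>E n\<^esub> w') (u \<otimes>\<^bsub>C (Suc n)\<^esub> u')"
proof -
  obtain v v' where "v \<in> carrier (D n)" "q n v = w" "dD n v = i (Suc n) u" "u \<in> carrier (C (Suc n))"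
    "v' \<in> carrier (D n)" "q n v' = w'" "dD n v' = i (Suc n) u'" "u' \<in> carrier (C (Suc n))"
    using assms by (auto simp: connects_def)
  then show ?thesis unfolding connects_def by (intro conjI bexI[of _ "v \<otimes>\<^bsub>D n\<^esub> v'"]) auto
qed

lemma connects_inv:
  assumes "connects n w u"
  shows "connects n (inv\<^bsub>E n\<^esub> w) (inv\<^bsub>C (Suc n)\<^esub> u)"
proof -
  obtain v where "v \<in> carrier (D n)" "q n v = w" "dD n v = i (Suc n) u" "u \<in> carrier (C (Suc n))"
    using assms by (auto simp: connects_def)
  then show ?thesis unfolding connects_def by (intro conjI bexI[of _ "inv\<^bsub>D n\<^esub> v"]) auto
qed

text \<open>By surjectivity of \<open>q\<close> one degree lower, a coboundary is the image of a
  coboundary, in particular of a cocycle; in degree 0 it is the neutral element.\<close>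

lemma B_lift:
  assumes "w \<in> q.D.B n"
  obtains b where "b \<in> carrier (D n)" "q n b = w" "dD n b = \<one>\<^bsub>D (Suc n)\<^esub>"
proof (cases n)
  case 0
  then have "w = \<one>\<^bsub>E n\<^esub>" using assms by (simp add: q.D.B_def)
  then show ?thesis using that[of "\<one>\<^bsub>D n\<^esub>"] by simp
next
  case (Suc k)
  then obtain e where e: "e \<in> carrier (E k)" "w = dE k e" using assms by (auto simp: q.D.B_def)
  obtain s where s: "s \<in> carrier (D k)" "q k s = e" using q_obtain[OF e(1)] .
  have "q n (dD k s) = w" using q.f_d[OF s(1)] s e Suc by simp
  then show ?thesis using that[of "dD k s"] s i.D.d_d[OF s(1)] Suc by simp
qed

text \<open>Two lifts of \<open>w\<close> differ by an element of the image of \<open>i\<close>.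
  Comparing \<open>v\<close> with a lift \<open>b\<close> that is a cocycle exhibits
  \<open>u\<close> as the differential of a preimage of this difference.\<close>

lemma connects_B:
  assumes "connects n w u" "w \<in> q.D.B n"
  shows "u \<in> i.C.B (Suc n)"
proof -
  obtain v where v: "v \<in> carrier (D n)" "q n v = w" "dD n v = i (Suc n) u" and u: "u \<in> carrier (C (Suc n))"
    using assms by (auto simp: connects_def)
  obtain b where b: "b \<in> carrier (D n)" "q n b = w" "dD n b = \<one>\<^bsub>D (Suc n)\<^esub>" using B_lift[OF assms(2)] .
  have "q n (v \<otimes>\<^bsub>D n\<^esub> inv\<^bsub>D n\<^esub> b) = \<one>\<^bsub>E n\<^esub>" using v b q.fh.hom_closed[OF v(1)] by simp
  then obtain t where t: "t \<in> carrier (C n)" "i n t = v \<otimes>\<^bsub>D n\<^esub> inv\<^bsub>D n\<^esub> b"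
    using q_one_obtain[of "v \<otimes>\<^bsub>D n\<^esub> inv\<^bsub>D n\<^esub> b" n] v b by auto
  have "i (Suc n) (dC n t) = dD n (v \<otimes>\<^bsub>D n\<^esub> inv\<^bsub>D n\<^esub> b)" using i.f_d[OF t(1)] t by simp
  also have "\<dots> = i (Suc n) u" using v b u by simp
  finally have "u = dC n t" using i_injD[of "Suc n" u "dC n t"] u t by simp
  then show ?thesis using i.C.d_B[OF t(1)] by simp
qed

lemma connects_cls:
  assumes "connects n w u" "connects n w' u'" "q.D.cls n w = q.D.cls n w'"
  shows "i.C.cls (Suc n) u = i.C.cls (Suc n) u'"
proof -
  note z = connects_Z[OF assms(1)] connects_Z[OF assms(2)]
  have "w \<otimes>\<^bsub>E n\<^esub> inv\<^bsub>E n\<^esub> w' \<in> q.D.B n" using assms(3) q.D.cls_eq_iff[OF z(2,4)] by simp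
  then have "u \<otimes>\<^bsub>C (Suc n)\<^esub> inv\<^bsub>C (Suc n)\<^esub> u' \<in> i.C.B (Suc n)"
    using connects_B[OF connects_mult[OF assms(1) connects_inv[OF assms(2)]]] by simp
  then show ?thesis using i.C.cls_eq_iff[OF z(1,3)] by simp
qed

text \<open>Any element connected to some representative of the class may be selected; its class
  does not depend on the selection, by \<open>delta_cls\<close>.\<close>

definition delta :: "nat \<Rightarrow> 'c set \<Rightarrow> 'a set" where
  "delta n X = i.C.cls (Suc n) (SOME u. \<exists>w\<in>q.D.Z n. X = q.D.cls n w \<and> connects n w u)"

lemma delta_cls:
  assumes "connects n w u"
  shows "delta n (q.D.cls n w) = i.C.cls (Suc n) u"
proof -
  let ?P = "\<lambda>u. \<exists>w'\<in>q.D.Z n. q.D.cls n w = q.D.cls n w' \<and> connects n w' u"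
  have "?P u" using assms connects_Z(2) by blast
  then have "?P (SOME u. ?P u)" by (rule someI)
  then obtain w' where "q.D.cls n w = q.D.cls n w'" "connects n w' (SOME u. ?P u)" by blast
  then show ?thesis using connects_cls[OF assms] unfolding delta_def by simp
qed

lemma delta_group_hom: "group_hom (q.D.H n) (i.C.H (Suc n)) (delta n)"
proof -
  have "delta n \<in> hom (q.D.H n) (i.C.H (Suc n))"
    unfolding hom_def
  proof (rule CollectI, intro conjI Pi_I ballI)
    fix X assume "X \<in> carrier (q.D.H n)"
    then obtain w where w: "X = q.D.cls n w" "w \<in> q.D.Z n" by (auto simp: q.D.carrier_H)
    obtain u where u: "connects n w u" using connects_exists[OF w(2)] by blast
    show "delta n X \<in> carrier (i.C.H (Suc n))" using delta_cls[OF u] w connects_Z(1)[OF u] i.C.cls_H by simp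
    fix Y assume "Y \<in> carrier (q.D.H n)"
    then obtain w' where w': "Y = q.D.cls n w'" "w' \<in> q.D.Z n" by (auto simp: q.D.carrier_H)
    obtain u' where u': "connects n w' u'" using connects_exists[OF w'(2)] by blast
    show "delta n (X \<otimes>\<^bsub>q.D.H n\<^esub> Y) = delta n X \<otimes>\<^bsub>i.C.H (Suc n)\<^esub> delta n Y"
      using delta_cls[OF connects_mult[OF u u']] delta_cls[OF u] delta_cls[OF u'] w w'
        q.D.cls_mult[OF w(2) w'(2)] i.C.cls_mult[OF connects_Z(1)[OF u] connects_Z(1)[OF u']] by simp
  qed
  then show ?thesis using q.D.H_group i.C.H_group by (simp add: group_hom_def group_hom_axioms_def)
qed

text \<open>The induced maps are prescribed only by their values on classes, so that the maps of the
  theorem, given by unions of cosets, can be inserted.\<close>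

context
  fixes iH :: "nat \<Rightarrow> 'a set \<Rightarrow> 'b set" and qH :: "nat \<Rightarrow> 'b set \<Rightarrow> 'c set"
  assumes iH: "z \<in> i.C.Z n \<Longrightarrow> iH n (i.C.cls n z) = i.D.cls n (i n z)"
    and qH: "y \<in> i.D.Z n \<Longrightarrow> qH n (i.D.cls n y) = q.D.cls n (q n y)"
begin

text \<open>In degree 0 the only coboundary is the neutral element, so injectivity of
  \<open>i\<close> passes to classes.\<close>

lemma iH_inj: "inj_on (iH 0) (carrier (i.C.H 0))"
proof (rule inj_onI)
  fix X Y assume "X \<in> carrier (i.C.H 0)" "Y \<in> carrier (i.C.H 0)" and eq: "iH 0 X = iH 0 Y"
  then obtain x y where x: "X = i.C.cls 0 x" "x \<in> i.C.Z 0" and y: "Y = i.C.cls 0 y" "y \<in> i.C.Z 0"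
    by (auto simp: i.C.carrier_H)
  have c: "x \<in> carrier (C 0)" "y \<in> carrier (C 0)" using x y by (auto simp: i.C.Z_iff)
  have "i 0 x \<otimes>\<^bsub>D 0\<^esub> inv\<^bsub>D 0\<^esub> i 0 y \<in> i.D.B 0"
    using eq x y iH i.D.cls_eq_iff[OF i.f_Z[OF x(2)] i.f_Z[OF y(2)]] by simp
  then have "i 0 x \<otimes>\<^bsub>D 0\<^esub> inv\<^bsub>D 0\<^esub> i 0 y = \<one>\<^bsub>D 0\<^esub>" by (simp add: i.D.B_def)
  then have "i 0 (x \<otimes>\<^bsub>C 0\<^esub> inv\<^bsub>C 0\<^esub> y) = \<one>\<^bsub>D 0\<^esub>" using c by simp
  then have "x \<otimes>\<^bsub>C 0\<^esub> inv\<^bsub>C 0\<^esub> y = \<one>\<^bsub>C 0\<^esub>" by (rule i_one_D) (use c in simp)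
  then have "x \<otimes>\<^bsub>C 0\<^esub> inv\<^bsub>C 0\<^esub> y \<in> i.C.B 0" by (simp add: i.C.B_def)
  then show "X = Y" using i.C.cls_eq_iff[OF x(2) y(2)] x y by simp
qed

lemma exact_middle: "exact_at (i.C.H n) (iH n) (i.D.H n) (qH n) (q.D.H n)"
  unfolding exact_at_def
proof (intro conjI equalityI subsetI)
  show "group_hom (i.C.H n) (i.D.H n) (iH n)" using iH by (rule i.induced_group_hom)
  show "group_hom (i.D.H n) (q.D.H n) (qH n)" using qH by (rule q.induced_group_hom)
  fix Y assume "Y \<in> iH n ` carrier (i.C.H n)"
  then obtain x where x: "x \<in> i.C.Z n" "Y = iH n (i.C.cls n x)" by (auto simp: i.C.carrier_H)
  have "Y = i.D.cls n (i n x)" using x iH by simp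
  moreover have "qH n Y = \<one>\<^bsub>q.D.H n\<^esub>"
    using qH[OF i.f_Z[OF x(1)]] calculation i_q[of x n] x by (simp add: i.C.Z_iff q.D.one_H)
  ultimately show "Y \<in> kernel (i.D.H n) (q.D.H n) (qH n)"
    using i.D.cls_H[OF i.f_Z[OF x(1)]] by (simp add: kernel_def)
next
  fix Y assume "Y \<in> kernel (i.D.H n) (q.D.H n) (qH n)"
  then obtain y where y: "y \<in> i.D.Z n" "Y = i.D.cls n y" "qH n Y = \<one>\<^bsub>q.D.H n\<^esub>"
    by (auto simp: kernel_def i.D.carrier_H)
  then have "q n y \<in> q.D.B n" using q.D.cls_eq_one_iff[OF q.f_Z[OF y(1)]] qH by simp
  moreover have yc: "y \<in> carrier (D n)" "dD n y = \<one>\<^bsub>D (Suc n)\<^esub>" using y by (auto simp: i.D.Z_iff)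
  \<comment> \<open>The coboundary \<open>q n y\<close> is lifted to a coboundary \<open>b\<close>,
    so that \<open>y\<close> can be changed within its class to an element of the kernel of
    \<open>q\<close>, hence of the image of \<open>i\<close>.\<close>
  ultimately obtain b where b: "b \<in> i.D.B n" "q n b = q n y"
  proof (cases n)
    case 0
    then have "q n y = \<one>\<^bsub>E n\<^esub>" using \<open>q n y \<in> q.D.B n\<close> by (simp add: q.D.B_def)
    then show ?thesis using that[of "\<one>\<^bsub>D n\<^esub>"] subgroup.one_closed[OF i.D.B_subgroup] by simp
  next
    case (Suc k)
    then obtain e where e: "e \<in> carrier (E k)" "q n y = dE k e" using \<open>q n y \<in> q.D.B n\<close> by (auto simp: q.D.B_def)
    obtain s where s: "s \<in> carrier (D k)" "q k s = e" using q_obtain[OF e(1)] .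
    have "q n (dD k s) = q n y" using q.f_d[OF s(1)] s e Suc by simp
    then show ?thesis using that[of "dD k s"] i.D.d_B[OF s(1)] Suc by simp
  qed
  have bc: "b \<in> carrier (D n)" "dD n b = \<one>\<^bsub>D (Suc n)\<^esub>" using i.D.B_Z[OF b(1)] by (auto simp: i.D.Z_iff)
  have "q n (y \<otimes>\<^bsub>D n\<^esub> inv\<^bsub>D n\<^esub> b) = \<one>\<^bsub>E n\<^esub>" using yc bc b(2) by simp
  then obtain x where x: "x \<in> carrier (C n)" "i n x = y \<otimes>\<^bsub>D n\<^esub> inv\<^bsub>D n\<^esub> b"
    using q_one_obtain[of "y \<otimes>\<^bsub>D n\<^esub> inv\<^bsub>D n\<^esub> b" n] yc bc by auto
  have "i (Suc n) (dC n x) = \<one>\<^bsub>D (Suc n)\<^esub>" using i.f_d[OF x(1)] x yc bc by simp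
  then have "dC n x = \<one>\<^bsub>C (Suc n)\<^esub>" by (rule i_one_D) (use x in simp)
  then have xZ: "x \<in> i.C.Z n" using x by (simp add: i.C.Z_iff)
  have "i n x \<otimes>\<^bsub>D n\<^esub> inv\<^bsub>D n\<^esub> y = inv\<^bsub>D n\<^esub> b"
    using x yc bc by (simp add: i.D.Cg.m_comm[of y n] i.D.Cg.m_assoc)
  then have "i n x \<otimes>\<^bsub>D n\<^esub> inv\<^bsub>D n\<^esub> y \<in> i.D.B n" using subgroup.m_inv_closed[OF i.D.B_subgroup b(1)] by simp
  then have "iH n (i.C.cls n x) = Y" using iH[OF xZ] i.D.cls_eq_iff[OF i.f_Z[OF xZ] y(1)] y by simp
  then show "Y \<in> iH n ` carrier (i.C.H n)" using i.C.cls_H[OF xZ] by blast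
qed

lemma exact_right: "exact_at (i.D.H n) (qH n) (q.D.H n) (delta n) (i.C.H (Suc n))"
  unfolding exact_at_def
proof (intro conjI equalityI subsetI)
  show "group_hom (i.D.H n) (q.D.H n) (qH n)" using qH by (rule q.induced_group_hom)
  show "group_hom (q.D.H n) (i.C.H (Suc n)) (delta n)" by (rule delta_group_hom)
  fix X assume "X \<in> qH n ` carrier (i.D.H n)"
  then obtain y where y: "y \<in> i.D.Z n" "X = q.D.cls n (q n y)" using qH by (auto simp: i.D.carrier_H)
  have "connects n (q n y) \<one>\<^bsub>C (Suc n)\<^esub>" using y by (auto simp: connects_def i.D.Z_iff)
  from delta_cls[OF this] have "delta n X = \<one>\<^bsub>i.C.H (Suc n)\<^esub>" using y by (simp add: i.C.one_H)
  then show "X \<in> kernel (q.D.H n) (i.C.H (Suc n)) (delta n)"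
    using y q.D.cls_H[OF q.f_Z[OF y(1)]] by (simp add: kernel_def)
next
  fix X assume "X \<in> kernel (q.D.H n) (i.C.H (Suc n)) (delta n)"
  then obtain w where w: "w \<in> q.D.Z n" "X = q.D.cls n w" "delta n X = \<one>\<^bsub>i.C.H (Suc n)\<^esub>"
    by (auto simp: kernel_def q.D.carrier_H)
  obtain u where u: "connects n w u" using connects_exists[OF w(1)] by blast
  then obtain v where v: "v \<in> carrier (D n)" "q n v = w" "dD n v = i (Suc n) u" and uc: "u \<in> carrier (C (Suc n))"
    by (auto simp: connects_def)
  have "u \<in> i.C.B (Suc n)" using delta_cls[OF u] w i.C.cls_eq_one_iff[OF connects_Z(1)[OF u]] by simp
  then obtain t where t: "t \<in> carrier (C n)" "u = dC n t" by (auto simp: i.C.B_def)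
  \<comment> \<open>Dividing by \<open>i n t\<close> removes the differential of the lift
    \<open>v\<close> without changing its image under \<open>q\<close>.\<close>
  let ?y = "v \<otimes>\<^bsub>D n\<^esub> inv\<^bsub>D n\<^esub> i n t"
  have "dD n (i n t) = i (Suc n) u" using i.f_d[OF t(1)] t by simp
  then have "?y \<in> i.D.Z n" using v t uc by (simp add: i.D.Z_iff)
  moreover have "q n ?y = w" using v t i_q[OF t(1)] q.fh.hom_closed[OF v(1)] by simp
  ultimately have "qH n (i.D.cls n ?y) = X" using qH w by simp
  then show "X \<in> qH n ` carrier (i.D.H n)" using i.D.cls_H[OF \<open>?y \<in> i.D.Z n\<close>] by blast
qed

lemma exact_left: "exact_at (q.D.H n) (delta n) (i.C.H (Suc n)) (iH (Suc n)) (i.D.H (Suc n))"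
  unfolding exact_at_def
proof (intro conjI equalityI subsetI)
  show "group_hom (q.D.H n) (i.C.H (Suc n)) (delta n)" by (rule delta_group_hom)
  show "group_hom (i.C.H (Suc n)) (i.D.H (Suc n)) (iH (Suc n))" using iH by (rule i.induced_group_hom)
  fix X assume "X \<in> delta n ` carrier (q.D.H n)"
  then obtain w where w: "w \<in> q.D.Z n" "X = delta n (q.D.cls n w)" by (auto simp: q.D.carrier_H)
  obtain u where u: "connects n w u" using connects_exists[OF w(1)] by blast
  then obtain v where v: "v \<in> carrier (D n)" "dD n v = i (Suc n) u" by (auto simp: connects_def)
  note uZ = connects_Z(1)[OF u]
  have X: "X = i.C.cls (Suc n) u" using delta_cls[OF u] w by simp
  have "i (Suc n) u \<in> i.D.B (Suc n)" using i.D.d_B[OF v(1)] v by simp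
  then have "iH (Suc n) X = \<one>\<^bsub>i.D.H (Suc n)\<^esub>" using iH[OF uZ] X i.D.cls_eq_one_iff[OF i.f_Z[OF uZ]] by simp
  then show "X \<in> kernel (i.C.H (Suc n)) (i.D.H (Suc n)) (iH (Suc n))"
    using X i.C.cls_H[OF uZ] by (simp add: kernel_def)
next
  fix X assume "X \<in> kernel (i.C.H (Suc n)) (i.D.H (Suc n)) (iH (Suc n))"
  then obtain u where u: "u \<in> i.C.Z (Suc n)" "X = i.C.cls (Suc n) u" "iH (Suc n) X = \<one>\<^bsub>i.D.H (Suc n)\<^esub>"
    by (auto simp: kernel_def i.C.carrier_H)
  then have "i (Suc n) u \<in> i.D.B (Suc n)" using iH i.D.cls_eq_one_iff[OF i.f_Z[OF u(1)]] by simp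
  then obtain v where v: "v \<in> carrier (D n)" "i (Suc n) u = dD n v" by (auto simp: i.D.B_def)
  then have c: "connects n (q n v) u" using u by (auto simp: connects_def i.C.Z_iff)
  then show "X \<in> delta n ` carrier (q.D.H n)"
    using delta_cls[OF c] u(2) q.D.cls_H[OF connects_Z(2)[OF c]] by (intro image_eqI[of _ _ "q.D.cls n (q n v)"]) auto
qed

end

end

section \<open>The long exact sequence of the skew product\<close>

lemma (in ample_groupoid) cochain_complex_cochains:
  assumes "smodule G M"
  shows "cochain_complex (cochains G M) (coboundary_map G)"
  by (rule cochain_complex.intro)
    (use comm_group_cochains[OF assms] coboundary_map_hom coboundary_coboundary[OF assms] in auto)

text \<open>The groups of the abstract theory have the same shape as the concrete definitions, so
  they are equal to them and not merely isomorphic.\<close>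

lemma cochain_complex_unfold:
  assumes "cochain_complex (cochains G M) (coboundary_map G)"
  shows "cochain_complex.ZG (cochains G M) (coboundary_map G) n = cocycle_group G M n"
    and "cochain_complex.B (cochains G M) (coboundary_map G) n = coboundaries G M n"
    and "cochain_complex.H (cochains G M) (coboundary_map G) n = cohomology G M n"
  using cochain_complex.Z_def[OF assms] cochain_complex.ZG_def[OF assms] cochain_complex.B_def[OF assms]
    cochain_complex.H_def[OF assms]
  by (simp_all add: cocycle_group_def coboundaries_def cohomology_def)

text \<open>\<open>F\<close> stands for a map given by an explicit formula and \<open>f\<close> for
  the cochain map it realises. Members of a class are cochains, so agreement on cochains suffices
  for the unions of cosets.\<close>

lemma cohomology_map_cls:
  assumes f: "cochain_map (cochains G M) (coboundary_map G) (cochains G' M') (coboundary_map G') f"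
    and F: "\<And>h. h \<in> carrier (cochains G M n) \<Longrightarrow> F h = f n h"
    and z: "z \<in> cochain_complex.Z (cochains G M) (coboundary_map G) n"
  shows "cohomology_map G' M' n F (cochain_complex.cls (cochains G M) (coboundary_map G) n z) =
    cochain_complex.cls (cochains G' M') (coboundary_map G') n (f n z)"
proof -
  interpret f: cochain_map "cochains G M" "coboundary_map G" "cochains G' M'" "coboundary_map G'" f by (rule f)
  note u = cochain_complex_unfold[OF f.D.cochain_complex_axioms]
  have "F h = f n h" if "h \<in> f.C.cls n z" for h using that f.C.mem_cls[OF z] F by (auto simp: f.C.Z_iff)
  then have "cohomology_map G' M' n F (f.C.cls n z) = (\<Union>h\<in>f.C.cls n z. f.D.B n #>\<^bsub>f.D.ZG n\<^esub> f n h)"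
    unfolding cohomology_map_def u by (intro SUP_cong) auto
  then show ?thesis using f.Union_coset[OF z] by simp
qed

lemma (in comm_group) hom_id_minus:
  assumes f: "f \<in> hom G G"
  shows "(\<lambda>x. x \<otimes> inv (f x)) \<in> hom G G"
proof -
  interpret f: group_hom G G f using f by (simp add: group_hom_def group_hom_axioms_def)
  show ?thesis by (rule homI) (auto simp: inv_mult_group m_ac)
qed

lemma (in cochain_complex) id_minus_cochain_map:
  assumes "cochain_map C d C d f"
  shows "cochain_map C d C d (\<lambda>n x. x \<otimes>\<^bsub>C n\<^esub> inv\<^bsub>C n\<^esub> (f n x))"
proof -
  interpret f: cochain_map C d C d f by (rule assms)
  show ?thesis
    by (intro cochain_map.intro cochain_complex_axioms cochain_map_axioms.intro Cg.hom_id_minus f.f_hom) (simp add: f.f_d)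
qed

theorem theorem4p2:
  fixes G :: "'g groupoid" and c :: "'g \<Rightarrow> int" and M :: "('g \<Rightarrow> int, 'm) module"
  assumes "ample_groupoid G" and "cocycle G c" and "groupoid_module G M"
  shows "let H = cohomology G M; HS = cohomology (skew_product G c) (pi_module G c M) in
    \<exists>d. inj_on (pi_star G c M 0) (carrier (H 0)) \<and>
      (\<forall>n. exact_at (H n) (pi_star G c M n) (HS n) (id_minus_c_star G c M n) (HS n) \<and>
           exact_at (HS n) (id_minus_c_star G c M n) (HS n) (d n) (H (Suc n)) \<and>
           exact_at (HS n) (d n) (H (Suc n)) (pi_star G c M (Suc n)) (HS (Suc n)))"
proof -
  interpret mg: module_groupoid G M using assms by (intro module_groupoid.intro module_groupoid_axioms.intro)
  interpret cg: cocycle_groupoid G c using assms by (intro cocycle_groupoid.intro cocycle_groupoid_axioms.intro)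
  interpret sk: skew_sheaf G mg.Sh c
    by (intro skew_sheaf.intro mg.gsheaf_Sh cg.cocycle_groupoid_axioms)
  interpret S: ample_groupoid cg.S by (rule cg.ample_groupoid_skew)
  let ?C = "cochains G M" and ?D = "cochains cg.S (pi_module G c M)"
  let ?dC = "coboundary_map G :: nat \<Rightarrow> (((nat \<Rightarrow> 'g) \<Rightarrow> int) \<Rightarrow> 'm) \<Rightarrow> _" and ?dD = "coboundary_map cg.S :: nat \<Rightarrow> _ \<Rightarrow> (((nat \<Rightarrow> 'g \<times> int) \<Rightarrow> int) \<Rightarrow> 'g \<times> int \<Rightarrow> ('g \<times> int) \<times> 'g \<times> ('g set \<times> 'm) set)"
  let ?N = "cochains G (section_module G mg.Sh)"
  \<comment> \<open>Cochains of \<open>M\<close> are first identified with cochains of its sections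
    and then pulled back; this composite underlies \<open>pi_star\<close>.\<close>
  define i where "i = (\<lambda>n. sk.Pi_map n \<circ> mg.Th n)"
  define q where "q = (\<lambda>n h. h \<otimes>\<^bsub>?D n\<^esub> inv\<^bsub>?D n\<^esub> (sk.Sh_map n h))"
  have P: "pi_sheaf G c M = sk.P" "pi_module G c M = section_module cg.S sk.P"
    by (simp_all add: pi_sheaf_def pi_module_def)
  have C: "cochain_complex ?C ?dC" by (rule mg.cochain_complex_cochains[OF mg.smodule_M])
  have D: "cochain_complex ?D ?dD"
    unfolding P by (rule S.cochain_complex_cochains[OF gsheaf.smodule_section[OF sk.gsheaf_pullback]])
  interpret D: cochain_complex ?D ?dD by (rule D)
  have Sh: "cochain_map ?D ?dD ?D ?dD sk.Sh_map"
    using sk.Sh_hom sk.Sh_coboundary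
    by (intro cochain_map.intro cochain_map_axioms.intro D) (auto simp: P)
  have i: "cochain_map ?C ?dC ?D ?dD i"
  proof (intro cochain_map.intro cochain_map_axioms.intro C D)
    show "i n \<in> hom (?C n) (?D n)" for n
      unfolding i_def P using mg.Th_hom sk.Pi_hom by (rule hom_compose)
    show "i (Suc n) (?dC n x) = ?dD n (i n x)" if "x \<in> carrier (?C n)" for n x
      using sk.Pi_coboundary[OF mg.Th_closed[OF that]] mg.Th_coboundary[of n x] by (simp add: i_def)
  qed
  have q: "cochain_map ?D ?dD ?D ?dD q"
    unfolding q_def by (rule D.id_minus_cochain_map[OF Sh])
  interpret Sh: cochain_map ?D ?dD ?D ?dD sk.Sh_map by (rule Sh)
  \<comment> \<open>The kernel of \<open>q\<close> thus consists of the shift-invariant cochains,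
    which \<open>Pi_image\<close> recognises as pullbacks.\<close>
  have q_one: "q n h = \<one>\<^bsub>?D n\<^esub> \<longleftrightarrow> sk.Sh_map n h = h" if h: "h \<in> carrier (?D n)" for n h
  proof
    assume "q n h = \<one>\<^bsub>?D n\<^esub>"
    then have "h \<otimes>\<^bsub>?D n\<^esub> inv\<^bsub>?D n\<^esub> (sk.Sh_map n h) = \<one>\<^bsub>?D n\<^esub>" by (simp add: q_def)
    from D.Cg.inv_equality[OF this] show "sk.Sh_map n h = h" using h by simp
  qed (use h in \<open>simp add: q_def\<close>)
  interpret X: short_exact_complexes ?C ?dC ?D ?dD ?D ?dD i q
  proof (intro short_exact_complexes.intro short_exact_complexes_axioms.intro i q)
    fix n
    have "inj_on (sk.Pi_map n) (mg.Th n ` carrier (?C n))"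
      by (rule inj_on_subset[OF sk.Pi_inj]) (use mg.Th_closed in blast)
    then show "inj_on (i n) (carrier (?C n))" unfolding i_def by (rule comp_inj_on[OF mg.Th_inj])
    show "i n ` carrier (?C n) = kernel (?D n) (?D n) (q n)"
    proof (intro equalityI subsetI)
      fix h assume "h \<in> i n ` carrier (?C n)"
      then obtain z where z: "z \<in> carrier (?C n)" "h = sk.Pi_map n (mg.Th n z)" by (auto simp: i_def)
      have "h \<in> carrier (?D n)" using sk.Pi_closed[OF mg.Th_closed[OF z(1)]] z(2) by (simp add: P)
      moreover have "sk.Sh_map n h = h" using sk.Sh_Pi[OF mg.Th_closed[OF z(1)]] z(2) by simp
      ultimately show "h \<in> kernel (?D n) (?D n) (q n)" using q_one by (simp add: kernel_def)
    next
      fix h assume "h \<in> kernel (?D n) (?D n) (q n)"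
      then have h: "h \<in> carrier (?D n)" "sk.Sh_map n h = h" using q_one by (auto simp: kernel_def)
      obtain y where y: "y \<in> carrier (?N n)" "h = sk.Pi_map n y" using sk.Pi_image[of h n] h unfolding P by blast
      obtain z where "z \<in> carrier (?C n)" "mg.Th n z = y" using mg.Th_surj[OF y(1)] by blast
      then show "h \<in> i n ` carrier (?C n)" using y by (auto simp: i_def)
    qed
    show "q n ` carrier (?D n) = carrier (?D n)"
    proof (intro equalityI subsetI)
      show "h \<in> carrier (?D n)" if "h \<in> q n ` carrier (?D n)" for h using that by (auto simp: q_def)
      show "h \<in> q n ` carrier (?D n)" if "h \<in> carrier (?D n)" for h
        using sk.id_minus_Sh_surj[of h n] that unfolding P q_def by auto
    qed
  qed
  have pi: "pi_star G c M n (X.i.C.cls n z) = D.cls n (i n z)" if "z \<in> X.i.C.Z n" for n z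
    unfolding pi_star_def
  proof (rule cohomology_map_cls[OF i _ that])
    show "pullback_cochain cg.S G fst mg.Sh n (mg.Th n h) = i n h" if "h \<in> carrier (?C n)" for h
      using sk.Pi_pullback_cochain[OF mg.Th_closed[OF that]] by (simp add: i_def)
  qed
  have c: "c_star G c M n (D.cls n z) = D.cls n (sk.Sh_map n z)" if "z \<in> D.Z n" for n z
    unfolding c_star_def
    by (rule cohomology_map_cls[OF Sh _ that]) (use sk.Sh_pullback_cochain in \<open>simp add: P\<close>)
  note u = cochain_complex_unfold[OF C] cochain_complex_unfold[OF D]
  have id: "id_minus_c_star G c M n (D.cls n z) = D.cls n (q n z)" if z: "z \<in> D.Z n" for n z
    using c[OF z] D.cls_inv[OF Sh.f_Z[OF z]] D.cls_mult[OF z D.Z_inv[OF Sh.f_Z[OF z]]]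
    by (simp add: id_minus_c_star_def Let_def u q_def)
  \<comment> \<open>The maps \<open>d\<close> are the connecting homomorphisms of the short exact
    sequence of complexes.\<close>
  show ?thesis
    unfolding Let_def
    using X.iH_inj[of "pi_star G c M", OF pi id] X.exact_middle[of "pi_star G c M" "id_minus_c_star G c M", OF pi id]
      X.exact_right[of "pi_star G c M" "id_minus_c_star G c M", OF pi id]
      X.exact_left[of "pi_star G c M" "id_minus_c_star G c M", OF pi id]
    unfolding u by (intro exI[of _ X.delta]) blast
qed

end
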